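(* In the setting described in the context (Hilbert space $X$ with family $\langle\cdot,\cdot\rangle_u$ satisfying (M1)-(M3), symmetric $G$-invariant $C^{1,1}$-submanifold $M\subset X\setminus\{0\}$, even $G$-invariant functional $\Phi\in C^{1,1}(M)$), suppose that $G$ satisfies: ($G_*$) if $g_n \ast u \to v$ in $X$ for a sequence $(g_n)_n$ in $G$ and $u,v \in X$, then there exists $g \in G$ with $g \ast u = v$. Suppose that there are values $c_*, c_\infty \in \mathbb{R} \cup \{+\infty\}$, $c_* < c_\infty$, with the following properties: (i) The metric space $(\Phi^{-1}([c_*,c]),d)$ is complete for all $c < c_\infty$. (ii) $k_*:= \lim_{c \to c_*,\, c>c_*}\gamma(\Phi^c)< \infty$. (iii) $\lim_{c \to c_\infty,\, c<c_\infty}\gamma(\Phi^c)=\infty$. (iv) For every $c \in [c_*,c_\infty)$ the condition $(NCG)_c$ holds, and $g\ast u\neq -u$ for all $u\in K_c$ and $g\in G$. Then $$c_* < c_{k_*+1} \le \dots \le c_{k} < c_\infty \quad \text{for } k > k_*,\qquad \lim_{k \to \infty} c_{k} = c_\infty,$$ and the values $c_k$, $k > k_*$, are critical values of $\Phi$. Hence there exists a sequence of pairs of critical points $\{\pm u_k\}$ of $\Phi$ with $\Phi(u_k) \to c_\infty$ as $k \to \infty$.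
   Context: Setting. $X$ is a real Hilbert space with scalar product $\langle\cdot,\cdot\rangle_X$ and norm $\|\cdot\|_X$. For every $u\in X\setminus\{0\}$ a scalar product $\langle\cdot,\cdot\rangle_u$ on $X$ with induced norm $\|\cdot\|_u$ is given. $G$ is a topological group acting linearly on $X$ from the left, the action being written $g\ast u$. Assume: (M1) For all $u\in X\setminus\{0\}$ there are a neighborhood $U\subset X\setminus\{0\}$ of $u$ and $C=C(u)$ with $\frac1C\|v\|_X\le\|v\|_{\tilde u}\le C\|v\|_X$ for all $\tilde u\in U$, $v\in X$. (M2) For all $u\in X\setminus\{0\}$ there are a neighborhood $U\subset X\setminus\{0\}$ of $u$ and $C=C(u)>0$ with $|\langle v,w\rangle_{u_1}-\langle v,w\rangle_{u_2}|\le C\|u_1-u_2\|_X\|v\|_X\|w\|_X$ for all $u_1,u_2\in U$, $v,w\in X$. (M3) $\langle g\ast v,g\ast w\rangle_{g\ast u}=\langle v,w\rangle_u$ for all $u,v,w\in X\setminus\{0\}$, $g\in G$. $M\subset X\setminus\{0\}$ is a submanifold of class $C^{1,1}$ with $M=-M$, and $\Phi\in C^{1,1}(M)$ is even; $M$ and $\Phi$ are $G$-invariant. Metric: for $u,v\in M$, $d(u,v)=\inf\{\int_0^1\|\gamma'(s)\|_{\gamma(s)}ds:\gamma\in C^1([0,1],M),\gamma(0)=u,\gamma(1)=v\}$ ($=\infty$ if $u,v$ lie in different components). For $u\in M$, $\nabla_u\Phi(u)\in T_uM$ is the gradient with respect to $\langle\cdot,\cdot\rangle_u$: $\Phi'(u)w=\langle\nabla_u\Phi(u),w\rangle_u$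 for all $w\in T_uM$. $\Phi^c=\{u\in M:\Phi(u)\le c\}$, $K_c=\{u\in M:\Phi'(u)=0,\ \Phi(u)=c\}$, and $N(w)=\inf\{\|u\|_u+d(u,w):u\in M\}$ for $w\in M$. Condition $(NCG)_c$: if $(u_n)_n\subset M$ satisfies $\Phi(u_n)\to c$ and $\|\nabla_{u_n}\Phi(u_n)\|_{u_n}(1+N(u_n))\to0$, then, after passing to a subsequence, there are $g_n\in G$ and $u\in M$ with $g_n\ast u_n\to u$ in $X$. Krasnoselskii genus: for a locally closed symmetric ($Z=-Z$) subset $Z\subset X$, $\gamma(\varnothing)=0$; if $Z\ne\varnothing$, $\gamma(Z)$ is the smallest integer $k\ge1$ such that there is an odd continuous map $Z\to\mathbb{S}^{k-1}\subset\mathbb{R}^k$, and $\gamma(Z)=\infty$ if no such $k$ exists. Ljusternik-Schnirelmann values: $c_k=\inf\{c\in\mathbb{R}:\gamma(\Phi^c)\ge k\}\in[-\infty,\infty]$, $k\in\mathbb{N}$. *)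

theory Defs
  imports "HOL-Analysis.Analysis" "HOL-Algebra.Group_Action"
begin

definition is_scalar_product :: "('a::real_vector \<Rightarrow> 'a \<Rightarrow> real) \<Rightarrow> bool" where
  "is_scalar_product b \<longleftrightarrow>
     bilinear b \<and> (\<forall>v w. b v w = b w v) \<and> (\<forall>v. v \<noteq> 0 \<longrightarrow> b v v > 0)"

text \<open>A family of scalar products is a function \<open>ip\<close>, where \<open>ip u v w\<close> stands for
  \<open>\<langle>v, w\<rangle>\<^sub>u\<close>; only base points \<open>u \<noteq> 0\<close> are relevant.\<close>

definition ipnorm :: "('a \<Rightarrow> 'a \<Rightarrow> 'a \<Rightarrow> real) \<Rightarrow> 'a \<Rightarrow> 'a \<Rightarrow> real" where
  "ipnorm ip u v = sqrt (ip u v v)"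

definition cond_M1 :: "('a::real_inner \<Rightarrow> 'a \<Rightarrow> 'a \<Rightarrow> real) \<Rightarrow> bool" where
  "cond_M1 ip \<longleftrightarrow>
     (\<forall>u. u \<noteq> 0 \<longrightarrow>
       (\<exists>U C. open U \<and> u \<in> U \<and> 0 \<notin> U \<and> C > 0 \<and>
          (\<forall>u'\<in>U. \<forall>v. 1 / C * norm v \<le> ipnorm ip u' v \<and> ipnorm ip u' v \<le> C * norm v)))"

definition cond_M2 :: "('a::real_inner \<Rightarrow> 'a \<Rightarrow> 'a \<Rightarrow> real) \<Rightarrow> bool" where
  "cond_M2 ip \<longleftrightarrow>
     (\<forall>u. u \<noteq> 0 \<longrightarrow>
       (\<exists>U C. open U \<and> u \<in> U \<and> 0 \<notin> U \<and> C > 0 \<and>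
          (\<forall>u1\<in>U. \<forall>u2\<in>U. \<forall>v w.
             \<bar>ip u1 v w - ip u2 v w\<bar> \<le> C * norm (u1 - u2) * norm v * norm w)))"

definition topological_group :: "('g, 'm) monoid_scheme \<Rightarrow> 'g topology \<Rightarrow> bool" where
  "topological_group G T \<longleftrightarrow>
     group G \<and> topspace T = carrier G \<and>
     continuous_map (prod_topology T T) T (\<lambda>(g, h). g \<otimes>\<^bsub>G\<^esub> h) \<and>
     continuous_map T T (\<lambda>g. inv\<^bsub>G\<^esub> g)"

text \<open>Continuity of the action is not part of this notion.\<close>

definition linear_action :: "('g, 'm) monoid_scheme \<Rightarrow> ('g \<Rightarrow> 'a::real_vector \<Rightarrow> 'a) \<Rightarrow> bool" where
  "linear_action G act \<longleftrightarrow> group_action G UNIV act \<and> (\<forall>g\<in>carrier G. linear (act g))"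

definition cond_M3 ::
    "('g, 'm) monoid_scheme \<Rightarrow> ('g \<Rightarrow> 'a::real_inner \<Rightarrow> 'a) \<Rightarrow> ('a \<Rightarrow> 'a \<Rightarrow> 'a \<Rightarrow> real) \<Rightarrow> bool" where
  "cond_M3 G act ip \<longleftrightarrow>
     (\<forall>u v w. \<forall>g\<in>carrier G. u \<noteq> 0 \<longrightarrow> v \<noteq> 0 \<longrightarrow> w \<noteq> 0 \<longrightarrow>
        ip (act g u) (act g v) (act g w) = ip u v w)"

definition cond_Gstar :: "('g, 'm) monoid_scheme \<Rightarrow> ('g \<Rightarrow> 'a::real_inner \<Rightarrow> 'a) \<Rightarrow> bool" where
  "cond_Gstar G act \<longleftrightarrow>
     (\<forall>g u v. (\<forall>n::nat. g n \<in> carrier G) \<and> (\<lambda>n. act (g n) u) \<longlonglongrightarrow> v \<longrightarrow>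
        (\<exists>h\<in>carrier G. act h u = v))"

text \<open>Class \<open>C\<^sup>1\<^sup>,\<^sup>1\<close>: differentiable with locally Lipschitz derivative.  This is applied to open
  sets \<open>S\<close> and to relatively open subsets \<open>S\<close> of closed subspaces \<open>E\<close>.  In the latter case the
  derivative within \<open>S\<close> is determined on \<open>E\<close> only; asking for some choice of bounded extensions
  that is locally Lipschitz is no restriction, as one can compose with the orthogonal projection
  onto \<open>E\<close>.\<close>

definition C11_on :: "'a::real_normed_vector set \<Rightarrow> ('a \<Rightarrow> 'b::real_normed_vector) \<Rightarrow> bool" where
  "C11_on S f \<longleftrightarrow>
     (\<exists>f' :: 'a \<Rightarrow> 'a \<Rightarrow>\<^sub>L 'b.
        (\<forall>x\<in>S. (f has_derivative blinfun_apply (f' x)) (at x within S)) \<and>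
        (\<forall>x\<in>S. \<exists>e>0. \<exists>L. L-lipschitz_on (ball x e \<inter> S) f'))"

text \<open>\<open>\<phi> : U \<rightarrow> V\<close> is a \<open>C\<^sup>1\<^sup>,\<^sup>1\<close> diffeomorphism with inverse \<open>\<psi>\<close> which flattens \<open>M\<close> to the closed
  subspace \<open>E\<close>.  In a Hilbert space every closed subspace is complemented.\<close>

definition submanifold_chart ::
    "'a::real_inner set \<Rightarrow> 'a set \<Rightarrow> 'a set \<Rightarrow> ('a \<Rightarrow> 'a) \<Rightarrow> ('a \<Rightarrow> 'a) \<Rightarrow> 'a set \<Rightarrow> bool" where
  "submanifold_chart M U V \<phi> \<psi> E \<longleftrightarrow>
     open U \<and> open V \<and> subspace E \<and> closed E \<and>
     homeomorphism U V \<phi> \<psi> \<and> C11_on U \<phi> \<and> C11_on V \<psi> \<and> \<phi> ` (U \<inter> M) = V \<inter> E"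

definition C11_submanifold :: "'a::real_inner set \<Rightarrow> bool" where
  "C11_submanifold M \<longleftrightarrow> (\<forall>u\<in>M. \<exists>U V \<phi> \<psi> E. u \<in> U \<and> submanifold_chart M U V \<phi> \<psi> E)"

definition C11_functional :: "'a::real_inner set \<Rightarrow> ('a \<Rightarrow> real) \<Rightarrow> bool" where
  "C11_functional M \<Phi> \<longleftrightarrow>
     (\<forall>U V \<phi> \<psi> E. submanifold_chart M U V \<phi> \<psi> E \<longrightarrow> C11_on (V \<inter> E) (\<Phi> \<circ> \<psi>))"

definition curve_through :: "'a::real_inner set \<Rightarrow> 'a \<Rightarrow> 'a \<Rightarrow> (real \<Rightarrow> 'a) \<Rightarrow> bool" where
  "curve_through M u w \<sigma> \<longleftrightarrow>
     \<sigma> 0 = u \<and> (\<sigma> has_vector_derivative w) (at 0) \<and>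
     (\<exists>e>0. \<sigma> ` {-e<..<e} \<subseteq> M \<and> \<sigma> C1_differentiable_on {-e<..<e})"

definition tangent_space :: "'a::real_inner set \<Rightarrow> 'a \<Rightarrow> 'a set" where
  "tangent_space M u = {w. \<exists>\<sigma>. curve_through M u w \<sigma>}"

text \<open>\<open>mderiv M \<Phi> u w\<close> is \<open>\<Phi>'(u) w\<close> for \<open>w \<in> T\<^sub>uM\<close>.\<close>

definition mderiv :: "'a::real_inner set \<Rightarrow> ('a \<Rightarrow> real) \<Rightarrow> 'a \<Rightarrow> 'a \<Rightarrow> real" where
  "mderiv M \<Phi> u w =
     (THE r. \<forall>\<sigma>. curve_through M u w \<sigma> \<longrightarrow> ((\<Phi> \<circ> \<sigma>) has_real_derivative r) (at 0))"

definition mgrad ::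
    "('a::real_inner \<Rightarrow> 'a \<Rightarrow> 'a \<Rightarrow> real) \<Rightarrow> 'a set \<Rightarrow> ('a \<Rightarrow> real) \<Rightarrow> 'a \<Rightarrow> 'a" where
  "mgrad ip M \<Phi> u =
     (THE v. v \<in> tangent_space M u \<and> (\<forall>w\<in>tangent_space M u. mderiv M \<Phi> u w = ip u v w))"

definition critical_point :: "'a::real_inner set \<Rightarrow> ('a \<Rightarrow> real) \<Rightarrow> 'a \<Rightarrow> bool" where
  "critical_point M \<Phi> u \<longleftrightarrow> u \<in> M \<and> (\<forall>w\<in>tangent_space M u. mderiv M \<Phi> u w = 0)"

definition critical_set :: "'a::real_inner set \<Rightarrow> ('a \<Rightarrow> real) \<Rightarrow> real \<Rightarrow> 'a set" where
  "critical_set M \<Phi> c = {u. critical_point M \<Phi> u \<and> \<Phi> u = c}"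

definition critical_value :: "'a::real_inner set \<Rightarrow> ('a \<Rightarrow> real) \<Rightarrow> ereal \<Rightarrow> bool" where
  "critical_value M \<Phi> c \<longleftrightarrow> (\<exists>u. critical_point M \<Phi> u \<and> ereal (\<Phi> u) = c)"

text \<open>The value is \<open>\<infinity>\<close> (infimum of the empty set) if no curve joins \<open>u\<close> to \<open>v\<close>.\<close>

definition curve_dist ::
    "('a::real_inner \<Rightarrow> 'a \<Rightarrow> 'a \<Rightarrow> real) \<Rightarrow> 'a set \<Rightarrow> 'a \<Rightarrow> 'a \<Rightarrow> ereal" where
  "curve_dist ip M u v =
     Inf {ereal (integral {0..1} (\<lambda>s. ipnorm ip (\<sigma> s) (\<sigma>' s))) | \<sigma> \<sigma>'.
            \<sigma> ` {0..1} \<subseteq> M \<and> \<sigma> 0 = u \<and> \<sigma> 1 = v \<and>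
            (\<forall>s\<in>{0..1}. (\<sigma> has_vector_derivative \<sigma>' s) (at s within {0..1})) \<and>
            continuous_on {0..1} \<sigma>'}"

text \<open>\<open>Metric_space.mcomplete\<close> does not apply, since \<open>d\<close> may take the value \<open>\<infinity>\<close>.\<close>

definition complete_wrt :: "('a \<Rightarrow> 'a \<Rightarrow> ereal) \<Rightarrow> 'a set \<Rightarrow> bool" where
  "complete_wrt d A \<longleftrightarrow>
     (\<forall>x :: nat \<Rightarrow> 'a.
        (\<forall>n. x n \<in> A) \<and> (\<forall>e>0. \<exists>n0. \<forall>m\<ge>n0. \<forall>n\<ge>n0. d (x m) (x n) < ereal e) \<longrightarrow>
        (\<exists>y\<in>A. (\<lambda>n. d (x n) y) \<longlonglongrightarrow> 0))"

definition Nfun :: "('a::real_inner \<Rightarrow> 'a \<Rightarrow> 'a \<Rightarrow> real) \<Rightarrow> 'a set \<Rightarrow> 'a \<Rightarrow> ereal" where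
  "Nfun ip M w = (INF u\<in>M. ereal (ipnorm ip u u) + curve_dist ip M u w)"

definition cond_NCG ::
    "('g, 'm) monoid_scheme \<Rightarrow> ('g \<Rightarrow> 'a::real_inner \<Rightarrow> 'a) \<Rightarrow> ('a \<Rightarrow> 'a \<Rightarrow> 'a \<Rightarrow> real) \<Rightarrow>
     'a set \<Rightarrow> ('a \<Rightarrow> real) \<Rightarrow> real \<Rightarrow> bool" where
  "cond_NCG G act ip M \<Phi> c \<longleftrightarrow>
     (\<forall>x :: nat \<Rightarrow> 'a.
        (\<forall>n. x n \<in> M) \<and> (\<lambda>n. \<Phi> (x n)) \<longlonglongrightarrow> c \<and>
        (\<lambda>n. ereal (ipnorm ip (x n) (mgrad ip M \<Phi> (x n))) * (1 + Nfun ip M (x n))) \<longlonglongrightarrow> 0 \<longrightarrow>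
        (\<exists>r g. \<exists>u\<in>M. strict_mono (r :: nat \<Rightarrow> nat) \<and> (\<forall>n. g n \<in> carrier G) \<and>
           (\<lambda>n. act (g n) (x (r n))) \<longlonglongrightarrow> u))"

text \<open>\<open>nsphere (k - 1)\<close> is the unit sphere of \<open>\<real>\<^sup>k\<close>, whose points are functions \<open>nat \<Rightarrow> real\<close>
  vanishing from index \<open>k\<close> on.  The infimum of the empty set is \<open>\<infinity>\<close>.\<close>

definition genus :: "'a::real_normed_vector set \<Rightarrow> enat" where
  "genus Z =
     (if Z = {} then 0
      else Inf {enat k | k. k \<ge> 1 \<and>
             (\<exists>f. continuous_map (top_of_set Z) (nsphere (k - 1)) f \<and>
                  (\<forall>x\<in>Z. f (- x) = (\<lambda>i. - f x i)))})"

definition sublevel :: "'a set \<Rightarrow> ('a \<Rightarrow> real) \<Rightarrow> ereal \<Rightarrow> 'a set" where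
  "sublevel M \<Phi> c = {u\<in>M. ereal (\<Phi> u) \<le> c}"

definition LS_value :: "'a::real_normed_vector set \<Rightarrow> ('a \<Rightarrow> real) \<Rightarrow> nat \<Rightarrow> ereal" where
  "LS_value M \<Phi> k = Inf {ereal c | c :: real. genus (sublevel M \<Phi> (ereal c)) \<ge> enat k}"

end

theory Submission
  imports Defs
begin

text \<open>If \<open>c\<close> lies strictly between \<open>c\<^sub>*\<close> and \<open>c\<^sub>\<infinity>\<close>, the condition \<open>(NCG)\<^sub>c\<close> bounds
  \<open>\<parallel>\<nabla>\<Phi>\<parallel> (1 + N)\<close> from below near level \<open>c\<close> outside a \<open>G\<close>-invariant tube around \<open>K\<^sub>c\<close>. Since \<open>N\<close>
  grows at most linearly with arc length, gradient descent through the strip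
  \<open>[c - \<epsilon>, c + \<epsilon>]\<close> has finite length, and completeness carries it to the level \<open>c - \<epsilon>\<close>. As
  neither the scalar products nor the gradient are compatible with \<open>u \<mapsto> - u\<close>, the
  odd deformation is composed of steps along the gradient field at \<open>u\<close> or along the reflected field
  from \<open>- u\<close>, steered by countably many odd functions without common zero in \<open>X - {0}\<close>.

  The tube is covered by finitely many neighbourhoods of orbits \<open>G v\<close>, each disjoint from its
  reflection because \<open>- v\<close> is not in \<open>G v\<close>. Hence crossing a level raises the genus by a finite
  amount only, and not at all if \<open>K\<^sub>c\<close> is empty. So the \<open>c\<^sub>k\<close> are critical, and they cannot
  accumulate below \<open>c\<^sub>\<infinity>\<close>.\<close>

subsection \<open>Krasnoselskii genus\<close>

text \<open>The single maps \<open>act g\<close> turn out to be bounded, but nothing bounds them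
  uniformly in \<open>g\<close> in the norm of X. They are isometries of d, so every argument with
  infinitely many group elements is carried out with lengths of curves, and d is compared with the
  norm only near one fixed point at a time. Compactness enters only modulo the group: if a uniform
  statement near K_c fails, it fails along a sequence; group elements move a subsequence to a limit
  in K_c, and invariance of the quantities involved carries the local estimate at the limit back to
  the sequence.

  Reflection, in contrast, preserves the norm but not d. The tube around K_c, which is a tube for d,
  therefore need not be symmetric. For this reason gradient bounds are proved where at least one of
  u and -u is outside the tube, the odd deformation is applied where both are outside, and the sets
  that must be disjoint from their reflections are defined through the norm.

  The number m by which the genus may rise at a level is fixed before k is chosen. This uniformity
  turns a supremum of the c_k below c_inf into a contradiction.\<close>

definition odd_family :: "nat \<Rightarrow> 'a::real_normed_vector set \<Rightarrow> (nat \<Rightarrow> 'a \<Rightarrow> real) \<Rightarrow> bool" where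
  "odd_family k Z f \<longleftrightarrow> (\<forall>i<k. continuous_on Z (f i)) \<and>
     (\<forall>i<k. \<forall>x\<in>Z. f i (- x) = - f i x) \<and> (\<forall>x\<in>Z. \<exists>i<k. f i x \<noteq> 0)"

text \<open>An odd map into \<open>R^k\<close> without zeros takes the place of a map into the
  sphere, which spares normalisation when maps are combined. For \<open>k = 0\<close> the last
  clause of \<open>odd_family\<close> forces \<open>Z\<close> to be empty, in accordance with genus
  0.\<close>

definition genus_le :: "'a::real_normed_vector set \<Rightarrow> nat \<Rightarrow> bool" where
  "genus_le Z k \<longleftrightarrow> (\<exists>f. odd_family k Z f)"

lemma odd_familyD:
  assumes "odd_family k Z f"
  shows "\<And>i. i < k \<Longrightarrow> continuous_on Z (f i)"
    and "\<And>i x. i < k \<Longrightarrow> x \<in> Z \<Longrightarrow> f i (- x) = - f i x"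
    and "\<And>x. x \<in> Z \<Longrightarrow> \<exists>i<k. f i x \<noteq> 0"
  using assms unfolding odd_family_def by simp_all

lemma genus_leI:
  fixes f :: "nat \<Rightarrow> 'a::real_normed_vector \<Rightarrow> real"
  assumes "\<And>i. i < k \<Longrightarrow> continuous_on Z (f i)"
    and "\<And>i x. i < k \<Longrightarrow> x \<in> Z \<Longrightarrow> f i (- x) = - f i x"
    and "\<And>x. x \<in> Z \<Longrightarrow> \<exists>i<k. f i x \<noteq> 0"
  shows "genus_le Z k"
  unfolding genus_le_def odd_family_def by (rule exI[of _ f]) (use assms in simp)

lemma genus_le_empty: "genus_le {} k"
  by (rule genus_leI) auto

lemma genus_le_mono: "genus_le Z k \<Longrightarrow> Y \<subseteq> Z \<Longrightarrow> k \<le> l \<Longrightarrow> genus_le Y l"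
proof -
  assume Zk: "genus_le Z k" and YZ: "Y \<subseteq> Z" and kl: "k \<le> l"
  from Zk obtain f where f0: "odd_family k Z f" unfolding genus_le_def by blast
  note f = odd_familyD[OF f0]
  show ?thesis
  proof (rule genus_leI[where f = "\<lambda>i x. if i < k then f i x else 0"])
    fix i show "continuous_on Y (\<lambda>x. if i < k then f i x else 0)"
      using f(1) YZ by (cases "i < k") (auto intro: continuous_on_subset)
    fix x assume "x \<in> Y"
    then show "(if i < k then f i (- x) else 0) = - (if i < k then f i x else 0)"
      using f(2) YZ by auto
    show "\<exists>i<l. (if i < k then f i x else 0) \<noteq> 0"
      using f(3) YZ \<open>x \<in> Y\<close> kl by (meson order_less_le_trans subsetD)
  qed
qed

lemma genus_le_vimage:
  assumes "genus_le Y k" and "continuous_on Z h" and "h ` Z \<subseteq> Y" and "\<And>x. x \<in> Z \<Longrightarrow> h (- x) = - h x"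
  shows "genus_le Z k"
proof -
  from assms(1) obtain f where f0: "odd_family k Y f" unfolding genus_le_def by blast
  note f = odd_familyD[OF f0]
  show ?thesis
  proof (rule genus_leI[where f = "\<lambda>i x. f i (h x)"])
    fix i assume "i < k"
    then show "continuous_on Z (\<lambda>x. f i (h x))"
      using f(1) assms(2,3) continuous_on_compose2 by blast
    fix x assume "x \<in> Z"
    then show "f i (h (- x)) = - f i (h x)"
      using f(2) assms(3,4) \<open>i < k\<close> by auto
  next
    fix x assume "x \<in> Z"
    then show "\<exists>i<k. f i (h x) \<noteq> 0" using f(3) assms(3) by auto
  qed
qed

lemma genus_le_of_genus:
  assumes "genus Z \<le> enat k" shows "genus_le Z k"
proof (cases "Z = {}")
  case True then show ?thesis by (simp add: genus_le_empty)
next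
  case False
  define S where "S = {enat k | k. k \<ge> 1 \<and>
             (\<exists>f. continuous_map (top_of_set Z) (nsphere (k - 1)) f \<and>
                  (\<forall>x\<in>Z. f (- x) = (\<lambda>i. - f x i)))}"
  have g: "genus Z = Inf S" using False by (simp add: genus_def S_def)
  have "S \<noteq> {}" using assms g by (metis Inf_enat_def enat_ord_code(5) infinity_ileE)
  then have "Inf S \<in> S" unfolding Inf_enat_def by (metis LeastI all_not_in_conv)
  then obtain l f where l: "Inf S = enat l" "l \<ge> 1" and
    c: "continuous_map (top_of_set Z) (nsphere (l - 1)) f" and odd: "\<forall>x\<in>Z. f (- x) = (\<lambda>i. - f x i)"
    unfolding S_def by (smt (verit) mem_Collect_eq)
  have lk: "l \<le> k" using assms g l by simp
  have "genus_le Z l"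
  proof (rule genus_leI[where f = "\<lambda>i x. f x i"])
    fix i
    have "continuous_map (top_of_set Z) euclideanreal ((\<lambda>x. x i) \<circ> f)"
      using c continuous_map_nsphere_projection by (rule continuous_map_compose)
    then show "continuous_on Z (\<lambda>x. f x i)" by (simp add: o_def)
    fix x assume x: "x \<in> Z"
    then show "f (- x) i = - f x i" using odd by simp
    have "f x \<in> topspace (nsphere (l - 1))" using c x by (auto simp: continuous_map_def)
    then have "(\<Sum>i\<le>l - 1. (f x i)\<^sup>2) = 1" by (simp add: nsphere_def)
    then obtain j where "j \<le> l - 1" "f x j \<noteq> 0"
      by (metis atMost_iff power_zero_numeral sum.neutral zero_neq_one)
    then show "\<exists>i<l. f x i \<noteq> 0" using l(2) by (intro exI[of _ j]) auto
  qed
  then show ?thesis using lk genus_le_mono by blast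
qed

lemma genus_of_genus_le:
  assumes "genus_le Z k" shows "genus Z \<le> enat k"
proof (cases "Z = {}")
  case True then show ?thesis by (simp add: genus_def)
next
  case False
  from assms obtain f where f0: "odd_family k Z f" unfolding genus_le_def by blast
  note f = odd_familyD[OF f0]
  have k: "k \<ge> 1" using f(3) False by (cases k) auto
  define N where "N x = sqrt (\<Sum>j<k. (f j x)\<^sup>2)" for x
  have pos: "(\<Sum>j<k. (f j x)\<^sup>2) > 0" if xZ: "x \<in> Z" for x
  proof -
    obtain j where "j < k" "f j x \<noteq> 0" using f(3)[OF xZ] by blast
    then show ?thesis by (intro sum_pos2[of _ j]) auto
  qed
  define F where "F x i = (if i < k then f i x / N x else 0)" for x i
  have cN: "continuous_on Z N" unfolding N_def using f(1) by (intro continuous_intros) auto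
  have Npos: "N x > 0" if "x \<in> Z" for x using pos[OF that] by (simp add: N_def)
  have cF: "continuous_on Z (\<lambda>x. F x i)" for i
    using f(1) cN Npos unfolding F_def by (cases "i < k") (fastforce intro!: continuous_intros)+
  have sum1: "(\<Sum>i\<le>k - 1. (F x i)\<^sup>2) = 1" if "x \<in> Z" for x
  proof -
    have "{..k - 1} = {..<k}" using k by auto
    then have "(\<Sum>i\<le>k - 1. (F x i)\<^sup>2) = (\<Sum>i<k. (f i x)\<^sup>2 / (N x)\<^sup>2)"
      by (simp add: F_def power_divide)
    also have "\<dots> = (\<Sum>i<k. (f i x)\<^sup>2) / (N x)\<^sup>2" by (simp add: sum_divide_distrib)
    also have "\<dots> = 1" using pos[OF that] by (simp add: N_def)
    finally show ?thesis .
  qed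
  have F0: "F x i = 0" if "k - 1 < i" for x i using that k by (simp add: F_def)
  have cont: "continuous_map (top_of_set Z) (nsphere (k - 1)) F"
    unfolding nsphere continuous_map_in_subtopology continuous_map_componentwise_UNIV
    using cF sum1 F0 by auto
  have "N (- x) = N x" if "x \<in> Z" for x
    unfolding N_def using f(2) that by (intro arg_cong[where f=sqrt] sum.cong) auto
  then have odd: "\<forall>x\<in>Z. F (- x) = (\<lambda>i. - F x i)" using f(2) by (auto simp: F_def fun_eq_iff)
  show ?thesis using False k cont odd unfolding genus_def by (auto intro!: Inf_lower)
qed

lemma genus_le_iff: "genus Z \<le> enat k \<longleftrightarrow> genus_le Z k"
  using genus_le_of_genus genus_of_genus_le by blast

lemma infdist_uminus_image:
  "infdist (- x) (uminus ` A) = infdist (x :: 'a::real_normed_vector) A"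
proof (cases "A = {}")
  case False
  have "dist (- x) (- y) = dist x y" for y :: 'a by (simp add: dist_norm norm_minus_commute)
  then show ?thesis using False by (simp add: infdist_def image_image)
qed (simp add: infdist_def)

lemma genus_le_Un:
  fixes B C :: "'a::real_normed_vector set"
  assumes B: "genus_le B k" and C: "genus_le C l"
    and oB: "openin (top_of_set (B \<union> C)) B" and oC: "openin (top_of_set (B \<union> C)) C"
    and sB: "uminus ` B = B" and sC: "uminus ` C = C"
  shows "genus_le (B \<union> C) (k + l)"
\<comment> \<open>For nested sets one complement is empty and \<open>infdist\<close> to it is 0, so
  the cutoff would vanish identically; the larger set settles this case alone.\<close>
proof (cases "B \<subseteq> C \<or> C \<subseteq> B")
  case True
  then have "B \<union> C = C \<or> B \<union> C = B" by blast
  then show ?thesis using B C genus_le_mono[of _ _ _ "k + l"] by (metis le_add1 le_add2 order_refl)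
next
  case False
  define A where "A = B \<union> C"
  from B obtain f where f0: "odd_family k B f" unfolding genus_le_def by blast
  note f = odd_familyD[OF f0]
  from C obtain g where g0: "odd_family l C g" unfolding genus_le_def by blast
  note g = odd_familyD[OF g0]
  have cut: "continuous_on A (\<lambda>x. if x \<in> D then infdist x (A - D) * max (- 1) (min 1 (h x)) else 0)"
    if D: "openin (top_of_set A) D" "D \<subset> A" and h: "continuous_on D h" for D and h :: "'a \<Rightarrow> real"
  proof -
    let ?F = "\<lambda>x. if x \<in> D then infdist x (A - D) * max (- 1) (min 1 (h x)) else 0"
    have "isCont_like": "continuous (at x within A) ?F" if "x \<in> A" for x
    proof (cases "x \<in> D")
      case True
      have "continuous_on D ?F"
        using h by (auto intro!: continuous_intros cong: continuous_on_cong_simp)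
      then have "continuous (at x within D) ?F" using True continuous_on_eq_continuous_within by blast
      moreover have "at x within A = at x within D"
      proof -
        obtain T where "open T" "D = A \<inter> T" using D(1) by (auto simp: openin_open)
        then show ?thesis using True at_within_nhd[of x T D A] by auto
      qed
      ultimately show ?thesis by simp
    next
      case False
      have z: "infdist x (A - D) = 0" using False \<open>x \<in> A\<close> by simp
      have "((\<lambda>y. infdist y (A - D)) \<longlongrightarrow> 0) (at x within A)"
        using continuous_infdist[OF continuous_ident, of x A "A - D"] z
        by (simp add: continuous_within)
      then have "(?F \<longlongrightarrow> 0) (at x within A)"
      proof (rule Lim_null_comparison[rotated])
        have "norm (?F y) \<le> infdist y (A - D)" for y
        proof -
          have "\<bar>infdist y (A - D) * max (- 1) (min 1 (h y))\<bar> \<le> infdist y (A - D) * 1"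
            unfolding abs_mult using infdist_nonneg[of y "A - D"] by (intro mult_mono) auto
          then show ?thesis using infdist_nonneg[of y "A - D"] by auto
        qed
        then show "\<forall>\<^sub>F y in at x within A. norm (?F y) \<le> infdist y (A - D)" by simp
      qed
      then show ?thesis using False by (simp add: continuous_within)
    qed
    then show ?thesis using continuous_on_eq_continuous_within by blast
  qed
  have symA: "uminus ` A = A" using sB sC by (simp add: A_def image_Un)
  have ev: "infdist (- x) (A - D) = infdist x (A - D)" if "uminus ` D = D" for D x
  proof -
    have "uminus ` (A - D) = A - D"
      using symA that by (metis image_set_diff inj_uminus)
    then show ?thesis using infdist_uminus_image[of x "A - D"] by simp
  qed
  have pos: "infdist x (A - D) > 0" if "openin (top_of_set A) D" "x \<in> D" "D \<subset> A" for D x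
  proof -
    have "closedin (top_of_set A) (A - D)" using that by (simp add: closedin_diff)
    then obtain T where T: "closed T" "A - D = A \<inter> T" by (auto simp: closedin_closed)
    have "x \<notin> closure (A - D)"
    proof
      assume "x \<in> closure (A - D)"
      then have "x \<in> T" using T by (metis closure_minimal inf_le2 subsetD)
      then show False using T that by blast
    qed
    moreover have "A - D \<noteq> {}" using that by blast
    ultimately show ?thesis using in_closure_iff_infdist_zero infdist_nonneg[of x "A - D"]
      by (metis less_eq_real_def)
  qed
  have BA: "B \<subset> A" "C \<subset> A" using False by (auto simp: A_def)
  have mem: "- x \<in> D \<longleftrightarrow> x \<in> D" if "uminus ` D = D" for D and x :: 'a
    using that by (metis image_eqI minus_minus)
  define F where "F i x = (if i < k then if x \<in> B then infdist x (A - B) * max (- 1) (min 1 (f i x)) else 0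
     else if x \<in> C then infdist x (A - C) * max (- 1) (min 1 (g (i - k) x)) else 0)" for i x
  have "genus_le A (k + l)"
  proof (rule genus_leI[where f=F])
    fix i assume i: "i < k + l"
    show "continuous_on A (F i)"
    proof (cases "i < k")
      case True
      then show ?thesis using cut[of B "f i"] oB BA f(1) by (simp add: F_def A_def)
    next
      case False
      then show ?thesis using cut[of C "g (i - k)"] oC BA g(1) i by (simp add: F_def A_def)
    qed
    fix x assume "x \<in> A"
    have neg: "max (- 1) (min 1 (- t)) = - max (- 1) (min 1 t)" for t :: real by auto
    show "F i (- x) = - F i x"
      using f(2) g(2) i ev[OF sB] ev[OF sC] mem[OF sB] mem[OF sC] by (auto simp: F_def neg)
  next
    fix x assume x: "x \<in> A"
    have nz: "max (- 1) (min 1 t) \<noteq> 0" if "t \<noteq> 0" for t :: real using that by auto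
    show "\<exists>i<k + l. F i x \<noteq> 0"
    proof (cases "x \<in> B")
      case True
      then obtain i where "i < k" "f i x \<noteq> 0" using f(3) by blast
      then show ?thesis using True pos[of B x] oB BA nz
        by (intro exI[of _ i]) (simp add: F_def A_def)
    next
      case False
      then have "x \<in> C" using x by (simp add: A_def)
      then obtain i where "i < l" "g i x \<noteq> 0" using g(3) by blast
      then show ?thesis using \<open>x \<in> C\<close> pos[of C x] oC BA nz
        by (intro exI[of _ "k + i"]) (simp add: F_def A_def)
    qed
  qed
  then show ?thesis by (simp add: A_def)
qed

text \<open>If u lies in \<open>P\<close>, then -u lies in \<open>Y - P\<close>. One of the two
  distances is then 0 and the other positive because \<open>P\<close> is relatively open.\<close>

lemma odd_separating_function:
  fixes P :: "'a::real_normed_vector set"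
  assumes op: "openin (top_of_set Y) P" and sym: "\<And>x. x \<in> Y \<Longrightarrow> - x \<in> Y"
    and disj: "P \<inter> uminus ` P = {}"
  defines "f \<equiv> \<lambda>u. infdist u (Y - P) - infdist (- u) (Y - P)"
  shows "continuous_on UNIV f" and "f (- u) = - f u" and "u \<in> P \<union> uminus ` P \<Longrightarrow> f u \<noteq> 0"
proof -
  show "continuous_on UNIV f" unfolding f_def by (intro continuous_intros)
  show odd: "f (- u) = - f u" for u by (simp add: f_def)
  have "f u > 0" if u: "u \<in> P" for u
  proof -
    have uY: "u \<in> Y" using op u openin_imp_subset by blast
    have m: "- u \<in> Y - P" using sym[OF uY] u disj by (auto intro: image_eqI[of _ _ "- u"])
    then have z: "infdist (- u) (Y - P) = 0" by simp
    obtain T where T: "open T" "P = Y \<inter> T" using op by (auto simp: openin_open)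
    have "u \<notin> closure (Y - P)"
    proof
      assume "u \<in> closure (Y - P)"
      moreover have "u \<in> T" using u T by blast
      ultimately have "(Y - P) \<inter> T \<noteq> {}" using T(1) by (metis Int_commute closure_iff_nhds_not_empty order_refl)
      then show False using T by blast
    qed
    then have "infdist u (Y - P) \<noteq> 0" using m in_closure_iff_infdist_zero[of "Y - P" u] by blast
    then show ?thesis unfolding f_def using z infdist_nonneg[of u "Y - P"] by linarith
  qed
  then show "u \<in> P \<union> uminus ` P \<Longrightarrow> f u \<noteq> 0" using odd by fastforce
qed

text \<open>A set together with its disjoint reflection costs only one odd function, so the genus is
  bounded by the number of such pairs.\<close>

lemma genus_le_finite_cover:
  fixes P :: "'b \<Rightarrow> 'a::real_normed_vector set"
  assumes F: "finite F" and sym: "\<And>x. x \<in> Y \<Longrightarrow> - x \<in> Y"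
    and P: "\<And>v. v \<in> F \<Longrightarrow> openin (top_of_set Y) (P v)" "\<And>v. v \<in> F \<Longrightarrow> P v \<inter> uminus ` P v = {}"
    and Z: "Z \<subseteq> (\<Union>v\<in>F. P v \<union> uminus ` P v)"
  shows "genus_le Z (card F)"
proof -
  obtain b where b: "bij_betw b {0..<card F} F" using ex_bij_betw_nat_finite[OF F] by blast
  show ?thesis
  proof (rule genus_leI[where f="\<lambda>i u. infdist u (Y - P (b i)) - infdist (- u) (Y - P (b i))"])
    fix i
    show "continuous_on Z (\<lambda>u. infdist u (Y - P (b i)) - infdist (- u) (Y - P (b i)))"
      by (intro continuous_intros)
  next
    fix x assume "x \<in> Z"
    then obtain v where v: "v \<in> F" "x \<in> P v \<union> uminus ` P v" using Z by blast
    have "v \<in> b ` {0..<card F}" using b v(1) by (simp add: bij_betw_def)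
    then obtain i where i: "i < card F" "b i = v" by auto
    show "\<exists>i<card F. infdist x (Y - P (b i)) - infdist (- x) (Y - P (b i)) \<noteq> 0"
      using odd_separating_function(3)[OF P(1)[OF v(1)] sym P(2)[OF v(1)] v(2)] i by blast
  qed simp
qed

subsection \<open>Odd functions without common zeros\<close>

definition orthonormal_set :: "'a::real_inner set \<Rightarrow> bool" where
  "orthonormal_set I \<longleftrightarrow> (\<forall>e\<in>I. norm e = 1) \<and> (\<forall>e\<in>I. \<forall>e'\<in>I. e \<noteq> e' \<longrightarrow> e \<bullet> e' = 0)"

text \<open>A maximal orthonormal set is total: a nonzero vector orthogonal to it could be
  normalised and added.\<close>

lemma orthonormal_set_total_exists:
  "\<exists>I :: 'a::real_inner set. orthonormal_set I \<and> (\<forall>u. u \<noteq> 0 \<longrightarrow> (\<exists>e\<in>I. u \<bullet> e \<noteq> 0))"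
proof -
  let ?A = "{I :: 'a set. orthonormal_set I}"
  have "\<exists>M\<in>?A. \<forall>X\<in>?A. M \<subseteq> X \<longrightarrow> X = M"
  proof (rule subset_Zorn')
    fix C assume C: "subset.chain ?A C"
    then have lin: "X \<subseteq> Y \<or> Y \<subseteq> X" if "X \<in> C" "Y \<in> C" for X Y
      using that by (auto simp: subset_chain_def)
    have on: "orthonormal_set X" if "X \<in> C" for X using C that by (auto simp: subset_chain_def)
    have "e \<bullet> e' = 0" if ee: "e \<in> \<Union>C" "e' \<in> \<Union>C" "e \<noteq> e'" for e e'
    proof -
      obtain X Y where "X \<in> C" "Y \<in> C" "e \<in> X" "e' \<in> Y" using ee by blast
      with lin[of X Y] obtain Z where "Z \<in> C" "e \<in> Z" "e' \<in> Z" by blast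
      then show ?thesis using on[of Z] ee(3) by (auto simp: orthonormal_set_def)
    qed
    moreover have "norm e = 1" if "e \<in> \<Union>C" for e using that on by (auto simp: orthonormal_set_def)
    ultimately show "\<Union>C \<in> ?A" by (simp add: orthonormal_set_def)
  qed
  then obtain I where IA: "I \<in> ?A" and "\<forall>X\<in>?A. I \<subseteq> X \<longrightarrow> X = I" by (elim bexE)
  then have I: "orthonormal_set I" and max: "\<And>X. orthonormal_set X \<Longrightarrow> I \<subseteq> X \<Longrightarrow> X = I"
    by simp_all
  have "\<exists>e\<in>I. u \<bullet> e \<noteq> 0" if u: "u \<noteq> 0" for u
  proof (rule ccontr)
    assume "\<not> (\<exists>e\<in>I. u \<bullet> e \<noteq> 0)"
    then have z: "u \<bullet> e = 0" "e \<bullet> u = 0" if "e \<in> I" for e using that by (auto simp: inner_commute)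
    define v where "v = u /\<^sub>R norm u"
    have "norm v = 1" using u by (simp add: v_def)
    moreover have "v \<bullet> e = 0" "e \<bullet> v = 0" if "e \<in> I" for e using z[OF that] by (simp_all add: v_def)
    ultimately have "orthonormal_set (insert v I)" using I by (auto simp: orthonormal_set_def)
    then have "v \<in> I" using max[of "insert v I"] by blast
    then have "u \<bullet> v = 0" using z by simp
    then show False using u by (simp add: v_def)
  qed
  then show ?thesis using I by blast
qed

lemma bessel_inequality:
  assumes I: "orthonormal_set I" and F: "finite F" "F \<subseteq> I"
  shows "(\<Sum>e\<in>F. (u \<bullet> e)\<^sup>2) \<le> u \<bullet> u"
proof -
  define w where "w = (\<Sum>e\<in>F. (u \<bullet> e) *\<^sub>R e)"
  have uw: "u \<bullet> w = (\<Sum>e\<in>F. (u \<bullet> e)\<^sup>2)" by (simp add: w_def inner_sum_right power2_eq_square)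
  have "w \<bullet> e = u \<bullet> e" if "e \<in> F" for e
  proof -
    have "w \<bullet> e = (\<Sum>e'\<in>F. (u \<bullet> e') * (e' \<bullet> e))" by (simp add: w_def inner_sum_left)
    also have "\<dots> = (\<Sum>e'\<in>F. if e' = e then u \<bullet> e else 0)"
    proof (rule sum.cong)
      fix e' assume "e' \<in> F"
      then show "(u \<bullet> e') * (e' \<bullet> e) = (if e' = e then u \<bullet> e else 0)"
        using I F that by (auto simp: orthonormal_set_def dot_square_norm)
    qed simp
    also have "\<dots> = u \<bullet> e" using F that by simp
    finally show ?thesis .
  qed
  then have ww: "w \<bullet> w = (\<Sum>e\<in>F. (u \<bullet> e)\<^sup>2)"
    by (subst (2) w_def) (simp add: inner_sum_right power2_eq_square)
  have "0 \<le> (u - w) \<bullet> (u - w)" by simp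
  also have "\<dots> = u \<bullet> u - (\<Sum>e\<in>F. (u \<bullet> e)\<^sup>2)"
    using uw ww by (simp add: inner_diff_left inner_diff_right inner_commute)
  finally show ?thesis by simp
qed

text \<open>By Bessel's inequality, n coefficients of modulus at least r force
  \<open>n * r^2 \<le> u \<bullet> u\<close>.\<close>

lemma finite_large_coefficients:
  assumes I: "orthonormal_set I" and r: "r > 0"
  shows "finite {e\<in>I. r \<le> \<bar>u \<bullet> e\<bar>}"
proof (rule ccontr)
  assume inf: "infinite {e\<in>I. r \<le> \<bar>u \<bullet> e\<bar>}"
  obtain n :: nat where n: "u \<bullet> u < n * r\<^sup>2" using r
    by (metis reals_Archimedean3 zero_less_power)
  obtain F where F: "finite F" "card F = n" "F \<subseteq> {e\<in>I. r \<le> \<bar>u \<bullet> e\<bar>}"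
    using infinite_arbitrarily_large[OF inf] by blast
  have "r\<^sup>2 \<le> (u \<bullet> e)\<^sup>2" if "e \<in> F" for e
    using that F r by (metis (mono_tags, lifting) abs_le_square_iff abs_of_pos mem_Collect_eq subsetD)
  then have "(\<Sum>e\<in>F. r\<^sup>2) \<le> (\<Sum>e\<in>F. (u \<bullet> e)\<^sup>2)" by (intro sum_mono)
  also have "\<dots> \<le> u \<bullet> u" using F by (intro bessel_inequality[OF I]) auto
  finally show False using n F by simp
qed

text \<open>Thresholding the coefficients at a level inside a gap \<open>[s, t]\<close> singles out a nonempty finite
  set of basis vectors that is locally constant and the same for \<open>u\<close> and \<open>- u\<close>; the sign of one
  chosen coefficient then separates \<open>u\<close> from \<open>- u\<close>.\<close>

lemma odd_functions_exist:
  "\<exists>g :: nat \<Rightarrow> 'a::real_inner \<Rightarrow> real. (\<forall>n. continuous_on UNIV (g n)) \<and>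
     (\<forall>n u. g n (- u) = - g n u) \<and> (\<forall>u. u \<noteq> 0 \<longrightarrow> (\<exists>n. g n u \<noteq> 0))"
proof -
  obtain I :: "'a set" where I: "orthonormal_set I" and tot: "\<forall>u. u \<noteq> 0 \<longrightarrow> (\<exists>e\<in>I. u \<bullet> e \<noteq> 0)"
    using orthonormal_set_total_exists by blast
  \<comment> \<open>Only absolute values enter, so \<open>big t\<close> is the same set for u and
    -u, and so is the vector that \<open>ch\<close> selects from it.\<close>
  define big where "big t u = {e\<in>I. t < \<bar>u \<bullet> e\<bar>}" for t :: real and u :: 'a
  define ch where "ch F = (SOME e. e \<in> F)" for F :: "'a set"
  define P where "P s t = {u. big t u \<noteq> {} \<and> (\<forall>e\<in>I. \<bar>u \<bullet> e\<bar> \<notin> {s..t}) \<and> 0 < u \<bullet> ch (big t u)}"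
    for s t :: real
  have bigm: "big t (- u) = big t u" for t u by (simp add: big_def)
  have ch: "ch F \<in> F" if "F \<noteq> {}" for F using that by (simp add: ch_def some_in_eq)
  have disj: "P s t \<inter> uminus ` P s t = {}" for s t
    by (auto simp: P_def bigm)
  have op: "open (P s t)" if st: "0 < s" "s < t" for s t
  proof (rule Topological_Spaces.openI)
    fix u assume u: "u \<in> P s t"
    \<comment> \<open>Only the finitely many coefficients in \<open>E\<close> need control one by
      one. The others are below s / 2 and change by less than s / 2 within the ball of radius s / 2,
      so they cannot reach the gap.\<close>
    define E where "E = {e\<in>I. s / 2 \<le> \<bar>u \<bullet> e\<bar>}"
    have finE: "finite E" unfolding E_def using finite_large_coefficients[OF I, of "s / 2" u] st by simp
    define W where "W e = (if \<bar>u \<bullet> e\<bar> < s then {v. \<bar>v \<bullet> e\<bar> < s} else {v. t < sgn (u \<bullet> e) * (v \<bullet> e)})" for e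
    have oW: "open (W e)" for e
      unfolding W_def by (auto intro!: open_Collect_less continuous_intros)
    define T where "T = ball u (s / 2) \<inter> (\<Inter>e\<in>E. W e)"
    have oT: "open T" unfolding T_def using finE oW by (intro open_Int open_INT) auto
    have gap: "\<bar>u \<bullet> e\<bar> < s \<or> t < \<bar>u \<bullet> e\<bar>" if "e \<in> I" for e
      using u that unfolding P_def by force
    have uT: "u \<in> T"
    proof -
      have "u \<in> W e" if "e \<in> E" for e
        using gap[of e] that st unfolding W_def E_def by (auto simp: sgn_if split: if_splits)
      then show ?thesis using st by (simp add: T_def)
    qed
    have "T \<subseteq> P s t"
    proof
      fix v assume v: "v \<in> T"
      have small: "\<bar>v \<bullet> e\<bar> < s" if e: "e \<in> I" "\<bar>u \<bullet> e\<bar> < s" for e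
      proof (cases "e \<in> E")
        case True
        then have "v \<in> W e" using v by (auto simp: T_def)
        then show ?thesis using e by (simp add: W_def)
      next
        case False
        have "\<bar>(v - u) \<bullet> e\<bar> \<le> norm (v - u) * norm e" by (rule Cauchy_Schwarz_ineq2)
        also have "\<dots> < s / 2" using v e I by (auto simp: T_def orthonormal_set_def dist_norm norm_minus_commute)
        finally have "\<bar>v \<bullet> e - u \<bullet> e\<bar> < s / 2" by (simp add: inner_diff_left)
        moreover have "\<bar>u \<bullet> e\<bar> < s / 2" using False e by (auto simp: E_def)
        ultimately show ?thesis by linarith
      qed
      have large: "t < sgn (u \<bullet> e) * (v \<bullet> e)" if e: "e \<in> I" "t < \<bar>u \<bullet> e\<bar>" for e
      proof -
        have "e \<in> E" using e st by (simp add: E_def)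
        then have "v \<in> W e" using v by (auto simp: T_def)
        then show ?thesis using e st by (simp add: W_def)
      qed
      have large': "t < \<bar>v \<bullet> e\<bar>" if e: "e \<in> I" "t < \<bar>u \<bullet> e\<bar>" for e
        using large[OF e] st by (auto simp: sgn_if split: if_splits)
      have eq: "big t v = big t u"
        using gap small large' st unfolding big_def by fastforce
      have g2: "\<forall>e\<in>I. \<bar>v \<bullet> e\<bar> \<notin> {s..t}"
        using gap small large' by fastforce
      have ne: "big t u \<noteq> {}" and pos: "0 < u \<bullet> ch (big t u)" using u by (auto simp: P_def)
      have "ch (big t u) \<in> big t u" by (rule ch[OF ne])
      then have "t < sgn (u \<bullet> ch (big t u)) * (v \<bullet> ch (big t u))"
        by (intro large) (auto simp: big_def)
      then show "v \<in> P s t" using eq g2 ne pos st by (simp add: P_def)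
    qed
    then show "\<exists>T. open T \<and> u \<in> T \<and> T \<subseteq> P s t" using oT uT by blast
  qed
  have cover: "\<exists>s t :: rat. 0 < s \<and> s < t \<and> u \<in> P (of_rat s) (of_rat t) \<union> uminus ` P (of_rat s) (of_rat t)"
    if u0: "u \<noteq> 0" for u
  proof -
    obtain e0 where e0: "e0 \<in> I" "u \<bullet> e0 \<noteq> 0" using tot u0 by blast
    define a where "a = \<bar>u \<bullet> e0\<bar>"
    have a: "a > 0" using e0 by (simp add: a_def)
    define E where "E = {e\<in>I. a / 2 \<le> \<bar>u \<bullet> e\<bar>}"
    have finE: "finite E" unfolding E_def using a finite_large_coefficients[OF I, of "a / 2" u] by simp
    \<comment> \<open>The maximum \<open>m\<close> of \<open>S\<close> is at least every coefficient
      below \<open>a\<close>, and the entry a / 2 keeps it positive. No coefficient lies strictly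
      between \<open>m\<close> and \<open>a\<close>, which leaves room for rational thresholds s <
      t.\<close>
    define S where "S = insert (a / 2) ((\<lambda>e. \<bar>u \<bullet> e\<bar>) ` {e\<in>E. \<bar>u \<bullet> e\<bar> < a})"
    have finS: "finite S" "S \<noteq> {}" using finE by (auto simp: S_def)
    define m where "m = Max S"
    have ma: "m < a" using finS a unfolding m_def by (subst Max_less_iff) (auto simp: S_def)
    have m0: "m > 0" using Max_ge[OF finS(1), of "a / 2"] a by (simp add: m_def S_def)
    have below: "\<bar>u \<bullet> e\<bar> \<le> m" if "e \<in> I" "\<bar>u \<bullet> e\<bar> < a" for e
    proof (cases "e \<in> E")
      case True
      then show ?thesis using that Max_ge[OF finS(1)] by (auto simp: m_def S_def)
    next
      case False
      then have "\<bar>u \<bullet> e\<bar> \<le> a / 2" using that by (auto simp: E_def)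
      then show ?thesis using Max_ge[OF finS(1), of "a / 2"] by (simp add: m_def S_def)
    qed
    obtain s where s: "m < of_rat s" "of_rat s < a" using of_rat_dense[OF ma] by blast
    obtain t where t: "of_rat s < (of_rat t :: real)" "of_rat t < a" using of_rat_dense[OF s(2)] by blast
    have s0: "0 < s" using s m0 by (metis less_trans zero_less_of_rat_iff)
    have st: "s < t" using t by (simp add: of_rat_less)
    have gap: "\<forall>e\<in>I. \<bar>u \<bullet> e\<bar> \<notin> {of_rat s..of_rat t}"
      using below s t by fastforce
    have "e0 \<in> big (of_rat t) u" using e0 t by (simp add: big_def a_def)
    then have ne: "big (of_rat t) u \<noteq> {}" by blast
    have "ch (big (of_rat t) u) \<in> big (of_rat t) u" by (rule ch[OF ne])
    moreover have "0 < (of_rat t :: real)" using s0 st by simp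
    ultimately have "u \<bullet> ch (big (of_rat t) u) \<noteq> 0" by (auto simp: big_def)
    then have "u \<in> P (of_rat s) (of_rat t) \<or> - u \<in> P (of_rat s) (of_rat t)"
      using ne gap by (auto simp: P_def bigm)
    then have "u \<in> P (of_rat s) (of_rat t) \<union> uminus ` P (of_rat s) (of_rat t)"
      by (auto intro: image_eqI[of _ _ "- u"])
    then show ?thesis using s0 st by blast
  qed
  \<comment> \<open>Rational thresholds leave countably many sets, so that a sequence of functions
    suffices although X may be nonseparable.\<close>
  define J where "J = {st :: rat \<times> rat. 0 < fst st \<and> fst st < snd st}"
  have "(1, 2) \<in> J" by (simp add: J_def)
  then have J: "countable J" "J \<noteq> {}" by (auto intro: countableI_type)
  define Q where "Q n = (case from_nat_into J n of (s, t) \<Rightarrow> P (of_rat s) (of_rat t))" for n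
  have inJ: "from_nat_into J n \<in> J" for n using J by (simp add: from_nat_into)
  have Q: "open (Q n)" "Q n \<inter> uminus ` Q n = {}" for n
    using inJ[of n] op disj unfolding Q_def J_def by (auto simp: of_rat_less split: prod.splits)
  have nz: "\<exists>n. infdist u (UNIV - Q n) - infdist (- u) (UNIV - Q n) \<noteq> 0" if u0: "u \<noteq> 0" for u
  proof -
    obtain s t where st: "(s, t) \<in> J" "u \<in> P (of_rat s) (of_rat t) \<union> uminus ` P (of_rat s) (of_rat t)"
      using cover[OF u0] unfolding J_def by auto
    obtain n where "from_nat_into J n = (s, t)"
      using st(1) J by (metis from_nat_into_surj)
    then have "u \<in> Q n \<union> uminus ` Q n" using st by (simp add: Q_def)
    moreover have "openin (top_of_set UNIV) (Q n)" using Q(1) by simp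
    ultimately show ?thesis using odd_separating_function(3)[of UNIV "Q n" u] Q(2) by blast
  qed
  have "continuous_on UNIV (\<lambda>u. infdist u (UNIV - Q n) - infdist (- u) (UNIV - Q n))" for n
    by (intro continuous_intros)
  then show ?thesis
    using nz by (intro exI[of _ "\<lambda>n u. infdist u (UNIV - Q n) - infdist (- u) (UNIV - Q n)"]) (auto simp del: right_minus_eq)
qed

subsection \<open>Closed subspaces of Hilbert spaces\<close>

text \<open>The direct method: \<open>J\<close> is bounded below by coercivity, the parallelogram
  identity makes a minimising sequence Cauchy, and the first variation at the minimiser is the
  asserted identity. The form \<open>b\<close> is arbitrary because the gradient is taken with
  respect to the scalar product at the base point.\<close>

lemma riesz_on_subspace:
  fixes E :: "'a::{real_inner,complete_space} set" and b :: "'a \<Rightarrow> 'a \<Rightarrow> real"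
  assumes E: "subspace E" "closed E" and b: "bounded_bilinear b"
    and sym: "\<And>v w. b v w = b w v"
    and coer: "\<kappa> > 0" "\<And>v. v \<in> E \<Longrightarrow> \<kappa> * (norm v)\<^sup>2 \<le> b v v"
    and l: "bounded_linear l"
  shows "\<exists>g\<in>E. \<forall>w\<in>E. b g w = l w"
proof -
  interpret b: bounded_bilinear b by (rule b)
  interpret l: bounded_linear l by (rule l)
  define J where "J v = b v v - 2 * l v" for v
  obtain K where K: "\<And>v. norm (l v) \<le> norm v * K" using l.nonneg_bounded by blast
  have low: "- K\<^sup>2 / \<kappa> \<le> J v" if "v \<in> E" for v
  proof -
    have "0 \<le> (\<kappa> * norm v - K)\<^sup>2 / \<kappa>" using coer by simp
    also have "\<dots> = \<kappa> * (norm v)\<^sup>2 - 2 * (norm v * K) + K\<^sup>2 / \<kappa>"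
      using coer by (simp add: power2_eq_square field_simps)
    finally show ?thesis using coer(2)[OF that] K[of v] by (simp add: J_def)
  qed
  have zE: "0 \<in> E" using E by (simp add: subspace_0)
  define m where "m = Inf (J ` E)"
  have bdd: "bdd_below (J ` E)" using low by (auto intro!: bdd_belowI[of _ "- K\<^sup>2 / \<kappa>"])
  have m: "m \<le> J v" if "v \<in> E" for v unfolding m_def using bdd that by (intro cInf_lower) auto
  have "\<exists>v\<in>E. J v < m + 1 / Suc n" for n
  proof -
    have "Inf (J ` E) < m + 1 / Suc n" unfolding m_def by simp
    then show ?thesis using cInf_lessD[of "J ` E"] zE by blast
  qed
  then obtain x where x: "\<And>n. x n \<in> E" "\<And>n. J (x n) < m + 1 / Suc n" by metis
  have par: "\<kappa> * (norm (v - w))\<^sup>2 \<le> 2 * (J v - m) + 2 * (J w - m)" if "v \<in> E" "w \<in> E" for v w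
  proof -
    have "b (v - w) (v - w) = 2 * J v + 2 * J w - 4 * J ((1/2) *\<^sub>R (v + w))"
    proof -
      have "J ((1/2) *\<^sub>R (v + w)) = (1/4) * b (v + w) (v + w) - l (v + w)"
        unfolding J_def b.scaleR_left b.scaleR_right l.scaleR by simp
      moreover have "b (v + w) (v + w) = b v v + 2 * b v w + b w w"
        "b (v - w) (v - w) = b v v - 2 * b v w + b w w"
        by (simp_all add: b.add_left b.add_right b.diff_left b.diff_right sym[of w v])
      ultimately show ?thesis by (simp add: J_def[of v] J_def[of w] l.add add_divide_distrib)
    qed
    moreover have "(1/2) *\<^sub>R (v + w) \<in> E" using E that by (intro subspace_scale subspace_add)
    ultimately show ?thesis
      using m[of "(1/2) *\<^sub>R (v + w)"] coer(2)[OF subspace_diff[OF E(1) that]] by fastforce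
  qed
  have "Cauchy x"
  proof (rule CauchyI)
    fix e :: real assume e: "e > 0"
    obtain n0 :: nat where n0: "4 / (\<kappa> * e\<^sup>2) < n0" using reals_Archimedean2 by blast
    have "norm (x p - x q) < e" if "p \<ge> n0" "q \<ge> n0" for p q
    proof -
      have "4 / (\<kappa> * e\<^sup>2) < Suc p" "4 / (\<kappa> * e\<^sup>2) < Suc q" using n0 that by linarith+
      then have "1 / Suc p < \<kappa> * e\<^sup>2 / 4" "1 / Suc q < \<kappa> * e\<^sup>2 / 4" using e coer(1) by (simp_all add: field_simps)
      moreover have "J (x p) - m < 1 / Suc p" "J (x q) - m < 1 / Suc q" using x(2)[of p] x(2)[of q] by simp_all
      ultimately have J4: "J (x p) - m < \<kappa> * e\<^sup>2 / 4" "J (x q) - m < \<kappa> * e\<^sup>2 / 4"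
        by (metis less_trans)+
      have "\<kappa> * (norm (x p - x q))\<^sup>2 \<le> 2 * (J (x p) - m) + 2 * (J (x q) - m)"
        by (rule par) (rule x)+
      also have "\<dots> < \<kappa> * e\<^sup>2" using J4 by argo
      finally have "\<kappa> * (norm (x p - x q))\<^sup>2 < \<kappa> * e\<^sup>2" .
      then show ?thesis using coer(1) e by (meson mult_less_cancel_left_pos power_less_imp_less_base less_imp_le)
    qed
    then show "\<exists>M. \<forall>m\<ge>M. \<forall>n\<ge>M. norm (x m - x n) < e" by blast
  qed
  then obtain g where g: "x \<longlonglongrightarrow> g" using Cauchy_convergent convergent_def by blast
  have gE: "g \<in> E" using E(2) x(1) g closed_sequentially by blast
  have "(\<lambda>n. J (x n)) \<longlonglongrightarrow> J g"
    unfolding J_def by (intro tendsto_intros b.tendsto l.tendsto g)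
  moreover have "(\<lambda>n. m + 1 / Suc n) \<longlonglongrightarrow> m + 0"
    by (intro tendsto_intros) (use LIMSEQ_Suc[OF lim_1_over_n] in simp)
  ultimately have Jg: "J g \<le> m" using x(2) by (intro LIMSEQ_le[of "\<lambda>n. J (x n)"]) (auto intro: less_imp_le)
  have "b g w = l w" if w: "w \<in> E" for w
  proof -
    define A where "A = b g w - l w"
    define B where "B = b w w"
    have B: "B \<ge> 0" using coer(1) coer(2)[OF w] unfolding B_def by (smt (verit) mult_nonneg_nonneg zero_le_power2)
    have "0 \<le> 2 * t * A + t\<^sup>2 * B" for t
    proof -
      have "J (g + t *\<^sub>R w) = J g + 2 * t * A + t\<^sup>2 * B"
        by (simp add: J_def A_def B_def b.add_left b.add_right b.scaleR_left b.scaleR_right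
          l.add l.scaleR sym[of w g] power2_eq_square algebra_simps)
      moreover have "m \<le> J (g + t *\<^sub>R w)" using E gE w by (intro m subspace_add subspace_scale)
      ultimately show ?thesis using Jg by linarith
    qed
    \<comment> \<open>The minimiser of the quadratic would be \<open>- A / B\<close>; the
      denominator \<open>B + 1\<close> works also for \<open>B = 0\<close> and still gives a
      negative value unless \<open>A = 0\<close>.\<close>
    from this[of "- A / (B + 1)"] have "0 \<le> - 2 * A\<^sup>2 / (B + 1) + A\<^sup>2 / (B + 1)\<^sup>2 * B"
      by (simp add: power2_eq_square)
    also have "\<dots> = A\<^sup>2 * (- B - 2) / (B + 1)\<^sup>2"
      using B by (simp add: power2_eq_square divide_simps) (simp add: algebra_simps)
    finally have "0 \<le> A\<^sup>2 * (- B - 2)" using B by (simp add: zero_le_divide_iff)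
    then have "A = 0" using B by (smt (verit) mult_pos_neg zero_less_power2)
    then show ?thesis by (simp add: A_def)
  qed
  then show ?thesis using gE by blast
qed

text \<open>The projection of x represents the functional \<open>w \<mapsto> x \<bullet> w\<close>
  on \<open>E\<close>; linearity and the norm bound follow from uniqueness of the
  representative.\<close>

lemma orthogonal_projection_exists:
  fixes E :: "'a::{real_inner,complete_space} set"
  assumes E: "subspace E" "closed E"
  shows "\<exists>P. bounded_linear P \<and> (\<forall>x. P x \<in> E) \<and> (\<forall>x\<in>E. P x = x)"
proof -
  have "\<exists>p\<in>E. \<forall>w\<in>E. p \<bullet> w = x \<bullet> w" for x
    by (rule riesz_on_subspace[OF E bounded_bilinear_inner, of 1])
       (auto simp: inner_commute dot_square_norm bounded_linear_inner_right)
  then obtain P where P: "\<And>x. P x \<in> E" "\<And>x w. w \<in> E \<Longrightarrow> P x \<bullet> w = x \<bullet> w" by metis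
  have uniq: "P x = y" if "y \<in> E" "\<And>w. w \<in> E \<Longrightarrow> y \<bullet> w = x \<bullet> w" for x y
  proof -
    have "P x - y \<in> E" using P(1) that(1) E by (simp add: subspace_diff)
    then have "(P x - y) \<bullet> (P x - y) = 0" using P(2) that(2) by (simp add: inner_diff_left)
    then show ?thesis by simp
  qed
  have "bounded_linear P"
  proof (rule bounded_linear_intro[where K=1])
    show "P (x + y) = P x + P y" for x y
      using E P by (intro uniq) (auto simp: inner_add_left subspace_add)
    show "P (r *\<^sub>R x) = r *\<^sub>R P x" for r x
      using E P by (intro uniq) (auto simp: subspace_scale)
    show "norm (P x) \<le> norm x * 1" for x
    proof (cases "P x = 0")
      case False
      have "(norm (P x))\<^sup>2 = x \<bullet> P x" using P by (simp add: dot_square_norm[symmetric])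
      also have "\<dots> \<le> norm x * norm (P x)" by (rule norm_cauchy_schwarz)
      finally show ?thesis using False by (simp add: power2_eq_square)
    qed simp
  qed
  then show ?thesis using P(1) uniq by blast
qed

subsection \<open>Differential equations on closed subspaces\<close>

text \<open>Sort inference does not identify \<open>{real_normed_vector, complete_space}\<close> with \<open>banach\<close>, so
  integration theory is applied to an isometric copy of the space.\<close>

typedef (overloaded) ('a::real_normed_vector) copy = "UNIV :: 'a set"
  morphisms of_copy to_copy by simp

lemma of_copy_to_copy [simp]: "of_copy (to_copy x) = x"
  by (simp add: to_copy_inverse)

lemma to_copy_of_copy [simp]: "to_copy (of_copy x) = x"
  by (rule of_copy_inverse)

instantiation copy :: (real_normed_vector) real_normed_vector
begin

definition "0 = to_copy 0"
definition "x + y = to_copy (of_copy x + of_copy y)"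
definition "x - y = to_copy (of_copy x - of_copy y)"
definition "- x = to_copy (- of_copy x)"
definition scaleR_copy :: "real \<Rightarrow> 'a copy \<Rightarrow> 'a copy" where "scaleR_copy r x = to_copy (r *\<^sub>R of_copy x)"
definition "norm x = norm (of_copy x)"
definition "dist x y = dist (of_copy x) (of_copy y)"
definition "sgn x = inverse (norm x) *\<^sub>R x" for x :: "'a copy"
definition "uniformity = (INF e\<in>{0<..}. principal {(x, y). dist (x :: 'a copy) y < e})"
definition "open U = (\<forall>x\<in>U. \<forall>\<^sub>F (x', y) in uniformity. x' = x \<longrightarrow> y \<in> U)" for U :: "'a copy set"

instance
proof
  fix x y z :: "'a copy" and a b :: real and U :: "'a copy set"
  show "x + y + z = x + (y + z)" "x + y = y + x" "0 + x = x" "- x + x = 0" "x - y = x + - y"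
    by (simp_all add: plus_copy_def zero_copy_def uminus_copy_def minus_copy_def ac_simps)
  show "a *\<^sub>R (x + y) = a *\<^sub>R x + a *\<^sub>R y" "(a + b) *\<^sub>R x = a *\<^sub>R x + b *\<^sub>R x"
    "a *\<^sub>R b *\<^sub>R x = (a * b) *\<^sub>R x" "1 *\<^sub>R x = x"
    by (simp_all add: plus_copy_def scaleR_copy_def scaleR_add_right scaleR_add_left)
  show "dist x y = norm (x - y)" by (simp add: dist_copy_def norm_copy_def minus_copy_def dist_norm)
  show "sgn x = inverse (norm x) *\<^sub>R x" by (simp add: sgn_copy_def)
  show "(norm x = 0) = (x = 0)"
    by (metis norm_copy_def norm_eq_zero of_copy_to_copy to_copy_of_copy zero_copy_def)
  show "norm (x + y) \<le> norm x + norm y"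
    by (simp add: norm_copy_def plus_copy_def norm_triangle_ineq)
  show "norm (a *\<^sub>R x) = \<bar>a\<bar> * norm x" by (simp add: norm_copy_def scaleR_copy_def)
  show "uniformity = (INF e\<in>{0<..}. principal {(x, y). dist (x :: 'a copy) y < e})"
    by (rule uniformity_copy_def)
  show "open U = (\<forall>x\<in>U. \<forall>\<^sub>F (x', y) in uniformity. x' = x \<longrightarrow> y \<in> U)"
    by (rule open_copy_def)
qed

end

lemma bounded_linear_of_copy: "bounded_linear of_copy"
  by (rule bounded_linear_intro[where K=1]) (simp_all add: plus_copy_def scaleR_copy_def norm_copy_def)

lemma bounded_linear_to_copy: "bounded_linear to_copy"
  by (rule bounded_linear_intro[where K=1]) (simp_all add: plus_copy_def scaleR_copy_def norm_copy_def)

instance copy :: ("{real_normed_vector, complete_space}") banach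
proof
  fix X :: "nat \<Rightarrow> 'a copy" assume "Cauchy X"
  then have "Cauchy (\<lambda>n. of_copy (X n))" by (simp add: Cauchy_def dist_copy_def)
  then obtain l where "(\<lambda>n. of_copy (X n)) \<longlonglongrightarrow> l"
    using Cauchy_convergent convergent_def by blast
  then have "(\<lambda>n. to_copy (of_copy (X n))) \<longlonglongrightarrow> to_copy l"
    by (rule bounded_linear.tendsto[OF bounded_linear_to_copy])
  then show "convergent X" by (auto simp: convergent_def)
qed

lemma antiderivative_exists:
  fixes f :: "real \<Rightarrow> 'a::{real_normed_vector,complete_space}"
  assumes "continuous_on {a..b} f"
  shows "\<exists>F. \<forall>t\<in>{a..b}. (F has_vector_derivative f t) (at t within {a..b})"
proof -
  define g where "g t = to_copy (f t)" for t
  have "continuous_on {a..b} g"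
    unfolding g_def using assms by (rule bounded_linear.continuous_on[OF bounded_linear_to_copy])
  then have "((\<lambda>u. integral {a..u} g) has_vector_derivative g t) (at t within {a..b})"
    if "t \<in> {a..b}" for t using that by (rule integral_has_vector_derivative)
  then have "((\<lambda>u. of_copy (integral {a..u} g)) has_vector_derivative of_copy (g t)) (at t within {a..b})"
    if "t \<in> {a..b}" for t
    using that by (intro bounded_linear.has_vector_derivative[OF bounded_linear_of_copy]) blast
  then show ?thesis by (intro exI[of _ "\<lambda>u. of_copy (integral {a..u} g)"]) (simp add: g_def)
qed

lemma vector_derivative_bound:
  fixes f :: "real \<Rightarrow> 'a::real_normed_vector"
  assumes f: "\<And>t. t \<in> {a..b} \<Longrightarrow> (f has_vector_derivative f' t) (at t within {a..b})"
    and B: "\<And>t. t \<in> {a..b} \<Longrightarrow> norm (f' t) \<le> B" and st: "s \<in> {a..b}" "t \<in> {a..b}"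
  shows "norm (f s - f t) \<le> B * \<bar>s - t\<bar>"
proof -
  have "norm (f s - f t) \<le> B * norm (s - t)"
  proof (rule differentiable_bound[OF convex_real_interval(5)[of a b]])
    fix x assume x: "x \<in> {a..b}"
    then show "(f has_derivative (\<lambda>h. h *\<^sub>R f' x)) (at x within {a..b})"
      using f by (simp add: has_vector_derivative_def)
    show "onorm (\<lambda>h. h *\<^sub>R f' x) \<le> B"
    proof (rule onorm_le)
      fix h :: real
      show "norm (h *\<^sub>R f' x) \<le> B * norm h"
        using mult_right_mono[OF B[OF x], of "\<bar>h\<bar>"] by (simp add: mult.commute)
    qed
  qed (use st in auto)
  then show ?thesis by simp
qed

text \<open>Banach's fixed point theorem for the integral operator:
  \<open>\<tau> * B \<le> r\<close> keeps curves in the ball and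
  \<open>\<tau> * L \<le> 1 / 2\<close> gives the contraction. As \<open>W\<close> is controlled
  only on \<open>E\<close>, the iteration must not leave \<open>E\<close>.\<close>

lemma picard_lindeloef_on_subspace:
  fixes W :: "'a::{real_inner,complete_space} \<Rightarrow> 'a"
  assumes E: "subspace E" "closed E" and y0: "y0 \<in> E"
    and lip: "\<And>x y. x \<in> E \<inter> cball y0 r \<Longrightarrow> y \<in> E \<inter> cball y0 r \<Longrightarrow> norm (W x - W y) \<le> L * norm (x - y)"
    and B: "\<And>x. x \<in> E \<inter> cball y0 r \<Longrightarrow> norm (W x) \<le> B"
    and WE: "\<And>x. x \<in> E \<inter> cball y0 r \<Longrightarrow> W x \<in> E"
    and r: "r \<ge> 0" "L \<ge> 0" "B \<ge> 0" and \<tau>: "\<tau> \<ge> 0" "\<tau> * B \<le> r" "\<tau> * L \<le> 1 / 2"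
  shows "\<exists>y. y 0 = y0 \<and> (\<forall>t\<in>{0..\<tau>}. y t \<in> E \<inter> cball y0 r \<and>
           (y has_vector_derivative W (y t)) (at t within {0..\<tau>}))"
proof -
  obtain P where P: "bounded_linear P" "\<forall>x. P x \<in> E" "\<forall>x\<in>E. P x = x"
    using orthogonal_projection_exists[OF E] by blast
  define D where "D = E \<inter> cball y0 r"
  define S where "S = PiC (UNIV :: real set) (\<lambda>_. D)"
  have mS: "h \<in> S \<longleftrightarrow> (\<forall>t. apply_bcontfun h t \<in> D)" for h by (simp add: S_def mem_PiC_iff Pi_iff)
  have "closed D" unfolding D_def using E by auto
  then have "closed S" unfolding S_def by (intro closed_PiC) auto
  then have S: "complete S" by (simp add: complete_eq_closed)
  have cW: "continuous_on D W"
  proof (rule lipschitz_on_continuous_on)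
    show "L-lipschitz_on D W" using lip r unfolding D_def by (intro lipschitz_onI) (simp_all add: dist_norm)
  qed
  have "\<exists>F. F 0 = 0 \<and> (\<forall>t\<in>{0..\<tau>}. (F has_vector_derivative W (apply_bcontfun h t)) (at t within {0..\<tau>}))
     \<and> (\<forall>t. F t \<in> E)" if h: "h \<in> S" for h :: "real \<Rightarrow>\<^sub>C 'a"
  proof -
    have "continuous_on {0..\<tau>} (\<lambda>t. W (apply_bcontfun h t))"
      using h mS by (intro continuous_on_compose2[OF cW]) auto
    then obtain F where F: "\<forall>t\<in>{0..\<tau>}. (F has_vector_derivative W (apply_bcontfun h t)) (at t within {0..\<tau>})"
      using antiderivative_exists by blast
    \<comment> \<open>An antiderivative of a curve in \<open>E\<close> may start outside
      \<open>E\<close>. Projecting does not change its derivative, because \<open>P\<close> fixes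
      the values of \<open>W\<close>, and places the curve in \<open>E\<close>.\<close>
    have d: "((\<lambda>t. P (F t) - P (F 0)) has_vector_derivative W (apply_bcontfun h t)) (at t within {0..\<tau>})"
      if "t \<in> {0..\<tau>}" for t
    proof -
      have "((\<lambda>t. P (F t)) has_vector_derivative P (W (apply_bcontfun h t))) (at t within {0..\<tau>})"
        using F that by (intro bounded_linear.has_vector_derivative[OF P(1)]) auto
      moreover have "P (W (apply_bcontfun h t)) = W (apply_bcontfun h t)"
        using P(3) WE h mS unfolding D_def by blast
      ultimately show ?thesis
        by (auto intro!: derivative_eq_intros simp: has_vector_derivative_diff_const)
    qed
    show ?thesis
      using d P(2) E by (intro exI[of _ "\<lambda>t. P (F t) - P (F 0)"]) (auto intro: subspace_diff)
  qed
  then obtain A where A0: "\<And>h. h \<in> S \<Longrightarrow> A h 0 = 0"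
    and A1: "\<And>h t. h \<in> S \<Longrightarrow> t \<in> {0..\<tau>} \<Longrightarrow> (A h has_vector_derivative W (apply_bcontfun h t)) (at t within {0..\<tau>})"
    and A2: "\<And>h t. h \<in> S \<Longrightarrow> A h t \<in> E" by metis
  \<comment> \<open>Clamping the time to [0, \<tau>] turns a curve on that interval into a bounded
    continuous function on the whole line, an element of a complete metric space.\<close>
  define cl where "cl t = max 0 (min \<tau> t)" for t
  have cl: "cl t \<in> {0..\<tau>}" for t using \<tau> by (auto simp: cl_def)
  have cl_id: "cl t = t" if "t \<in> {0..\<tau>}" for t using that by (auto simp: cl_def)
  have Abound: "norm (A h s) \<le> r" if "h \<in> S" "s \<in> {0..\<tau>}" for h s
  proof -
    have "norm (A h s - A h 0) \<le> B * \<bar>s - 0\<bar>"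
    proof (rule vector_derivative_bound[of 0 \<tau> "A h"])
      fix t assume t: "t \<in> {0..\<tau>}"
      show "(A h has_vector_derivative W (apply_bcontfun h t)) (at t within {0..\<tau>})"
        using A1 that t by blast
      show "norm (W (apply_bcontfun h t)) \<le> B"
        using B that(1) mS unfolding D_def by blast
    qed (use that \<tau> in auto)
    also have "\<dots> \<le> \<tau> * B" using that r by (simp add: mult.commute mult_left_mono)
    finally show ?thesis using A0 that \<tau> by simp
  qed
  define T where "T h = Bcontfun (\<lambda>t. y0 + A h (cl t))" for h
  have T: "apply_bcontfun (T h) t = y0 + A h (cl t)" if h: "h \<in> S" for h t
  proof -
    have "continuous_on {0..\<tau>} (A h)"
      using A1[OF h] has_vector_derivative_continuous continuous_on_eq_continuous_within by blast
    moreover have "continuous_on UNIV cl" unfolding cl_def by (intro continuous_intros)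
    ultimately have "continuous_on UNIV (\<lambda>t. A h (cl t))"
      by (rule continuous_on_compose2) (use cl in blast)
    then have c: "continuous_on UNIV (\<lambda>t. y0 + A h (cl t))" by (intro continuous_intros)
    have "norm (y0 + A h (cl t)) \<le> norm y0 + r" for t
      using norm_triangle_ineq[of y0 "A h (cl t)"] Abound[OF h cl[of t]] by linarith
    then have "bounded (range (\<lambda>t. y0 + A h (cl t)))" by (auto simp: bounded_iff)
    with c have "(\<lambda>t. y0 + A h (cl t)) \<in> bcontfun" by (simp add: bcontfun_def)
    then show ?thesis by (simp add: T_def Bcontfun_inverse)
  qed
  have TS: "T h \<in> S" if h: "h \<in> S" for h
    unfolding mS T[OF h] D_def
    using A2[OF h] Abound[OF h cl] E y0 by (auto simp: dist_norm intro: subspace_add)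
  have lipT: "dist (T h) (T k) \<le> 1 / 2 * dist h k" if hk: "h \<in> S" "k \<in> S" for h k
  proof (rule dist_bound)
    fix t
    have "norm ((A h (cl t) - A k (cl t)) - (A h 0 - A k 0)) \<le> (L * dist h k) * \<bar>cl t - 0\<bar>"
    proof (rule vector_derivative_bound[of 0 \<tau> "\<lambda>t. A h t - A k t"])
      fix t assume t: "t \<in> {0..\<tau>}"
      show "((\<lambda>t. A h t - A k t) has_vector_derivative W (apply_bcontfun h t) - W (apply_bcontfun k t)) (at t within {0..\<tau>})"
        using A1 hk t by (intro has_vector_derivative_diff) auto
      have "norm (W (apply_bcontfun h t) - W (apply_bcontfun k t)) \<le> L * dist (apply_bcontfun h t) (apply_bcontfun k t)"
        using lip hk mS unfolding D_def by (auto simp: dist_norm)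
      also have "\<dots> \<le> L * dist h k" using r dist_bounded by (intro mult_left_mono)
      finally show "norm (W (apply_bcontfun h t) - W (apply_bcontfun k t)) \<le> L * dist h k" .
    qed (use cl \<tau> in auto)
    also have "\<dots> = (\<bar>cl t\<bar> * L) * dist h k" by simp
    also have "\<dots> \<le> (\<tau> * L) * dist h k" using cl[of t] r by (intro mult_right_mono) auto
    also have "\<dots> \<le> 1 / 2 * dist h k" using \<tau> by (intro mult_right_mono) auto
    finally show "dist (apply_bcontfun (T h) t) (apply_bcontfun (T k) t) \<le> 1 / 2 * dist h k"
      using A0 hk by (simp add: T dist_norm)
  qed
  have "const_bcontfun y0 \<in> S" using y0 r by (simp add: mS const_bcontfun.rep_eq D_def)
  then have "S \<noteq> {}" by blast
  then have "\<exists>!x\<in>S. T x = x"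
    using Banach_fix[OF S, of "1/2" T] TS lipT by (auto simp: image_subset_iff)
  then obtain h where h: "h \<in> S" "T h = h" by blast
  have e: "apply_bcontfun h t = y0 + A h (cl t)" for t using T[OF h(1), of t] h(2) by simp
  show ?thesis
  proof (intro exI[of _ "apply_bcontfun h"] conjI ballI)
    show "apply_bcontfun h 0 = y0" using e[of 0] A0[OF h(1)] \<tau> by (simp add: cl_def)
    fix t assume t: "t \<in> {0..\<tau>}"
    show "apply_bcontfun h t \<in> E \<inter> cball y0 r" using h mS D_def by blast
    have "((\<lambda>t. y0 + A h t) has_vector_derivative W (apply_bcontfun h t)) (at t within {0..\<tau>})"
      using A1[OF h(1) t] by (auto intro!: derivative_eq_intros)
    then show "(apply_bcontfun h has_vector_derivative W (apply_bcontfun h t)) (at t within {0..\<tau>})"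
      by (rule has_vector_derivative_transform[OF t, rotated]) (simp add: e cl_id)
  qed
qed

subsection \<open>Varying scalar products and the length metric\<close>

locale riemannian_setting =
  fixes G :: "('g, 'm) monoid_scheme"
    and act :: "'g \<Rightarrow> 'a::{real_inner,complete_space} \<Rightarrow> 'a"
    and ip :: "'a \<Rightarrow> 'a \<Rightarrow> 'a \<Rightarrow> real"
    and M :: "'a set"
    and \<Phi> :: "'a \<Rightarrow> real"
  assumes scalar_products: "\<And>u. u \<noteq> 0 \<Longrightarrow> is_scalar_product (ip u)"
    and G_group: "group G"
    and action: "linear_action G act"
    and M1: "cond_M1 ip"
    and M2: "cond_M2 ip"
    and M3: "cond_M3 G act ip"
    and M_nonzero: "M \<subseteq> UNIV - {0}"
    and M_submanifold: "C11_submanifold M"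
    and M_symmetric: "M = uminus ` M"
    and M_invariant: "\<And>g u. g \<in> carrier G \<Longrightarrow> u \<in> M \<Longrightarrow> act g u \<in> M"
    and Phi_C11: "C11_functional M \<Phi>"
    and Phi_even: "\<And>u. u \<in> M \<Longrightarrow> \<Phi> (- u) = \<Phi> u"
    and Phi_invariant: "\<And>g u. g \<in> carrier G \<Longrightarrow> u \<in> M \<Longrightarrow> \<Phi> (act g u) = \<Phi> u"
begin

abbreviation nrm :: "'a \<Rightarrow> 'a \<Rightarrow> real" where "nrm \<equiv> ipnorm ip"

lemma M_neq_0: "u \<in> M \<Longrightarrow> u \<noteq> 0"
  using M_nonzero by blast

lemma M_uminus: "u \<in> M \<Longrightarrow> - u \<in> M"
  using M_symmetric by blast

lemma ip_bilinear: "u \<noteq> 0 \<Longrightarrow> bilinear (ip u)"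
  and ip_sym: "u \<noteq> 0 \<Longrightarrow> ip u v w = ip u w v"
  and ip_pos: "u \<noteq> 0 \<Longrightarrow> v \<noteq> 0 \<Longrightarrow> 0 < ip u v v"
  using scalar_products[of u] by (simp_all add: is_scalar_product_def)

lemma ip_zero [simp]: "u \<noteq> 0 \<Longrightarrow> ip u 0 w = 0" "u \<noteq> 0 \<Longrightarrow> ip u w 0 = 0"
  using ip_bilinear[of u] by (simp_all add: bilinear_lzero bilinear_rzero)

lemma ip_nonneg: "u \<noteq> 0 \<Longrightarrow> 0 \<le> ip u v v"
  using ip_pos[of u v] by (cases "v = 0") auto

lemma ip_scaleR:
  "u \<noteq> 0 \<Longrightarrow> ip u (r *\<^sub>R v) w = r * ip u v w" "u \<noteq> 0 \<Longrightarrow> ip u v (r *\<^sub>R w) = r * ip u v w"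
  using ip_bilinear[of u] by (simp_all add: bilinear_lmul bilinear_rmul)

lemma nrm_nonneg: "u \<noteq> 0 \<Longrightarrow> 0 \<le> nrm u v"
  by (simp add: ipnorm_def ip_nonneg)

lemma nrm_sq: "u \<noteq> 0 \<Longrightarrow> (nrm u v)\<^sup>2 = ip u v v"
  by (simp add: ipnorm_def ip_nonneg)

lemma nrm_scaleR: "u \<noteq> 0 \<Longrightarrow> nrm u (r *\<^sub>R v) = \<bar>r\<bar> * nrm u v"
  by (simp add: ipnorm_def ip_scaleR real_sqrt_mult power2_eq_square[symmetric] mult.assoc[symmetric])

lemma nrm_zero [simp]: "u \<noteq> 0 \<Longrightarrow> nrm u 0 = 0"
  by (simp add: ipnorm_def)

lemma nrm_uminus: "u \<noteq> 0 \<Longrightarrow> nrm u (- v) = nrm u v"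
  using nrm_scaleR[of u "-1" v] by simp

lemma ip_cauchy_schwarz:
  assumes u: "u \<noteq> 0" shows "\<bar>ip u v w\<bar> \<le> nrm u v * nrm u w"
proof (cases "w = 0")
  case False
  note bl = ip_bilinear[OF u]
  define B where "B = ip u w w"
  have B: "B > 0" using ip_pos[OF u False] by (simp add: B_def)
  define t where "t = ip u v w / B"
  have "0 \<le> ip u (v - t *\<^sub>R w) (v - t *\<^sub>R w)" by (rule ip_nonneg[OF u])
  also have "\<dots> = ip u v v - 2 * t * ip u v w + t\<^sup>2 * B"
    by (simp add: bilinear_lsub[OF bl] bilinear_rsub[OF bl] ip_scaleR[OF u] ip_sym[OF u, of w v] B_def
        power2_eq_square algebra_simps)
  also have "\<dots> = ip u v v - (ip u v w)\<^sup>2 / B"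
    using B by (simp add: t_def power2_eq_square)
  finally have "(ip u v w)\<^sup>2 \<le> ip u v v * B" using B by (simp add: field_simps)
  then have "sqrt ((ip u v w)\<^sup>2) \<le> sqrt (ip u v v * B)" by (rule real_sqrt_le_mono)
  then show ?thesis by (simp add: ipnorm_def B_def real_sqrt_mult)
qed (use u in simp)

lemma local_metric_bounds:
  assumes "u0 \<noteq> 0"
  shows "\<exists>r>0. \<exists>C>0. \<forall>u\<in>ball u0 r. u \<noteq> 0 \<and> (\<forall>v. nrm u v \<le> C * norm v \<and> norm v \<le> C * nrm u v) \<and>
     (\<forall>u'\<in>ball u0 r. \<forall>v w. \<bar>ip u v w - ip u' v w\<bar> \<le> C * norm (u - u') * norm v * norm w)"
proof -
  define P1 where "P1 U C \<longleftrightarrow> open U \<and> u0 \<in> U \<and> 0 \<notin> U \<and> C > 0 \<and>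
    (\<forall>u'\<in>U. \<forall>v. 1 / C * norm v \<le> nrm u' v \<and> nrm u' v \<le> C * norm v)" for U C
  define P2 where "P2 U C \<longleftrightarrow> open U \<and> u0 \<in> U \<and> 0 \<notin> U \<and> C > 0 \<and>
    (\<forall>u1\<in>U. \<forall>u2\<in>U. \<forall>v w. \<bar>ip u1 v w - ip u2 v w\<bar> \<le> C * norm (u1 - u2) * norm v * norm w)" for U C
  have "\<exists>U C. P1 U C" "\<exists>U C. P2 U C"
    using M1 M2 assms unfolding cond_M1_def cond_M2_def P1_def P2_def by simp_all
  then obtain U1 C1 U2 C2 where P12: "P1 U1 C1" "P2 U2 C2" by blast
  note U1 = P12(1)[unfolded P1_def, THEN conjunct1] P12(1)[unfolded P1_def, THEN conjunct2, THEN conjunct1]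
    P12(1)[unfolded P1_def, THEN conjunct2, THEN conjunct2, THEN conjunct1]
    P12(1)[unfolded P1_def, THEN conjunct2, THEN conjunct2, THEN conjunct2, THEN conjunct1]
    P12(1)[unfolded P1_def, THEN conjunct2, THEN conjunct2, THEN conjunct2, THEN conjunct2]
  note U2 = P12(2)[unfolded P2_def, THEN conjunct1] P12(2)[unfolded P2_def, THEN conjunct2, THEN conjunct1]
    P12(2)[unfolded P2_def, THEN conjunct2, THEN conjunct2, THEN conjunct1]
    P12(2)[unfolded P2_def, THEN conjunct2, THEN conjunct2, THEN conjunct2, THEN conjunct1]
    P12(2)[unfolded P2_def, THEN conjunct2, THEN conjunct2, THEN conjunct2, THEN conjunct2]
  obtain r where r: "r > 0" "ball u0 r \<subseteq> U1 \<inter> U2"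
    using open_Int[OF U1(1) U2(1)] U1(2) U2(2) open_contains_ball by blast
  define C where "C = max C1 C2"
  have C: "C > 0" using U1 by (simp add: C_def)
  have "u \<noteq> 0 \<and> (\<forall>v. nrm u v \<le> C * norm v \<and> norm v \<le> C * nrm u v) \<and>
     (\<forall>u'\<in>ball u0 r. \<forall>v w. \<bar>ip u v w - ip u' v w\<bar> \<le> C * norm (u - u') * norm v * norm w)"
    if u: "u \<in> ball u0 r" for u
  proof (intro conjI allI ballI)
    have uU: "u \<in> U1" "u \<in> U2" using u r by blast+
    show u0: "u \<noteq> 0" using uU U1 by blast
    fix v w
    have a: "1 / C1 * norm v \<le> nrm u v" "nrm u v \<le> C1 * norm v" using U1(5) uU by blast+
    show "nrm u v \<le> C * norm v"
      using a(2) mult_right_mono[of C1 C "norm v"] by (simp add: C_def)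
    have "norm v \<le> C1 * nrm u v" using a(1) U1(4) by (simp add: field_simps)
    also have "\<dots> \<le> C * nrm u v" using nrm_nonneg[OF u0] by (intro mult_right_mono) (simp_all add: C_def)
    finally show "norm v \<le> C * nrm u v" .
    fix u' assume "u' \<in> ball u0 r"
    then have "u' \<in> U2" using r by blast
    then have "\<bar>ip u v w - ip u' v w\<bar> \<le> C2 * (norm (u - u') * norm v * norm w)"
      using U2(5) uU by (simp add: mult.assoc)
    also have "\<dots> \<le> C * (norm (u - u') * norm v * norm w)" by (intro mult_right_mono) (simp_all add: C_def)
    finally show "\<bar>ip u v w - ip u' v w\<bar> \<le> C * norm (u - u') * norm v * norm w" by (simp add: mult.assoc)
  qed
  then show ?thesis using r(1) C by blast
qed

lemma bounded_bilinear_ip: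
  assumes u: "u \<noteq> 0" shows "bounded_bilinear (ip u)"
proof -
  obtain r C where "r > 0" "C > 0" and rC: "\<forall>u'\<in>ball u r. u' \<noteq> 0 \<and> (\<forall>v. nrm u' v \<le> C * norm v \<and> norm v \<le> C * nrm u' v) \<and>
     (\<forall>u''\<in>ball u r. \<forall>v w. \<bar>ip u' v w - ip u'' v w\<bar> \<le> C * norm (u' - u'') * norm v * norm w)"
    using local_metric_bounds[OF u] by blast
  then have C: "nrm u v \<le> C * norm v" for v by (metis centre_in_ball)
  note bl = ip_bilinear[OF u]
  show ?thesis
  proof (unfold_locales)
    show "\<exists>K. \<forall>a b. norm (ip u a b) \<le> norm a * norm b * K"
    proof (intro exI allI)
      fix a b
      have "\<bar>ip u a b\<bar> \<le> nrm u a * nrm u b" by (rule ip_cauchy_schwarz[OF u])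
      also have "\<dots> \<le> (C * norm a) * (C * norm b)"
        using C nrm_nonneg[OF u] \<open>C > 0\<close> by (intro mult_mono) auto
      finally show "norm (ip u a b) \<le> norm a * norm b * (C * C)" by (simp add: mult_ac)
    qed
  qed (simp_all add: bilinear_ladd[OF bl] bilinear_radd[OF bl] ip_scaleR[OF u])
qed

lemma tendsto_ip:
  assumes f: "(f \<longlongrightarrow> a) F" and g: "(g \<longlongrightarrow> b) F" and h: "(h \<longlongrightarrow> c) F" and a: "a \<noteq> 0"
  shows "((\<lambda>x. ip (f x) (g x) (h x)) \<longlongrightarrow> ip a b c) F"
proof -
  obtain r C where r: "r > 0" "C > 0" and C: "\<forall>u\<in>ball a r. u \<noteq> 0 \<and> (\<forall>v. nrm u v \<le> C * norm v \<and> norm v \<le> C * nrm u v) \<and>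
     (\<forall>u'\<in>ball a r. \<forall>v w. \<bar>ip u v w - ip u' v w\<bar> \<le> C * norm (u - u') * norm v * norm w)"
    using local_metric_bounds[OF a] by blast
  have "((\<lambda>x. C * norm (f x - a) * norm (g x) * norm (h x)) \<longlongrightarrow> C * norm (a - a) * norm b * norm c) F"
    by (intro tendsto_intros f g h)
  then have z: "((\<lambda>x. C * norm (f x - a) * norm (g x) * norm (h x)) \<longlongrightarrow> 0) F" by simp
  have "\<forall>\<^sub>F x in F. f x \<in> ball a r" using f r by (metis centre_in_ball open_ball topological_tendstoD)
  then have "\<forall>\<^sub>F x in F. norm (ip (f x) (g x) (h x) - ip a (g x) (h x)) \<le> C * norm (f x - a) * norm (g x) * norm (h x)"
    by eventually_elim (use C r in auto)
  then have "((\<lambda>x. ip (f x) (g x) (h x) - ip a (g x) (h x)) \<longlongrightarrow> 0) F"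
    using z by (rule Lim_null_comparison)
  moreover have "((\<lambda>x. ip a (g x) (h x)) \<longlongrightarrow> ip a b c) F"
    by (rule bounded_bilinear.tendsto[OF bounded_bilinear_ip[OF a] g h])
  ultimately have "((\<lambda>x. (ip (f x) (g x) (h x) - ip a (g x) (h x)) + ip a (g x) (h x)) \<longlongrightarrow> 0 + ip a b c) F"
    by (rule tendsto_add)
  then show ?thesis by simp
qed

lemma tendsto_nrm:
  "(f \<longlongrightarrow> a) F \<Longrightarrow> (g \<longlongrightarrow> b) F \<Longrightarrow> a \<noteq> 0 \<Longrightarrow> ((\<lambda>x. nrm (f x) (g x)) \<longlongrightarrow> nrm a b) F"
  unfolding ipnorm_def by (intro tendsto_real_sqrt tendsto_ip)

lemma continuous_on_nrm:
  assumes "continuous_on S f" "continuous_on S g" "\<And>x. x \<in> S \<Longrightarrow> f x \<noteq> 0"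
  shows "continuous_on S (\<lambda>x. nrm (f x) (g x))"
  using assms unfolding continuous_on_def by (auto intro: tendsto_nrm)

section \<open>The group acts by isometries between the scalar products\<close>

interpretation grp: group G by (rule G_group)
interpretation ga: group_action G UNIV act using action by (simp add: linear_action_def)

lemma act_linear: "g \<in> carrier G \<Longrightarrow> linear (act g)"
  using action by (simp add: linear_action_def)

lemma act_mult: "g \<in> carrier G \<Longrightarrow> h \<in> carrier G \<Longrightarrow> act (g \<otimes>\<^bsub>G\<^esub> h) x = act g (act h x)"
  by (rule ga.composition_rule) simp_all

lemma act_inv: "g \<in> carrier G \<Longrightarrow> act (inv\<^bsub>G\<^esub> g) (act g x) = x"
  using ga.orbit_sym_aux by simp

lemma act_inv': "g \<in> carrier G \<Longrightarrow> act g (act (inv\<^bsub>G\<^esub> g) x) = x"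
  using act_inv[of "inv\<^bsub>G\<^esub> g" x] by simp

lemma act_zero: "g \<in> carrier G \<Longrightarrow> act g 0 = 0"
  using act_linear linear_0 by blast

lemma act_neq_0: "g \<in> carrier G \<Longrightarrow> x \<noteq> 0 \<Longrightarrow> act g x \<noteq> 0"
  by (metis act_inv act_zero grp.inv_closed)

lemma act_uminus: "g \<in> carrier G \<Longrightarrow> act g (- x) = - act g x"
  using act_linear linear_neg by blast

lemma ip_act:
  assumes "g \<in> carrier G" "u \<noteq> 0" shows "ip (act g u) (act g v) (act g w) = ip u v w"
proof (cases "v = 0 \<or> w = 0")
  case True
  then show ?thesis using assms act_neq_0[OF assms] by (auto simp: act_zero)
next
  case False
  then show ?thesis using M3 assms unfolding cond_M3_def by blast
qed

lemma nrm_act: "g \<in> carrier G \<Longrightarrow> u \<noteq> 0 \<Longrightarrow> nrm (act g u) (act g v) = nrm u v"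
  by (simp add: ipnorm_def ip_act)

text \<open>Linearity alone does not bound \<open>act g\<close>. It is an isometry from the scalar
  product at u to the one at \<open>act g u\<close>, and both are equivalent to the given norm. The
  bound depends on \<open>g\<close>.\<close>

lemma act_bounded_linear:
  assumes g: "g \<in> carrier G" shows "bounded_linear (act g)"
proof (cases "\<exists>u::'a. u \<noteq> 0")
  case True
  then obtain u :: 'a where u: "u \<noteq> 0" by blast
  obtain C where C: "C > 0" "\<forall>v. nrm u v \<le> C * norm v"
    using local_metric_bounds[OF u] by (metis centre_in_ball)
  obtain C' where C': "C' > 0" "\<forall>v. norm v \<le> C' * nrm (act g u) v"
    using local_metric_bounds[OF act_neq_0[OF g u]] by (metis centre_in_ball)
  show ?thesis
  proof (rule bounded_linear_intro[where K="C' * C"])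
    fix x
    have "norm (act g x) \<le> C' * nrm (act g u) (act g x)" using C' by blast
    also have "\<dots> = C' * nrm u x" by (simp add: nrm_act g u)
    also have "\<dots> \<le> C' * (C * norm x)" using C C' by (intro mult_left_mono) auto
    finally show "norm (act g x) \<le> norm x * (C' * C)" by (simp add: mult_ac)
  qed (use act_linear[OF g] in \<open>simp_all add: linear_add linear_scale\<close>)
next
  case False
  then have "x = 0" for x :: 'a by blast
  then have "norm (act g x) \<le> norm x * 1" for x by (metis mult_1_right order_refl)
  then show ?thesis
    using act_linear[OF g] by (intro bounded_linear_intro[where K=1]) (simp_all add: linear_add linear_scale)
qed

section \<open>Curves in M and their lengths\<close>

definition C1_path :: "(real \<Rightarrow> 'a) \<Rightarrow> (real \<Rightarrow> 'a) \<Rightarrow> bool" where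
  "C1_path \<sigma> \<sigma>' \<longleftrightarrow> \<sigma> ` {0..1} \<subseteq> M \<and>
     (\<forall>s\<in>{0..1}. (\<sigma> has_vector_derivative \<sigma>' s) (at s within {0..1})) \<and> continuous_on {0..1} \<sigma>'"

definition path_length :: "(real \<Rightarrow> 'a) \<Rightarrow> (real \<Rightarrow> 'a) \<Rightarrow> real" where
  "path_length \<sigma> \<sigma>' = integral {0..1} (\<lambda>s. nrm (\<sigma> s) (\<sigma>' s))"

definition joins :: "'a \<Rightarrow> 'a \<Rightarrow> (real \<Rightarrow> 'a) \<Rightarrow> (real \<Rightarrow> 'a) \<Rightarrow> bool" where
  "joins u v \<sigma> \<sigma>' \<longleftrightarrow> C1_path \<sigma> \<sigma>' \<and> \<sigma> 0 = u \<and> \<sigma> 1 = v"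

text \<open>An actual curve of length at most \<open>L\<close>, in place of an extended real
  infimum. Thus d < t becomes \<open>\<exists>L<t. conn u v L\<close>, and different components need
  no special treatment.\<close>

definition conn :: "'a \<Rightarrow> 'a \<Rightarrow> real \<Rightarrow> bool" where
  "conn u v L \<longleftrightarrow> (\<exists>\<sigma> \<sigma>'. joins u v \<sigma> \<sigma>' \<and> path_length \<sigma> \<sigma>' \<le> L)"

lemma connE:
  assumes "conn u v L"
  obtains \<sigma> \<sigma>' where "C1_path \<sigma> \<sigma>'" "\<sigma> 0 = u" "\<sigma> 1 = v" "path_length \<sigma> \<sigma>' \<le> L"
  using assms unfolding conn_def joins_def by blast

lemma connI:
  "C1_path \<sigma> \<sigma>' \<Longrightarrow> \<sigma> 0 = u \<Longrightarrow> \<sigma> 1 = v \<Longrightarrow> path_length \<sigma> \<sigma>' \<le> L \<Longrightarrow> conn u v L"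
  unfolding conn_def joins_def by blast

lemma C1_path_continuous: "C1_path \<sigma> \<sigma>' \<Longrightarrow> continuous_on {0..1} \<sigma>"
  unfolding C1_path_def continuous_on_eq_continuous_within
  by (auto intro: has_vector_derivative_continuous)

lemma C1_path_mem: "C1_path \<sigma> \<sigma>' \<Longrightarrow> s \<in> {0..1} \<Longrightarrow> \<sigma> s \<in> M"
  by (auto simp: C1_path_def)

lemma C1_path_speed_continuous:
  assumes "C1_path \<sigma> \<sigma>'" shows "continuous_on {0..1} (\<lambda>s. nrm (\<sigma> s) (\<sigma>' s))"
proof (rule continuous_on_nrm)
  show "continuous_on {0..1} \<sigma>" by (rule C1_path_continuous[OF assms])
  show "continuous_on {0..1} \<sigma>'" using assms by (simp add: C1_path_def)
  show "\<sigma> s \<noteq> 0" if "s \<in> {0..1}" for s using C1_path_mem[OF assms that] by (rule M_neq_0)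
qed

lemma C1_path_length_nonneg: "C1_path \<sigma> \<sigma>' \<Longrightarrow> 0 \<le> path_length \<sigma> \<sigma>'"
  unfolding path_length_def by (intro integral_nonneg integrable_continuous_interval C1_path_speed_continuous
      nrm_nonneg M_neq_0 C1_path_mem)

lemma curve_dist_less_iff: "curve_dist ip M u v < ereal t \<longleftrightarrow> (\<exists>L<t. conn u v L)"
proof -
  have "curve_dist ip M u v = Inf {ereal (path_length \<sigma> \<sigma>') | \<sigma> \<sigma>'. joins u v \<sigma> \<sigma>'}"
    unfolding curve_dist_def joins_def C1_path_def path_length_def
    by (intro arg_cong[where f=Inf] Collect_cong) (simp add: conj_ac)
  then have "curve_dist ip M u v < ereal t \<longleftrightarrow> (\<exists>\<sigma> \<sigma>'. joins u v \<sigma> \<sigma>' \<and> path_length \<sigma> \<sigma>' < t)"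
    by (simp only: Inf_less_iff) (simp add: Bex_def, metis less_ereal.simps(1))
  then show ?thesis unfolding conn_def by (meson le_less_trans order_refl)
qed

lemma conn_nonneg: "conn u v L \<Longrightarrow> 0 \<le> L"
  by (elim connE) (use C1_path_length_nonneg order_trans in blast)

lemma conn_mono: "conn u v L \<Longrightarrow> L \<le> L' \<Longrightarrow> conn u v L'"
  unfolding conn_def by (meson order_trans)

lemma conn_in_M: assumes "conn u v L" shows "u \<in> M" "v \<in> M"
  using assms by (auto elim!: connE intro!: C1_path_mem)

lemma curve_dist_nonneg: "0 \<le> curve_dist ip M u v"
  by (metis conn_nonneg curve_dist_less_iff not_less zero_ereal_def)

text \<open>After affine rescaling to the unit interval the length is an integral of at most
  \<open>K * (b - a)\<close>. Length estimates for solutions of the flow all take this form.\<close>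

lemma conn_speed_bound:
  assumes ab: "a \<le> b" and M: "\<And>t. t \<in> {a..b} \<Longrightarrow> \<sigma> t \<in> M"
    and d: "\<And>t. t \<in> {a..b} \<Longrightarrow> (\<sigma> has_vector_derivative \<sigma>' t) (at t within {a..b})"
    and c: "continuous_on {a..b} \<sigma>'" and K: "\<And>t. t \<in> {a..b} \<Longrightarrow> nrm (\<sigma> t) (\<sigma>' t) \<le> K"
  shows "conn (\<sigma> a) (\<sigma> b) (K * (b - a))"
proof -
  define q where "q s = a + (b - a) * s" for s
  have q: "q s \<in> {a..b}" if "s \<in> {0..1}" for s
    using that ab mult_left_mono[of s 1 "b - a"] by (simp add: q_def)
  have cp: "C1_path (\<sigma> \<circ> q) (\<lambda>s. (b - a) *\<^sub>R \<sigma>' (q s))"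
    unfolding C1_path_def
  proof (intro conjI ballI)
    show "(\<sigma> \<circ> q) ` {0..1} \<subseteq> M" using q M by auto
    show "continuous_on {0..1} (\<lambda>s. (b - a) *\<^sub>R \<sigma>' (q s))"
      using q by (intro continuous_on_scaleR continuous_on_const continuous_on_compose2[OF c])
        (auto simp: q_def intro!: continuous_intros)
    fix s :: real assume s: "s \<in> {0..1}"
    show "((\<sigma> \<circ> q) has_vector_derivative (b - a) *\<^sub>R \<sigma>' (q s)) (at s within {0..1})"
    proof (rule vector_diff_chain_within)
      show "(q has_vector_derivative b - a) (at s within {0..1})"
        unfolding q_def by (auto intro!: derivative_eq_intros)
      show "(\<sigma> has_vector_derivative \<sigma>' (q s)) (at (q s) within q ` {0..1})"
        using d[OF q[OF s]] by (rule has_vector_derivative_within_subset) (use q in blast)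
    qed
  qed
  have "integral {0..1} (\<lambda>s. nrm ((\<sigma> \<circ> q) s) ((b - a) *\<^sub>R \<sigma>' (q s))) \<le> integral {0..1} (\<lambda>s::real. K * (b - a))"
  proof (rule integral_le)
    show "(\<lambda>s. nrm ((\<sigma> \<circ> q) s) ((b - a) *\<^sub>R \<sigma>' (q s))) integrable_on {0..1}"
      by (intro integrable_continuous_interval C1_path_speed_continuous cp)
    fix s :: real assume s: "s \<in> {0..1}"
    have "\<sigma> (q s) \<noteq> 0" using M q s M_neq_0 by blast
    then have "nrm ((\<sigma> \<circ> q) s) ((b - a) *\<^sub>R \<sigma>' (q s)) = (b - a) * nrm (\<sigma> (q s)) (\<sigma>' (q s))"
      using ab by (simp add: nrm_scaleR)
    also have "\<dots> \<le> (b - a) * K" using ab K q s by (intro mult_left_mono) auto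
    finally show "nrm ((\<sigma> \<circ> q) s) ((b - a) *\<^sub>R \<sigma>' (q s)) \<le> K * (b - a)" by (simp add: mult.commute)
  qed (rule integrable_const_ivl)
  then have "path_length (\<sigma> \<circ> q) (\<lambda>s. (b - a) *\<^sub>R \<sigma>' (q s)) \<le> K * (b - a)"
    by (simp add: path_length_def)
  then show ?thesis by (rule connI[OF cp, rotated 2]) (simp_all add: q_def)
qed

lemma conn_refl: "u \<in> M \<Longrightarrow> conn u u 0"
  using conn_speed_bound[of 0 1 "\<lambda>_. u" "\<lambda>_. 0" 0] M_neq_0 by simp

lemma conn_sym: "conn u v L \<Longrightarrow> conn v u L"
proof -
  assume "conn u v L"
  then obtain \<sigma> \<sigma>' where p: "C1_path \<sigma> \<sigma>'" and e: "\<sigma> 0 = u" "\<sigma> 1 = v"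
    and L: "path_length \<sigma> \<sigma>' \<le> L" by (rule connE)
  define q where "q s = 1 - s" for s :: real
  have q: "q s \<in> {0..1}" if "s \<in> {0..1}" for s using that by (auto simp: q_def)
  have cp: "C1_path (\<sigma> \<circ> q) (\<lambda>s. (- 1) *\<^sub>R \<sigma>' (q s))"
    unfolding C1_path_def
  proof (intro conjI ballI)
    show "(\<sigma> \<circ> q) ` {0..1} \<subseteq> M" using q p by (auto simp: C1_path_def)
    have "continuous_on {0..1} \<sigma>'" using p by (simp add: C1_path_def)
    moreover have "continuous_on {0..1} q" unfolding q_def by (intro continuous_intros)
    ultimately have "continuous_on {0..1} (\<lambda>s. \<sigma>' (q s))"
      by (rule continuous_on_compose2) (use q in blast)
    then show "continuous_on {0..1} (\<lambda>s. (- 1) *\<^sub>R \<sigma>' (q s))" by (intro continuous_intros)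
    fix s :: real assume s: "s \<in> {0..1}"
    show "((\<sigma> \<circ> q) has_vector_derivative (- 1) *\<^sub>R \<sigma>' (q s)) (at s within {0..1})"
    proof (rule vector_diff_chain_within)
      show "(q has_vector_derivative - 1) (at s within {0..1})"
        unfolding q_def by (auto intro!: derivative_eq_intros)
      have "(\<sigma> has_vector_derivative \<sigma>' (q s)) (at (q s) within {0..1})"
        using p q[OF s] by (simp add: C1_path_def)
      then show "(\<sigma> has_vector_derivative \<sigma>' (q s)) (at (q s) within q ` {0..1})"
        by (rule has_vector_derivative_within_subset) (use q in auto)
    qed
  qed
  have nz: "\<sigma> (q s) \<noteq> 0" if "s \<in> {0..1}" for s using q[OF that] p C1_path_mem M_neq_0 by blast
  have "integral {0..1} (\<lambda>s. nrm ((\<sigma> \<circ> q) s) ((- 1) *\<^sub>R \<sigma>' (q s)))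
      = integral {0..1} (\<lambda>s. nrm (\<sigma> (1 - s)) (\<sigma>' (1 - s)))"
    using nz by (intro integral_cong) (simp add: nrm_uminus q_def)
  also have "\<dots> = integral {0..1} (\<lambda>s. nrm (\<sigma> s) (\<sigma>' s))"
  proof -
    let ?h = "\<lambda>s. nrm (\<sigma> s) (\<sigma>' s)"
    have "(?h has_integral integral {0..1} ?h) {0..1}"
      by (intro integrable_integral integrable_continuous_interval C1_path_speed_continuous p)
    then have "(?h has_integral integral {0..1} ?h) (cbox 0 1)" by (simp add: cbox_interval)
    from has_integral_affinity[OF this, of "-1" 1]
    have "((\<lambda>s. ?h (1 - s)) has_integral integral {0..1} ?h) ((\<lambda>x. 1 - x) ` {0..1})"
      by (simp add: cbox_interval algebra_simps)
    moreover have "(\<lambda>x. 1 - x) ` {0..1} = {0..1::real}"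
      by (auto intro: image_eqI[of _ _ "1 - x" for x])
    ultimately show ?thesis by (simp add: integral_unique)
  qed
  finally have "path_length (\<sigma> \<circ> q) (\<lambda>s. (- 1) *\<^sub>R \<sigma>' (q s)) \<le> L"
    using L by (simp add: path_length_def)
  then show ?thesis by (rule connI[OF cp, rotated 2]) (use e in \<open>simp_all add: q_def\<close>)
qed

lemma conn_act:
  assumes g: "g \<in> carrier G" and "conn u v L" shows "conn (act g u) (act g v) L"
proof -
  obtain \<sigma> \<sigma>' where p: "C1_path \<sigma> \<sigma>'" and e: "\<sigma> 0 = u" "\<sigma> 1 = v"
    and L: "path_length \<sigma> \<sigma>' \<le> L" using assms(2) by (rule connE)
  note bl = act_bounded_linear[OF g]
  have cp: "C1_path (\<lambda>s. act g (\<sigma> s)) (\<lambda>s. act g (\<sigma>' s))"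
    using p M_invariant[OF g] unfolding C1_path_def
    by (auto intro!: bounded_linear.has_vector_derivative[OF bl] bounded_linear.continuous_on[OF bl])
  have "integral {0..1} (\<lambda>s. nrm (act g (\<sigma> s)) (act g (\<sigma>' s))) = integral {0..1} (\<lambda>s. nrm (\<sigma> s) (\<sigma>' s))"
    using p C1_path_mem M_neq_0 by (intro integral_cong nrm_act[OF g]) blast
  then have "path_length (\<lambda>s. act g (\<sigma> s)) (\<lambda>s. act g (\<sigma>' s)) \<le> L"
    using L by (simp add: path_length_def)
  then show ?thesis by (rule connI[OF cp, rotated 2]) (use e in simp_all)
qed

end

section \<open>Concatenation of curves, and comparison of d with the norm\<close>

context riemannian_setting begin

lemma vector_derivative_imp_continuous_on:
  assumes "\<And>t. t \<in> S \<Longrightarrow> (f has_vector_derivative f' t) (at t within S)"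
  shows "continuous_on S f"
  unfolding continuous_on_eq_continuous_within using assms has_vector_derivative_continuous by blast

lemma path_length_partial:
  assumes p: "C1_path \<sigma> \<sigma>'"
  defines "H \<equiv> \<lambda>x. integral {0..x} (\<lambda>s. nrm (\<sigma> s) (\<sigma>' s))"
  shows "\<And>x. x \<in> {0..1} \<Longrightarrow> (H has_vector_derivative nrm (\<sigma> x) (\<sigma>' x)) (at x within {0..1})"
    and "\<And>x. x \<in> {0..1} \<Longrightarrow> H x \<le> path_length \<sigma> \<sigma>'"
    and "H 0 = 0" and "H 1 = path_length \<sigma> \<sigma>'"
proof -
  note c = C1_path_speed_continuous[OF p]
  show "(H has_vector_derivative nrm (\<sigma> x) (\<sigma>' x)) (at x within {0..1})" if "x \<in> {0..1}" for x
    unfolding H_def using c that by (rule integral_has_vector_derivative)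
  show "H 0 = 0" by (simp add: H_def)
  show "H 1 = path_length \<sigma> \<sigma>'" by (simp add: H_def path_length_def)
  fix x :: real assume x: "x \<in> {0..1}"
  show "H x \<le> path_length \<sigma> \<sigma>'"
    unfolding H_def path_length_def
  proof (rule integral_subset_le)
    show "{0..x} \<subseteq> {0..1}" using x by auto
    then show "(\<lambda>s. nrm (\<sigma> s) (\<sigma>' s)) integrable_on {0..x}"
      by (intro integrable_continuous_interval continuous_on_subset[OF c])
    show "(\<lambda>s. nrm (\<sigma> s) (\<sigma>' s)) integrable_on {0..1}"
      by (rule integrable_continuous_interval[OF c])
  qed (intro ballI nrm_nonneg M_neq_0 C1_path_mem[OF p])
qed

text \<open>The length of an initial piece, as a function of its endpoint, is an antiderivative of
  the speed; composed with \<open>q\<close> it yields invariance of the length. The assumption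
  \<open>0 \<le> q'\<close> removes the absolute value when \<open>q'\<close> is pulled out of the
  norm.\<close>

lemma C1_path_reparam:
  fixes q q' :: "real \<Rightarrow> real"
  assumes p: "C1_path \<sigma> \<sigma>'" and ab: "a \<le> b"
    and q: "\<And>s. s \<in> {a..b} \<Longrightarrow> q s \<in> {0..1}" "q a = 0" "q b = 1"
    and q': "\<And>s. s \<in> {a..b} \<Longrightarrow> (q has_vector_derivative q' s) (at s within {a..b})"
      "\<And>s. s \<in> {a..b} \<Longrightarrow> 0 \<le> q' s" "continuous_on {a..b} q'"
  shows "\<And>s. s \<in> {a..b} \<Longrightarrow> ((\<lambda>s. \<sigma> (q s)) has_vector_derivative q' s *\<^sub>R \<sigma>' (q s)) (at s within {a..b})"
    and "continuous_on {a..b} (\<lambda>s. q' s *\<^sub>R \<sigma>' (q s))"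
    and "((\<lambda>s. nrm (\<sigma> (q s)) (q' s *\<^sub>R \<sigma>' (q s))) has_integral path_length \<sigma> \<sigma>') {a..b}"
proof -
  have sub: "q ` {a..b} \<subseteq> {0..1}" using q(1) by blast
  show "((\<lambda>s. \<sigma> (q s)) has_vector_derivative q' s *\<^sub>R \<sigma>' (q s)) (at s within {a..b})" if s: "s \<in> {a..b}" for s
  proof -
    have "(\<sigma> has_vector_derivative \<sigma>' (q s)) (at (q s) within {0..1})"
      using p q(1)[OF s] by (simp add: C1_path_def)
    then have "(\<sigma> has_vector_derivative \<sigma>' (q s)) (at (q s) within q ` {a..b})"
      using sub by (rule has_vector_derivative_within_subset)
    from vector_diff_chain_within[OF q'(1)[OF s] this] show ?thesis by (simp add: o_def)
  qed
  have "continuous_on {a..b} q"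
    using q'(1) by (rule vector_derivative_imp_continuous_on)
  moreover have "continuous_on {0..1} \<sigma>'" using p by (simp add: C1_path_def)
  ultimately have "continuous_on {a..b} (\<lambda>s. \<sigma>' (q s))"
    using sub by (metis continuous_on_compose2)
  with q'(3) show "continuous_on {a..b} (\<lambda>s. q' s *\<^sub>R \<sigma>' (q s))" by (rule continuous_on_scaleR)
  define H where "H x = integral {0..x} (\<lambda>s. nrm (\<sigma> s) (\<sigma>' s))" for x
  have "((\<lambda>s. q' s *\<^sub>R nrm (\<sigma> (q s)) (\<sigma>' (q s))) has_integral (H \<circ> q) b - (H \<circ> q) a) {a..b}"
  proof (rule fundamental_theorem_of_calculus[OF ab])
    fix s assume s: "s \<in> {a..b}"
    have "(H has_vector_derivative nrm (\<sigma> (q s)) (\<sigma>' (q s))) (at (q s) within {0..1})"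
      unfolding H_def by (rule path_length_partial(1)[OF p q(1)[OF s]])
    then have "(H has_vector_derivative nrm (\<sigma> (q s)) (\<sigma>' (q s))) (at (q s) within q ` {a..b})"
      using sub by (rule has_vector_derivative_within_subset)
    from vector_diff_chain_within[OF q'(1)[OF s] this]
    show "((H \<circ> q) has_vector_derivative q' s *\<^sub>R nrm (\<sigma> (q s)) (\<sigma>' (q s))) (at s within {a..b})" .
  qed
  moreover have "(H \<circ> q) b - (H \<circ> q) a = path_length \<sigma> \<sigma>'"
    using path_length_partial(3,4)[OF p] q by (simp add: H_def)
  ultimately have "((\<lambda>s. q' s *\<^sub>R nrm (\<sigma> (q s)) (\<sigma>' (q s))) has_integral path_length \<sigma> \<sigma>') {a..b}" by simp
  moreover have "q' s *\<^sub>R nrm (\<sigma> (q s)) (\<sigma>' (q s)) = nrm (\<sigma> (q s)) (q' s *\<^sub>R \<sigma>' (q s))" if s: "s \<in> {a..b}" for s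
    using nrm_scaleR[OF M_neq_0[OF C1_path_mem[OF p q(1)[OF s]]]] q'(2)[OF s] by simp
  ultimately show "((\<lambda>s. nrm (\<sigma> (q s)) (q' s *\<^sub>R \<sigma>' (q s))) has_integral path_length \<sigma> \<sigma>') {a..b}"
    by (rule has_integral_eq[rotated])
qed

text \<open>Both paths are traversed with speed zero at the junction, which makes the concatenation
  continuously differentiable.\<close>

lemma conn_trans:
  assumes "conn u v L1" "conn v w L2" shows "conn u w (L1 + L2)"
proof -
  obtain \<sigma> \<sigma>' where p: "C1_path \<sigma> \<sigma>'" and e: "\<sigma> 0 = u" "\<sigma> 1 = v" and L1: "path_length \<sigma> \<sigma>' \<le> L1"
    using assms(1) by (rule connE)
  obtain \<tau> \<tau>' where r: "C1_path \<tau> \<tau>'" and f: "\<tau> 0 = v" "\<tau> 1 = w" and L2: "path_length \<tau> \<tau>' \<le> L2"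
    using assms(2) by (rule connE)
  \<comment> \<open>The cubic \<open>3 x^2 - 2 x^3\<close>: it runs from 0 to 1 on the unit interval
    and its derivative \<open>k'\<close> vanishes at both ends.\<close>
  define k where "k x = x\<^sup>2 * (3 - 2 * x)" for x :: real
  define k' where "k' x = 6 * x * (1 - x)" for x :: real
  have k01: "k x \<in> {0..1}" if "x \<in> {0..1}" for x
  proof -
    have "1 - k x = (1 - x)\<^sup>2 * (1 + 2 * x)" by (simp add: k_def power2_eq_square algebra_simps)
    moreover have "0 \<le> (1 - x)\<^sup>2 * (1 + 2 * x)" "0 \<le> k x" using that by (simp_all add: k_def)
    ultimately show ?thesis by simp
  qed
  have kd: "((\<lambda>s. k (2 * s - c)) has_vector_derivative 2 * k' (2 * s - c)) (at s within S)" for s c S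
    unfolding k_def k'_def has_real_derivative_iff_has_vector_derivative[symmetric]
    by (auto intro!: derivative_eq_intros simp: power2_eq_square algebra_simps)
  have k'0: "0 \<le> 2 * k' x" if "x \<in> {0..1}" for x using that by (simp add: k'_def)
  have k'c: "continuous_on S (\<lambda>s. 2 * k' (2 * s - c))" for S c
    unfolding k'_def by (intro continuous_intros)
  have i1: "2 * s - 0 \<in> {0..1}" if "s \<in> {0..1/2}" for s :: real using that by auto
  have i2: "2 * s - 1 \<in> {0..1}" if "s \<in> {1/2..1}" for s :: real using that by auto
  define q1 where "q1 s = k (2 * s - 0)" for s
  define q1' where "q1' s = 2 * k' (2 * s - 0)" for s
  define q2 where "q2 s = k (2 * s - 1)" for s
  define q2' where "q2' s = 2 * k' (2 * s - 1)" for s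
  have Q1: "q1 s \<in> {0..1}" if "s \<in> {0..1/2}" for s unfolding q1_def by (rule k01[OF i1[OF that]])
  have Q2: "q2 s \<in> {0..1}" if "s \<in> {1/2..1}" for s unfolding q2_def by (rule k01[OF i2[OF that]])
  have A: "\<And>s. s \<in> {0..1/2} \<Longrightarrow> ((\<lambda>s. \<sigma> (q1 s)) has_vector_derivative q1' s *\<^sub>R \<sigma>' (q1 s)) (at s within {0..1/2})"
    "continuous_on {0..1/2} (\<lambda>s. q1' s *\<^sub>R \<sigma>' (q1 s))"
    "((\<lambda>s. nrm (\<sigma> (q1 s)) (q1' s *\<^sub>R \<sigma>' (q1 s))) has_integral path_length \<sigma> \<sigma>') {0..1/2}"
  proof -
    have *: "q1 0 = 0" "q1 (1/2) = 1" "(0::real) \<le> 1/2" by (simp_all add: q1_def k_def)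
    have d: "\<And>s. s \<in> {0..1/2} \<Longrightarrow> (q1 has_vector_derivative q1' s) (at s within {0..1/2})"
      "\<And>s. s \<in> {0..1/2} \<Longrightarrow> 0 \<le> q1' s" "continuous_on {0..1/2} q1'"
      unfolding q1_def q1'_def by (rule kd, rule k'0[OF i1], assumption, rule k'c)
    show "\<And>s. s \<in> {0..1/2} \<Longrightarrow> ((\<lambda>s. \<sigma> (q1 s)) has_vector_derivative q1' s *\<^sub>R \<sigma>' (q1 s)) (at s within {0..1/2})"
      "continuous_on {0..1/2} (\<lambda>s. q1' s *\<^sub>R \<sigma>' (q1 s))"
      "((\<lambda>s. nrm (\<sigma> (q1 s)) (q1' s *\<^sub>R \<sigma>' (q1 s))) has_integral path_length \<sigma> \<sigma>') {0..1/2}"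
      using C1_path_reparam[OF p *(3) Q1 *(1) *(2) d] by blast+
  qed
  have B: "\<And>s. s \<in> {1/2..1} \<Longrightarrow> ((\<lambda>s. \<tau> (q2 s)) has_vector_derivative q2' s *\<^sub>R \<tau>' (q2 s)) (at s within {1/2..1})"
    "continuous_on {1/2..1} (\<lambda>s. q2' s *\<^sub>R \<tau>' (q2 s))"
    "((\<lambda>s. nrm (\<tau> (q2 s)) (q2' s *\<^sub>R \<tau>' (q2 s))) has_integral path_length \<tau> \<tau>') {1/2..1}"
  proof -
    have *: "q2 (1/2) = 0" "q2 1 = 1" "(1/2::real) \<le> 1" by (simp_all add: q2_def k_def)
    have d: "\<And>s. s \<in> {1/2..1} \<Longrightarrow> (q2 has_vector_derivative q2' s) (at s within {1/2..1})"
      "\<And>s. s \<in> {1/2..1} \<Longrightarrow> 0 \<le> q2' s" "continuous_on {1/2..1} q2'"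
      unfolding q2_def q2'_def by (rule kd, rule k'0[OF i2], assumption, rule k'c)
    show "\<And>s. s \<in> {1/2..1} \<Longrightarrow> ((\<lambda>s. \<tau> (q2 s)) has_vector_derivative q2' s *\<^sub>R \<tau>' (q2 s)) (at s within {1/2..1})"
      "continuous_on {1/2..1} (\<lambda>s. q2' s *\<^sub>R \<tau>' (q2 s))"
      "((\<lambda>s. nrm (\<tau> (q2 s)) (q2' s *\<^sub>R \<tau>' (q2 s))) has_integral path_length \<tau> \<tau>') {1/2..1}"
      using C1_path_reparam[OF r *(3) Q2 *(1) *(2) d] by blast+
  qed
  have mid: "q1 (1/2) = 1" "q2 (1/2) = 0" "q1' (1/2) = 0" "q2' (1/2) = 0" "q1 0 = 0" "q2 1 = 1"
    by (simp_all add: q1_def q2_def q1'_def q2'_def k_def k'_def)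
  define \<gamma> where "\<gamma> s = (if s \<in> {0..1/2} then \<sigma> (q1 s) else \<tau> (q2 s))" for s
  define \<gamma>' where "\<gamma>' s = (if s \<in> {0..1/2} then q1' s *\<^sub>R \<sigma>' (q1 s) else q2' s *\<^sub>R \<tau>' (q2 s))" for s
  have U: "{0..1} = {0..1/2} \<union> {1/2..1::real}" by auto
  have cl: "closure {0..1/2::real} \<inter> closure {1/2..1} = {1/2}" by auto
  have g2: "\<gamma> s = \<tau> (q2 s)" "\<gamma>' s = q2' s *\<^sub>R \<tau>' (q2 s)" if "s \<in> {1/2..1}" for s
  proof -
    have *: "s = 1/2" if "s \<in> {0..1/2}" using that \<open>s \<in> {1/2..1}\<close> by simp
    have "\<sigma> (q1 s) = \<tau> (q2 s)" "q1' s *\<^sub>R \<sigma>' (q1 s) = q2' s *\<^sub>R \<tau>' (q2 s)" if "s \<in> {0..1/2}"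
      unfolding *[OF that] by (simp_all only: mid e f scaleR_zero_left)
    then show "\<gamma> s = \<tau> (q2 s)" "\<gamma>' s = q2' s *\<^sub>R \<tau>' (q2 s)" by (simp_all only: \<gamma>_def \<gamma>'_def if_cancel split: if_split) blast+
  qed
  have cp: "C1_path \<gamma> \<gamma>'"
    unfolding C1_path_def
  proof (intro conjI ballI)
    show "\<gamma> ` {0..1} \<subseteq> M"
    proof
      fix x assume "x \<in> \<gamma> ` {0..1}"
      then obtain s where s: "s \<in> {0..1}" "x = \<gamma> s" by blast
      show "x \<in> M"
      proof (cases "s \<in> {0..1/2}")
        case True
        then show ?thesis using s C1_path_mem[OF p Q1] by (simp add: \<gamma>_def)
      next
        case False
        then have "s \<in> {1/2..1}" using s by auto
        then show ?thesis using s C1_path_mem[OF r Q2] g2 by simp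
      qed
    qed
    have "\<gamma>' = (\<lambda>s. if s \<le> 1/2 then \<gamma>' s else \<gamma>' s)" by simp
    have "continuous_on {0..1/2} \<gamma>'"
      using A(2) by (rule continuous_on_eq) (simp add: \<gamma>'_def)
    moreover have "continuous_on {1/2..1} \<gamma>'"
      using B(2) by (rule continuous_on_eq) (simp only: g2)
    ultimately show "continuous_on {0..1} \<gamma>'" unfolding U by (intro continuous_on_closed_Un) simp_all
    fix s :: real assume s: "s \<in> {0..1}"
    have "((\<lambda>x. if x \<in> {0..1/2} then \<sigma> (q1 x) else \<tau> (q2 x)) has_vector_derivative
        (if s \<in> {0..1/2} then q1' s *\<^sub>R \<sigma>' (q1 s) else q2' s *\<^sub>R \<tau>' (q2 s))) (at s within {0..1})"
    proof (rule has_vector_derivative_If_within_closures[OF _ U])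
      show "s \<in> {0..1/2} \<union> {1/2..1}" using s U by simp
      show "((\<lambda>x. \<sigma> (q1 x)) has_vector_derivative q1' s *\<^sub>R \<sigma>' (q1 s))
         (at s within {0..1/2} \<union> closure {0..1/2} \<inter> closure {1/2..1})"
        if "s \<in> {0..1/2} \<union> closure {0..1/2} \<inter> closure {1/2..1}"
      proof -
        have eq: "{0..1/2} \<union> closure {0..1/2} \<inter> closure {1/2..1} = {0..1/2::real}" unfolding cl by auto
        show ?thesis using that A(1)[of s] unfolding eq by blast
      qed
      show "((\<lambda>x. \<tau> (q2 x)) has_vector_derivative q2' s *\<^sub>R \<tau>' (q2 s))
         (at s within {1/2..1} \<union> closure {0..1/2} \<inter> closure {1/2..1})"
        if "s \<in> {1/2..1} \<union> closure {0..1/2} \<inter> closure {1/2..1}"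
      proof -
        have eq: "{1/2..1} \<union> closure {0..1/2} \<inter> closure {1/2..1} = {1/2..1::real}" unfolding cl by auto
        show ?thesis using that B(1)[of s] unfolding eq by blast
      qed
      assume "s \<in> closure {0..1/2}" "s \<in> closure {1/2..1}"
      then have s12: "s = 1/2" by simp
      show "\<sigma> (q1 s) = \<tau> (q2 s)" "q1' s *\<^sub>R \<sigma>' (q1 s) = q2' s *\<^sub>R \<tau>' (q2 s)"
        unfolding s12 by (simp_all only: mid e f scaleR_zero_left)
    qed
    then show "(\<gamma> has_vector_derivative \<gamma>' s) (at s within {0..1})"
      unfolding \<gamma>_def[abs_def] \<gamma>'_def .
  qed
  have "((\<lambda>s. nrm (\<gamma> s) (\<gamma>' s)) has_integral path_length \<sigma> \<sigma>' + path_length \<tau> \<tau>') {0..1}"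
  proof (rule has_integral_combine[of 0 "1/2"])
    show "((\<lambda>s. nrm (\<gamma> s) (\<gamma>' s)) has_integral path_length \<sigma> \<sigma>') {0..1/2}"
      using A(3) by (rule has_integral_eq[rotated]) (simp add: \<gamma>_def \<gamma>'_def)
    show "((\<lambda>s. nrm (\<gamma> s) (\<gamma>' s)) has_integral path_length \<tau> \<tau>') {1/2..1}"
      using B(3) by (rule has_integral_eq[rotated]) (simp only: g2)
  qed simp_all
  then have "path_length \<gamma> \<gamma>' \<le> L1 + L2" unfolding path_length_def[of \<gamma>]
    using L1 L2 by (simp add: integral_unique)
  moreover have "\<gamma> 0 = u" using e mid by (simp add: \<gamma>_def)
  moreover have "\<gamma> 1 = w" using f mid by (simp add: \<gamma>_def)
  ultimately show ?thesis using cp by (blast intro: connI)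
qed

text \<open>The comparison of norms holds only in a ball that the curve might leave. Up to the first
  time at distance \<rho> from u the curve stays inside, and its length is already too short to
  reach that distance.\<close>

lemma conn_norm_less:
  assumes C: "\<And>x v. x \<in> ball u r \<Longrightarrow> norm v \<le> C * nrm x v" "C > 0"
    and \<rho>: "0 < \<rho>" "\<rho> \<le> r" and c: "conn u x L" and L: "C * L < \<rho>"
  shows "norm (x - u) < \<rho>"
proof (rule ccontr)
  assume neg: "\<not> norm (x - u) < \<rho>"
  obtain \<sigma> \<sigma>' where p: "C1_path \<sigma> \<sigma>'" and e: "\<sigma> 0 = u" "\<sigma> 1 = x" and L': "path_length \<sigma> \<sigma>' \<le> L"
    using c by (rule connE)
  note cs = C1_path_continuous[OF p]
  define S where "S = {s \<in> {0..1}. \<rho> \<le> norm (\<sigma> s - u)}"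
  have "compact S"
  proof -
    have "continuous_on {0..1} (\<lambda>s. norm (\<sigma> s - u))" using cs by (intro continuous_intros)
    then have "closed ({0..1} \<inter> (\<lambda>s. norm (\<sigma> s - u)) -` {\<rho>..})"
      by (rule continuous_closed_preimage) simp_all
    moreover have "S = {0..1} \<inter> (\<lambda>s. norm (\<sigma> s - u)) -` {\<rho>..}" by (auto simp: S_def)
    ultimately have "closed S" by simp
    moreover have "bounded S" by (rule bounded_subset[of "{0..1}"]) (auto simp: S_def)
    ultimately show ?thesis by (simp add: compact_eq_bounded_closed)
  qed
  moreover have "S \<noteq> {}" using neg e by (auto simp: S_def intro!: exI[of _ 1])
  \<comment> \<open>The first exit time exists because \<open>S\<close> is compact.\<close>
  ultimately obtain t where t: "t \<in> S" "\<forall>s\<in>S. t \<le> s" using compact_attains_inf by blast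
  have t01: "0 < t" "t \<le> 1" using t(1) e \<rho> by (auto simp: S_def less_eq_real_def)
  define H where "H x = integral {0..x} (\<lambda>s. nrm (\<sigma> s) (\<sigma>' s))" for x
  note H = path_length_partial[OF p, folded H_def]
  have "norm (\<sigma> t - \<sigma> 0) \<le> C * H t - C * H 0"
  proof (rule differentiable_bound_general[OF t01(1)])
    show "continuous_on {0..t} \<sigma>" using cs by (rule continuous_on_subset) (use t01 in auto)
    have "continuous_on {0..1} H"
      using H(1) by (rule vector_derivative_imp_continuous_on)
    then have "continuous_on {0..t} H" by (rule continuous_on_subset) (use t01 in auto)
    then show "continuous_on {0..t} (\<lambda>x. C * H x)" by (intro continuous_intros)
    fix s assume s: "0 < s" "s < t"
    then have s01: "s \<in> {0..1}" "0 < s" "s < 1" using t01 by auto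
    have at: "at s within {0..1} = at s" using s01 by (simp add: at_within_Icc_at)
    show "(\<sigma> has_vector_derivative \<sigma>' s) (at s)" using p s01(1) unfolding C1_path_def at[symmetric] by blast
    have "(H has_vector_derivative nrm (\<sigma> s) (\<sigma>' s)) (at s)" using H(1)[OF s01(1)] by (simp add: at)
    then show "((\<lambda>x. C * H x) has_vector_derivative C * nrm (\<sigma> s) (\<sigma>' s)) (at s)"
      by (rule has_vector_derivative_mult_right)
    have "s \<notin> S" using t(2) s by auto
    then have "norm (\<sigma> s - u) < r" using s01 \<rho> by (simp add: S_def)
    then have "\<sigma> s \<in> ball u r" by (simp add: dist_norm norm_minus_commute)
    then show "norm (\<sigma>' s) \<le> C * nrm (\<sigma> s) (\<sigma>' s)" by (rule C(1))
  qed
  also have "\<dots> \<le> C * L"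
    using H(2)[of t] H(3) t01 L' C(2) by simp
  finally have "norm (\<sigma> t - u) < \<rho>" using e L by simp
  then show False using t(1) by (simp add: S_def)
qed

lemma conn_small_imp_close:
  assumes "u \<in> M" "e > 0"
  shows "\<exists>d>0. \<forall>x L. conn u x L \<longrightarrow> L \<le> d \<longrightarrow> norm (x - u) < e"
proof -
  obtain r C where r: "r > 0" "C > 0" and C: "\<forall>x\<in>ball u r. x \<noteq> 0 \<and> (\<forall>v. nrm x v \<le> C * norm v \<and> norm v \<le> C * nrm x v) \<and>
     (\<forall>u'\<in>ball u r. \<forall>v w. \<bar>ip x v w - ip u' v w\<bar> \<le> C * norm (x - u') * norm v * norm w)"
    using local_metric_bounds[OF M_neq_0[OF assms(1)]] by blast
  define \<rho> where "\<rho> = min r e"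
  have "norm (x - u) < e" if c: "conn u x L" and L: "L \<le> \<rho> / (2 * C)" for x L
  proof -
    have "C * L \<le> \<rho> / 2" using L r by (simp add: field_simps)
    moreover have "\<rho> > 0" using r assms by (simp add: \<rho>_def)
    ultimately have "C * L < \<rho>" by linarith
    then have "norm (x - u) < \<rho>"
      using C r \<open>\<rho> > 0\<close> c by (intro conn_norm_less[of u r C \<rho> x L]) (auto simp: \<rho>_def)
    then show ?thesis by (simp add: \<rho>_def)
  qed
  moreover have "\<rho> / (2 * C) > 0" using r assms by (simp add: \<rho>_def)
  ultimately show ?thesis by blast
qed

text \<open>The limit is delivered in the norm topology, in which \<open>\<Phi>\<close> and the
  gradient are continuous.\<close>

lemma complete_wrt_conn:
  assumes A: "complete_wrt (curve_dist ip M) A" "A \<subseteq> M" and x: "\<And>n. x n \<in> A"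
    and C: "\<And>e. e > 0 \<Longrightarrow> \<exists>n0. \<forall>m\<ge>n0. \<forall>n\<ge>n0. conn (x m) (x n) e"
  shows "\<exists>y\<in>A. x \<longlonglongrightarrow> y"
proof -
  have "\<forall>e>0. \<exists>n0. \<forall>m\<ge>n0. \<forall>n\<ge>n0. curve_dist ip M (x m) (x n) < ereal e"
  proof (intro allI impI)
    fix e :: real assume "e > 0"
    then obtain n0 where "\<forall>m\<ge>n0. \<forall>n\<ge>n0. conn (x m) (x n) (e / 2)" using C[of "e / 2"] by auto
    then show "\<exists>n0. \<forall>m\<ge>n0. \<forall>n\<ge>n0. curve_dist ip M (x m) (x n) < ereal e"
      using \<open>e > 0\<close> by (auto simp: curve_dist_less_iff intro!: exI[of _ n0] exI[of _ "e / 2"])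
  qed
  then obtain y where y: "y \<in> A" and lim: "(\<lambda>n. curve_dist ip M (x n) y) \<longlonglongrightarrow> 0"
    using A(1) x unfolding complete_wrt_def by blast
  have "x \<longlonglongrightarrow> y"
  proof (rule LIMSEQ_I)
    fix e :: real assume "e > 0"
    then obtain d where d: "d > 0" "\<forall>z L. conn y z L \<longrightarrow> L \<le> d \<longrightarrow> norm (z - y) < e"
      using conn_small_imp_close[of y e] y A(2) by blast
    have "\<forall>\<^sub>F n in sequentially. curve_dist ip M (x n) y < ereal d"
      using lim d(1) by (intro order_tendstoD(2)[OF lim]) simp
    then obtain n0 where "\<forall>n\<ge>n0. curve_dist ip M (x n) y < ereal d" by (auto simp: eventually_sequentially)
    then have "\<forall>n\<ge>n0. norm (x n - y) < e"
      using d(2) conn_sym by (fastforce simp: curve_dist_less_iff)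
    then show "\<exists>n0. \<forall>n\<ge>n0. norm (x n - y) < e" by blast
  qed
  then show ?thesis using y by blast
qed

section \<open>The function N\<close>

definition Nr :: "'a \<Rightarrow> real" where
  "Nr w = real_of_ereal (Nfun ip M w)"

lemma Nfun_less_iff:
  "Nfun ip M w < ereal t \<longleftrightarrow> (\<exists>u\<in>M. \<exists>L. conn u w L \<and> nrm u u + L < t)"
proof -
  have "ereal a + d < ereal t \<longleftrightarrow> d < ereal (t - a)" if "0 \<le> d" for a d
    using that by (cases d) auto
  then have "ereal (nrm u u) + curve_dist ip M u w < ereal t \<longleftrightarrow> (\<exists>L. conn u w L \<and> nrm u u + L < t)" for u
    using curve_dist_nonneg[of u w] curve_dist_less_iff[of u w "t - nrm u u"] by (auto simp: algebra_simps)
  then show ?thesis unfolding Nfun_def by (simp add: INF_less_iff)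
qed

text \<open>The constant curve at w shows \<open>N(w) \<le> nrm w w\<close>, so N is finite on M and
  real arithmetic applies from here on.\<close>

lemma Nfun_eq: "w \<in> M \<Longrightarrow> Nfun ip M w = ereal (Nr w)"
  and Nr_nonneg: "w \<in> M \<Longrightarrow> 0 \<le> Nr w"
  and Nr_le_nrm: "w \<in> M \<Longrightarrow> Nr w \<le> nrm w w"
proof -
  assume w: "w \<in> M"
  have "\<not> Nfun ip M w < ereal 0"
    unfolding Nfun_less_iff using conn_nonneg nrm_nonneg[OF M_neq_0] by (smt (verit))
  then have 0: "0 \<le> Nfun ip M w" by (simp add: zero_ereal_def)
  have "Nfun ip M w \<le> ereal (nrm w w)"
  proof (rule ccontr)
    assume "\<not> Nfun ip M w \<le> ereal (nrm w w)"
    then obtain z where z: "ereal (nrm w w) < ereal z" "ereal z < Nfun ip M w"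
      using ereal_dense2[of "ereal (nrm w w)" "Nfun ip M w"] by (auto simp: not_le)
    then have "Nfun ip M w < ereal z"
      unfolding Nfun_less_iff using conn_refl[OF w] w by (intro bexI[of _ w] exI[of _ 0]) auto
    then show False using z(2) by simp
  qed
  then show "Nfun ip M w = ereal (Nr w)" "0 \<le> Nr w" "Nr w \<le> nrm w w"
    using 0 unfolding Nr_def by (cases "Nfun ip M w"; simp)+
qed

lemma Nr_less_iff: "w \<in> M \<Longrightarrow> Nr w < t \<longleftrightarrow> (\<exists>u\<in>M. \<exists>L. conn u w L \<and> nrm u u + L < t)"
  using Nfun_less_iff[of w t] by (simp add: Nfun_eq)

text \<open>A nearly optimal curve ending at w is prolonged to w'. This Lipschitz bound with respect
  to d is what limits the growth of N along a solution by its length.\<close>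

lemma Nr_conn:
  assumes c: "conn w w' L" shows "Nr w' \<le> Nr w + L"
proof (rule field_le_epsilon)
  fix e :: real assume "e > 0"
  have M: "w \<in> M" "w' \<in> M" using conn_in_M[OF c] by auto
  obtain u K where "u \<in> M" "conn u w K" "nrm u u + K < Nr w + e"
    using Nr_less_iff[OF M(1), of "Nr w + e"] \<open>e > 0\<close> by auto
  then have "Nr w' < Nr w + L + e"
    using conn_trans[OF _ c] by (intro Nr_less_iff[THEN iffD2] M bexI[of _ u] exI[of _ "K + L"]) auto
  then show "Nr w' \<le> Nr w + L + e" by simp
qed

lemma Nr_act:
  assumes g: "g \<in> carrier G" and w: "w \<in> M" shows "Nr (act g w) = Nr w"
proof -
  have le: "Nr (act h v) \<le> Nr v" if h: "h \<in> carrier G" and v: "v \<in> M" for h v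
  proof (rule field_le_epsilon)
    fix e :: real assume "e > 0"
    obtain u K where "u \<in> M" "conn u v K" "nrm u u + K < Nr v + e"
      using Nr_less_iff[OF v, of "Nr v + e"] \<open>e > 0\<close> by auto
    then have "Nr (act h v) < Nr v + e"
      using conn_act[OF h] M_invariant[OF h] nrm_act[OF h M_neq_0] v
      by (intro Nr_less_iff[THEN iffD2] bexI[of _ "act h u"] exI[of _ K]) auto
    then show "Nr (act h v) \<le> Nr v + e" by simp
  qed
  have "inv\<^bsub>G\<^esub> g \<in> carrier G" using G_group g by (simp add: group.inv_closed)
  from le[OF this M_invariant[OF g w]] le[OF g w] show ?thesis by (simp add: act_inv[OF g])
qed

end

subsection \<open>Submanifold charts and the gradient\<close>

lemma local_lipschitz_bound:
  fixes f' :: "'a::real_normed_vector \<Rightarrow> 'b::real_normed_vector"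
  assumes "\<exists>e>0. \<exists>L. L-lipschitz_on (ball x e \<inter> S) f'" "x \<in> S"
  shows "\<exists>e>0. \<exists>K>0. (\<forall>y\<in>ball x e \<inter> S. norm (f' y) \<le> K) \<and>
     (\<forall>y\<in>ball x e \<inter> S. \<forall>z\<in>ball x e \<inter> S. norm (f' y - f' z) \<le> K * norm (y - z))"
proof -
  obtain e L where e: "e > 0" and L: "L-lipschitz_on (ball x e \<inter> S) f'" using assms by blast
  have L0: "L \<ge> 0" using L by (rule lipschitz_on_nonneg)
  define K where "K = norm (f' x) + L * e + L + 1"
  have K: "K > 0" "L \<le> K" "norm (f' x) + L * e \<le> K" using mult_nonneg_nonneg[of L e] norm_ge_zero[of "f' x"] L0 e unfolding K_def by linarith+
  have lip: "norm (f' y - f' z) \<le> L * norm (y - z)" if "y \<in> ball x e \<inter> S" "z \<in> ball x e \<inter> S" for y z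
    using lipschitz_onD[OF L that] by (simp add: dist_norm)
  have n1: "norm (f' y) \<le> K" if y: "y \<in> ball x e \<inter> S" for y
  proof -
    have "norm (f' y - f' x) \<le> L * norm (y - x)" using y e assms(2) by (intro lip) auto
    also have "\<dots> \<le> L * e" using y L0 by (intro mult_left_mono) (auto simp: dist_norm norm_minus_commute)
    finally show ?thesis using norm_triangle_ineq2[of "f' y" "f' x"] K(3) by linarith
  qed
  have n2: "norm (f' y - f' z) \<le> K * norm (y - z)" if "y \<in> ball x e \<inter> S" "z \<in> ball x e \<inter> S" for y z
    using lip[OF that] mult_right_mono[OF K(2), of "norm (y - z)"] by simp
  show ?thesis
    by (rule exI[of _ e], intro conjI e, rule exI[of _ K], intro conjI ballI K(1) n1 n2)
qed

text \<open>The difference quotients lie in \<open>E\<close>, hence so does their limit.\<close>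

lemma vector_derivative_in_closed_subspace:
  fixes f :: "real \<Rightarrow> 'a::real_normed_vector"
  assumes E: "subspace E" "closed E" and d: "(f has_vector_derivative w) (at t within S)"
    and fE: "\<forall>\<^sub>F x in at t within S. f x \<in> E" and ft: "f t \<in> E" and nt: "at t within S \<noteq> bot"
  shows "w \<in> E"
proof -
  have n: "((\<lambda>y. norm (f y - f t - (y - t) *\<^sub>R w) / norm (y - t)) \<longlongrightarrow> 0) (at t within S)"
    using d unfolding has_vector_derivative_def has_derivative_iff_norm by simp
  have "\<forall>\<^sub>F y in at t within S. norm (f y - f t - (y - t) *\<^sub>R w) / norm (y - t) = norm ((f y - f t) /\<^sub>R (y - t) - w)"
  proof -
    have "norm (f y - f t - (y - t) *\<^sub>R w) / norm (y - t) = norm ((f y - f t) /\<^sub>R (y - t) - w)" if "y \<noteq> t" for y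
    proof -
      have "(f y - f t) /\<^sub>R (y - t) - w = (f y - f t - (y - t) *\<^sub>R w) /\<^sub>R (y - t)"
        using that by (simp add: scaleR_diff_right)
      then show ?thesis by (simp add: divide_inverse mult.commute)
    qed
    then show ?thesis by (simp add: eventually_at_filter)
  qed
  then have "((\<lambda>y. norm ((f y - f t) /\<^sub>R (y - t) - w)) \<longlongrightarrow> 0) (at t within S)"
    using n by (rule Lim_transform_eventually[rotated])
  then have lim: "((\<lambda>x. (f x - f t) /\<^sub>R (x - t)) \<longlongrightarrow> w) (at t within S)"
    by (simp add: tendsto_norm_zero_iff flip: LIM_zero_iff[of _ w])
  have ev: "\<forall>\<^sub>F x in at t within S. (f x - f t) /\<^sub>R (x - t) \<in> E"
    using fE by eventually_elim (use E ft in \<open>auto intro: subspace_diff subspace_scale\<close>)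
  show ?thesis by (rule Lim_in_closed_set[OF E(2) ev nt lim])
qed

locale riemannian_chart = riemannian_setting G act ip M \<Phi>
  for G :: "('g, 'm) monoid_scheme" and act :: "'g \<Rightarrow> 'a::{real_inner,complete_space} \<Rightarrow> 'a"
    and ip M \<Phi> +
  fixes U V :: "'a set" and \<phi> \<psi> :: "'a \<Rightarrow> 'a" and E :: "'a set"
    and d\<phi> d\<psi> :: "'a \<Rightarrow> 'a \<Rightarrow>\<^sub>L 'a" and dF :: "'a \<Rightarrow> 'a \<Rightarrow>\<^sub>L real"
  assumes chart: "submanifold_chart M U V \<phi> \<psi> E"
    and d\<phi>: "\<And>x. x \<in> U \<Longrightarrow> (\<phi> has_derivative blinfun_apply (d\<phi> x)) (at x within U)"
    and lip_d\<phi>: "\<And>x. x \<in> U \<Longrightarrow> \<exists>e>0. \<exists>L. L-lipschitz_on (ball x e \<inter> U) d\<phi>"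
    and d\<psi>: "\<And>y. y \<in> V \<Longrightarrow> (\<psi> has_derivative blinfun_apply (d\<psi> y)) (at y within V)"
    and lip_d\<psi>: "\<And>y. y \<in> V \<Longrightarrow> \<exists>e>0. \<exists>L. L-lipschitz_on (ball y e \<inter> V) d\<psi>"
    and dF: "\<And>y. y \<in> V \<inter> E \<Longrightarrow> ((\<Phi> \<circ> \<psi>) has_derivative blinfun_apply (dF y)) (at y within V \<inter> E)"
    and lip_dF: "\<And>y. y \<in> V \<inter> E \<Longrightarrow> \<exists>e>0. \<exists>L. L-lipschitz_on (ball y e \<inter> (V \<inter> E)) dF"
begin

lemma open_U: "open U" and open_V: "open V" and subspace_E: "subspace E" and closed_E: "closed E"
  using chart by (simp_all add: submanifold_chart_def)

lemma homeo: "homeomorphism U V \<phi> \<psi>"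
  using chart by (simp add: submanifold_chart_def)

lemma \<phi>_V: "x \<in> U \<Longrightarrow> \<phi> x \<in> V" and \<psi>_U: "y \<in> V \<Longrightarrow> \<psi> y \<in> U"
  and \<psi>\<phi>: "x \<in> U \<Longrightarrow> \<psi> (\<phi> x) = x" and \<phi>\<psi>: "y \<in> V \<Longrightarrow> \<phi> (\<psi> y) = y"
  and cont_\<phi>: "continuous_on U \<phi>" and cont_\<psi>: "continuous_on V \<psi>"
  using homeo by (auto simp: homeomorphism_def)

lemma M_iff: assumes x: "x \<in> U" shows "x \<in> M \<longleftrightarrow> \<phi> x \<in> E"
proof -
  have eq: "\<phi> ` (U \<inter> M) = V \<inter> E" using chart by (simp add: submanifold_chart_def)
  show ?thesis
  proof
    assume "x \<in> M" then show "\<phi> x \<in> E" using eq x by blast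
  next
    assume "\<phi> x \<in> E"
    then have "\<phi> x \<in> \<phi> ` (U \<inter> M)" using eq \<phi>_V[OF x] by simp
    then obtain x' where "x' \<in> U" "x' \<in> M" "\<phi> x = \<phi> x'" by blast
    then show "x \<in> M" using \<psi>\<phi> x by metis
  qed
qed

lemma \<psi>_M: "y \<in> V \<Longrightarrow> y \<in> E \<Longrightarrow> \<psi> y \<in> M"
  using M_iff[OF \<psi>_U] \<phi>\<psi> by simp

lemma d\<phi>_at: "x \<in> U \<Longrightarrow> (\<phi> has_derivative blinfun_apply (d\<phi> x)) (at x)"
  using d\<phi>[of x] at_within_open[OF _ open_U] by simp

lemma d\<psi>_at: "y \<in> V \<Longrightarrow> (\<psi> has_derivative blinfun_apply (d\<psi> y)) (at y)"
  using d\<psi>[of y] at_within_open[OF _ open_V] by simp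

lemma d\<psi>_d\<phi>: assumes x: "x \<in> U" shows "d\<psi> (\<phi> x) (d\<phi> x w) = w"
proof -
  have "((\<lambda>x. \<psi> (\<phi> x)) has_derivative (\<lambda>w. d\<psi> (\<phi> x) (d\<phi> x w))) (at x)"
    by (rule has_derivative_compose[OF d\<phi>_at[OF x] d\<psi>_at[OF \<phi>_V[OF x]]])
  then have "((\<lambda>x. x) has_derivative (\<lambda>w. d\<psi> (\<phi> x) (d\<phi> x w))) (at x)"
    by (rule has_derivative_transform_within_open[OF _ open_U x]) (simp add: \<psi>\<phi>)
  then have "(\<lambda>w. d\<psi> (\<phi> x) (d\<phi> x w)) = (\<lambda>w. w)"
    using has_derivative_unique has_derivative_ident by blast
  then show ?thesis by (rule fun_cong)
qed

lemma d\<phi>_d\<psi>: assumes y: "y \<in> V" shows "d\<phi> (\<psi> y) (d\<psi> y w) = w"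
proof -
  have "((\<lambda>y. \<phi> (\<psi> y)) has_derivative (\<lambda>w. d\<phi> (\<psi> y) (d\<psi> y w))) (at y)"
    by (rule has_derivative_compose[OF d\<psi>_at[OF y] d\<phi>_at[OF \<psi>_U[OF y]]])
  then have "((\<lambda>y. y) has_derivative (\<lambda>w. d\<phi> (\<psi> y) (d\<psi> y w))) (at y)"
    by (rule has_derivative_transform_within_open[OF _ open_V y]) (simp add: \<phi>\<psi>)
  then have "(\<lambda>w. d\<phi> (\<psi> y) (d\<psi> y w)) = (\<lambda>w. w)"
    using has_derivative_unique has_derivative_ident by blast
  then show ?thesis by (rule fun_cong)
qed

lemma continuous_on_d\<psi>: "continuous_on V d\<psi>"
  unfolding continuous_on_eq_continuous_within
proof
  fix y assume y: "y \<in> V"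
  obtain e L where e: "e > 0" and L: "L-lipschitz_on (ball y e \<inter> V) d\<psi>" using lip_d\<psi>[OF y] by blast
  have "continuous (at y within ball y e \<inter> V) d\<psi>"
    using lipschitz_on_continuous_on[OF L] y e by (simp add: continuous_on_eq_continuous_within)
  moreover have "at y within ball y e \<inter> V = at y within V"
    using e by (intro at_within_nhd[of y "ball y e"]) auto
  ultimately show "continuous (at y within V) d\<psi>" by simp
qed

text \<open>Derivatives are taken within \<open>S\<close>, so that the lemma serves both the curves
  on open intervals that define tangent vectors and the solutions on closed intervals.\<close>

lemma curve_derivative_chart:
  assumes S: "t \<in> S" "\<sigma> ` S \<subseteq> M" and t: "\<sigma> t \<in> U" and d: "(\<sigma> has_vector_derivative w) (at t within S)"
  shows "((\<lambda>x. \<phi> (\<sigma> x)) has_vector_derivative d\<phi> (\<sigma> t) w) (at t within S)"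
    and "\<forall>\<^sub>F x in at t within S. \<phi> (\<sigma> x) \<in> E \<and> \<sigma> x \<in> U"
    and "((\<lambda>x. \<Phi> (\<sigma> x)) has_vector_derivative dF (\<phi> (\<sigma> t)) (d\<phi> (\<sigma> t) w)) (at t within S)"
proof -
  have "((\<phi> \<circ> \<sigma>) has_derivative blinfun_apply (d\<phi> (\<sigma> t)) \<circ> (\<lambda>h. h *\<^sub>R w)) (at t within S)"
    using d has_derivative_at_withinI[OF d\<phi>_at[OF t]] unfolding has_vector_derivative_def
    by (intro diff_chain_within)
  then show 1: "((\<lambda>x. \<phi> (\<sigma> x)) has_vector_derivative d\<phi> (\<sigma> t) w) (at t within S)"
    by (simp add: has_vector_derivative_def o_def blinfun.scaleR_right)
  have "(\<sigma> \<longlongrightarrow> \<sigma> t) (at t within S)"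
    using has_vector_derivative_continuous[OF d] by (simp add: continuous_within)
  then have evU: "\<forall>\<^sub>F x in at t within S. \<sigma> x \<in> U" using open_U t by (rule topological_tendstoD)
  have "\<forall>\<^sub>F x in at t within S. x \<in> S" by (simp add: eventually_at_filter)
  with evU show 2: "\<forall>\<^sub>F x in at t within S. \<phi> (\<sigma> x) \<in> E \<and> \<sigma> x \<in> U"
    by eventually_elim (use S(2) M_iff in blast)
  obtain A where A: "open A" "t \<in> A" "\<And>x. x \<in> A \<Longrightarrow> x \<in> S \<Longrightarrow> \<sigma> x \<in> U"
    using evU t unfolding eventually_at_topological by metis
  \<comment> \<open>Near \<open>t\<close> the curve stays in \<open>U\<close>; cutting
    \<open>S\<close> down to such times leaves the filter at \<open>t\<close> unchanged.\<close>
  define S' where "S' = A \<inter> S"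
  have atS: "at t within S' = at t within S"
    using A(1,2) by (intro at_within_nhd[of t A]) (auto simp: S'_def)
  have im: "(\<lambda>x. \<phi> (\<sigma> x)) ` S' \<subseteq> V \<inter> E"
    using A(3) S(2) M_iff \<phi>_V by (auto simp: S'_def)
  have yt: "\<phi> (\<sigma> t) \<in> V \<inter> E" using im A(2) S(1) by (auto simp: S'_def)
  have "((\<Phi> \<circ> \<psi>) has_derivative blinfun_apply (dF (\<phi> (\<sigma> t)))) (at (\<phi> (\<sigma> t)) within (\<lambda>x. \<phi> (\<sigma> x)) ` S')"
    using dF[OF yt] im by (rule has_derivative_subset)
  then have "(((\<Phi> \<circ> \<psi>) \<circ> (\<lambda>x. \<phi> (\<sigma> x))) has_derivative
      blinfun_apply (dF (\<phi> (\<sigma> t))) \<circ> (\<lambda>h. h *\<^sub>R d\<phi> (\<sigma> t) w)) (at t within S')"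
    using 1 unfolding has_vector_derivative_def atS[symmetric] by (intro diff_chain_within)
  then have "(((\<Phi> \<circ> \<psi>) \<circ> (\<lambda>x. \<phi> (\<sigma> x))) has_vector_derivative dF (\<phi> (\<sigma> t)) (d\<phi> (\<sigma> t) w)) (at t within S')"
    by (simp add: has_vector_derivative_def o_def blinfun.scaleR_right)
  moreover have "((\<Phi> \<circ> \<psi>) \<circ> (\<lambda>x. \<phi> (\<sigma> x))) x = \<Phi> (\<sigma> x)" if "x \<in> S'" for x
    using that A(3) \<psi>\<phi> by (simp add: S'_def)
  moreover have "t \<in> S'" using A S by (simp add: S'_def)
  ultimately show "((\<lambda>x. \<Phi> (\<sigma> x)) has_vector_derivative dF (\<phi> (\<sigma> t)) (d\<phi> (\<sigma> t) w)) (at t within S)"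
    unfolding atS[symmetric] by (metis (no_types, lifting) has_vector_derivative_transform)
qed

text \<open>In the chart a curve in M runs in the closed subspace \<open>E\<close>, so its velocity
  lies in \<open>E\<close>; conversely a straight line in \<open>E\<close> is carried back by
  \<open>\<psi>\<close> to a curve in M.\<close>

lemma tangent_space_chart:
  assumes u: "u \<in> U" "u \<in> M"
  shows "tangent_space M u = blinfun_apply (d\<psi> (\<phi> u)) ` E"
proof (intro equalityI subsetI)
  fix w assume "w \<in> tangent_space M u"
  then obtain \<sigma> where c: "curve_through M u w \<sigma>" unfolding tangent_space_def by blast
  then have c0: "\<sigma> 0 = u" and d0: "(\<sigma> has_vector_derivative w) (at 0)" by (simp_all add: curve_through_def)
  obtain e where e: "e > 0" "\<sigma> ` {-e<..<e} \<subseteq> M" using c unfolding curve_through_def by blast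
  have z: "(0::real) \<in> {-e<..<e}" using e by simp
  have at: "at 0 within {-e<..<e} = at (0::real)" using z by (intro at_within_open) auto
  have d: "(\<sigma> has_vector_derivative w) (at 0 within {-e<..<e})" using d0 by (simp add: at)
  note cd = curve_derivative_chart[OF z e(2) _ d]
  have U0: "\<sigma> 0 \<in> U" using c0 u by simp
  have "d\<phi> (\<sigma> 0) w \<in> E"
  proof (rule vector_derivative_in_closed_subspace[OF subspace_E closed_E cd(1)[OF U0]])
    show "\<forall>\<^sub>F x in at 0 within {-e<..<e}. \<phi> (\<sigma> x) \<in> E" using cd(2)[OF U0] by eventually_elim simp
    show "\<phi> (\<sigma> 0) \<in> E" using u c0 M_iff by simp
    show "at 0 within {-e<..<e} \<noteq> bot" by (simp add: at)
  qed
  then have "d\<phi> u w \<in> E" by (simp add: c0)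
  then show "w \<in> blinfun_apply (d\<psi> (\<phi> u)) ` E" using d\<psi>_d\<phi>[OF u(1), of w] by (metis imageI)
next
  fix w assume "w \<in> blinfun_apply (d\<psi> (\<phi> u)) ` E"
  then obtain h where h: "h \<in> E" "w = d\<psi> (\<phi> u) h" by blast
  define l where "l t = \<phi> u + t *\<^sub>R h" for t :: real
  define \<sigma> where "\<sigma> t = \<psi> (l t)" for t
  have l0: "l 0 = \<phi> u" by (simp add: l_def)
  have cl: "continuous_on UNIV l" unfolding l_def by (intro continuous_intros)
  have "open (l -` V)" using cl open_V by (simp add: continuous_on_open_vimage)
  moreover have "0 \<in> l -` V" using \<phi>_V[OF u(1)] l0 by simp
  ultimately obtain e where e: "e > 0" "ball 0 e \<subseteq> l -` V" using open_contains_ball by blast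
  have lV: "l t \<in> V" if "t \<in> {-e<..<e}" for t
  proof -
    have "t \<in> ball 0 e" using that by (auto simp: dist_real_def)
    then show ?thesis using e(2) by blast
  qed
  have lE: "l t \<in> E" for t
    unfolding l_def using subspace_E h(1) u M_iff by (intro subspace_add subspace_scale) auto
  have d: "(\<sigma> has_vector_derivative d\<psi> (l t) h) (at t)" if "t \<in> {-e<..<e}" for t
  proof -
    have "(l has_derivative (\<lambda>s. s *\<^sub>R h)) (at t)"
      unfolding l_def by (auto intro!: derivative_eq_intros)
    then have "((\<lambda>t. \<psi> (l t)) has_derivative (\<lambda>s. d\<psi> (l t) (s *\<^sub>R h))) (at t)"
      using d\<psi>_at[OF lV[OF that]] by (rule has_derivative_compose)
    then show ?thesis by (simp add: \<sigma>_def[abs_def] has_vector_derivative_def blinfun.scaleR_right)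
  qed
  have "curve_through M u w \<sigma>"
    unfolding curve_through_def
  proof (intro conjI exI[of _ e])
    show "\<sigma> 0 = u" using l0 \<psi>\<phi> u by (simp add: \<sigma>_def)
    show "(\<sigma> has_vector_derivative w) (at 0)" using d[of 0] e h l0 by simp
    show "e > 0" by fact
    show "\<sigma> ` {-e<..<e} \<subseteq> M" using lV lE \<psi>_M by (auto simp: \<sigma>_def)
    have "continuous_on {-e<..<e} l" by (rule continuous_on_subset[OF cl]) simp
    then have "continuous_on {-e<..<e} (\<lambda>t. d\<psi> (l t))"
      by (rule continuous_on_compose2[OF continuous_on_d\<psi>]) (use lV in blast)
    then have "continuous_on {-e<..<e} (\<lambda>t. blinfun_apply (d\<psi> (l t)) h)"
      by (intro continuous_intros)
    then show "\<sigma> C1_differentiable_on {-e<..<e}"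
      unfolding C1_differentiable_on_def
      by (intro exI[of _ "\<lambda>t. blinfun_apply (d\<psi> (l t)) h"] conjI ballI d)
  qed
  then show "w \<in> tangent_space M u" unfolding tangent_space_def by blast
qed

lemma mderiv_chart:
  assumes u: "u \<in> U" "u \<in> M" and w: "w \<in> tangent_space M u"
  shows "mderiv M \<Phi> u w = dF (\<phi> u) (d\<phi> u w)"
proof -
  have all: "((\<Phi> \<circ> \<sigma>) has_real_derivative dF (\<phi> u) (d\<phi> u w)) (at 0)" if c: "curve_through M u w \<sigma>" for \<sigma>
  proof -
    have c0: "\<sigma> 0 = u" and d0: "(\<sigma> has_vector_derivative w) (at 0)" using c by (simp_all add: curve_through_def)
    obtain e where e: "e > 0" "\<sigma> ` {-e<..<e} \<subseteq> M" using c unfolding curve_through_def by blast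
    have z: "(0::real) \<in> {-e<..<e}" using e by simp
    have at: "at 0 within {-e<..<e} = at (0::real)" using z by (intro at_within_open) auto
    have d: "(\<sigma> has_vector_derivative w) (at 0 within {-e<..<e})" using d0 by (simp add: at)
    have "\<sigma> 0 \<in> U" using c0 u by simp
    from curve_derivative_chart(3)[OF z e(2) this d] show ?thesis
      by (simp add: at c0 o_def has_real_derivative_iff_has_vector_derivative)
  qed
  obtain \<sigma> where \<sigma>: "curve_through M u w \<sigma>" using w unfolding tangent_space_def by blast
  show ?thesis
    unfolding mderiv_def
  proof (rule the_equality)
    show "\<forall>\<sigma>. curve_through M u w \<sigma> \<longrightarrow> ((\<Phi> \<circ> \<sigma>) has_real_derivative dF (\<phi> u) (d\<phi> u w)) (at 0)"
      using all by blast
    fix r assume "\<forall>\<sigma>. curve_through M u w \<sigma> \<longrightarrow> ((\<Phi> \<circ> \<sigma>) has_real_derivative r) (at 0)"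
    then show "r = dF (\<phi> u) (d\<phi> u w)" using all \<sigma> DERIV_unique by blast
  qed
qed

text \<open>The scalar product at u, pulled back to \<open>E\<close> by the derivative of
  \<open>\<psi>\<close>, is coercive because that derivative has a bounded inverse. The Riesz
  theorem on \<open>E\<close> then gives the gradient.\<close>

lemma gradient_exists_chart:
  assumes u: "u \<in> U" "u \<in> M"
  shows "\<exists>v\<in>tangent_space M u. \<forall>w\<in>tangent_space M u. mderiv M \<Phi> u w = ip u v w"
proof -
  have u0: "u \<noteq> 0" using M_neq_0 u by blast
  obtain C where C: "C > 0" "\<forall>v. norm v \<le> C * nrm u v"
    using local_metric_bounds[OF u0] by (metis centre_in_ball)
  define A where "A = d\<psi> (\<phi> u)"
  define b where "b v w = ip u (A v) (A w)" for v w
  define K where "K = norm (d\<phi> u) + 1"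
  have K: "K > 0" by (simp add: K_def add_nonneg_pos)
  interpret B: bounded_bilinear "ip u" by (rule bounded_bilinear_ip[OF u0])
  have bb: "bounded_bilinear b"
    unfolding b_def using B.comp[OF blinfun.bounded_linear_right blinfun.bounded_linear_right] .
  have "\<exists>g\<in>E. \<forall>w\<in>E. b g w = dF (\<phi> u) w"
  proof (rule riesz_on_subspace[OF subspace_E closed_E bb])
    show "b v w = b w v" for v w by (simp add: b_def ip_sym[OF u0])
    show "0 < 1 / (K * C)\<^sup>2" using K C by simp
    show "bounded_linear (blinfun_apply (dF (\<phi> u)))" by (rule blinfun.bounded_linear_right)
    fix v
    have "norm v = norm (d\<phi> u (A v))" using d\<phi>_d\<psi>[OF \<phi>_V[OF u(1)]] \<psi>\<phi>[OF u(1)] by (simp add: A_def)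
    also have "\<dots> \<le> norm (d\<phi> u) * norm (A v)" by (rule norm_blinfun)
    also have "\<dots> \<le> K * norm (A v)" by (intro mult_right_mono) (simp_all add: K_def)
    also have "\<dots> \<le> K * (C * nrm u (A v))" using K C by (intro mult_left_mono) auto
    finally have "(norm v)\<^sup>2 \<le> (K * C * nrm u (A v))\<^sup>2" by (intro power_mono) (simp_all add: mult_ac)
    then have "(norm v)\<^sup>2 \<le> (K * C)\<^sup>2 * b v v" by (simp add: power_mult_distrib nrm_sq[OF u0] b_def)
    then show "1 / (K * C)\<^sup>2 * (norm v)\<^sup>2 \<le> b v v" using K C by (simp add: field_simps)
  qed
  then obtain g where g: "g \<in> E" "\<forall>w\<in>E. b g w = dF (\<phi> u) w" by blast
  have "mderiv M \<Phi> u w = ip u (A g) w" if w: "w \<in> tangent_space M u" for w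
  proof -
    obtain h where h: "h \<in> E" "w = A h" using w tangent_space_chart[OF u] by (auto simp: A_def)
    have "d\<phi> u w = h" using d\<phi>_d\<psi>[OF \<phi>_V[OF u(1)]] \<psi>\<phi>[OF u(1)] by (simp add: h A_def)
    then show ?thesis using mderiv_chart[OF u w] g(2) h by (simp add: b_def)
  qed
  moreover have "A g \<in> tangent_space M u" using g(1) tangent_space_chart[OF u] by (simp add: A_def)
  ultimately show ?thesis by blast
qed

lemma mgrad_chart:
  assumes u: "u \<in> U" "u \<in> M"
  shows "mgrad ip M \<Phi> u \<in> tangent_space M u"
    and "\<And>w. w \<in> tangent_space M u \<Longrightarrow> mderiv M \<Phi> u w = ip u (mgrad ip M \<Phi> u) w"
    and "subspace (tangent_space M u)"
proof -
  have u0: "u \<noteq> 0" using M_neq_0 u by blast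
  show sub: "subspace (tangent_space M u)"
    unfolding tangent_space_chart[OF u]
    by (intro linear_subspace_image subspace_E bounded_linear.linear blinfun.bounded_linear_right)
  have "\<exists>!v. v \<in> tangent_space M u \<and> (\<forall>w\<in>tangent_space M u. mderiv M \<Phi> u w = ip u v w)"
  proof (rule ex_ex1I)
    show "\<exists>v. v \<in> tangent_space M u \<and> (\<forall>w\<in>tangent_space M u. mderiv M \<Phi> u w = ip u v w)"
      using gradient_exists_chart[OF u] by blast
    fix v v' assume v: "v \<in> tangent_space M u \<and> (\<forall>w\<in>tangent_space M u. mderiv M \<Phi> u w = ip u v w)"
      and v': "v' \<in> tangent_space M u \<and> (\<forall>w\<in>tangent_space M u. mderiv M \<Phi> u w = ip u v' w)"
    have "v - v' \<in> tangent_space M u" using v v' sub by (simp add: subspace_diff)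
    then have "ip u v (v - v') = ip u v' (v - v')" using v v' by metis
    then have "ip u (v - v') (v - v') = 0"
      using bilinear_lsub[OF ip_bilinear[OF u0]] by simp
    then show "v = v'" using ip_pos[OF u0, of "v - v'"] by force
  qed
  from theI'[OF this] show "mgrad ip M \<Phi> u \<in> tangent_space M u"
    "\<And>w. w \<in> tangent_space M u \<Longrightarrow> mderiv M \<Phi> u w = ip u (mgrad ip M \<Phi> u) w"
    unfolding mgrad_def by blast+
qed

end

section \<open>Quantitative estimates in a chart\<close>

context riemannian_chart begin

text \<open>The radii are nested: \<open>\<phi>\<close> maps the ball of radius \<rho> into that of
  radius s, and \<open>\<psi>\<close> maps the latter into the ball of radius r. Whatever is reached
  through the chart from near \<open>u0\<close> stays where the common constant \<open>K\<close> is
  valid.\<close>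

definition uniform_bounds :: "'a \<Rightarrow> real \<Rightarrow> real \<Rightarrow> real \<Rightarrow> real \<Rightarrow> bool" where
  "uniform_bounds u0 \<rho> s r K \<longleftrightarrow> \<rho> > 0 \<and> s > 0 \<and> r > 0 \<and> K \<ge> 1 \<and> ball u0 \<rho> \<subseteq> ball u0 r \<and> ball u0 r \<subseteq> U \<and>
     \<phi> ` ball u0 \<rho> \<subseteq> ball (\<phi> u0) s \<and> ball (\<phi> u0) s \<subseteq> V \<and> \<psi> ` ball (\<phi> u0) s \<subseteq> ball u0 r \<and>
     (\<forall>x\<in>ball u0 r. x \<noteq> 0 \<and> (\<forall>v. nrm x v \<le> K * norm v \<and> norm v \<le> K * nrm x v) \<and> norm (d\<phi> x) \<le> K) \<and>
     (\<forall>x\<in>ball u0 r. \<forall>x'\<in>ball u0 r. norm (d\<phi> x - d\<phi> x') \<le> K * norm (x - x') \<and>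
        norm (\<phi> x - \<phi> x') \<le> K * norm (x - x') \<and>
        (\<forall>v w. \<bar>ip x v w - ip x' v w\<bar> \<le> K * norm (x - x') * norm v * norm w)) \<and>
     (\<forall>y\<in>ball (\<phi> u0) s. norm (d\<psi> y) \<le> K) \<and>
     (\<forall>y\<in>ball (\<phi> u0) s. \<forall>z\<in>ball (\<phi> u0) s. norm (d\<psi> y - d\<psi> z) \<le> K * norm (y - z) \<and>
        norm (\<psi> y - \<psi> z) \<le> K * norm (y - z)) \<and>
     (\<forall>y\<in>ball (\<phi> u0) s \<inter> E. norm (dF y) \<le> K) \<and>
     (\<forall>y\<in>ball (\<phi> u0) s \<inter> E. \<forall>z\<in>ball (\<phi> u0) s \<inter> E. norm (dF y - dF z) \<le> K * norm (y - z))"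

lemma uniform_bounds_exists:
  assumes u0: "u0 \<in> U" "u0 \<in> M"
  shows "\<exists>\<rho> s r K. uniform_bounds u0 \<rho> s r K"
proof -
  define y0 where "y0 = \<phi> u0"
  have y0: "y0 \<in> V" "y0 \<in> E" using u0 \<phi>_V M_iff by (simp_all add: y0_def)
  obtain r0 C0 where r0: "r0 > 0" "C0 > 0" and C0: "\<forall>u\<in>ball u0 r0. u \<noteq> 0 \<and> (\<forall>v. nrm u v \<le> C0 * norm v \<and> norm v \<le> C0 * nrm u v) \<and>
     (\<forall>u'\<in>ball u0 r0. \<forall>v w. \<bar>ip u v w - ip u' v w\<bar> \<le> C0 * norm (u - u') * norm v * norm w)"
    using local_metric_bounds[OF M_neq_0[OF u0(2)]] by blast
  obtain e1 K1 where e1: "e1 > 0" "K1 > 0" and K1: "\<forall>y\<in>ball u0 e1 \<inter> U. norm (d\<phi> y) \<le> K1"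
    "\<forall>y\<in>ball u0 e1 \<inter> U. \<forall>z\<in>ball u0 e1 \<inter> U. norm (d\<phi> y - d\<phi> z) \<le> K1 * norm (y - z)"
    using local_lipschitz_bound[OF lip_d\<phi>[OF u0(1)] u0(1)] by blast
  obtain e2 where e2: "e2 > 0" "ball u0 e2 \<subseteq> U" using open_U u0(1) open_contains_ball by blast
  obtain e3 K3 where e3: "e3 > 0" "K3 > 0" and K3: "\<forall>y\<in>ball y0 e3 \<inter> V. norm (d\<psi> y) \<le> K3"
    "\<forall>y\<in>ball y0 e3 \<inter> V. \<forall>z\<in>ball y0 e3 \<inter> V. norm (d\<psi> y - d\<psi> z) \<le> K3 * norm (y - z)"
    using local_lipschitz_bound[OF lip_d\<psi>[OF y0(1)] y0(1)] by blast
  obtain e4 where e4: "e4 > 0" "ball y0 e4 \<subseteq> V" using open_V y0(1) open_contains_ball by blast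
  have yVE: "y0 \<in> V \<inter> E" using y0 by simp
  obtain e5 K5 where e5: "e5 > 0" "K5 > 0" and K5: "\<forall>y\<in>ball y0 e5 \<inter> (V \<inter> E). norm (dF y) \<le> K5"
    "\<forall>y\<in>ball y0 e5 \<inter> (V \<inter> E). \<forall>z\<in>ball y0 e5 \<inter> (V \<inter> E). norm (dF y - dF z) \<le> K5 * norm (y - z)"
    using local_lipschitz_bound[OF lip_dF[OF yVE] yVE] by blast
  define r where "r = min r0 (min e1 e2)"
  have r: "r > 0" "r \<le> r0" "r \<le> e1" "r \<le> e2" using r0 e1 e2 by (simp_all add: r_def)
  have rb: "ball u0 r \<subseteq> ball u0 r0" "ball u0 r \<subseteq> ball u0 e1" "ball u0 r \<subseteq> U"
    using r e2(2) by (auto simp: subset_ball)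
  have "isCont \<psi> y0" using cont_\<psi> open_V y0(1) continuous_on_eq_continuous_at by blast
  then have t\<psi>: "(\<psi> \<longlongrightarrow> u0) (nhds y0)"
    using \<psi>\<phi>[OF u0(1)] unfolding isCont_def tendsto_at_iff_tendsto_nhds by (simp add: y0_def)
  have "\<forall>\<^sub>F y in nhds y0. \<psi> y \<in> ball u0 r"
    by (rule topological_tendstoD[OF t\<psi> open_ball]) (simp add: r(1))
  then obtain e6 where e6: "e6 > 0" "\<forall>y. dist y y0 < e6 \<longrightarrow> \<psi> y \<in> ball u0 r"
    unfolding eventually_nhds_metric by blast
  define s where "s = min (min e3 e4) (min e5 e6)"
  have s: "s > 0" "s \<le> e3" "s \<le> e4" "s \<le> e5" "s \<le> e6" using e3 e4 e5 e6 by (simp_all add: s_def)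
  have sb: "ball y0 s \<subseteq> ball y0 e3" "ball y0 s \<subseteq> V" "ball y0 s \<subseteq> ball y0 e5" "\<psi> ` ball y0 s \<subseteq> ball u0 r"
    using s e4(2) e6(2) by (auto simp: subset_ball dist_commute)
  have "isCont \<phi> u0" using cont_\<phi> open_U u0(1) continuous_on_eq_continuous_at by blast
  then have t\<phi>: "(\<phi> \<longlongrightarrow> y0) (nhds u0)"
    unfolding isCont_def tendsto_at_iff_tendsto_nhds by (simp add: y0_def)
  have "\<forall>\<^sub>F x in nhds u0. \<phi> x \<in> ball y0 s"
    by (rule topological_tendstoD[OF t\<phi> open_ball]) (simp add: s(1))
  then obtain e7 where e7: "e7 > 0" "\<forall>x. dist x u0 < e7 \<longrightarrow> \<phi> x \<in> ball y0 s"
    unfolding eventually_nhds_metric by blast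
  define \<rho> where "\<rho> = min e7 r"
  have \<rho>: "\<rho> > 0" "ball u0 \<rho> \<subseteq> ball u0 r" "\<phi> ` ball u0 \<rho> \<subseteq> ball y0 s"
    using e7 r(1) by (auto simp: \<rho>_def dist_commute)
  define K where "K = C0 + K1 + K3 + K5 + 1"
  have K: "1 \<le> K" "C0 \<le> K" "K1 \<le> K" "K3 \<le> K" "K5 \<le> K" using r0 e1 e3 e5 by (simp_all add: K_def)
  have up: "a \<le> K * b" if "a \<le> c * b" "c \<le> K" "0 \<le> b" for a b c
    using that mult_right_mono order_trans by blast
  have A1: "x \<noteq> 0 \<and> (\<forall>v. nrm x v \<le> K * norm v \<and> norm v \<le> K * nrm x v) \<and> norm (d\<phi> x) \<le> K"
    if x: "x \<in> ball u0 r" for x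
  proof (intro conjI allI)
    have x0: "x \<in> ball u0 r0" "x \<in> ball u0 e1 \<inter> U" using x rb by blast+
    show n0: "x \<noteq> 0" using bspec[OF C0 x0(1)] by (rule conjunct1)
    have "norm (d\<phi> x) \<le> K1" by (rule bspec[OF K1(1) x0(2)])
    then show "norm (d\<phi> x) \<le> K" using K(3) by linarith
    fix v
    have a: "nrm x v \<le> C0 * norm v" "norm v \<le> C0 * nrm x v" using bspec[OF C0 x0(1)] by simp_all
    show "nrm x v \<le> K * norm v" by (rule up[OF a(1) K(2)]) simp
    show "norm v \<le> K * nrm x v" by (rule up[OF a(2) K(2) nrm_nonneg[OF n0]])
  qed
  have lip\<phi>: "norm (\<phi> x - \<phi> x') \<le> K * norm (x - x')" if "x \<in> ball u0 r" "x' \<in> ball u0 r" for x x'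
  proof (rule differentiable_bound[OF convex_ball _ _ that])
    fix z assume z: "z \<in> ball u0 r"
    then have "z \<in> U" using rb by blast
    then show "(\<phi> has_derivative blinfun_apply (d\<phi> z)) (at z within ball u0 r)"
      by (rule has_derivative_at_withinI[OF d\<phi>_at])
    show "onorm (blinfun_apply (d\<phi> z)) \<le> K" using A1[OF z] by (simp add: norm_blinfun.rep_eq)
  qed
  have A2: "norm (d\<phi> x - d\<phi> x') \<le> K * norm (x - x') \<and> norm (\<phi> x - \<phi> x') \<le> K * norm (x - x') \<and>
      (\<forall>v w. \<bar>ip x v w - ip x' v w\<bar> \<le> K * norm (x - x') * norm v * norm w)"
    if x: "x \<in> ball u0 r" "x' \<in> ball u0 r" for x x'
  proof (intro conjI allI lip\<phi> x)
    have x0: "x \<in> ball u0 r0" "x \<in> ball u0 e1 \<inter> U" "x' \<in> ball u0 r0" "x' \<in> ball u0 e1 \<inter> U" using x rb by blast+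
    have "norm (d\<phi> x - d\<phi> x') \<le> K1 * norm (x - x')" by (rule bspec[OF bspec[OF K1(2) x0(2)] x0(4)])
    then show "norm (d\<phi> x - d\<phi> x') \<le> K * norm (x - x')" by (rule up[OF _ K(3)]) simp
    fix v w
    have "\<bar>ip x v w - ip x' v w\<bar> \<le> C0 * norm (x - x') * norm v * norm w"
      using bspec[OF bspec[OF C0 x0(1), THEN conjunct2, THEN conjunct2] x0(3)] by simp
    then have "\<bar>ip x v w - ip x' v w\<bar> \<le> C0 * (norm (x - x') * norm v * norm w)" by (simp only: mult.assoc)
    then have "\<bar>ip x v w - ip x' v w\<bar> \<le> K * (norm (x - x') * norm v * norm w)"
      by (rule up[OF _ K(2)]) simp
    then show "\<bar>ip x v w - ip x' v w\<bar> \<le> K * norm (x - x') * norm v * norm w" by (simp only: mult.assoc)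
  qed
  have A3: "norm (d\<psi> y) \<le> K" if y: "y \<in> ball y0 s" for y
  proof -
    have "y \<in> ball y0 e3 \<inter> V" using y sb by blast
    then have "norm (d\<psi> y) \<le> K3" by (rule bspec[OF K3(1)])
    then show ?thesis using K(4) by linarith
  qed
  have A4: "norm (\<psi> y - \<psi> z) \<le> K * norm (y - z)" if "y \<in> ball y0 s" "z \<in> ball y0 s" for y z
  proof (rule differentiable_bound[OF convex_ball _ _ that])
    fix x assume x: "x \<in> ball y0 s"
    then have "x \<in> V" using sb by blast
    then show "(\<psi> has_derivative blinfun_apply (d\<psi> x)) (at x within ball y0 s)"
      by (rule has_derivative_at_withinI[OF d\<psi>_at])
    show "onorm (blinfun_apply (d\<psi> x)) \<le> K" using A3[OF x] by (simp add: norm_blinfun.rep_eq)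
  qed
  have A5: "norm (d\<psi> y - d\<psi> z) \<le> K * norm (y - z)" if y: "y \<in> ball y0 s" "z \<in> ball y0 s" for y z
  proof -
    have yz: "y \<in> ball y0 e3 \<inter> V" "z \<in> ball y0 e3 \<inter> V" using y sb by blast+
    have "norm (d\<psi> y - d\<psi> z) \<le> K3 * norm (y - z)" by (rule bspec[OF bspec[OF K3(2) yz(1)] yz(2)])
    then show ?thesis by (rule up[OF _ K(4)]) simp
  qed
  have A6: "norm (dF y) \<le> K" if y: "y \<in> ball y0 s \<inter> E" for y
  proof -
    have "y \<in> ball y0 e5 \<inter> (V \<inter> E)" using y sb by blast
    then have "norm (dF y) \<le> K5" by (rule bspec[OF K5(1)])
    then show ?thesis using K(5) by linarith
  qed
  have A7: "norm (dF y - dF z) \<le> K * norm (y - z)" if y: "y \<in> ball y0 s \<inter> E" "z \<in> ball y0 s \<inter> E" for y z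
  proof -
    have yz: "y \<in> ball y0 e5 \<inter> (V \<inter> E)" "z \<in> ball y0 e5 \<inter> (V \<inter> E)" using y sb by blast+
    have "norm (dF y - dF z) \<le> K5 * norm (y - z)" by (rule bspec[OF bspec[OF K5(2) yz(1)] yz(2)])
    then show ?thesis by (rule up[OF _ K(5)]) simp
  qed
  have "uniform_bounds u0 \<rho> s r K"
    unfolding uniform_bounds_def y0_def[symmetric]
    by (intro conjI ballI \<rho> s(1) r(1) K(1) rb(3) sb(2) sb(4) A1 A2 A3 A4 A5 A6 A7)
  then show ?thesis by blast
qed

text \<open>The segment between the chart images is carried back to M. Of the three factors
  \<open>K\<close> in its length one comes from \<open>\<phi>\<close>, one from the derivative of
  \<open>\<psi>\<close>, and one from the passage between norms.\<close>

lemma conn_near_chart: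
  assumes u0: "u0 \<in> U" "u0 \<in> M"
  shows "\<exists>\<rho>>0. \<exists>K>0. \<forall>x\<in>M \<inter> ball u0 \<rho>. \<forall>y\<in>M \<inter> ball u0 \<rho>. conn x y (K * norm (x - y))"
proof -
  obtain \<rho> s r K where ub: "uniform_bounds u0 \<rho> s r K" using uniform_bounds_exists[OF u0] by blast
  note ub = ub[unfolded uniform_bounds_def]
  have K: "K \<ge> 1" and \<rho>: "\<rho> > 0" using ub by simp_all
  have "conn x y (K * (K * (K * norm (x - y))))" if x: "x \<in> M" "x \<in> ball u0 \<rho>" and y: "y \<in> M" "y \<in> ball u0 \<rho>" for x y
  proof -
    have xr: "x \<in> ball u0 r" "y \<in> ball u0 r" using ub x y by blast+
    then have xU: "x \<in> U" "y \<in> U" using ub by blast+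
    have bx: "\<phi> x \<in> ball (\<phi> u0) s" "\<phi> y \<in> ball (\<phi> u0) s" using ub x y by blast+
    have Ex: "\<phi> x \<in> E" "\<phi> y \<in> E" using M_iff xU x y by blast+
    define h where "h = \<phi> y - \<phi> x"
    define l where "l t = \<phi> x + t *\<^sub>R h" for t :: real
    have lb: "l t \<in> ball (\<phi> u0) s" if "t \<in> {0..1}" for t
    proof -
      have "l t = (1 - t) *\<^sub>R \<phi> x + t *\<^sub>R \<phi> y" by (simp add: l_def h_def algebra_simps)
      then show ?thesis using bx that convexD[OF convex_ball, of "\<phi> x" "\<phi> u0" s "\<phi> y" "1 - t" t] by simp
    qed
    have lE: "l t \<in> E" for t
      unfolding l_def h_def using subspace_E Ex by (intro subspace_add subspace_scale subspace_diff)
    have lV: "l t \<in> V" if "t \<in> {0..1}" for t using lb[OF that] ub by blast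
    have hn: "norm h \<le> K * norm (x - y)"
      using ub xr by (simp add: h_def norm_minus_commute)
    define \<sigma> where "\<sigma> t = \<psi> (l t)" for t
    have "conn (\<sigma> 0) (\<sigma> 1) (K * (K * (K * norm (x - y))) * (1 - 0))"
    proof (rule conn_speed_bound[where \<sigma>' = "\<lambda>t. blinfun_apply (d\<psi> (l t)) h"])
      fix t :: real assume t: "t \<in> {0..1}"
      show "\<sigma> t \<in> M" unfolding \<sigma>_def by (rule \<psi>_M[OF lV[OF t] lE])
      have "(l has_derivative (\<lambda>s. s *\<^sub>R h)) (at t within {0..1})"
        unfolding l_def by (auto intro!: derivative_eq_intros)
      then have "((\<lambda>t. \<psi> (l t)) has_derivative (\<lambda>s. d\<psi> (l t) (s *\<^sub>R h))) (at t within {0..1})"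
        using d\<psi>_at[OF lV[OF t]] by (rule has_derivative_compose)
      then show "(\<sigma> has_vector_derivative blinfun_apply (d\<psi> (l t)) h) (at t within {0..1})"
        by (simp add: \<sigma>_def[abs_def] has_vector_derivative_def blinfun.scaleR_right)
      have "\<sigma> t \<in> ball u0 r" unfolding \<sigma>_def using lb[OF t] ub by blast
      then have "nrm (\<sigma> t) (d\<psi> (l t) h) \<le> K * norm (d\<psi> (l t) h)" using ub by blast
      also have "\<dots> \<le> K * (K * (K * norm (x - y)))"
      proof (rule mult_left_mono)
        have "norm (d\<psi> (l t) h) \<le> norm (d\<psi> (l t)) * norm h" by (rule norm_blinfun)
        also have "\<dots> \<le> K * (K * norm (x - y))" using hn ub lb[OF t] K by (intro mult_mono) auto
        finally show "norm (d\<psi> (l t) h) \<le> K * (K * norm (x - y))" .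
      qed (use K in simp)
      finally show "nrm (\<sigma> t) (d\<psi> (l t) h) \<le> K * (K * (K * norm (x - y)))" .
    next
      have "continuous_on {0..1} l" unfolding l_def by (intro continuous_intros)
      then have "continuous_on {0..1} (\<lambda>t. d\<psi> (l t))"
        by (rule continuous_on_compose2[OF continuous_on_d\<psi>]) (use lV in blast)
      then show "continuous_on {0..1} (\<lambda>t. blinfun_apply (d\<psi> (l t)) h)" by (intro continuous_intros)
    qed simp
    moreover have "\<sigma> 0 = x" "\<sigma> 1 = y" using \<psi>\<phi> xU by (simp_all add: \<sigma>_def l_def h_def)
    ultimately show ?thesis by simp
  qed
  then have "\<forall>x\<in>M \<inter> ball u0 \<rho>. \<forall>y\<in>M \<inter> ball u0 \<rho>. conn x y ((K * K * K) * norm (x - y))"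
    by (simp add: mult.assoc)
  moreover have "K * K * K > 0" using K by simp
  ultimately show ?thesis using \<rho> by blast
qed

text \<open>In the chart the gradient \<open>g x\<close> solves
  \<open>ip x (A x (g x)) (A x h) = dF (\<phi> x) h\<close> for all \<open>h\<close> in
  \<open>E\<close>, an equation whose coefficients are Lipschitz in x and whose form is uniformly
  coercive. The equations at x and y are subtracted and tested with
  \<open>h = g x - g y\<close>.\<close>

lemma gradient_lipschitz_chart:
  assumes u0: "u0 \<in> U" "u0 \<in> M"
  shows "\<exists>\<rho>>0. \<exists>L>0. \<forall>x\<in>M \<inter> ball u0 \<rho>. \<forall>y\<in>M \<inter> ball u0 \<rho>.
     norm (mgrad ip M \<Phi> x - mgrad ip M \<Phi> y) \<le> L * norm (x - y)"
proof -
  obtain \<rho> s r K where ub: "uniform_bounds u0 \<rho> s r K" using uniform_bounds_exists[OF u0] by blast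
  note ub = ub[unfolded uniform_bounds_def]
  have K: "K \<ge> 1" and \<rho>: "\<rho> > 0" using ub by simp_all
  \<comment> \<open>The inverse of the coercivity constant:
    \<open>norm h \<le> K * K * nrm x (A x h)\<close>.\<close>
  define c where "c = (K * K)\<^sup>2"
  have c: "c \<ge> 1" unfolding c_def using K by (simp add: one_le_power mult_ge1_I)
  define A where "A x = d\<psi> (\<phi> x)" for x
  define g where "g x = d\<phi> x (mgrad ip M \<Phi> x)" for x
  have basic: "x \<in> U" "x \<noteq> 0" "\<phi> x \<in> ball (\<phi> u0) s \<inter> E" "x \<in> ball u0 r" "norm (A x) \<le> K"
    "g x \<in> E" "A x (g x) = mgrad ip M \<Phi> x"
    "\<And>h. h \<in> E \<Longrightarrow> ip x (A x (g x)) (A x h) = dF (\<phi> x) h"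
    "\<And>h. h \<in> E \<Longrightarrow> (norm h)\<^sup>2 \<le> c * ip x (A x h) (A x h)"
    if x: "x \<in> M" "x \<in> ball u0 \<rho>" for x
  proof -
    show xr: "x \<in> ball u0 r" using ub x by blast
    then show xU: "x \<in> U" using ub by blast
    show x0: "x \<noteq> 0" using M_neq_0 x by blast
    show px: "\<phi> x \<in> ball (\<phi> u0) s \<inter> E" using M_iff[OF xU] x ub by blast
    then show "norm (A x) \<le> K" using ub by (simp add: A_def)
    show Ag: "A x (g x) = mgrad ip M \<Phi> x" unfolding A_def g_def by (rule d\<psi>_d\<phi>[OF xU])
    have inv: "d\<phi> x (A x h) = h" for h
      unfolding A_def using d\<phi>_d\<psi>[OF \<phi>_V[OF xU], of h] by (simp add: \<psi>\<phi>[OF xU])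
    show "g x \<in> E"
    proof -
      obtain h where "h \<in> E" "mgrad ip M \<Phi> x = A x h"
        using mgrad_chart(1)[OF xU x(1)] tangent_space_chart[OF xU x(1)] by (auto simp: A_def)
      then show ?thesis by (simp add: g_def inv)
    qed
    fix h assume h: "h \<in> E"
    have "A x h \<in> tangent_space M x" using h tangent_space_chart[OF xU x(1)] by (simp add: A_def)
    then show "ip x (A x (g x)) (A x h) = dF (\<phi> x) h"
      using mgrad_chart(2)[OF xU x(1), of "A x h"] mderiv_chart[OF xU x(1), of "A x h"] by (simp add: Ag inv)
    have "norm h = norm (d\<phi> x (A x h))" by (simp add: inv)
    also have "\<dots> \<le> norm (d\<phi> x) * norm (A x h)" by (rule norm_blinfun)
    also have "\<dots> \<le> K * (K * nrm x (A x h))" using ub xr K by (intro mult_mono) auto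
    finally have "(norm h)\<^sup>2 \<le> (K * K * nrm x (A x h))\<^sup>2" by (intro power_mono) (simp_all add: mult_ac)
    then show "(norm h)\<^sup>2 \<le> c * ip x (A x h) (A x h)"
      by (simp add: c_def power_mult_distrib nrm_sq[OF x0])
  qed
  have gb: "norm (g x) \<le> c * K" if x: "x \<in> M" "x \<in> ball u0 \<rho>" for x
  proof (cases "g x = 0")
    case True then show ?thesis using c K by simp
  next
    case False
    have "dF (\<phi> x) (g x) \<le> norm (dF (\<phi> x) (g x))" by simp
    also have "\<dots> \<le> norm (dF (\<phi> x)) * norm (g x)" by (rule norm_blinfun)
    also have "\<dots> \<le> K * norm (g x)" using ub basic(3)[OF x] by (intro mult_right_mono) auto
    finally have "(norm (g x))\<^sup>2 \<le> c * (K * norm (g x))"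
      using basic(9)[OF x basic(6)[OF x]] basic(8)[OF x basic(6)[OF x]] c
      by (smt (verit) mult_left_mono)
    then have "norm (g x) * norm (g x) \<le> (c * K) * norm (g x)" by (simp add: power2_eq_square mult.assoc)
    then show ?thesis using False by simp
  qed
  \<comment> \<open>The term \<open>K * K\<close> comes from the change of \<open>dF\<close>; the
    three equal terms bound the change of the scalar product and of \<open>A\<close> in either
    argument.\<close>
  define L1 where "L1 = c * (K * K + 3 * (K * K * K * K * (c * K) * K))"
  define L where "L = K * L1 + K * K * (c * K) + 1"
  have L1: "L1 \<ge> 0" using c K by (simp add: L1_def)
  have main: "norm (mgrad ip M \<Phi> x - mgrad ip M \<Phi> y) \<le> L * norm (x - y)"
    if x: "x \<in> M" "x \<in> ball u0 \<rho>" and y: "y \<in> M" "y \<in> ball u0 \<rho>" for x y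
  proof -
    note bx = basic[OF x] and byy = basic[OF y]
    define D where "D = norm (x - y)"
    define h where "h = g x - g y"
    have hE: "h \<in> E" unfolding h_def using subspace_E bx(6) byy(6) by (rule subspace_diff)
    have phi: "norm (\<phi> x - \<phi> y) \<le> K * D" using ub bx(4) byy(4) by (simp add: D_def)
    have Axy: "norm (A x - A y) \<le> K * (K * D)"
    proof -
      have "norm (A x - A y) \<le> K * norm (\<phi> x - \<phi> y)" using ub bx(3) byy(3) by (simp add: A_def)
      also have "\<dots> \<le> K * (K * D)" using phi K by (intro mult_left_mono) auto
      finally show ?thesis .
    qed
    have ipb: "\<bar>ip y v w\<bar> \<le> K * norm v * (K * norm w)" for v w
    proof -
      have "\<bar>ip y v w\<bar> \<le> nrm y v * nrm y w" by (rule ip_cauchy_schwarz[OF byy(2)])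
      also have "\<dots> \<le> (K * norm v) * (K * norm w)"
        using ub byy(4) nrm_nonneg[OF byy(2)] K by (intro mult_mono) auto
      finally show ?thesis .
    qed
    have nA: "norm (A x v) \<le> K * norm v" for v
      using norm_blinfun[of "A x" v] mult_right_mono[OF bx(5), of "norm v"] by simp
    have nA': "norm (A y v) \<le> K * norm v" for v
      using norm_blinfun[of "A y" v] mult_right_mono[OF byy(5), of "norm v"] by simp
    have nAd: "norm ((A x - A y) v) \<le> K * (K * D) * norm v" for v
      using norm_blinfun[of "A x - A y" v] mult_right_mono[OF Axy, of "norm v"] by simp
    note bl = ip_bilinear[OF byy(2)]
    have gy: "norm (g y) \<le> c * K" by (rule gb[OF y])
    have D0: "D \<ge> 0" by (simp add: D_def)
    have n1: "norm ((A x - A y) (g y)) \<le> K * (K * D) * (c * K)"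
      by (rule order_trans[OF nAd]) (use gy K D0 in \<open>intro mult_left_mono, auto\<close>)
    have n2: "norm (A y (g y)) \<le> K * (c * K)"
      by (rule order_trans[OF nA']) (use gy K in \<open>intro mult_left_mono, auto\<close>)
    have n3: "norm (A x (g y)) \<le> K * (c * K)"
      by (rule order_trans[OF nA]) (use gy K in \<open>intro mult_left_mono, auto\<close>)
    let ?B = "K * K * K * K * (c * K) * D * norm h"
    have T1: "\<bar>dF (\<phi> x) h - dF (\<phi> y) h\<bar> \<le> K * K * D * norm h"
    proof -
      have "\<bar>dF (\<phi> x) h - dF (\<phi> y) h\<bar> = norm ((dF (\<phi> x) - dF (\<phi> y)) h)" by (simp add: blinfun.diff_left)
      also have "\<dots> \<le> norm (dF (\<phi> x) - dF (\<phi> y)) * norm h" by (rule norm_blinfun)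
      also have "\<dots> \<le> (K * norm (\<phi> x - \<phi> y)) * norm h" using ub bx(3) byy(3) by (intro mult_right_mono) auto
      also have "\<dots> \<le> (K * (K * D)) * norm h" using phi K by (intro mult_right_mono mult_left_mono) auto
      finally show ?thesis by (simp add: mult.assoc)
    qed
    have KK: "K \<le> K * K" "1 \<le> K * K" using K by (simp_all add: mult_ge1_I)
    have T2: "\<bar>ip x (A x (g y)) (A x h) - ip y (A x (g y)) (A x h)\<bar> \<le> ?B"
    proof -
      have "\<bar>ip x (A x (g y)) (A x h) - ip y (A x (g y)) (A x h)\<bar> \<le> K * D * norm (A x (g y)) * norm (A x h)"
        using ub bx(4) byy(4) by (simp add: D_def)
      also have "\<dots> \<le> K * D * (K * (c * K)) * (K * norm h)"
        using nA[of h] n3 K c D0 by (intro mult_mono mult_nonneg_nonneg) auto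
      also have "\<dots> = 1 * (K * K * K * (c * K) * D * norm h)" by (simp add: mult_ac)
      also have "\<dots> \<le> K * (K * K * K * (c * K) * D * norm h)"
        using K c by (intro mult_right_mono) (auto simp: D_def)
      finally show ?thesis by (simp add: mult_ac)
    qed
    have T3: "\<bar>ip y ((A x - A y) (g y)) (A x h)\<bar> \<le> ?B * K"
    proof -
      have "\<bar>ip y ((A x - A y) (g y)) (A x h)\<bar> \<le> K * norm ((A x - A y) (g y)) * (K * norm (A x h))" by (rule ipb)
      also have "\<dots> \<le> K * (K * (K * D) * (c * K)) * (K * (K * norm h))"
        using nA[of h] n1 K c D0 by (intro mult_mono mult_left_mono mult_nonneg_nonneg) auto
      finally show ?thesis by (simp add: mult_ac)
    qed
    have T4: "\<bar>ip y (A y (g y)) ((A x - A y) h)\<bar> \<le> ?B * K"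
    proof -
      have "\<bar>ip y (A y (g y)) ((A x - A y) h)\<bar> \<le> K * norm (A y (g y)) * (K * norm ((A x - A y) h))" by (rule ipb)
      also have "\<dots> \<le> K * (K * (c * K)) * (K * (K * (K * D) * norm h))"
        using nAd[of h] n2 K c D0 by (intro mult_mono mult_left_mono mult_nonneg_nonneg) auto
      finally show ?thesis by (simp add: mult_ac)
    qed
    have e1: "ip y (A x (g y)) (A x h) - ip y (A y (g y)) (A y h) =
        ip y ((A x - A y) (g y)) (A x h) + ip y (A y (g y)) ((A x - A y) h)"
      by (simp add: blinfun.diff_left bilinear_lsub[OF bl] bilinear_rsub[OF bl])
    have "ip x (A x h) (A x h) = ip x (A x (g x)) (A x h) - ip x (A x (g y)) (A x h)"
      unfolding h_def blinfun.diff_right by (simp add: bilinear_lsub[OF ip_bilinear[OF bx(2)]])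
    also have "ip x (A x (g x)) (A x h) = dF (\<phi> x) h" by (rule bx(8)[OF hE])
    also have "dF (\<phi> x) h - ip x (A x (g y)) (A x h) = (dF (\<phi> x) h - dF (\<phi> y) h)
        - (ip x (A x (g y)) (A x h) - ip y (A x (g y)) (A x h))
        - (ip y ((A x - A y) (g y)) (A x h) + ip y (A y (g y)) ((A x - A y) h))"
      using byy(8)[OF hE] e1 by simp
    finally have "ip x (A x h) (A x h) \<le> K * K * D * norm h + ?B + ?B * K + ?B * K"
      using T1 T2 T3 T4 by linarith
    also have "\<dots> \<le> K * K * D * norm h + ?B * K + ?B * K + ?B * K"
    proof -
      have "?B \<ge> 0" using K c by (simp add: D_def)
      then have "?B * 1 \<le> ?B * K" using K by (intro mult_left_mono)
      then show ?thesis by linarith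
    qed
    also have "\<dots> = (K * K + 3 * (K * K * K * K * (c * K) * K)) * D * norm h" by (simp add: algebra_simps)
    finally have hb: "ip x (A x h) (A x h) \<le> (K * K + 3 * (K * K * K * K * (c * K) * K)) * D * norm h" .
    have "norm h \<le> L1 * D"
    proof (cases "h = 0")
      case True then show ?thesis using L1 by (simp add: D_def)
    next
      case False
      have "norm h * norm h \<le> c * ip x (A x h) (A x h)" using bx(9)[OF hE] by (simp add: power2_eq_square)
      also have "\<dots> \<le> c * ((K * K + 3 * (K * K * K * K * (c * K) * K)) * D * norm h)"
        using hb c by (intro mult_left_mono) auto
      also have "\<dots> = L1 * D * norm h" by (simp add: L1_def mult.assoc)
      finally show ?thesis using False by simp
    qed
    then have "norm (A x h) \<le> K * (L1 * D)"
      using nA[of h] K by (meson mult_left_mono order_trans zero_le_one)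
    moreover note n1
    moreover have "mgrad ip M \<Phi> x - mgrad ip M \<Phi> y = A x h + (A x - A y) (g y)"
      by (simp add: bx(7)[symmetric] byy(7)[symmetric] h_def blinfun.diff_left blinfun.diff_right)
    ultimately have "norm (mgrad ip M \<Phi> x - mgrad ip M \<Phi> y) \<le> K * (L1 * D) + K * (K * D) * (c * K)"
      using norm_triangle_ineq[of "A x h" "(A x - A y) (g y)"] by simp
    also have "\<dots> \<le> L * D" by (simp add: L_def D_def algebra_simps)
    finally show ?thesis by (simp add: D_def)
  qed
  have "L > 0" using L1 K c by (simp add: L_def add_nonneg_pos)
  then show ?thesis using \<rho> main by blast
qed

end

section \<open>Local solutions of differential equations on M\<close>

context riemannian_chart begin

text \<open>The field is transported to \<open>E\<close>, where Picard-Lindeloef applies because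
  tangency means that the transported field takes values in \<open>E\<close>. Radius and existence
  time are the same for all starting points near \<open>u0\<close>, which is what continuation of
  solutions relies on.\<close>

lemma local_solution_chart:
  fixes f :: "'a \<Rightarrow> 'a"
  assumes u0: "u0 \<in> U" "u0 \<in> M" and R: "R \<subseteq> M" "e > 0" "M \<inter> ball u0 e \<subseteq> R"
    and tan: "\<And>x. x \<in> R \<Longrightarrow> f x \<in> tangent_space M x"
    and L: "L \<ge> 0" "\<And>x y. x \<in> M \<inter> ball u0 e \<Longrightarrow> y \<in> M \<inter> ball u0 e \<Longrightarrow> norm (f x - f y) \<le> L * norm (x - y)"
  shows "\<exists>\<rho>>0. \<exists>\<tau>>0. \<forall>x\<in>M \<inter> ball u0 \<rho>. \<exists>\<sigma>. \<sigma> 0 = x \<and>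
     (\<forall>t\<in>{0..\<tau>}. \<sigma> t \<in> M \<inter> ball u0 e \<and> (\<sigma> has_vector_derivative f (\<sigma> t)) (at t within {0..\<tau>}))"
proof -
  obtain \<rho>0 s0 r K where ub: "uniform_bounds u0 \<rho>0 s0 r K" using uniform_bounds_exists[OF u0] by blast
  note ub = ub[unfolded uniform_bounds_def]
  have K: "K \<ge> 1" and s0: "s0 > 0" and \<rho>0: "\<rho>0 > 0" using ub by simp_all
  define y0 where "y0 = \<phi> u0"
  have inV: "y \<in> V" "norm (d\<psi> y) \<le> K" "\<psi> y \<in> ball u0 r" "norm (d\<phi> (\<psi> y)) \<le> K" if y: "y \<in> ball y0 s0" for y
  proof -
    show "y \<in> V" using ub y unfolding y0_def by blast
    show "norm (d\<psi> y) \<le> K" using ub y unfolding y0_def by blast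
    show "\<psi> y \<in> ball u0 r" using ub y unfolding y0_def by blast
    then show "norm (d\<phi> (\<psi> y)) \<le> K" using ub by blast
  qed
  have lip\<psi>: "norm (\<psi> y - \<psi> z) \<le> K * norm (y - z)" if "y \<in> ball y0 s0" "z \<in> ball y0 s0" for y z
    using ub that unfolding y0_def by blast
  have lipd: "norm (d\<phi> (\<psi> y) - d\<phi> (\<psi> z)) \<le> K * (K * norm (y - z))" if y: "y \<in> ball y0 s0" "z \<in> ball y0 s0" for y z
  proof -
    have "norm (d\<phi> (\<psi> y) - d\<phi> (\<psi> z)) \<le> K * norm (\<psi> y - \<psi> z)"
      using ub inV(3)[OF y(1)] inV(3)[OF y(2)] by blast
    also have "\<dots> \<le> K * (K * norm (y - z))" using lip\<psi>[OF y] K by (intro mult_left_mono) auto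
    finally show ?thesis .
  qed
  \<comment> \<open>The bound \<open>K * s \<le> e\<close> keeps the image under
    \<open>\<psi>\<close> in the ball where \<open>f\<close> is Lipschitz.\<close>
  define s where "s = min s0 (e / K)"
  have s: "s > 0" "s \<le> s0" "K * s \<le> e" using s0 K R(2) by (auto simp: s_def min_def field_simps)
  have sb: "y \<in> ball y0 s0" "\<psi> y \<in> ball u0 e" if y: "y \<in> ball y0 s" for y
  proof -
    show y1: "y \<in> ball y0 s0" using y s by auto
    have "norm (\<psi> y - \<psi> y0) \<le> K * norm (y - y0)" using y1 s0 by (intro lip\<psi>) auto
    also have "\<dots> < K * s" using y K by (intro mult_strict_left_mono) (auto simp: dist_norm norm_minus_commute)
    finally show "\<psi> y \<in> ball u0 e" using s(3) \<psi>\<phi>[OF u0(1)] by (auto simp: y0_def dist_norm norm_minus_commute)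
  qed
  have ME: "\<psi> y \<in> M \<inter> ball u0 e" if y: "y \<in> ball y0 s" "y \<in> E" for y
    using sb[OF y(1)] inV(1) \<psi>_M y(2) by blast
  define B0 where "B0 = norm (f u0) + L * e"
  have B0: "B0 \<ge> 0" using L R(2) by (simp add: B0_def)
  have fB: "norm (f x) \<le> B0" if x: "x \<in> M \<inter> ball u0 e" for x
  proof -
    have "norm (f x - f u0) \<le> L * norm (x - u0)" using x u0 R(2) by (intro L) auto
    also have "\<dots> \<le> L * e" using x L(1) by (intro mult_left_mono) (auto simp: dist_norm norm_minus_commute)
    finally show ?thesis using norm_triangle_ineq2[of "f x" "f u0"] by (simp add: B0_def)
  qed
  define W where "W y = d\<phi> (\<psi> y) (f (\<psi> y))" for y
  define LW where "LW = K * (L * K) + K * K * B0"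
  have LW: "LW \<ge> 0" using K L B0 by (simp add: LW_def)
  have WL: "norm (W y - W z) \<le> LW * norm (y - z)" if y: "y \<in> ball y0 s" "y \<in> E" and z: "z \<in> ball y0 s" "z \<in> E" for y z
  proof -
    have e: "W y - W z = d\<phi> (\<psi> y) (f (\<psi> y) - f (\<psi> z)) + (d\<phi> (\<psi> y) - d\<phi> (\<psi> z)) (f (\<psi> z))"
      by (simp add: W_def blinfun.diff_left blinfun.diff_right)
    have f1: "norm (f (\<psi> y) - f (\<psi> z)) \<le> L * (K * norm (y - z))"
      using L(2)[OF ME[OF y] ME[OF z]] lip\<psi>[OF sb(1)[OF y(1)] sb(1)[OF z(1)]] L(1)
      by (meson mult_left_mono order_trans)
    have "norm (d\<phi> (\<psi> y) (f (\<psi> y) - f (\<psi> z))) \<le> norm (d\<phi> (\<psi> y)) * norm (f (\<psi> y) - f (\<psi> z))" by (rule norm_blinfun)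
    also have "\<dots> \<le> K * (L * (K * norm (y - z)))"
      using f1 inV(4)[OF sb(1)[OF y(1)]] K by (intro mult_mono) auto
    finally have a: "norm (d\<phi> (\<psi> y) (f (\<psi> y) - f (\<psi> z))) \<le> K * (L * (K * norm (y - z)))" .
    have "norm ((d\<phi> (\<psi> y) - d\<phi> (\<psi> z)) (f (\<psi> z))) \<le> norm (d\<phi> (\<psi> y) - d\<phi> (\<psi> z)) * norm (f (\<psi> z))" by (rule norm_blinfun)
    also have "\<dots> \<le> (K * (K * norm (y - z))) * B0"
      using lipd[OF sb(1)[OF y(1)] sb(1)[OF z(1)]] fB[OF ME[OF z]] K by (intro mult_mono) auto
    finally have b: "norm ((d\<phi> (\<psi> y) - d\<phi> (\<psi> z)) (f (\<psi> z))) \<le> (K * (K * norm (y - z))) * B0" .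
    have "norm (W y - W z) \<le> K * (L * (K * norm (y - z))) + (K * (K * norm (y - z))) * B0"
      unfolding e using norm_triangle_ineq a b by (meson add_mono order_trans)
    also have "\<dots> = LW * norm (y - z)" by (simp add: LW_def algebra_simps)
    finally show ?thesis .
  qed
  have WB: "norm (W y) \<le> K * B0" if y: "y \<in> ball y0 s" "y \<in> E" for y
  proof -
    have "norm (W y) \<le> norm (d\<phi> (\<psi> y)) * norm (f (\<psi> y))" unfolding W_def by (rule norm_blinfun)
    also have "\<dots> \<le> K * B0" using inV(4)[OF sb(1)[OF y(1)]] fB[OF ME[OF y]] K by (intro mult_mono) auto
    finally show ?thesis .
  qed
  have WE: "W y \<in> E" if y: "y \<in> ball y0 s" "y \<in> E" for y
  proof -
    have yV: "y \<in> V" by (rule inV(1)[OF sb(1)[OF y(1)]])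
    have m: "\<psi> y \<in> M" using ME[OF y] by blast
    have "\<psi> y \<in> R" using ME[OF y] R(3) by blast
    then have "f (\<psi> y) \<in> blinfun_apply (d\<psi> (\<phi> (\<psi> y))) ` E"
      using tan tangent_space_chart[OF \<psi>_U[OF yV] m] by blast
    then obtain h where h: "h \<in> E" "f (\<psi> y) = d\<psi> y h" by (auto simp: \<phi>\<psi>[OF yV])
    then show ?thesis by (simp add: W_def d\<phi>_d\<psi>[OF yV])
  qed
  define \<rho> where "\<rho> = min \<rho>0 (s / (2 * K))"
  have \<rho>: "\<rho> > 0" "\<rho> \<le> \<rho>0" "K * \<rho> \<le> s / 2" using \<rho>0 s K by (auto simp: \<rho>_def min_def field_simps)
  \<comment> \<open>The first entry keeps the solution within s / 4 of its start, the second makes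
    the contraction constant at most 1 / 2; adding 1 in the denominators avoids division by
    zero.\<close>
  define \<tau> where "\<tau> = min (s / (4 * (K * B0 + 1))) (1 / (2 * (LW + 1)))"
  have KB: "K * B0 \<ge> 0" using K B0 by simp
  have \<tau>0: "\<tau> > 0" using s KB LW by (simp add: \<tau>_def)
  have \<tau>1: "\<tau> * (K * B0) \<le> s / 4"
  proof -
    have "\<tau> * (K * B0) \<le> \<tau> * (K * B0 + 1)" using \<tau>0 by simp
    also have "\<dots> \<le> (s / (4 * (K * B0 + 1))) * (K * B0 + 1)"
      using KB by (intro mult_right_mono) (simp_all add: \<tau>_def)
    also have "\<dots> = s / 4" using KB by (simp add: field_simps)
    finally show ?thesis .
  qed
  have \<tau>2: "\<tau> * LW \<le> 1 / 2"
  proof -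
    have "\<tau> * LW \<le> \<tau> * (LW + 1)" using \<tau>0 by simp
    also have "\<dots> \<le> (1 / (2 * (LW + 1))) * (LW + 1)"
      using LW by (intro mult_right_mono) (simp_all add: \<tau>_def)
    also have "\<dots> = 1 / 2" using LW by (simp add: field_simps)
    finally show ?thesis .
  qed
  have "\<exists>\<sigma>. \<sigma> 0 = x \<and>
     (\<forall>t\<in>{0..\<tau>}. \<sigma> t \<in> M \<inter> ball u0 e \<and> (\<sigma> has_vector_derivative f (\<sigma> t)) (at t within {0..\<tau>}))"
    if x: "x \<in> M \<inter> ball u0 \<rho>" for x
  proof -
    have "x \<in> ball u0 \<rho>0" using x \<rho>(2) by auto
    then have xr: "x \<in> ball u0 r" using ub by blast
    then have xU: "x \<in> U" using ub by blast
    have u0r: "u0 \<in> ball u0 r" using ub by simp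
    have xE: "\<phi> x \<in> E" using M_iff[OF xU] x by blast
    have "norm (\<phi> x - \<phi> u0) \<le> K * norm (x - u0)" using ub xr u0r by blast
    also have "\<dots> \<le> K * \<rho>" using x K by (intro mult_left_mono) (auto simp: dist_norm norm_minus_commute)
    finally have px: "norm (\<phi> x - y0) \<le> s / 2" using \<rho>(3) by (simp add: y0_def)
    have cb: "y \<in> ball y0 s" if y: "y \<in> cball (\<phi> x) (s / 4)" for y
    proof -
      have "dist y0 y \<le> dist y0 (\<phi> x) + dist (\<phi> x) y" by (rule dist_triangle)
      also have "\<dots> \<le> s / 2 + s / 4" using y px by (intro add_mono) (auto simp: dist_norm norm_minus_commute)
      also have "\<dots> < s" using s by simp
      finally show ?thesis by simp
    qed
    have "\<exists>y. y 0 = \<phi> x \<and> (\<forall>t\<in>{0..\<tau>}. y t \<in> E \<inter> cball (\<phi> x) (s / 4) \<and>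
           (y has_vector_derivative W (y t)) (at t within {0..\<tau>}))"
    proof (rule picard_lindeloef_on_subspace[OF subspace_E closed_E xE, of "s / 4" W LW "K * B0" \<tau>])
      show "norm (W y - W z) \<le> LW * norm (y - z)" if "y \<in> E \<inter> cball (\<phi> x) (s / 4)" "z \<in> E \<inter> cball (\<phi> x) (s / 4)" for y z
        using that cb by (intro WL) blast+
      show "norm (W y) \<le> K * B0" if "y \<in> E \<inter> cball (\<phi> x) (s / 4)" for y
        using that cb by (intro WB) blast+
      show "W y \<in> E" if "y \<in> E \<inter> cball (\<phi> x) (s / 4)" for y
        using that cb by (intro WE) blast+
    qed (use s LW KB \<tau>0 \<tau>1 \<tau>2 in simp_all)
    then obtain y where y0': "y 0 = \<phi> x" and y1: "\<forall>t\<in>{0..\<tau>}. y t \<in> E \<inter> cball (\<phi> x) (s / 4) \<and>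
           (y has_vector_derivative W (y t)) (at t within {0..\<tau>})" by blast
    show ?thesis
    proof (intro exI[of _ "\<lambda>t. \<psi> (y t)"] conjI ballI)
      show "\<psi> (y 0) = x" by (simp add: y0' \<psi>\<phi>[OF xU])
      fix t assume t: "t \<in> {0..\<tau>}"
      have yt: "y t \<in> ball y0 s" "y t \<in> E" and dy: "(y has_vector_derivative W (y t)) (at t within {0..\<tau>})"
        using y1 t cb by blast+
      show "\<psi> (y t) \<in> M \<inter> ball u0 e" by (rule ME[OF yt])
      have yV: "y t \<in> V" by (rule inV(1)[OF sb(1)[OF yt(1)]])
      have "((\<lambda>t. \<psi> (y t)) has_derivative (\<lambda>h. d\<psi> (y t) (h *\<^sub>R W (y t)))) (at t within {0..\<tau>})"
        using dy d\<psi>_at[OF yV] unfolding has_vector_derivative_def by (rule has_derivative_compose)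
      moreover have "d\<psi> (y t) (W (y t)) = f (\<psi> (y t))"
        using d\<psi>_d\<phi>[OF \<psi>_U[OF yV], of "f (\<psi> (y t))"] by (simp add: W_def \<phi>\<psi>[OF yV])
      ultimately show "((\<lambda>t. \<psi> (y t)) has_vector_derivative f (\<psi> (y t))) (at t within {0..\<tau>})"
        by (simp add: has_vector_derivative_def blinfun.scaleR_right)
    qed
  qed
  then show ?thesis using \<rho>(1) \<tau>0 by blast
qed

end

section \<open>Consequences without reference to a chart\<close>

context riemannian_setting begin

lemma chart_exists:
  assumes "u \<in> M"
  shows "\<exists>U V \<phi> \<psi> E d\<phi> d\<psi> dF. u \<in> U \<and> riemannian_chart G act ip M \<Phi> U V \<phi> \<psi> E d\<phi> d\<psi> dF"
proof -
  obtain U V \<phi> \<psi> E where u: "u \<in> U" and c: "submanifold_chart M U V \<phi> \<psi> E"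
    using M_submanifold assms unfolding C11_submanifold_def by blast
  have C: "C11_on U \<phi>" "C11_on V \<psi>" "C11_on (V \<inter> E) (\<Phi> \<circ> \<psi>)"
    using c Phi_C11 unfolding C11_functional_def submanifold_chart_def by blast+
  obtain d\<phi> where d\<phi>: "\<forall>x\<in>U. (\<phi> has_derivative blinfun_apply (d\<phi> x)) (at x within U)"
    "\<forall>x\<in>U. \<exists>e>0. \<exists>L. L-lipschitz_on (ball x e \<inter> U) d\<phi>" using C(1) unfolding C11_on_def by blast
  obtain d\<psi> where d\<psi>: "\<forall>x\<in>V. (\<psi> has_derivative blinfun_apply (d\<psi> x)) (at x within V)"
    "\<forall>x\<in>V. \<exists>e>0. \<exists>L. L-lipschitz_on (ball x e \<inter> V) d\<psi>" using C(2) unfolding C11_on_def by blast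
  obtain dF where dF: "\<forall>x\<in>V \<inter> E. ((\<Phi> \<circ> \<psi>) has_derivative blinfun_apply (dF x)) (at x within V \<inter> E)"
    "\<forall>x\<in>V \<inter> E. \<exists>e>0. \<exists>L. L-lipschitz_on (ball x e \<inter> (V \<inter> E)) dF" using C(3) unfolding C11_on_def by blast
  have "riemannian_chart G act ip M \<Phi> U V \<phi> \<psi> E d\<phi> d\<psi> dF"
    by unfold_locales (use c d\<phi> d\<psi> dF in blast)+
  then show ?thesis using u by blast
qed

definition grad :: "'a \<Rightarrow> 'a" where "grad = mgrad ip M \<Phi>"

lemma grad_tangent: "u \<in> M \<Longrightarrow> grad u \<in> tangent_space M u"
  and mderiv_grad: "u \<in> M \<Longrightarrow> w \<in> tangent_space M u \<Longrightarrow> mderiv M \<Phi> u w = ip u (grad u) w"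
  and tangent_subspace: "u \<in> M \<Longrightarrow> subspace (tangent_space M u)"
proof -
  assume u: "u \<in> M"
  obtain U V \<phi> \<psi> E d\<phi> d\<psi> dF where uU: "u \<in> U" and c: "riemannian_chart G act ip M \<Phi> U V \<phi> \<psi> E d\<phi> d\<psi> dF"
    using chart_exists[OF u] by blast
  interpret c: riemannian_chart G act ip M \<Phi> U V \<phi> \<psi> E d\<phi> d\<psi> dF by (rule c)
  show "grad u \<in> tangent_space M u" "subspace (tangent_space M u)"
    unfolding grad_def by (rule c.mgrad_chart(1)[OF uU u], rule c.mgrad_chart(3)[OF uU u])
  show "w \<in> tangent_space M u \<Longrightarrow> mderiv M \<Phi> u w = ip u (grad u) w"
    unfolding grad_def by (rule c.mgrad_chart(2)[OF uU u])
qed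

lemma derivative_along_curve:
  assumes t: "t \<in> S" "\<sigma> ` S \<subseteq> M" and d: "(\<sigma> has_vector_derivative w) (at t within S)"
    and w: "w \<in> tangent_space M (\<sigma> t)"
  shows "((\<lambda>x. \<Phi> (\<sigma> x)) has_vector_derivative ip (\<sigma> t) (grad (\<sigma> t)) w) (at t within S)"
proof -
  have u: "\<sigma> t \<in> M" using t by blast
  obtain U V \<phi> \<psi> E d\<phi> d\<psi> dF where uU: "\<sigma> t \<in> U" and c: "riemannian_chart G act ip M \<Phi> U V \<phi> \<psi> E d\<phi> d\<psi> dF"
    using chart_exists[OF u] by blast
  interpret c: riemannian_chart G act ip M \<Phi> U V \<phi> \<psi> E d\<phi> d\<psi> dF by (rule c)
  show ?thesis
    using c.curve_derivative_chart(3)[OF t uU d] c.mderiv_chart[OF uU u w] mderiv_grad[OF u w] by simp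
qed

lemma conn_near:
  assumes "u \<in> M"
  shows "\<exists>\<rho>>0. \<exists>K>0. \<forall>x\<in>M \<inter> ball u \<rho>. \<forall>y\<in>M \<inter> ball u \<rho>. conn x y (K * norm (x - y))"
proof -
  obtain U V \<phi> \<psi> E d\<phi> d\<psi> dF where uU: "u \<in> U" and c: "riemannian_chart G act ip M \<Phi> U V \<phi> \<psi> E d\<phi> d\<psi> dF"
    using chart_exists[OF assms] by blast
  interpret c: riemannian_chart G act ip M \<Phi> U V \<phi> \<psi> E d\<phi> d\<psi> dF by (rule c)
  show ?thesis by (rule c.conn_near_chart[OF uU assms])
qed

lemma grad_locally_lipschitz:
  assumes "u \<in> M"
  shows "\<exists>\<rho>>0. \<exists>L>0. \<forall>x\<in>M \<inter> ball u \<rho>. \<forall>y\<in>M \<inter> ball u \<rho>. norm (grad x - grad y) \<le> L * norm (x - y)"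
proof -
  obtain U V \<phi> \<psi> E d\<phi> d\<psi> dF where uU: "u \<in> U" and c: "riemannian_chart G act ip M \<Phi> U V \<phi> \<psi> E d\<phi> d\<psi> dF"
    using chart_exists[OF assms] by blast
  interpret c: riemannian_chart G act ip M \<Phi> U V \<phi> \<psi> E d\<phi> d\<psi> dF by (rule c)
  show ?thesis unfolding grad_def by (rule c.gradient_lipschitz_chart[OF uU assms])
qed

lemma local_solution:
  fixes f :: "'a \<Rightarrow> 'a"
  assumes u0: "u0 \<in> M" and R: "R \<subseteq> M" "e > 0" "M \<inter> ball u0 e \<subseteq> R"
    and tan: "\<And>x. x \<in> R \<Longrightarrow> f x \<in> tangent_space M x"
    and L: "L \<ge> 0" "\<And>x y. x \<in> M \<inter> ball u0 e \<Longrightarrow> y \<in> M \<inter> ball u0 e \<Longrightarrow> norm (f x - f y) \<le> L * norm (x - y)"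
  shows "\<exists>\<rho>>0. \<exists>\<tau>>0. \<forall>x\<in>M \<inter> ball u0 \<rho>. \<exists>\<sigma>. \<sigma> 0 = x \<and>
     (\<forall>t\<in>{0..\<tau>}. \<sigma> t \<in> M \<inter> ball u0 e \<and> (\<sigma> has_vector_derivative f (\<sigma> t)) (at t within {0..\<tau>}))"
proof -
  obtain U V \<phi> \<psi> E d\<phi> d\<psi> dF where uU: "u0 \<in> U" and c: "riemannian_chart G act ip M \<Phi> U V \<phi> \<psi> E d\<phi> d\<psi> dF"
    using chart_exists[OF u0] by blast
  interpret c: riemannian_chart G act ip M \<Phi> U V \<phi> \<psi> E d\<phi> d\<psi> dF by (rule c)
  show ?thesis by (rule c.local_solution_chart[OF uU u0 R tan L])
qed

end

subsection \<open>The normalised gradient flow\<close>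

context riemannian_setting begin

definition gnorm :: "'a \<Rightarrow> real" where "gnorm u = nrm u (grad u)"

definition regular :: "'a set" where "regular = {u\<in>M. grad u \<noteq> 0}"

text \<open>The normalisation makes \<open>\<Phi>\<close> decrease at unit rate along solutions.\<close>

definition vel :: "'a \<Rightarrow> 'a" where "vel u = (- 1 / (gnorm u)\<^sup>2) *\<^sub>R grad u"

lemma regular_M: "u \<in> regular \<Longrightarrow> u \<in> M"
  by (simp add: regular_def)

lemma critical_point_iff: "critical_point M \<Phi> u \<longleftrightarrow> u \<in> M \<and> grad u = 0"
proof (cases "u \<in> M")
  case True
  note u0 = M_neq_0[OF True]
  show ?thesis
  proof
    assume "critical_point M \<Phi> u"
    then have "ip u (grad u) (grad u) = 0"
      using mderiv_grad[OF True grad_tangent[OF True]] grad_tangent[OF True] by (simp add: critical_point_def)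
    then show "u \<in> M \<and> grad u = 0" using ip_pos[OF u0, of "grad u"] True by force
  next
    assume "u \<in> M \<and> grad u = 0"
    then show "critical_point M \<Phi> u" using mderiv_grad[OF True] u0 by (simp add: critical_point_def)
  qed
qed (simp add: critical_point_def)

lemma gnorm_pos: "u \<in> regular \<Longrightarrow> 0 < gnorm u"
  using ip_pos[OF M_neq_0] by (simp add: regular_def gnorm_def ipnorm_def)

lemma gnorm_nonneg: "u \<in> M \<Longrightarrow> 0 \<le> gnorm u"
  by (simp add: gnorm_def nrm_nonneg M_neq_0)

lemma tendsto_grad:
  assumes X: "(X \<longlongrightarrow> u) F" "\<forall>\<^sub>F n in F. X n \<in> M" and u: "u \<in> M"
  shows "((\<lambda>n. grad (X n)) \<longlongrightarrow> grad u) F"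
proof -
  obtain \<rho> L where \<rho>: "\<rho> > 0" "L > 0" and L: "\<forall>x\<in>M \<inter> ball u \<rho>. \<forall>y\<in>M \<inter> ball u \<rho>. norm (grad x - grad y) \<le> L * norm (x - y)"
    using grad_locally_lipschitz[OF u] by blast
  have "\<forall>\<^sub>F n in F. X n \<in> ball u \<rho>" by (rule topological_tendstoD[OF X(1) open_ball]) (simp add: \<rho>)
  with X(2) have "\<forall>\<^sub>F n in F. norm (grad (X n) - grad u) \<le> L * norm (X n - u)"
  proof eventually_elim
    case (elim n)
    then have "X n \<in> M \<inter> ball u \<rho>" "u \<in> M \<inter> ball u \<rho>" using u \<rho> by simp_all
    then show ?case by (rule bspec[OF bspec[OF L]])
  qed
  moreover have "((\<lambda>n. L * norm (X n - u)) \<longlongrightarrow> L * norm (u - u)) F" by (intro tendsto_intros X(1))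
  then have "((\<lambda>n. L * norm (X n - u)) \<longlongrightarrow> 0) F" by simp
  ultimately have "((\<lambda>n. grad (X n) - grad u) \<longlongrightarrow> 0) F" by (rule Lim_null_comparison)
  then show ?thesis by (simp add: LIM_zero_iff)
qed

lemma tendsto_gnorm:
  assumes X: "(X \<longlongrightarrow> u) F" "\<forall>\<^sub>F n in F. X n \<in> M" and u: "u \<in> M"
  shows "((\<lambda>n. gnorm (X n)) \<longlongrightarrow> gnorm u) F"
  unfolding gnorm_def by (rule tendsto_nrm[OF X(1) tendsto_grad[OF assms] M_neq_0[OF u]])

lemma regular_open:
  assumes "u \<in> regular" shows "\<exists>e>0. M \<inter> ball u e \<subseteq> regular"
proof -
  have u: "u \<in> M" "grad u \<noteq> 0" using assms by (simp_all add: regular_def)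
  obtain \<rho> L where \<rho>: "\<rho> > 0" "L > 0" and L: "\<forall>x\<in>M \<inter> ball u \<rho>. \<forall>y\<in>M \<inter> ball u \<rho>. norm (grad x - grad y) \<le> L * norm (x - y)"
    using grad_locally_lipschitz[OF u(1)] by blast
  define e where "e = min \<rho> (norm (grad u) / L)"
  have "grad x \<noteq> 0" if x: "x \<in> M" "x \<in> ball u e" for x
  proof
    assume z: "grad x = 0"
    have m: "x \<in> M \<inter> ball u \<rho>" "u \<in> M \<inter> ball u \<rho>" using x u \<rho> by (simp_all add: e_def)
    have "norm (grad x - grad u) \<le> L * norm (x - u)" by (rule bspec[OF bspec[OF L m(1)] m(2)])
    also have "norm (x - u) < norm (grad u) / L" using x by (simp add: e_def dist_norm norm_minus_commute)
    then have "L * norm (x - u) < norm (grad u)" using \<rho> by (simp add: field_simps)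
    finally show False using z by simp
  qed
  then have "M \<inter> ball u e \<subseteq> regular" by (auto simp: regular_def)
  moreover have "e > 0" using \<rho> u by (simp add: e_def)
  ultimately show ?thesis by blast
qed

lemma vel_tangent: "u \<in> M \<Longrightarrow> vel u \<in> tangent_space M u"
  unfolding vel_def by (intro subspace_scale tangent_subspace grad_tangent)

lemma nrm_vel: assumes u: "u \<in> regular" shows "nrm u (vel u) = 1 / gnorm u"
proof -
  have "nrm u (vel u) = \<bar>- 1 / (gnorm u)\<^sup>2\<bar> * gnorm u"
    unfolding vel_def by (subst nrm_scaleR[OF M_neq_0[OF regular_M[OF u]]]) (simp add: gnorm_def)
  then show ?thesis using gnorm_pos[OF u] by (simp add: power2_eq_square)
qed

lemma ip_grad_vel: assumes u: "u \<in> regular" shows "ip u (grad u) (vel u) = - 1"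
proof -
  note u0 = M_neq_0[OF regular_M[OF u]]
  have "ip u (grad u) (vel u) = (- 1 / (gnorm u)\<^sup>2) * (gnorm u)\<^sup>2"
    unfolding vel_def by (subst ip_scaleR(2)[OF u0]) (simp add: gnorm_def nrm_sq[OF u0])
  then show ?thesis using gnorm_pos[OF u] by simp
qed

text \<open>Near a regular point \<open>gnorm\<close> exceeds half its value there, so
  \<open>vel\<close> is a quotient of locally Lipschitz functions with denominator bounded away from
  0.\<close>

lemma vel_locally_lipschitz:
  assumes u: "u \<in> regular"
  shows "\<exists>e>0. \<exists>L\<ge>0. M \<inter> ball u e \<subseteq> regular \<and>
     (\<forall>x\<in>M \<inter> ball u e. \<forall>y\<in>M \<inter> ball u e. norm (vel x - vel y) \<le> L * norm (x - y))"
proof -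
  have uM: "u \<in> M" using u by (rule regular_M)
  obtain r C where r: "r > 0" "C > 0" and C: "\<forall>x\<in>ball u r. x \<noteq> 0 \<and> (\<forall>v. nrm x v \<le> C * norm v \<and> norm v \<le> C * nrm x v) \<and>
     (\<forall>x'\<in>ball u r. \<forall>v w. \<bar>ip x v w - ip x' v w\<bar> \<le> C * norm (x - x') * norm v * norm w)"
    using local_metric_bounds[OF M_neq_0[OF uM]] by blast
  obtain \<rho> L where \<rho>: "\<rho> > 0" "L > 0" and L: "\<forall>x\<in>M \<inter> ball u \<rho>. \<forall>y\<in>M \<inter> ball u \<rho>. norm (grad x - grad y) \<le> L * norm (x - y)"
    using grad_locally_lipschitz[OF uM] by blast
  obtain e1 where e1: "e1 > 0" "M \<inter> ball u e1 \<subseteq> regular" using regular_open[OF u] by blast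
  define a where "a = gnorm u / 2"
  have a: "a > 0" using gnorm_pos[OF u] by (simp add: a_def)
  have "\<forall>\<^sub>F x in at u within M. gnorm x > a"
  proof (rule order_tendstoD(1)[OF tendsto_gnorm[OF tendsto_ident_at _ uM]])
    show "\<forall>\<^sub>F x in at u within M. x \<in> M" by (simp add: eventually_at_filter)
    show "a < gnorm u" using a by (simp add: a_def)
  qed
  then obtain e2 where e2: "e2 > 0" "\<forall>x\<in>M. x \<noteq> u \<and> dist x u < e2 \<longrightarrow> gnorm x > a"
    unfolding eventually_at by blast
  define e where "e = min (min r \<rho>) (min e1 e2)"
  have e: "e > 0" using r \<rho> e1 e2 by (simp add: e_def)
  define B where "B = norm (grad u) + L * e"
  have B: "B \<ge> 0" using \<rho> e by (simp add: B_def)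
  have in1: "x \<in> ball u r" "x \<in> M \<inter> ball u \<rho>" "x \<in> regular" "a < gnorm x" "norm (grad x) \<le> B" "x \<noteq> 0"
    if x: "x \<in> M \<inter> ball u e" for x
  proof -
    show "x \<in> ball u r" and x\<rho>: "x \<in> M \<inter> ball u \<rho>" using x by (auto simp: e_def)
    have "x \<in> M \<inter> ball u e1" using x by (auto simp: e_def)
    then show "x \<in> regular" using e1 by blast
    show "x \<noteq> 0" using x M_neq_0 by blast
    show "a < gnorm x"
    proof (cases "x = u")
      case True then show ?thesis using a by (simp add: a_def)
    next
      case False
      have "x \<in> M" "dist x u < e2" using x by (auto simp: e_def dist_commute)
      then show ?thesis using e2(2) False by blast
    qed
    have m: "u \<in> M \<inter> ball u \<rho>" using uM \<rho> by simp
    have "norm (grad x - grad u) \<le> L * norm (x - u)" by (rule bspec[OF bspec[OF L x\<rho>] m])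
    also have "\<dots> \<le> L * e" using x \<rho> by (intro mult_left_mono) (auto simp: dist_norm norm_minus_commute)
    finally show "norm (grad x) \<le> B" using norm_triangle_ineq2[of "grad x" "grad u"] by (simp add: B_def)
  qed
  define q where "q x = (gnorm x)\<^sup>2" for x
  have qa: "a\<^sup>2 \<le> q x" "q x > 0" if x: "x \<in> M \<inter> ball u e" for x
    using in1(4)[OF x] a by (auto simp: q_def intro!: power_mono)
  have qlip: "\<bar>q x - q y\<bar> \<le> (C * B * B + 2 * (C * C * B * L)) * norm (x - y)"
    if x: "x \<in> M \<inter> ball u e" and y: "y \<in> M \<inter> ball u e" for x y
  proof -
    have q: "q z = ip z (grad z) (grad z)" if z: "z \<in> M \<inter> ball u e" for z
      unfolding q_def gnorm_def by (rule nrm_sq[OF in1(6)[OF z]])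
    have y0: "y \<noteq> 0" by (rule in1(6)[OF y])
    have gl: "norm (grad x - grad y) \<le> L * norm (x - y)"
      by (rule bspec[OF bspec[OF L in1(2)[OF x]] in1(2)[OF y]])
    have ipb: "\<bar>ip y v w\<bar> \<le> (C * norm v) * (C * norm w)" for v w
    proof -
      have "\<bar>ip y v w\<bar> \<le> nrm y v * nrm y w" by (rule ip_cauchy_schwarz[OF y0])
      also have "\<dots> \<le> (C * norm v) * (C * norm w)"
        using bspec[OF C in1(1)[OF y]] nrm_nonneg[OF y0] r by (intro mult_mono) auto
      finally show ?thesis .
    qed
    have "\<bar>ip x (grad x) (grad x) - ip y (grad x) (grad x)\<bar> \<le> C * norm (x - y) * norm (grad x) * norm (grad x)"
      using bspec[OF bspec[OF C in1(1)[OF x], THEN conjunct2, THEN conjunct2] in1(1)[OF y]] by simp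
    also have "\<dots> \<le> C * norm (x - y) * B * B"
      using in1(5)[OF x] r B by (intro mult_mono mult_nonneg_nonneg) auto
    finally have 1: "\<bar>ip x (grad x) (grad x) - ip y (grad x) (grad x)\<bar> \<le> C * norm (x - y) * B * B" .
    have "\<bar>ip y (grad x - grad y) (grad x)\<bar> \<le> (C * norm (grad x - grad y)) * (C * norm (grad x))" by (rule ipb)
    also have "\<dots> \<le> (C * (L * norm (x - y))) * (C * B)"
      using gl in1(5)[OF x] r \<rho> B by (intro mult_mono mult_left_mono mult_nonneg_nonneg) auto
    finally have 2: "\<bar>ip y (grad x - grad y) (grad x)\<bar> \<le> (C * (L * norm (x - y))) * (C * B)" .
    have "\<bar>ip y (grad y) (grad x - grad y)\<bar> \<le> (C * norm (grad y)) * (C * norm (grad x - grad y))" by (rule ipb)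
    also have "\<dots> \<le> (C * B) * (C * (L * norm (x - y)))"
      using gl in1(5)[OF y] r \<rho> B by (intro mult_mono mult_left_mono mult_nonneg_nonneg) auto
    finally have 3: "\<bar>ip y (grad y) (grad x - grad y)\<bar> \<le> (C * B) * (C * (L * norm (x - y)))" .
    note bl = ip_bilinear[OF y0]
    have "q x - q y = (ip x (grad x) (grad x) - ip y (grad x) (grad x)) + ip y (grad x - grad y) (grad x)
        + ip y (grad y) (grad x - grad y)"
      by (simp add: q[OF x] q[OF y] bilinear_lsub[OF bl] bilinear_rsub[OF bl])
    then have "\<bar>q x - q y\<bar> \<le> C * norm (x - y) * B * B + (C * (L * norm (x - y))) * (C * B) + (C * B) * (C * (L * norm (x - y)))"
      using 1 2 3 by linarith
    also have "\<dots> = (C * B * B + 2 * (C * C * B * L)) * norm (x - y)" by (simp add: algebra_simps)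
    finally show ?thesis .
  qed
  define Q where "Q = C * B * B + 2 * (C * C * B * L)"
  have Q: "Q \<ge> 0" using r B \<rho> by (simp add: Q_def)
  define K where "K = L / a\<^sup>2 + Q * B / (a\<^sup>2 * a\<^sup>2)"
  have K: "K \<ge> 0" using \<rho> Q B by (simp add: K_def)
  have main: "norm (vel x - vel y) \<le> K * norm (x - y)" if x: "x \<in> M \<inter> ball u e" and y: "y \<in> M \<inter> ball u e" for x y
  proof -
    have gl: "norm (grad x - grad y) \<le> L * norm (x - y)"
      by (rule bspec[OF bspec[OF L in1(2)[OF x]] in1(2)[OF y]])
    have e: "vel x - vel y = (- 1 / q x) *\<^sub>R (grad x - grad y) + ((q x - q y) / (q x * q y)) *\<^sub>R grad y"
    proof -
      have c: "(q x - q y) / (q x * q y) = 1 / q y - 1 / q x"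
        using qa(2)[OF x] qa(2)[OF y] by (simp add: field_simps)
      show ?thesis unfolding c vel_def q_def[symmetric]
        by (simp add: scaleR_diff_left scaleR_diff_right)
    qed
    have a2: "a\<^sup>2 > 0" using a by simp
    have "norm ((- 1 / q x) *\<^sub>R (grad x - grad y)) = (1 / q x) * norm (grad x - grad y)" using qa(2)[OF x] by simp
    also have "\<dots> \<le> (1 / a\<^sup>2) * (L * norm (x - y))"
      using gl qa(1)[OF x] mult_pos_pos[OF qa(2)[OF x] a2] by (intro mult_mono divide_left_mono) auto
    finally have 1: "norm ((- 1 / q x) *\<^sub>R (grad x - grad y)) \<le> (1 / a\<^sup>2) * (L * norm (x - y))" .
    have "norm (((q x - q y) / (q x * q y)) *\<^sub>R grad y) = \<bar>q x - q y\<bar> / (q x * q y) * norm (grad y)"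
      using qa(2)[OF x] qa(2)[OF y] by (simp add: abs_mult)
    also have "\<dots> \<le> (Q * norm (x - y)) / (a\<^sup>2 * a\<^sup>2) * B"
      using qlip[OF x y] qa[OF x] qa[OF y] a2 in1(5)[OF y] Q
      by (intro mult_mono frac_le)
        (auto simp: Q_def[symmetric] intro: less_imp_le[OF qa(2)[OF x]] less_imp_le[OF qa(2)[OF y]])
    finally have 2: "norm (((q x - q y) / (q x * q y)) *\<^sub>R grad y) \<le> (Q * norm (x - y)) / (a\<^sup>2 * a\<^sup>2) * B" .
    have "norm (vel x - vel y) \<le> (1 / a\<^sup>2) * (L * norm (x - y)) + (Q * norm (x - y)) / (a\<^sup>2 * a\<^sup>2) * B"
      unfolding e using norm_triangle_ineq 1 2 by (meson add_mono order_trans)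
    also have "\<dots> = K * norm (x - y)" by (simp add: K_def algebra_simps)
    finally show ?thesis .
  qed
  have "M \<inter> ball u e \<subseteq> regular" using in1(3) by blast
  then show ?thesis using e K main by blast
qed

definition sol :: "(real \<Rightarrow> 'a) \<Rightarrow> real \<Rightarrow> bool" where
  "sol \<sigma> T \<longleftrightarrow> (\<forall>t\<in>{0..T}. \<sigma> t \<in> regular \<and> (\<sigma> has_vector_derivative vel (\<sigma> t)) (at t within {0..T}))"

lemma solD:
  assumes "sol \<sigma> T" "t \<in> {0..T}"
  shows "\<sigma> t \<in> regular" "(\<sigma> has_vector_derivative vel (\<sigma> t)) (at t within {0..T})"
  using assms by (simp_all add: sol_def)

lemma sol_restrict: "sol \<sigma> T \<Longrightarrow> T' \<le> T \<Longrightarrow> sol \<sigma> T'"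
proof -
  assume s: "sol \<sigma> T" and T: "T' \<le> T"
  then have sub: "{0..T'} \<subseteq> {0..T}" by auto
  show ?thesis
    unfolding sol_def
  proof (intro ballI conjI)
    fix t assume t: "t \<in> {0..T'}"
    then have tT: "t \<in> {0..T}" using sub by blast
    show "\<sigma> t \<in> regular" by (rule solD(1)[OF s tT])
    show "(\<sigma> has_vector_derivative vel (\<sigma> t)) (at t within {0..T'})"
      by (rule has_vector_derivative_within_subset[OF solD(2)[OF s tT] sub])
  qed
qed

lemma sol_continuous: "sol \<sigma> T \<Longrightarrow> continuous_on {0..T} \<sigma>"
  using vector_derivative_imp_continuous_on[of "{0..T}" \<sigma> "\<lambda>t. vel (\<sigma> t)"] by (simp add: sol_def)

lemma sol_shift_derivative:
  assumes s: "sol \<sigma> T" and t: "c + t \<in> {0..T}" and S: "\<And>x. x \<in> S \<Longrightarrow> c + x \<in> {0..T}"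
  shows "((\<lambda>x. \<sigma> (c + x)) has_vector_derivative vel (\<sigma> (c + t))) (at t within S)"
proof -
  have "((\<lambda>x. c + x) has_vector_derivative 1) (at t within S)" by (auto intro!: derivative_eq_intros)
  moreover have "(\<sigma> has_vector_derivative vel (\<sigma> (c + t))) (at (c + t) within (\<lambda>x. c + x) ` S)"
    by (rule has_vector_derivative_within_subset[OF solD(2)[OF s t]]) (use S in blast)
  ultimately have "((\<sigma> \<circ> (\<lambda>x. c + x)) has_vector_derivative 1 *\<^sub>R vel (\<sigma> (c + t))) (at t within S)"
    by (rule vector_diff_chain_within)
  then show ?thesis by (simp add: o_def)
qed

lemma sol_concat:
  assumes s1: "sol \<sigma>1 a" and s2: "sol \<sigma>2 b" and e: "\<sigma>2 0 = \<sigma>1 a" and ab: "0 \<le> a" "0 \<le> b"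
  shows "sol (\<lambda>t. if t \<in> {0..a} then \<sigma>1 t else \<sigma>2 (- a + t)) (a + b)"
  unfolding sol_def
proof (intro ballI conjI)
  fix t assume t: "t \<in> {0..a + b}"
  have U: "{0..a + b} = {0..a} \<union> {a..a + b}" using ab by auto
  show "(if t \<in> {0..a} then \<sigma>1 t else \<sigma>2 (- a + t)) \<in> regular"
    using solD(1)[OF s1, of t] solD(1)[OF s2, of "- a + t"] t by auto
  have "((\<lambda>t. if t \<in> {0..a} then \<sigma>1 t else \<sigma>2 (- a + t)) has_vector_derivative
      (if t \<in> {0..a} then vel (\<sigma>1 t) else vel (\<sigma>2 (- a + t)))) (at t within {0..a + b})"
  proof (rule has_vector_derivative_If_within_closures[OF _ U])
    show "t \<in> {0..a} \<union> {a..a + b}" using t U by simp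
    have eq: "{0..a} \<union> closure {0..a} \<inter> closure {a..a + b} = {0..a}"
      "{a..a + b} \<union> closure {0..a} \<inter> closure {a..a + b} = {a..a + b}" using ab by auto
    show "(\<sigma>1 has_vector_derivative vel (\<sigma>1 t)) (at t within {0..a} \<union> closure {0..a} \<inter> closure {a..a + b})"
      if "t \<in> {0..a} \<union> closure {0..a} \<inter> closure {a..a + b}"
      using that unfolding eq by (rule solD(2)[OF s1])
    show "((\<lambda>t. \<sigma>2 (- a + t)) has_vector_derivative vel (\<sigma>2 (- a + t)))
        (at t within {a..a + b} \<union> closure {0..a} \<inter> closure {a..a + b})"
      if "t \<in> {a..a + b} \<union> closure {0..a} \<inter> closure {a..a + b}"
      using that unfolding eq by (intro sol_shift_derivative[OF s2]) auto
    assume "t \<in> closure {0..a}" "t \<in> closure {a..a + b}"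
    then have ta: "t = a" by simp
    show "\<sigma>1 t = \<sigma>2 (- a + t)" "vel (\<sigma>1 t) = vel (\<sigma>2 (- a + t))" by (simp_all add: ta e)
  qed
  then show "((\<lambda>t. if t \<in> {0..a} then \<sigma>1 t else \<sigma>2 (- a + t)) has_vector_derivative
      vel (if t \<in> {0..a} then \<sigma>1 t else \<sigma>2 (- a + t))) (at t within {0..a + b})"
    by (simp only: if_distrib[of vel])
qed

lemma sol_Phi:
  assumes s: "sol \<sigma> T" and t: "t \<in> {0..T}" shows "\<Phi> (\<sigma> t) = \<Phi> (\<sigma> 0) - t"
proof -
  have im: "\<sigma> ` {0..T} \<subseteq> M" using solD(1)[OF s] regular_M by blast
  have d: "((\<lambda>x. \<Phi> (\<sigma> x) + x) has_vector_derivative 0) (at x within {0..T})" if x: "x \<in> {0..T}" for x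
  proof -
    have "((\<lambda>x. \<Phi> (\<sigma> x)) has_vector_derivative ip (\<sigma> x) (grad (\<sigma> x)) (vel (\<sigma> x))) (at x within {0..T})"
      by (rule derivative_along_curve[OF x im solD(2)[OF s x] vel_tangent[OF regular_M[OF solD(1)[OF s x]]]])
    then have "((\<lambda>x. \<Phi> (\<sigma> x)) has_vector_derivative - 1) (at x within {0..T})"
      by (simp add: ip_grad_vel[OF solD(1)[OF s x]])
    then have "((\<lambda>x. \<Phi> (\<sigma> x) + x) has_vector_derivative - 1 + 1) (at x within {0..T})"
      by (intro has_vector_derivative_add) (auto intro!: derivative_eq_intros)
    then show ?thesis by simp
  qed
  have "norm ((\<Phi> (\<sigma> t) + t) - (\<Phi> (\<sigma> 0) + 0)) \<le> 0 * \<bar>t - 0\<bar>"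
    by (rule vector_derivative_bound[of 0 T "\<lambda>x. \<Phi> (\<sigma> x) + x" "\<lambda>_. 0"]) (use d t in simp_all)
  then show ?thesis by simp
qed

text \<open>Over a short interval Gronwall's inequality is replaced by absorption: the maximal
  difference m satisfies \<open>m \<le> norm (D a) + m / 2\<close>.\<close>

lemma local_comparison:
  fixes \<sigma> \<zeta> :: "real \<Rightarrow> 'a"
  assumes a: "a \<le> b" and L: "L \<ge> 0" "(b - a) * L \<le> 1 / 2"
    and d1: "\<And>t. t \<in> {a..b} \<Longrightarrow> (\<sigma> has_vector_derivative f (\<sigma> t)) (at t within {a..b})"
    and d2: "\<And>t. t \<in> {a..b} \<Longrightarrow> (\<zeta> has_vector_derivative f (\<zeta> t)) (at t within {a..b})"
    and lip: "\<And>t. t \<in> {a..b} \<Longrightarrow> norm (f (\<sigma> t) - f (\<zeta> t)) \<le> L * norm (\<sigma> t - \<zeta> t)"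
    and t: "t \<in> {a..b}"
  shows "norm (\<sigma> t - \<zeta> t) \<le> 2 * norm (\<sigma> a - \<zeta> a)"
proof -
  define D where "D t = \<sigma> t - \<zeta> t" for t
  have dD: "(D has_vector_derivative f (\<sigma> t) - f (\<zeta> t)) (at t within {a..b})" if "t \<in> {a..b}" for t
    unfolding D_def by (rule has_vector_derivative_diff[OF d1[OF that] d2[OF that]])
  have "continuous_on {a..b} D" using dD by (rule vector_derivative_imp_continuous_on)
  then have "continuous_on {a..b} (\<lambda>t. norm (D t))" by (intro continuous_intros)
  then obtain t0 where t0: "t0 \<in> {a..b}" "\<forall>t\<in>{a..b}. norm (D t) \<le> norm (D t0)"
    using continuous_attains_sup[of "{a..b}" "\<lambda>t. norm (D t)"] a by (metis atLeastAtMost_iff compact_Icc empty_iff order_refl)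
  define m where "m = norm (D t0)"
  have "norm (D t0 - D a) \<le> (L * m) * \<bar>t0 - a\<bar>"
  proof (rule vector_derivative_bound[OF dD])
    fix t assume t: "t \<in> {a..b}"
    have "norm (f (\<sigma> t) - f (\<zeta> t)) \<le> L * norm (D t)" unfolding D_def by (rule lip[OF t])
    also have "\<dots> \<le> L * m" using t0(2) t L(1) unfolding m_def by (intro mult_left_mono) auto
    finally show "norm (f (\<sigma> t) - f (\<zeta> t)) \<le> L * m" .
  qed (use t0 a in auto)
  also have "\<dots> = (\<bar>t0 - a\<bar> * L) * m" by simp
  also have "\<dots> \<le> ((b - a) * L) * m" using t0(1) L(1) by (intro mult_right_mono) (auto simp: m_def)
  also have "\<dots> \<le> 1 / 2 * m" using L(2) by (intro mult_right_mono) (auto simp: m_def)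
  finally have "norm (D t0 - D a) \<le> 1 / 2 * m" .
  then have "m \<le> norm (D a) + 1 / 2 * m" using norm_triangle_ineq2[of "D t0" "D a"] by (simp add: m_def)
  then have "m \<le> 2 * norm (D a)" by simp
  then show ?thesis using t0(2) t unfolding m_def D_def by force
qed

text \<open>The uniform existence time lets a solution be restarted from a point close to a limit
  \<open>p\<close> and be carried past the time at which \<open>p\<close> would be reached.\<close>

lemma flow_box:
  assumes p: "p \<in> regular" and e: "e > 0"
  shows "\<exists>\<rho>>0. \<exists>\<tau>>0. \<forall>x\<in>M \<inter> ball p \<rho>. \<exists>\<sigma>. \<sigma> 0 = x \<and> sol \<sigma> \<tau> \<and> (\<forall>t\<in>{0..\<tau>}. \<sigma> t \<in> ball p e)"
proof -
  obtain e0 L where e0: "e0 > 0" "L \<ge> 0" "M \<inter> ball p e0 \<subseteq> regular"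
    and L: "\<forall>x\<in>M \<inter> ball p e0. \<forall>y\<in>M \<inter> ball p e0. norm (vel x - vel y) \<le> L * norm (x - y)"
    using vel_locally_lipschitz[OF p] by blast
  define e1 where "e1 = min e e0"
  have e1: "e1 > 0" "M \<inter> ball p e1 \<subseteq> regular" using e e0 by (auto simp: e1_def)
  have lip: "norm (vel x - vel y) \<le> L * norm (x - y)" if "x \<in> M \<inter> ball p e1" "y \<in> M \<inter> ball p e1" for x y
  proof -
    have "x \<in> M \<inter> ball p e0" "y \<in> M \<inter> ball p e0" using that by (auto simp: e1_def)
    then show ?thesis by (rule bspec[OF bspec[OF L]])
  qed
  have "regular \<subseteq> M" using regular_M by blast
  from local_solution[OF regular_M[OF p] this e1 vel_tangent[OF regular_M] e0(2) lip]
  obtain \<rho> \<tau> where \<rho>: "\<rho> > 0" "\<tau> > 0" and s: "\<forall>x\<in>M \<inter> ball p \<rho>. \<exists>\<sigma>. \<sigma> 0 = x \<and>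
     (\<forall>t\<in>{0..\<tau>}. \<sigma> t \<in> M \<inter> ball p e1 \<and> (\<sigma> has_vector_derivative vel (\<sigma> t)) (at t within {0..\<tau>}))" by blast
  have "\<exists>\<sigma>. \<sigma> 0 = x \<and> sol \<sigma> \<tau> \<and> (\<forall>t\<in>{0..\<tau>}. \<sigma> t \<in> ball p e)" if x: "x \<in> M \<inter> ball p \<rho>" for x
  proof -
    obtain \<sigma> where 0: "\<sigma> 0 = x" and 1: "\<forall>t\<in>{0..\<tau>}. \<sigma> t \<in> M \<inter> ball p e1 \<and> (\<sigma> has_vector_derivative vel (\<sigma> t)) (at t within {0..\<tau>})"
      using bspec[OF s x] by blast
    have "sol \<sigma> \<tau>" using 1 e1(2) unfolding sol_def by blast
    moreover have "\<sigma> t \<in> ball p e" if "t \<in> {0..\<tau>}" for t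
      using bspec[OF 1 that] by (simp add: e1_def)
    ultimately show ?thesis using 0 by blast
  qed
  then show ?thesis using \<rho> by blast
qed

end

section \<open>Uniqueness, continuous dependence and the flow\<close>

context riemannian_setting begin

lemma sol_at:
  assumes "sol \<sigma> T" "t \<in> {0..T}" "d > 0"
  shows "\<exists>e>0. \<forall>x\<in>{0..T}. \<bar>x - t\<bar> < e \<longrightarrow> norm (\<sigma> x - \<sigma> t) < d"
proof -
  have "\<exists>e>0. \<forall>x\<in>{0..T}. dist x t < e \<longrightarrow> dist (\<sigma> x) (\<sigma> t) < d"
    using sol_continuous[OF assms(1)] assms(2,3) unfolding continuous_on_iff by blast
  then show ?thesis by (simp only: dist_norm real_norm_def)
qed

lemma le_half_if_le_reciprocal: "(L::real) \<ge> 0 \<Longrightarrow> a \<le> (1 / (2 * (L + 1))) * (L + 1) \<Longrightarrow> a \<le> 1 / 2"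
proof -
  assume "L \<ge> 0" and a: "a \<le> (1 / (2 * (L + 1))) * (L + 1)"
  then have "(1 / (2 * (L + 1))) * (L + 1) = 1 / 2" by (simp add: field_simps)
  then show ?thesis using a by linarith
qed

text \<open>By bisection a property of intervals that is additive and holds for all short intervals
  around each point holds on the whole interval. The property is that equality at the left end
  implies equality at the right end.\<close>

lemma sol_unique:
  assumes s1: "sol \<sigma> T" and s2: "sol \<zeta> T" and e: "\<sigma> 0 = \<zeta> 0" and t: "t \<in> {0..T}"
  shows "\<sigma> t = \<zeta> t"
proof -
  define P where "P a b \<longleftrightarrow> (0 \<le> a \<longrightarrow> b \<le> T \<longrightarrow> \<sigma> a = \<zeta> a \<longrightarrow> \<sigma> b = \<zeta> b)" for a b
  have "P 0 t"
  proof (rule Bolzano[of 0 t P])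
    show "0 \<le> t" using t by simp
    show "P a c" if "P a b" "P b c" "a \<le> b" "b \<le> c" for a b c
      using that unfolding P_def by auto
    fix x assume x: "0 \<le> x" "x \<le> t"
    then have xT: "x \<in> {0..T}" using t by auto
    show "\<exists>d>0. \<forall>a b. a \<le> x \<and> x \<le> b \<and> b - a < d \<longrightarrow> P a b"
    proof (cases "\<sigma> x = \<zeta> x")
      case True
      obtain e0 L where e0: "e0 > 0" "L \<ge> 0" and L: "\<forall>x'\<in>M \<inter> ball (\<sigma> x) e0. \<forall>y\<in>M \<inter> ball (\<sigma> x) e0. norm (vel x' - vel y) \<le> L * norm (x' - y)"
        using vel_locally_lipschitz[OF solD(1)[OF s1 xT]] by blast
      obtain d1 where d1: "d1 > 0" "\<forall>y\<in>{0..T}. \<bar>y - x\<bar> < d1 \<longrightarrow> norm (\<sigma> y - \<sigma> x) < e0"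
        using sol_at[OF s1 xT e0(1)] by blast
      obtain d2 where d2: "d2 > 0" "\<forall>y\<in>{0..T}. \<bar>y - x\<bar> < d2 \<longrightarrow> norm (\<zeta> y - \<zeta> x) < e0"
        using sol_at[OF s2 xT e0(1)] by blast
      define d where "d = min (min d1 d2) (1 / (2 * (L + 1)))"
      have d: "d > 0" using d1 d2 e0 by (simp add: d_def)
      have "P a b" if ab: "a \<le> x" "x \<le> b" "b - a < d" for a b
        unfolding P_def
      proof (intro impI)
        assume r: "0 \<le> a" "b \<le> T" and eq: "\<sigma> a = \<zeta> a"
        have sub: "{a..b} \<subseteq> {0..T}" using r by auto
        have near: "\<sigma> y \<in> M \<inter> ball (\<sigma> x) e0" "\<zeta> y \<in> M \<inter> ball (\<sigma> x) e0" if y: "y \<in> {a..b}" for y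
        proof -
          have yT: "y \<in> {0..T}" using y sub by blast
          have "\<bar>y - x\<bar> < d" using y ab by (auto simp: abs_if)
          then have "\<bar>y - x\<bar> < d1" "\<bar>y - x\<bar> < d2" by (simp_all add: d_def)
          then have "norm (\<sigma> y - \<sigma> x) < e0" "norm (\<zeta> y - \<zeta> x) < e0" using d1(2) d2(2) yT by blast+
          moreover have "\<sigma> y \<in> M" "\<zeta> y \<in> M" using solD(1)[OF s1 yT] solD(1)[OF s2 yT] regular_M by blast+
          ultimately show "\<sigma> y \<in> M \<inter> ball (\<sigma> x) e0" "\<zeta> y \<in> M \<inter> ball (\<sigma> x) e0"
            by (simp_all add: dist_norm norm_minus_commute True)
        qed
        have "norm (\<sigma> b - \<zeta> b) \<le> 2 * norm (\<sigma> a - \<zeta> a)"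
        proof (rule local_comparison[of a b L \<sigma> vel \<zeta>])
          show "a \<le> b" "L \<ge> 0" "b \<in> {a..b}" using ab e0 by simp_all
          have "(b - a) * L \<le> (1 / (2 * (L + 1))) * (L + 1)"
            using ab e0 by (intro mult_mono) (simp_all add: d_def)
          then show "(b - a) * L \<le> 1 / 2" by (rule le_half_if_le_reciprocal[OF e0(2)])
          fix y assume y: "y \<in> {a..b}"
          then have yT: "y \<in> {0..T}" using sub by blast
          show "(\<sigma> has_vector_derivative vel (\<sigma> y)) (at y within {a..b})"
            by (rule has_vector_derivative_within_subset[OF solD(2)[OF s1 yT] sub])
          show "(\<zeta> has_vector_derivative vel (\<zeta> y)) (at y within {a..b})"
            by (rule has_vector_derivative_within_subset[OF solD(2)[OF s2 yT] sub])
          show "norm (vel (\<sigma> y) - vel (\<zeta> y)) \<le> L * norm (\<sigma> y - \<zeta> y)"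
            by (rule bspec[OF bspec[OF L near(1)[OF y]] near(2)[OF y]])
        qed
        then show "\<sigma> b = \<zeta> b" using eq by simp
      qed
      then show ?thesis using d by blast
    next
      \<comment> \<open>If the solutions differ at x, continuity makes them differ at the left end
        of every short interval around x, so the implication is vacuous.\<close>
      case False
      define d0 where "d0 = norm (\<sigma> x - \<zeta> x) / 2"
      have d0: "d0 > 0" using False by (simp add: d0_def)
      obtain d1 where d1: "d1 > 0" "\<forall>y\<in>{0..T}. \<bar>y - x\<bar> < d1 \<longrightarrow> norm (\<sigma> y - \<sigma> x) < d0"
        using sol_at[OF s1 xT d0] by blast
      obtain d2 where d2: "d2 > 0" "\<forall>y\<in>{0..T}. \<bar>y - x\<bar> < d2 \<longrightarrow> norm (\<zeta> y - \<zeta> x) < d0"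
        using sol_at[OF s2 xT d0] by blast
      have "P a b" if ab: "a \<le> x" "x \<le> b" "b - a < min d1 d2" for a b
        unfolding P_def
      proof (intro impI)
        assume r: "0 \<le> a" "b \<le> T" and eq: "\<sigma> a = \<zeta> a"
        have aT: "a \<in> {0..T}" "\<bar>a - x\<bar> < d1" "\<bar>a - x\<bar> < d2" using ab r by auto
        have "norm (\<sigma> a - \<sigma> x) < d0" "norm (\<zeta> a - \<zeta> x) < d0" using d1(2) d2(2) aT by blast+
        moreover have "norm (\<sigma> x - \<zeta> x) \<le> norm (\<sigma> a - \<sigma> x) + norm (\<zeta> a - \<zeta> x)"
          using norm_triangle_ineq4[of "\<zeta> a - \<zeta> x" "\<sigma> a - \<sigma> x"] by (simp add: eq)
        ultimately have False using d0_def by linarith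
        then show "\<sigma> b = \<zeta> b" ..
      qed
      then show ?thesis using d1(1) d2(1) by (intro exI[of _ "min d1 d2"]) simp
    qed
  qed
  then show ?thesis using t e by (simp add: P_def)
qed

definition follows :: "(real \<Rightarrow> 'a) \<Rightarrow> real \<Rightarrow> real \<Rightarrow> real \<Rightarrow> 'a \<Rightarrow> (real \<Rightarrow> 'a) \<Rightarrow> bool" where
  "follows \<sigma> a b e x \<zeta> \<longleftrightarrow> \<zeta> 0 = x \<and> sol \<zeta> (b - a) \<and> (\<forall>t\<in>{0..b - a}. norm (\<zeta> t - \<sigma> (a + t)) < e)"

text \<open>Again bisection, now for the statement that starting close at \<open>a\<close> means
  staying close up to \<open>b\<close>. Composition works because the radius required at the start
  of the second interval serves as the tolerance on the first. Existence of the neighbouring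
  solution is part of the statement and is glued along.\<close>

lemma sol_dependence:
  assumes s: "sol \<sigma> T" and T: "0 \<le> T" and e: "e > 0"
  shows "\<exists>\<delta>>0. \<forall>x\<in>M. norm (x - \<sigma> 0) < \<delta> \<longrightarrow>
     (\<exists>\<zeta>. \<zeta> 0 = x \<and> sol \<zeta> T \<and> (\<forall>t\<in>{0..T}. norm (\<zeta> t - \<sigma> t) < e))"
proof -
  define P where "P a b \<longleftrightarrow> (0 \<le> a \<longrightarrow> b \<le> T \<longrightarrow>
    (\<forall>e>0. \<exists>\<delta>>0. \<forall>x\<in>M. norm (x - \<sigma> a) < \<delta> \<longrightarrow> (\<exists>\<zeta>. follows \<sigma> a b e x \<zeta>)))" for a b
  have "P 0 T"
  proof (rule Bolzano[of 0 T P, OF T])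
    fix a b c assume P1: "P a b" and P2: "P b c" and abc: "a \<le> b" "b \<le> c"
    show "P a c"
      unfolding P_def
    proof (intro impI allI)
      fix e :: real assume r: "0 \<le> a" "c \<le> T" and e: "e > 0"
      obtain \<delta>2 where \<delta>2: "\<delta>2 > 0" "\<forall>x\<in>M. norm (x - \<sigma> b) < \<delta>2 \<longrightarrow> (\<exists>\<zeta>. follows \<sigma> b c e x \<zeta>)"
        using P2 r e abc unfolding P_def by (meson order_trans)
      have e1: "min e \<delta>2 > 0" using e \<delta>2 by simp
      obtain \<delta>1 where \<delta>1: "\<delta>1 > 0" "\<forall>x\<in>M. norm (x - \<sigma> a) < \<delta>1 \<longrightarrow> (\<exists>\<zeta>. follows \<sigma> a b (min e \<delta>2) x \<zeta>)"
        using P1 r e1 abc unfolding P_def by (meson order_trans)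
      have "\<exists>\<zeta>. follows \<sigma> a c e x \<zeta>" if x: "x \<in> M" "norm (x - \<sigma> a) < \<delta>1" for x
      proof -
        obtain \<zeta>1 where \<zeta>1: "follows \<sigma> a b (min e \<delta>2) x \<zeta>1" using \<delta>1(2) x by blast
        note z1 = \<zeta>1[unfolded follows_def]
        define y where "y = \<zeta>1 (b - a)"
        have ba: "b - a \<in> {0..b - a}" using abc by simp
        have "norm (y - \<sigma> (a + (b - a))) < min e \<delta>2" using z1 ba unfolding y_def by blast
        then have "norm (y - \<sigma> b) < \<delta>2" by simp
        moreover have "y \<in> M" unfolding y_def using z1 solD(1)[OF _ ba] regular_M by blast
        ultimately obtain \<zeta>2 where \<zeta>2: "follows \<sigma> b c e y \<zeta>2" using \<delta>2(2) by blast
        note z2 = \<zeta>2[unfolded follows_def]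
        define \<zeta> where "\<zeta> t = (if t \<in> {0..b - a} then \<zeta>1 t else \<zeta>2 (- (b - a) + t))" for t
        have "sol \<zeta> ((b - a) + (c - b))"
          unfolding \<zeta>_def[abs_def] using z1 z2 abc by (intro sol_concat) (simp_all add: y_def)
        then have "sol \<zeta> (c - a)" by simp
        moreover have "\<zeta> 0 = x" using z1 abc by (simp add: \<zeta>_def)
        moreover have "norm (\<zeta> t - \<sigma> (a + t)) < e" if t: "t \<in> {0..c - a}" for t
        proof (cases "t \<in> {0..b - a}")
          case True
          then have "norm (\<zeta>1 t - \<sigma> (a + t)) < min e \<delta>2" using z1 by blast
          then show ?thesis using True by (simp add: \<zeta>_def)
        next
          case False
          then have t2: "- (b - a) + t \<in> {0..c - b}" using t by auto
          then have "norm (\<zeta>2 (- (b - a) + t) - \<sigma> (b + (- (b - a) + t))) < e" using z2 by blast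
          moreover have "b + (- (b - a) + t) = a + t" by simp
          moreover have "\<zeta> t = \<zeta>2 (- (b - a) + t)" using False unfolding \<zeta>_def by (rule if_not_P)
          ultimately show ?thesis by (simp only:)
        qed
        ultimately have "follows \<sigma> a c e x \<zeta>" unfolding follows_def by blast
        then show ?thesis by blast
      qed
      then show "\<exists>\<delta>>0. \<forall>x\<in>M. norm (x - \<sigma> a) < \<delta> \<longrightarrow> (\<exists>\<zeta>. follows \<sigma> a c e x \<zeta>)"
        using \<delta>1(1) by blast
    qed
  next
    fix s0 assume s0: "0 \<le> s0" "s0 \<le> T"
    then have sT: "s0 \<in> {0..T}" by simp
    define p where "p = \<sigma> s0"
    have p: "p \<in> regular" unfolding p_def by (rule solD(1)[OF s sT])
    obtain e0 L where e0: "e0 > 0" "L \<ge> 0" and L: "\<forall>x\<in>M \<inter> ball p e0. \<forall>y\<in>M \<inter> ball p e0. norm (vel x - vel y) \<le> L * norm (x - y)"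
      using vel_locally_lipschitz[OF p] by blast
    obtain \<rho> \<tau> where \<rho>: "\<rho> > 0" "\<tau> > 0" and box: "\<forall>x\<in>M \<inter> ball p \<rho>. \<exists>\<zeta>. \<zeta> 0 = x \<and> sol \<zeta> \<tau> \<and> (\<forall>t\<in>{0..\<tau>}. \<zeta> t \<in> ball p e0)"
      using flow_box[OF p e0(1)] by blast
    have "min e0 (\<rho> / 2) > 0" using e0 \<rho> by simp
    then obtain d0 where d0: "d0 > 0" "\<forall>y\<in>{0..T}. \<bar>y - s0\<bar> < d0 \<longrightarrow> norm (\<sigma> y - \<sigma> s0) < min e0 (\<rho> / 2)"
      using sol_at[OF s sT] by blast
    define d where "d = min (min d0 \<tau>) (1 / (2 * (L + 1)))"
    have d: "d > 0" using d0 \<rho> e0 by (simp add: d_def)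
    have "P a b" if ab: "a \<le> s0" "s0 \<le> b" "b - a < d" for a b
      unfolding P_def
    proof (intro impI allI)
      fix e :: real assume r: "0 \<le> a" "b \<le> T" and e: "e > 0"
      have near: "norm (\<sigma> y - p) < min e0 (\<rho> / 2)" if y: "y \<in> {a..b}" for y
      proof -
        have "y \<in> {0..T}" "\<bar>y - s0\<bar> < d0" using y ab r by (auto simp: d_def abs_if)
        then show ?thesis using d0(2) by (simp add: p_def)
      qed
      define \<delta> where "\<delta> = min (\<rho> / 2) (e / 2)"
      have "\<exists>\<zeta>. follows \<sigma> a b e x \<zeta>" if x: "x \<in> M" "norm (x - \<sigma> a) < \<delta>" for x
      proof -
        have "norm (x - p) \<le> norm (x - \<sigma> a) + norm (\<sigma> a - p)" using norm_triangle_ineq[of "x - \<sigma> a" "\<sigma> a - p"] by simp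
        also have "\<dots> < \<rho> / 2 + \<rho> / 2" using x(2) near[of a] ab by (intro add_strict_mono) (simp_all add: \<delta>_def)
        finally have "x \<in> M \<inter> ball p \<rho>" using x(1) by (simp add: dist_norm norm_minus_commute)
        then obtain \<zeta> where \<zeta>: "\<zeta> 0 = x" "sol \<zeta> \<tau>" "\<forall>t\<in>{0..\<tau>}. \<zeta> t \<in> ball p e0" using box by blast
        have ba: "b - a \<le> \<tau>" "0 \<le> b - a" using ab by (simp_all add: d_def)
        have sz: "sol \<zeta> (b - a)" by (rule sol_restrict[OF \<zeta>(2) ba(1)])
        have "norm (\<zeta> t - \<sigma> (a + t)) < e" if t: "t \<in> {0..b - a}" for t
        proof -
          have "norm (\<zeta> t - \<sigma> (a + t)) \<le> 2 * norm (\<zeta> 0 - \<sigma> (a + 0))"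
          proof (rule local_comparison[of 0 "b - a" L \<zeta> vel "\<lambda>t. \<sigma> (a + t)"])
            have "((b - a) - 0) * L \<le> (1 / (2 * (L + 1))) * (L + 1)"
              using ab e0 by (intro mult_mono) (simp_all add: d_def)
            then show "((b - a) - 0) * L \<le> 1 / 2" by (rule le_half_if_le_reciprocal[OF e0(2)])
            fix y assume y: "y \<in> {0..b - a}"
            show "(\<zeta> has_vector_derivative vel (\<zeta> y)) (at y within {0..b - a})" by (rule solD(2)[OF sz y])
            show "((\<lambda>t. \<sigma> (a + t)) has_vector_derivative vel (\<sigma> (a + y))) (at y within {0..b - a})"
              using y r by (intro sol_shift_derivative[OF s]) auto
            have "y \<in> {0..\<tau>}" using y ba by auto
            then have m1: "\<zeta> y \<in> M \<inter> ball p e0" using \<zeta>(3) regular_M[OF solD(1)[OF sz y]] by blast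
            have ay: "a + y \<in> {a..b}" "a + y \<in> {0..T}" using y r by auto
            have m2: "\<sigma> (a + y) \<in> M \<inter> ball p e0"
              using near[OF ay(1)] regular_M[OF solD(1)[OF s ay(2)]] by (simp add: dist_norm norm_minus_commute)
            show "norm (vel (\<zeta> y) - vel (\<sigma> (a + y))) \<le> L * norm (\<zeta> y - \<sigma> (a + y))"
              by (rule bspec[OF bspec[OF L m1] m2])
          qed (use t ba e0 in simp_all)
          also have "\<dots> < e" using x(2) \<zeta>(1) by (simp add: \<delta>_def)
          finally show ?thesis .
        qed
        then have "follows \<sigma> a b e x \<zeta>" using \<zeta>(1) sz by (simp add: follows_def)
        then show ?thesis by blast
      qed
      moreover have "\<delta> > 0" using \<rho> e by (simp add: \<delta>_def)
      ultimately show "\<exists>\<delta>>0. \<forall>x\<in>M. norm (x - \<sigma> a) < \<delta> \<longrightarrow> (\<exists>\<zeta>. follows \<sigma> a b e x \<zeta>)" by blast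
    qed
    then show "\<exists>d>0. \<forall>a b. a \<le> s0 \<and> s0 \<le> b \<and> b - a < d \<longrightarrow> P a b" using d by blast
  qed
  then obtain \<delta> where \<delta>: "\<delta> > 0" "\<forall>x\<in>M. norm (x - \<sigma> 0) < \<delta> \<longrightarrow> (\<exists>\<zeta>. follows \<sigma> 0 T e x \<zeta>)"
    using e unfolding P_def by blast
  show ?thesis
  proof (intro exI[of _ \<delta>] conjI ballI impI \<delta>(1))
    fix x assume x: "x \<in> M" "norm (x - \<sigma> 0) < \<delta>"
    have "\<exists>\<zeta>. follows \<sigma> 0 T e x \<zeta>" by (rule \<delta>(2)[rule_format, OF x])
    then obtain \<zeta> where "follows \<sigma> 0 T e x \<zeta>" by blast
    then have "\<zeta> 0 = x \<and> sol \<zeta> T \<and> (\<forall>t\<in>{0..T}. norm (\<zeta> t - \<sigma> t) < e)"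
      unfolding follows_def by simp
    then show "\<exists>\<zeta>. \<zeta> 0 = x \<and> sol \<zeta> T \<and> (\<forall>t\<in>{0..T}. norm (\<zeta> t - \<sigma> t) < e)" by blast
  qed
qed

text \<open>The value x for \<open>t \<le> 0\<close> does not depend on x being regular. This
  matters for points at or below the bottom level, which may be critical and have to stay
  fixed.\<close>

definition flow :: "real \<Rightarrow> 'a \<Rightarrow> 'a" where
  "flow t x = (if t \<le> 0 then x else (SOME \<sigma>. sol \<sigma> t \<and> \<sigma> 0 = x) t)"

definition flows :: "real \<Rightarrow> 'a \<Rightarrow> bool" where
  "flows t x \<longleftrightarrow> (\<exists>\<sigma>. sol \<sigma> t \<and> \<sigma> 0 = x)"

lemma flow_eq:
  assumes s: "sol \<sigma> T" "\<sigma> 0 = x" and t: "t \<in> {0..T}" shows "flow t x = \<sigma> t"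
proof (cases "t \<le> 0")
  case True
  then show ?thesis using s t by (simp add: flow_def)
next
  case False
  have st: "sol \<sigma> t" by (rule sol_restrict[OF s(1)]) (use t in simp)
  define \<zeta> where "\<zeta> = (SOME \<zeta>. sol \<zeta> t \<and> \<zeta> 0 = x)"
  have "\<exists>\<zeta>. sol \<zeta> t \<and> \<zeta> 0 = x" using st s(2) by blast
  from someI_ex[OF this] have z: "sol \<zeta> t" "\<zeta> 0 = x" unfolding \<zeta>_def by simp_all
  have "\<zeta> 0 = \<sigma> 0" "t \<in> {0..t}" using z(2) s(2) False by simp_all
  then have "\<zeta> t = \<sigma> t" by (rule sol_unique[OF z(1) st])
  then show ?thesis using False by (simp add: flow_def \<zeta>_def)
qed

lemma flow_0 [simp]: "flow 0 x = x"
  by (simp add: flow_def)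

lemma flows_extend:
  assumes s: "sol \<sigma> T" and T: "0 \<le> T"
  shows "\<exists>\<tau>>0. \<exists>\<zeta>. \<zeta> 0 = \<sigma> 0 \<and> sol \<zeta> (T + \<tau>)"
proof -
  have p: "\<sigma> T \<in> regular" using T by (intro solD(1)[OF s]) simp
  obtain \<rho> \<tau> where \<rho>: "\<rho> > 0" "\<tau> > 0" and box: "\<forall>x\<in>M \<inter> ball (\<sigma> T) \<rho>. \<exists>\<zeta>. \<zeta> 0 = x \<and> sol \<zeta> \<tau> \<and> (\<forall>t\<in>{0..\<tau>}. \<zeta> t \<in> ball (\<sigma> T) 1)"
    using flow_box[OF p zero_less_one] by blast
  have "\<sigma> T \<in> M \<inter> ball (\<sigma> T) \<rho>" using \<rho> regular_M[OF p] by simp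
  then obtain \<zeta>2 where z: "\<zeta>2 0 = \<sigma> T" "sol \<zeta>2 \<tau>" using box by blast
  have "sol (\<lambda>t. if t \<in> {0..T} then \<sigma> t else \<zeta>2 (- T + t)) (T + \<tau>)"
    by (rule sol_concat[OF s z(2,1) T]) (use \<rho> in simp)
  then show ?thesis using \<rho>(2) T
    by (intro exI[of _ \<tau>] conjI exI[of _ "\<lambda>t. if t \<in> {0..T} then \<sigma> t else \<zeta>2 (- T + t)"]) simp_all
qed

lemma tendsto_flow:
  assumes fl: "flows t0 x0" "0 \<le> t0" and t: "(t \<longlongrightarrow> t0) F" "\<forall>\<^sub>F n in F. 0 \<le> t n"
    and X: "(X \<longlongrightarrow> x0) F" "\<forall>\<^sub>F n in F. X n \<in> M"
  shows "((\<lambda>n. flow (t n) (X n)) \<longlongrightarrow> flow t0 x0) F"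
proof -
  obtain \<sigma>0 where s0: "sol \<sigma>0 t0" "\<sigma>0 0 = x0" using fl(1) unfolding flows_def by blast
  \<comment> \<open>The solution is prolonged beyond \<open>t0\<close>, because the times
    \<open>t n\<close> may exceed \<open>t0\<close>.\<close>
  obtain \<tau> \<sigma> where \<tau>: "\<tau> > 0" "\<sigma> 0 = \<sigma>0 0" and s: "sol \<sigma> (t0 + \<tau>)"
    using flows_extend[OF s0(1) fl(2)] by blast
  define T where "T = t0 + \<tau>"
  have T: "0 \<le> T" "t0 \<in> {0..T}" "t0 < T" using \<tau> fl(2) by (simp_all add: T_def)
  have sT: "sol \<sigma> T" "\<sigma> 0 = x0" using s s0 \<tau> by (simp_all add: T_def)
  have f0: "flow t0 x0 = \<sigma> t0" by (rule flow_eq[OF sT T(2)])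
  show ?thesis
    unfolding f0
  proof (rule tendstoI)
    fix e :: real assume "e > 0"
    then have e2: "e / 2 > 0" by simp
    obtain \<delta> where \<delta>: "\<delta> > 0" "\<forall>x\<in>M. norm (x - \<sigma> 0) < \<delta> \<longrightarrow>
     (\<exists>\<zeta>. \<zeta> 0 = x \<and> sol \<zeta> T \<and> (\<forall>t\<in>{0..T}. norm (\<zeta> t - \<sigma> t) < e / 2))"
      using sol_dependence[OF sT(1) T(1) e2] by blast
    obtain d where d: "d > 0" "\<forall>y\<in>{0..T}. \<bar>y - t0\<bar> < d \<longrightarrow> norm (\<sigma> y - \<sigma> t0) < e / 2"
      using sol_at[OF sT(1) T(2) e2] by blast
    have "\<forall>\<^sub>F n in F. dist (X n) x0 < \<delta>" by (rule tendstoD[OF X(1) \<delta>(1)])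
    moreover have "\<forall>\<^sub>F n in F. dist (t n) t0 < d" by (rule tendstoD[OF t(1) d(1)])
    moreover have "\<forall>\<^sub>F n in F. t n < T" by (rule order_tendstoD(2)[OF t(1) T(3)])
    ultimately show "\<forall>\<^sub>F n in F. dist (flow (t n) (X n)) (\<sigma> t0) < e"
      using t(2) X(2)
    proof eventually_elim
      case (elim n)
      have "norm (X n - \<sigma> 0) < \<delta>" using elim(1) sT(2) by (simp add: dist_norm)
      then obtain \<zeta> where z: "\<zeta> 0 = X n" "sol \<zeta> T" "\<forall>t\<in>{0..T}. norm (\<zeta> t - \<sigma> t) < e / 2"
        using \<delta>(2) elim(5) by blast
      have tn: "t n \<in> {0..T}" using elim by simp
      have "flow (t n) (X n) = \<zeta> (t n)" by (rule flow_eq[OF z(2,1) tn])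
      moreover have "norm (\<zeta> (t n) - \<sigma> (t n)) < e / 2" using z(3) tn by blast
      moreover have "norm (\<sigma> (t n) - \<sigma> t0) < e / 2" using d(2) tn elim(2) by (simp add: dist_real_def)
      ultimately show ?case
        using norm_triangle_ineq[of "\<zeta> (t n) - \<sigma> (t n)" "\<sigma> (t n) - \<sigma> t0"] by (simp add: dist_norm)
    qed
  qed
qed

end

subsection \<open>Compactness modulo the group at a level\<close>

context riemannian_chart begin

lemma tendsto_Phi_chart:
  assumes u: "u \<in> U" "u \<in> M" and X: "(X \<longlongrightarrow> u) F" "\<forall>\<^sub>F n in F. X n \<in> M"
  shows "((\<lambda>n. \<Phi> (X n)) \<longlongrightarrow> \<Phi> u) F"
proof -
  have y: "\<phi> u \<in> V \<inter> E" using u \<phi>_V M_iff by blast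
  have c: "continuous_on (V \<inter> E) (\<Phi> \<circ> \<psi>)"
    unfolding continuous_on_eq_continuous_within
    using dF has_derivative_continuous by blast
  have UX: "\<forall>\<^sub>F n in F. X n \<in> U" by (rule topological_tendstoD[OF X(1) open_U u(1)])
  have "((\<lambda>n. \<phi> (X n)) \<longlongrightarrow> \<phi> u) F"
    by (rule continuous_on_tendsto_compose[OF cont_\<phi> X(1) u(1) UX])
  moreover have "\<forall>\<^sub>F n in F. \<phi> (X n) \<in> V \<inter> E"
    using UX X(2) by eventually_elim (use \<phi>_V M_iff in blast)
  ultimately have "((\<lambda>n. (\<Phi> \<circ> \<psi>) (\<phi> (X n))) \<longlongrightarrow> (\<Phi> \<circ> \<psi>) (\<phi> u)) F"
    using y by (intro continuous_on_tendsto_compose[OF c])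
  moreover have "\<forall>\<^sub>F n in F. (\<Phi> \<circ> \<psi>) (\<phi> (X n)) = \<Phi> (X n)"
    using UX by eventually_elim (simp add: \<psi>\<phi>)
  ultimately show ?thesis by (simp add: tendsto_cong \<psi>\<phi>[OF u(1)])
qed

end

context riemannian_setting begin

lemma tendsto_Phi:
  assumes u: "u \<in> M" and X: "(X \<longlongrightarrow> u) F" "\<forall>\<^sub>F n in F. X n \<in> M"
  shows "((\<lambda>n. \<Phi> (X n)) \<longlongrightarrow> \<Phi> u) F"
proof -
  obtain U V \<phi> \<psi> E d\<phi> d\<psi> dF where uU: "u \<in> U" and c: "riemannian_chart G act ip M \<Phi> U V \<phi> \<psi> E d\<phi> d\<psi> dF"
    using chart_exists[OF u] by blast
  interpret c: riemannian_chart G act ip M \<Phi> U V \<phi> \<psi> E d\<phi> d\<psi> dF by (rule c)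
  show ?thesis by (rule c.tendsto_Phi_chart[OF uU u X])
qed

text \<open>No scalar product enters the conclusion, so the lemma applies to the reflection as well
  as to the group elements.\<close>

lemma tangent_map:
  assumes B: "bounded_linear B" "\<And>x. x \<in> M \<Longrightarrow> B x \<in> M" "\<And>x. x \<in> M \<Longrightarrow> \<Phi> (B x) = \<Phi> x"
    and u: "u \<in> M" and w: "w \<in> tangent_space M u"
  shows "B w \<in> tangent_space M (B u)" and "mderiv M \<Phi> (B u) (B w) = mderiv M \<Phi> u w"
proof -
  obtain \<sigma> where c: "curve_through M u w \<sigma>" using w unfolding tangent_space_def by blast
  then have c0: "\<sigma> 0 = u" and d0: "(\<sigma> has_vector_derivative w) (at 0)" by (simp_all add: curve_through_def)
  obtain e where e: "e > 0" "\<sigma> ` {-e<..<e} \<subseteq> M" "\<sigma> C1_differentiable_on {-e<..<e}"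
    using c unfolding curve_through_def by blast
  obtain D where D: "\<forall>x\<in>{-e<..<e}. (\<sigma> has_vector_derivative D x) (at x)" "continuous_on {-e<..<e} D"
    using e(3) unfolding C1_differentiable_on_def by blast
  have d0B: "((\<lambda>t. B (\<sigma> t)) has_vector_derivative B w) (at 0)"
    by (rule bounded_linear.has_vector_derivative[OF B(1) d0])
  have "curve_through M (B u) (B w) (\<lambda>t. B (\<sigma> t))"
    unfolding curve_through_def
  proof (intro conjI exI[of _ e])
    show "B (\<sigma> 0) = B u" by (simp add: c0)
    show "((\<lambda>t. B (\<sigma> t)) has_vector_derivative B w) (at 0)" by (rule d0B)
    show "e > 0" by (rule e)
    show "(\<lambda>t. B (\<sigma> t)) ` {-e<..<e} \<subseteq> M" using e(2) B(2) by blast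
    show "(\<lambda>t. B (\<sigma> t)) C1_differentiable_on {-e<..<e}"
      unfolding C1_differentiable_on_def
    proof (intro exI[of _ "\<lambda>x. B (D x)"] conjI ballI)
      show "((\<lambda>t. B (\<sigma> t)) has_vector_derivative B (D x)) (at x)" if "x \<in> {-e<..<e}" for x
        by (rule bounded_linear.has_vector_derivative[OF B(1)]) (use D(1) that in blast)
      show "continuous_on {-e<..<e} (\<lambda>x. B (D x))"
        by (rule bounded_linear.continuous_on[OF B(1) D(2)])
    qed
  qed
  then show BT: "B w \<in> tangent_space M (B u)" unfolding tangent_space_def by blast
  have z: "(0::real) \<in> {-e<..<e}" using e by simp
  have at: "at 0 within {-e<..<e} = at (0::real)" using z by (intro at_within_open) auto
  have 1: "((\<lambda>x. \<Phi> (\<sigma> x)) has_vector_derivative ip u (grad u) w) (at 0)"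
    using derivative_along_curve[OF z e(2), of w] d0 w by (simp add: at c0)
  have im: "(\<lambda>t. B (\<sigma> t)) ` {-e<..<e} \<subseteq> M" using e(2) B(2) by blast
  have 2: "((\<lambda>x. \<Phi> (B (\<sigma> x))) has_vector_derivative ip (B u) (grad (B u)) (B w)) (at 0)"
    using derivative_along_curve[OF z im, of "B w"] d0B BT by (simp add: at c0)
  have o: "open {-e<..<e}" by simp
  have "((\<lambda>x. \<Phi> (\<sigma> x)) has_vector_derivative ip (B u) (grad (B u)) (B w)) (at 0)"
    by (rule has_vector_derivative_transform_within_open[OF 2 o z]) (use B(3) e(2) in blast)
  then have "ip (B u) (grad (B u)) (B w) = ip u (grad u) w"
    using 1 by (rule vector_derivative_unique_at)
  then show "mderiv M \<Phi> (B u) (B w) = mderiv M \<Phi> u w"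
    using mderiv_grad[OF u w] mderiv_grad[OF B(2)[OF u] BT] by simp
qed

lemma grad_unique:
  assumes u: "u \<in> M" and v: "v \<in> tangent_space M u" "\<And>w. w \<in> tangent_space M u \<Longrightarrow> mderiv M \<Phi> u w = ip u v w"
  shows "grad u = v"
proof -
  have u0: "u \<noteq> 0" by (rule M_neq_0[OF u])
  have t: "v - grad u \<in> tangent_space M u" using v(1) grad_tangent[OF u] tangent_subspace[OF u] by (simp add: subspace_diff)
  have "ip u v (v - grad u) = ip u (grad u) (v - grad u)"
    using v(2)[OF t] mderiv_grad[OF u t] by simp
  then have "ip u (v - grad u) (v - grad u) = 0" using bilinear_lsub[OF ip_bilinear[OF u0]] by simp
  then show ?thesis using ip_pos[OF u0, of "v - grad u"] by force
qed

lemma grad_act: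
  assumes g: "g \<in> carrier G" and u: "u \<in> M" shows "grad (act g u) = act g (grad u)"
proof (rule grad_unique[OF M_invariant[OF g u]])
  let ?h = "inv\<^bsub>G\<^esub> g"
  have h: "?h \<in> carrier G" using G_group g by (simp add: group.inv_closed)
  note map = tangent_map[OF act_bounded_linear M_invariant Phi_invariant]
  show "act g (grad u) \<in> tangent_space M (act g u)"
    by (rule map(1)[OF g g _ g _ u grad_tangent[OF u]])
  fix w assume w: "w \<in> tangent_space M (act g u)"
  define w' where "w' = act ?h w"
  have "w' \<in> tangent_space M (act ?h (act g u))"
    unfolding w'_def by (rule map(1)[OF h h _ h _ M_invariant[OF g u] w])
  then have w': "w' \<in> tangent_space M u" by (simp add: act_inv[OF g])
  have e: "act g w' = w" unfolding w'_def by (rule act_inv'[OF g])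
  have "mderiv M \<Phi> (act g u) (act g w') = mderiv M \<Phi> u w'"
    by (rule map(2)[OF g g _ g _ u w'])
  also have "\<dots> = ip u (grad u) w'" by (rule mderiv_grad[OF u w'])
  also have "\<dots> = ip (act g u) (act g (grad u)) (act g w')" by (rule ip_act[symmetric, OF g M_neq_0[OF u]])
  finally show "mderiv M \<Phi> (act g u) w = ip (act g u) (act g (grad u)) w" by (simp add: e)
qed

lemma gnorm_act: "g \<in> carrier G \<Longrightarrow> u \<in> M \<Longrightarrow> gnorm (act g u) = gnorm u"
  by (simp add: gnorm_def grad_act nrm_act M_neq_0)

text \<open>The gradients at u and -u belong to unrelated scalar products and need not correspond,
  but the derivatives of \<open>\<Phi>\<close> do; hence vanishing at u passes to -u.\<close>

lemma grad_uminus_0: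
  assumes u: "u \<in> M" and z: "grad u = 0" shows "grad (- u) = 0"
proof -
  have bl: "bounded_linear (uminus :: 'a \<Rightarrow> 'a)" by (rule bounded_linear_minus[OF bounded_linear_ident])
  note mu = M_uminus[OF u]
  have t: "- grad (- u) \<in> tangent_space M (- (- u))"
    by (rule tangent_map(1)[OF bl M_uminus Phi_even mu grad_tangent[OF mu]])
  have "mderiv M \<Phi> (- (- u)) (- grad (- u)) = mderiv M \<Phi> (- u) (grad (- u))"
    by (rule tangent_map(2)[OF bl M_uminus Phi_even mu grad_tangent[OF mu]])
  then have "ip u (grad u) (- grad (- u)) = ip (- u) (grad (- u)) (grad (- u))"
    using mderiv_grad[OF u] t mderiv_grad[OF mu grad_tangent[OF mu]] by simp
  then have "ip (- u) (grad (- u)) (grad (- u)) = 0" using z M_neq_0[OF u] by simp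
  then show ?thesis using ip_pos[OF M_neq_0[OF mu], of "grad (- u)"] by force
qed

end

section \<open>Sequences that converge modulo the group\<close>

locale cerami_level = riemannian_setting G act ip M \<Phi>
  for G :: "('g, 'm) monoid_scheme" and act :: "'g \<Rightarrow> 'a::{real_inner,complete_space} \<Rightarrow> 'a"
    and ip M \<Phi> +
  fixes c :: real
  assumes NCG: "cond_NCG G act ip M \<Phi> c"
    and Gstar: "cond_Gstar G act"
    and free: "\<And>u g. u \<in> critical_set M \<Phi> c \<Longrightarrow> g \<in> carrier G \<Longrightarrow> act g u \<noteq> - u"
begin

interpretation grp: group G by (rule G_group)

definition K :: "'a set" where "K = {u\<in>M. grad u = 0 \<and> \<Phi> u = c}"

lemma critical_set_eq: "critical_set M \<Phi> c = K"
  by (auto simp: critical_set_def K_def critical_point_iff)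

lemma K_M: "u \<in> K \<Longrightarrow> u \<in> M" by (simp add: K_def)

lemma K_act: "g \<in> carrier G \<Longrightarrow> u \<in> K \<Longrightarrow> act g u \<in> K"
  by (simp add: K_def M_invariant grad_act act_zero Phi_invariant)

lemma K_uminus: "u \<in> K \<Longrightarrow> - u \<in> K"
  by (simp add: K_def M_uminus grad_uminus_0 Phi_even)

text \<open>Since \<open>1 + N \<ge> 1\<close>, the gradient norms themselves tend to 0. They and
  \<open>\<Phi>\<close> are constant on orbits, so both limits can be read off the translated
  sequence and the limit is critical at level c.\<close>

lemma cerami_sequence:
  assumes X: "\<And>n. X n \<in> M" and \<Phi>: "(\<lambda>n. \<Phi> (X n)) \<longlonglongrightarrow> c"
    and z: "(\<lambda>n. gnorm (X n) * (1 + Nr (X n))) \<longlonglongrightarrow> 0"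
  shows "\<exists>(r::nat\<Rightarrow>nat) g. \<exists>u\<in>K. strict_mono r \<and> (\<forall>n. g n \<in> carrier G) \<and> (\<lambda>n. act (g n) (X (r n))) \<longlonglongrightarrow> u"
proof -
  have "ereal (ipnorm ip (X n) (mgrad ip M \<Phi> (X n))) * (1 + Nfun ip M (X n)) = ereal (gnorm (X n) * (1 + Nr (X n)))" for n
    by (simp add: Nfun_eq[OF X] gnorm_def grad_def one_ereal_def)
  then have "(\<lambda>n. ereal (ipnorm ip (X n) (mgrad ip M \<Phi> (X n))) * (1 + Nfun ip M (X n))) \<longlonglongrightarrow> 0"
    using z by (simp add: zero_ereal_def)
  then obtain r g u where u: "u \<in> M" "strict_mono (r :: nat \<Rightarrow> nat)" "\<forall>n. g n \<in> carrier G"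
    "(\<lambda>n. act (g n) (X (r n))) \<longlonglongrightarrow> u"
    using NCG X \<Phi> unfolding cond_NCG_def by blast
  have YM: "act (g n) (X (r n)) \<in> M" for n using M_invariant u(3) X by blast
  have ev: "\<forall>\<^sub>F n in sequentially. act (g n) (X (r n)) \<in> M" using YM by simp
  have "(\<lambda>n. gnorm (X n)) \<longlonglongrightarrow> 0"
  proof (rule Lim_null_comparison[OF _ z])
    have "norm (gnorm (X n)) \<le> gnorm (X n) * (1 + Nr (X n))" for n
    proof -
      have "gnorm (X n) * 1 \<le> gnorm (X n) * (1 + Nr (X n))"
        using gnorm_nonneg[OF X] Nr_nonneg[OF X] by (intro mult_left_mono) simp_all
      then show ?thesis using gnorm_nonneg[OF X] by simp
    qed
    then show "\<forall>\<^sub>F n in sequentially. norm (gnorm (X n)) \<le> gnorm (X n) * (1 + Nr (X n))" by simp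
  qed
  then have "(\<lambda>n. gnorm (X (r n))) \<longlonglongrightarrow> 0" using LIMSEQ_subseq_LIMSEQ[OF _ u(2)] by (simp add: o_def)
  moreover have "gnorm (act (g n) (X (r n))) = gnorm (X (r n))" for n using gnorm_act u(3) X by blast
  ultimately have "(\<lambda>n. gnorm (act (g n) (X (r n)))) \<longlonglongrightarrow> 0" by simp
  then have "gnorm u = 0" using tendsto_gnorm[OF u(4) ev u(1)] LIMSEQ_unique by blast
  then have g0: "grad u = 0" using gnorm_pos[of u] u(1) by (force simp: regular_def)
  have "(\<lambda>n. \<Phi> (X (r n))) \<longlonglongrightarrow> c" using LIMSEQ_subseq_LIMSEQ[OF \<Phi> u(2)] by (simp add: o_def)
  moreover have "\<Phi> (act (g n) (X (r n))) = \<Phi> (X (r n))" for n using Phi_invariant u(3) X by blast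
  ultimately have "(\<lambda>n. \<Phi> (act (g n) (X (r n)))) \<longlonglongrightarrow> c" by simp
  then have "\<Phi> u = c" using tendsto_Phi[OF u(1) u(4) ev] LIMSEQ_unique by blast
  then have "u \<in> K" using u(1) g0 by (simp add: K_def)
  then show ?thesis using u by blast
qed

text \<open>Compactness of \<open>K\<close> modulo the group: a sequence in \<open>K\<close> is
  trivially a Cerami sequence.\<close>

lemma K_sequence:
  assumes X: "\<And>n. X n \<in> K"
  shows "\<exists>(r::nat\<Rightarrow>nat) g. \<exists>u\<in>K. strict_mono r \<and> (\<forall>n. g n \<in> carrier G) \<and> (\<lambda>n. act (g n) (X (r n))) \<longlonglongrightarrow> u"
proof (rule cerami_sequence)
  show "X n \<in> M" for n using X K_M by blast
  have "\<Phi> (X n) = c" "gnorm (X n) = 0" for n using X M_neq_0 by (auto simp: K_def gnorm_def)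
  then show "(\<lambda>n. \<Phi> (X n)) \<longlonglongrightarrow> c" "(\<lambda>n. gnorm (X n) * (1 + Nr (X n))) \<longlonglongrightarrow> 0" by simp_all
qed

text \<open>The open tube of radius \<open>d\<close> around \<open>K\<close> for the length metric.
  It is invariant under the group, but in general not under reflection.\<close>

definition S :: "real \<Rightarrow> 'a set" where "S d = {x. \<exists>v\<in>K. \<exists>L<d. conn x v L}"

lemma S_M: "x \<in> S d \<Longrightarrow> x \<in> M"
  using conn_in_M by (auto simp: S_def)

lemma S_mono: "d \<le> d' \<Longrightarrow> S d \<subseteq> S d'"
  unfolding S_def using less_le_trans by blast

lemma S_act: "g \<in> carrier G \<Longrightarrow> x \<in> S d \<Longrightarrow> act g x \<in> S d"
  unfolding S_def using conn_act K_act by blast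

lemma S_conn: "x \<in> S d \<Longrightarrow> conn y x L \<Longrightarrow> y \<in> S (d + L)"
proof -
  assume "x \<in> S d" and c: "conn y x L"
  then obtain v L' where v: "v \<in> K" "L' < d" "conn x v L'" unfolding S_def by blast
  have "conn y v (L + L')" by (rule conn_trans[OF c v(3)])
  then show ?thesis unfolding S_def using v(1,2) by (auto intro!: bexI[of _ v] exI[of _ "L + L'"])
qed

text \<open>Near u the length distance is at most a multiple of the norm distance; with
  \<open>conn_small_imp_close\<close> this makes both notions of convergence to a point of M
  agree.\<close>

lemma eventually_conn:
  assumes X: "(X \<longlongrightarrow> u) F" "\<forall>\<^sub>F n in F. X n \<in> M" and u: "u \<in> M" and d: "d > 0"
  shows "\<forall>\<^sub>F n in F. \<exists>L<d. conn (X n) u L"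
proof -
  obtain \<rho> C where \<rho>: "\<rho> > 0" "C > 0" and C: "\<forall>x\<in>M \<inter> ball u \<rho>. \<forall>y\<in>M \<inter> ball u \<rho>. conn x y (C * norm (x - y))"
    using conn_near[OF u] by blast
  have "min \<rho> (d / C) > 0" using \<rho> d by simp
  then have "\<forall>\<^sub>F n in F. dist (X n) u < min \<rho> (d / C)" by (rule tendstoD[OF X(1)])
  then show ?thesis using X(2)
  proof eventually_elim
    case (elim n)
    have "X n \<in> M \<inter> ball u \<rho>" "u \<in> M \<inter> ball u \<rho>" using elim u \<rho> by (simp_all add: dist_commute)
    then have "conn (X n) u (C * norm (X n - u))" by (rule bspec[OF bspec[OF C]])
    moreover have "C * norm (X n - u) < d" using elim(1) \<rho> by (simp add: dist_norm field_simps)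
    ultimately show ?case by blast
  qed
qed

lemma S_open: "openin (top_of_set M) (S d)"
proof (subst openin_subopen, intro ballI)
  fix x assume x: "x \<in> S d"
  then obtain v L where v: "v \<in> K" "L < d" "conn x v L" unfolding S_def by blast
  have xM: "x \<in> M" by (rule S_M[OF x])
  have "\<forall>\<^sub>F y in at x within M. \<exists>L'<d - L. conn y x L'"
    by (rule eventually_conn[OF tendsto_ident_at _ xM]) (use v in \<open>simp_all add: eventually_at_filter\<close>)
  then obtain e where e: "e > 0" "\<forall>y\<in>M. y \<noteq> x \<and> dist y x < e \<longrightarrow> (\<exists>L'<d - L. conn y x L')"
    unfolding eventually_at by blast
  have "M \<inter> ball x e \<subseteq> S d"
  proof
    fix y assume y: "y \<in> M \<inter> ball x e"
    show "y \<in> S d"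
    proof (cases "y = x")
      case False
      then obtain L' where L': "L' < d - L" "conn y x L'" using e(2) y by (auto simp: dist_commute)
      have "conn y v (L' + L)" by (rule conn_trans[OF L'(2) v(3)])
      then show ?thesis unfolding S_def using v(1) L'(1) by (auto intro!: bexI[of _ v] exI[of _ "L' + L"])
    qed (use x in simp)
  qed
  moreover have "openin (top_of_set M) (M \<inter> ball x e)" by auto
  ultimately show "\<exists>T. openin (top_of_set M) T \<and> x \<in> T \<and> T \<subseteq> S d"
    using xM e(1) by (intro exI[of _ "M \<inter> ball x e"]) simp
qed

lemma inverse_Suc_less: "(e::real) > 0 \<Longrightarrow> \<exists>n0. \<forall>n\<ge>n0. 1 / real (Suc n) < e"
proof -
  assume e: "e > 0"
  obtain n0 where n0: "1 / real (Suc n0) < e" using nat_approx_posE[OF e] by blast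
  have "1 / real (Suc n) \<le> 1 / real (Suc n0)" if "n \<ge> n0" for n using that by (simp add: frac_le)
  then show ?thesis using n0 le_less_trans by blast
qed

text \<open>The nearby points of \<open>K\<close> converge after translation; the translates remain
  as close in d as the original points were, because the action preserves lengths.\<close>

lemma S_sequence:
  assumes X: "\<And>n. X n \<in> S (1 / real (Suc n))"
  shows "\<exists>(r::nat\<Rightarrow>nat) g. \<exists>u\<in>K. strict_mono r \<and> (\<forall>n. g n \<in> carrier G) \<and> (\<lambda>n. act (g n) (X (r n))) \<longlonglongrightarrow> u"
proof -
  have "\<exists>v. v \<in> K \<and> (\<exists>L<1 / real (Suc n). conn (X n) v L)" for n using X[of n] unfolding S_def by blast
  then obtain v where v: "\<And>n. v n \<in> K" "\<And>n. \<exists>L<1 / real (Suc n). conn (X n) (v n) L" by metis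
  obtain r g u where u: "u \<in> K" "strict_mono (r::nat\<Rightarrow>nat)" "\<forall>n. g n \<in> carrier G" "(\<lambda>n. act (g n) (v (r n))) \<longlonglongrightarrow> u"
    using K_sequence[of v, OF v(1)] by blast
  have uM: "u \<in> M" using K_M u by blast
  have "(\<lambda>n. act (g n) (X (r n))) \<longlonglongrightarrow> u"
  proof (rule LIMSEQ_I)
    fix e :: real assume "e > 0"
    then obtain d where d: "d > 0" "\<forall>x L. conn u x L \<longrightarrow> L \<le> d \<longrightarrow> norm (x - u) < e"
      using conn_small_imp_close[OF uM] by blast
    have ev: "\<forall>\<^sub>F n in sequentially. act (g n) (v (r n)) \<in> M"
      using M_invariant u(3) v(1) K_M by (intro always_eventually) blast
    have "\<forall>\<^sub>F n in sequentially. \<exists>L<d / 2. conn (act (g n) (v (r n))) u L"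
      by (rule eventually_conn[OF u(4) ev uM]) (use d in simp)
    then obtain n1 where n1: "\<forall>n\<ge>n1. \<exists>L<d / 2. conn (act (g n) (v (r n))) u L"
      unfolding eventually_sequentially by blast
    obtain n2 where n2: "\<forall>n\<ge>n2. 1 / real (Suc n) < d / 2" using inverse_Suc_less[of "d / 2"] d by auto
    have "norm (act (g n) (X (r n)) - u) < e" if n: "n \<ge> max n1 n2" for n
    proof -
      have "r n \<ge> n2" using seq_suble[OF u(2), of n] n by simp
      then have "1 / real (Suc (r n)) < d / 2" using n2 by blast
      then obtain L where L: "L < d / 2" "conn (X (r n)) (v (r n)) L" using v(2)[of "r n"] less_trans by blast
      obtain L' where L': "L' < d / 2" "conn (act (g n) (v (r n))) u L'" using n1 n by auto
      have gn: "g n \<in> carrier G" using u(3) by blast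
      have "conn (act (g n) (X (r n))) u (L + L')" by (rule conn_trans[OF conn_act[OF gn L(2)] L'(2)])
      then have "conn u (act (g n) (X (r n))) (L + L')" by (rule conn_sym)
      moreover have "L + L' \<le> d" using L L' by simp
      ultimately show ?thesis using d(2) by blast
    qed
    then show "\<exists>n0. \<forall>n\<ge>n0. norm (act (g n) (X (r n)) - u) < e" by blast
  qed
  then show ?thesis using u by blast
qed

end

section \<open>Uniform estimates near the critical set, and a finite cover by orbit
  neighbourhoods\<close>

context cerami_level begin

interpretation grp: group G by (rule G_group)

text \<open>A violating sequence would converge, after translation, to some u in \<open>K\<close>.
  As -u lies in \<open>K\<close> too, both the points and their reflections would enter the tube.
  The disjunction is essential later: it bounds the gradient at x and at -x once one of the two is
  known to be outside.\<close>

lemma gradient_lower_bound: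
  assumes d: "d > 0"
  shows "\<exists>\<alpha>>0. \<exists>\<epsilon>>0. \<forall>x\<in>M. \<bar>\<Phi> x - c\<bar> < \<epsilon> \<longrightarrow> x \<notin> S d \<or> - x \<notin> S d \<longrightarrow> \<alpha> \<le> gnorm x * (1 + Nr x)"
proof (rule ccontr)
  assume neg: "\<not> ?thesis"
  have "\<exists>x. x \<in> M \<and> \<bar>\<Phi> x - c\<bar> < 1 / real (Suc n) \<and> (x \<notin> S d \<or> - x \<notin> S d) \<and> gnorm x * (1 + Nr x) < 1 / real (Suc n)" for n
  proof (rule ccontr)
    assume "\<not> ?thesis"
    then have "\<forall>x\<in>M. \<bar>\<Phi> x - c\<bar> < 1 / real (Suc n) \<longrightarrow> x \<notin> S d \<or> - x \<notin> S d \<longrightarrow> 1 / real (Suc n) \<le> gnorm x * (1 + Nr x)"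
      by (meson not_less)
    moreover have "1 / real (Suc n) > 0" by simp
    ultimately show False using neg by blast
  qed
  then obtain X where X: "\<And>n. X n \<in> M" "\<And>n. \<bar>\<Phi> (X n) - c\<bar> < 1 / real (Suc n)" "\<And>n. X n \<notin> S d \<or> - X n \<notin> S d"
    "\<And>n. gnorm (X n) * (1 + Nr (X n)) < 1 / real (Suc n)" by metis
  have lim: "(\<lambda>n. 1 / real (Suc n)) \<longlonglongrightarrow> 0" using LIMSEQ_Suc[OF lim_1_over_n] by simp
  have "(\<lambda>n. \<Phi> (X n) - c) \<longlonglongrightarrow> 0"
    by (rule Lim_null_comparison[OF _ lim]) (use X(2) in \<open>auto intro: always_eventually less_imp_le\<close>)
  then have 1: "(\<lambda>n. \<Phi> (X n)) \<longlonglongrightarrow> c" by (simp add: LIM_zero_iff)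
  have nn: "0 \<le> gnorm (X n) * (1 + Nr (X n))" for n
    using gnorm_nonneg[OF X(1)] Nr_nonneg[OF X(1)] by simp
  have 2: "(\<lambda>n. gnorm (X n) * (1 + Nr (X n))) \<longlonglongrightarrow> 0"
  proof (rule Lim_null_comparison[OF _ lim])
    have "norm (gnorm (X n) * (1 + Nr (X n))) \<le> 1 / real (Suc n)" for n
      using X(4)[of n] nn[of n] by (simp only: real_norm_def abs_of_nonneg less_imp_le)
    then show "\<forall>\<^sub>F n in sequentially. norm (gnorm (X n) * (1 + Nr (X n))) \<le> 1 / real (Suc n)" by simp
  qed
  obtain r g u where u: "u \<in> K" "strict_mono (r::nat\<Rightarrow>nat)" "\<forall>n. g n \<in> carrier G" "(\<lambda>n. act (g n) (X (r n))) \<longlonglongrightarrow> u"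
    using cerami_sequence[of X, OF X(1) 1 2] by blast
  have YM: "act (g n) (X (r n)) \<in> M" for n using M_invariant u(3) X(1) by blast
  have "\<forall>\<^sub>F n in sequentially. \<exists>L<d. conn (act (g n) (X (r n))) u L"
    by (rule eventually_conn[OF u(4) _ K_M[OF u(1)] d]) (use YM in simp)
  moreover have "\<forall>\<^sub>F n in sequentially. \<exists>L<d. conn (- act (g n) (X (r n))) (- u) L"
    by (rule eventually_conn[OF tendsto_minus[OF u(4)] _ K_M[OF K_uminus[OF u(1)]] d]) (use YM M_uminus in simp)
  ultimately have ev: "\<forall>\<^sub>F n in sequentially. (\<exists>L<d. conn (act (g n) (X (r n))) u L) \<and> (\<exists>L<d. conn (- act (g n) (X (r n))) (- u) L)"
    by (rule eventually_conj)
  obtain n where n: "\<exists>L<d. conn (act (g n) (X (r n))) u L" "\<exists>L<d. conn (- act (g n) (X (r n))) (- u) L"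
    using eventually_happens'[OF sequentially_bot ev] by blast
  have gn: "g n \<in> carrier G" "inv\<^bsub>G\<^esub> g n \<in> carrier G" using u(3) by simp_all
  have "act (g n) (X (r n)) \<in> S d" using n(1) u(1) unfolding S_def by blast
  then have "act (inv\<^bsub>G\<^esub> g n) (act (g n) (X (r n))) \<in> S d" by (rule S_act[OF gn(2)])
  then have a: "X (r n) \<in> S d" by (simp add: act_inv[OF gn(1)])
  have "- act (g n) (X (r n)) \<in> S d" using n(2) K_uminus[OF u(1)] unfolding S_def by blast
  then have "act (inv\<^bsub>G\<^esub> g n) (- act (g n) (X (r n))) \<in> S d" by (rule S_act[OF gn(2)])
  then have "- X (r n) \<in> S d" by (simp add: act_uminus[OF gn(2)] act_inv[OF gn(1)])
  then show False using a X(3)[of "r n"] by blast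
qed

text \<open>All three quantities are unchanged when x is replaced by a translate, so a violating
  sequence can be tested near a single limit u and its reflection -u, where the local bounds of the
  scalar products apply.\<close>

lemma S_bounds:
  "\<exists>d>0. \<exists>C>0. \<forall>x\<in>S d. (\<forall>w. nrm x w \<le> C * nrm (- x) w) \<and> Nr x \<le> C \<and> Nr (- x) \<le> C"
proof (rule ccontr)
  assume neg: "\<not> ?thesis"
  define bad where "bad n x \<longleftrightarrow> \<not> ((\<forall>w. nrm x w \<le> n * nrm (- x) w) \<and> Nr x \<le> n \<and> Nr (- x) \<le> n)" for n x
  have "\<exists>x. x \<in> S (1 / real (Suc n)) \<and> bad (real (Suc n)) x" for n
  proof (rule ccontr)
    assume "\<not> ?thesis"
    then have "\<forall>x\<in>S (1 / real (Suc n)). (\<forall>w. nrm x w \<le> real (Suc n) * nrm (- x) w) \<and> Nr x \<le> real (Suc n) \<and> Nr (- x) \<le> real (Suc n)"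
      unfolding bad_def by blast
    moreover have "1 / real (Suc n) > 0" "real (Suc n) > 0" by simp_all
    ultimately show False using neg by blast
  qed
  then obtain X where X: "\<And>n. X n \<in> S (1 / real (Suc n))" "\<And>n. bad (real (Suc n)) (X n)" by metis
  have XM: "X n \<in> M" for n using X(1) S_M by blast
  obtain r g u where u: "u \<in> K" "strict_mono (r::nat\<Rightarrow>nat)" "\<forall>n. g n \<in> carrier G" "(\<lambda>n. act (g n) (X (r n))) \<longlonglongrightarrow> u"
    using S_sequence[of X, OF X(1)] by blast
  have uM: "u \<in> M" "- u \<in> M" using K_M u(1) M_uminus by blast+
  obtain r1 C1 where r1: "r1 > 0" "C1 > 0" and C1: "\<forall>x\<in>ball u r1. x \<noteq> 0 \<and> (\<forall>v. nrm x v \<le> C1 * norm v \<and> norm v \<le> C1 * nrm x v) \<and>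
     (\<forall>x'\<in>ball u r1. \<forall>v w. \<bar>ip x v w - ip x' v w\<bar> \<le> C1 * norm (x - x') * norm v * norm w)"
    using local_metric_bounds[OF M_neq_0[OF uM(1)]] by blast
  obtain r2 C2 where r2: "r2 > 0" "C2 > 0" and C2: "\<forall>x\<in>ball (- u) r2. x \<noteq> 0 \<and> (\<forall>v. nrm x v \<le> C2 * norm v \<and> norm v \<le> C2 * nrm x v) \<and>
     (\<forall>x'\<in>ball (- u) r2. \<forall>v w. \<bar>ip x v w - ip x' v w\<bar> \<le> C2 * norm (x - x') * norm v * norm w)"
    using local_metric_bounds[OF M_neq_0[OF uM(2)]] by blast
  \<comment> \<open>One summand for each of the three inequalities; near u the norm of a point is
    below \<open>norm u + 1\<close>.\<close>
  define B where "B = C1 * C2 + C1 * (norm u + 1) + C2 * (norm u + 1)"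
  have "min (min r1 r2) 1 > 0" using r1 r2 by simp
  then obtain n1 where n1: "\<forall>n\<ge>n1. norm (act (g n) (X (r n)) - u) < min (min r1 r2) 1"
    using LIMSEQ_D[OF u(4)] by blast
  obtain n2 :: nat where n2: "B < n2" using reals_Archimedean2 by blast
  define n where "n = max n1 n2"
  define y where "y = act (g n) (X (r n))"
  have gn: "g n \<in> carrier G" using u(3) by blast
  have yn: "norm (y - u) < min (min r1 r2) 1" using n1 by (simp add: y_def n_def)
  have yM: "y \<in> M" "- y \<in> M" using M_invariant[OF gn XM] M_uminus by (auto simp: y_def)
  have yb: "y \<in> ball u r1" using yn by (simp add: dist_norm norm_minus_commute)
  have "norm (- y - - u) = norm (y - u)" by (metis minus_diff_minus norm_minus_cancel)
  then have yb2: "- y \<in> ball (- u) r2" using yn by (simp add: dist_norm norm_minus_commute)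
  have y1: "norm y \<le> norm u + 1" using yn norm_triangle_ineq2[of y u] by simp
  have bd: "C1 * C2 \<le> B" "C1 * (norm u + 1) \<le> B" "C2 * (norm u + 1) \<le> B"
    using r1 r2 by (simp_all add: B_def)
  have "n \<le> r n" by (rule seq_suble[OF u(2)])
  then have rB: "B \<le> real (Suc (r n))" using n2 by (simp add: n_def)
  have a: "nrm y w \<le> real (Suc (r n)) * nrm (- y) w" for w
  proof -
    have "nrm y w \<le> C1 * norm w" using bspec[OF C1 yb] by simp
    also have "\<dots> \<le> C1 * (C2 * nrm (- y) w)" using bspec[OF C2 yb2] r1 by (intro mult_left_mono) simp_all
    also have "\<dots> = (C1 * C2) * nrm (- y) w" by simp
    also have "\<dots> \<le> real (Suc (r n)) * nrm (- y) w"
      using nrm_nonneg[OF M_neq_0[OF yM(2)]] bd(1) rB by (intro mult_right_mono) linarith+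
    finally show ?thesis .
  qed
  have b: "Nr y \<le> real (Suc (r n))"
  proof -
    have "Nr y \<le> nrm y y" by (rule Nr_le_nrm[OF yM(1)])
    also have "\<dots> \<le> C1 * norm y" using bspec[OF C1 yb] by simp
    also have "\<dots> \<le> C1 * (norm u + 1)" using y1 r1 by (intro mult_left_mono) simp_all
    finally show ?thesis using bd rB by linarith
  qed
  have c': "Nr (- y) \<le> real (Suc (r n))"
  proof -
    have "Nr (- y) \<le> nrm (- y) (- y)" by (rule Nr_le_nrm[OF yM(2)])
    also have "\<dots> \<le> C2 * norm (- y)" using bspec[OF C2 yb2] by blast
    also have "\<dots> \<le> C2 * (norm u + 1)" using y1 r2 by (intro mult_left_mono) simp_all
    finally show ?thesis using bd rB by linarith
  qed
  let ?x = "X (r n)"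
  have my: "- y = act (g n) (- ?x)" by (simp add: y_def act_uminus[OF gn])
  have x0: "?x \<noteq> 0" "- ?x \<noteq> 0" using M_neq_0[OF XM] by simp_all
  have "nrm ?x w \<le> real (Suc (r n)) * nrm (- ?x) w" for w
    using a[of "act (g n) w"] unfolding my unfolding y_def nrm_act[OF gn x0(1)] nrm_act[OF gn x0(2)] .
  moreover have "Nr ?x \<le> real (Suc (r n))" using b unfolding y_def Nr_act[OF gn XM] .
  moreover have "Nr (- ?x) \<le> real (Suc (r n))" using c' unfolding my Nr_act[OF gn M_uminus[OF XM]] .
  ultimately have "\<not> bad (real (Suc (r n))) ?x" unfolding bad_def by blast
  then show False using X(2) by blast
qed

text \<open>The points whose orbit meets a ball around \<open>v\<close>. The ball is one of the
  norm, which reflection preserves, not of d.\<close>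

definition orbit_ball :: "'a \<Rightarrow> real \<Rightarrow> 'a set" where
  "orbit_ball v s = {x\<in>M. \<exists>g\<in>carrier G. norm (act g x - v) < s}"

lemma orbit_ball_open: "openin (top_of_set M) (orbit_ball v s)"
proof -
  have "open {x. norm (act g x - v) < s}" if g: "g \<in> carrier G" for g
  proof -
    have "continuous_on UNIV (act g)"
      by (rule linear_continuous_on[OF act_bounded_linear[OF g]])
    then show ?thesis by (intro open_Collect_less continuous_intros)
  qed
  then have "open (\<Union>g\<in>carrier G. {x. norm (act g x - v) < s})" by blast
  moreover have "orbit_ball v s = M \<inter> (\<Union>g\<in>carrier G. {x. norm (act g x - v) < s})"
    by (auto simp: orbit_ball_def)
  ultimately show ?thesis by (simp add: openin_open_Int)
qed

lemma orbit_ball_act: "g \<in> carrier G \<Longrightarrow> x \<in> M \<Longrightarrow> act g x \<in> orbit_ball v s \<Longrightarrow> x \<in> orbit_ball v s"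
proof -
  assume g: "g \<in> carrier G" and x: "x \<in> M" and "act g x \<in> orbit_ball v s"
  then obtain h where h: "h \<in> carrier G" "norm (act h (act g x) - v) < s" by (auto simp: orbit_ball_def)
  then have "norm (act (h \<otimes>\<^bsub>G\<^esub> g) x - v) < s" by (simp add: act_mult g)
  then show ?thesis using x g h(1) unfolding orbit_ball_def by blast
qed

text \<open>Otherwise points x_n have translates \<open>g n\<close> x_n tending to v and
  \<open>h n\<close> x_n tending to -v. The elements \<open>h n\<close> times the inverse of
  \<open>g n\<close> preserve d and carry the first translates to the second; they therefore carry v
  close to -v. By \<open>cond_Gstar\<close> the orbit of v contains -v itself, which is excluded on
  \<open>K\<close>.\<close>

lemma orbit_ball_disjoint:
  assumes v: "v \<in> K"
  shows "\<exists>s>0. orbit_ball v s \<inter> uminus ` orbit_ball v s = {}"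
proof (rule ccontr)
  assume neg: "\<not> ?thesis"
  have vM: "v \<in> M" "- v \<in> M" using v K_M M_uminus by blast+
  have "\<exists>x. x \<in> orbit_ball v (1 / real (Suc n)) \<and> - x \<in> orbit_ball v (1 / real (Suc n))" for n
  proof (rule ccontr)
    assume no: "\<not> ?thesis"
    have "orbit_ball v (1 / real (Suc n)) \<inter> uminus ` orbit_ball v (1 / real (Suc n)) = {}"
    proof (rule ccontr)
      assume "\<not> ?thesis"
      then obtain y where "y \<in> orbit_ball v (1 / real (Suc n))" "- y \<in> orbit_ball v (1 / real (Suc n))" by auto
      then show False using no by blast
    qed
    moreover have "1 / real (Suc n) > 0" by simp
    ultimately show False using neg by blast
  qed
  then have "\<exists>x g h. x \<in> M \<and> g \<in> carrier G \<and> h \<in> carrier G \<and> norm (act g x - v) < 1 / real (Suc n) \<and> norm (act h (- x) - v) < 1 / real (Suc n)" for n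
    unfolding orbit_ball_def by blast
  then obtain X g h where X: "\<And>n. X n \<in> M" "\<And>n. g n \<in> carrier G" "\<And>n. h n \<in> carrier G"
    "\<And>n. norm (act (g n) (X n) - v) < 1 / real (Suc n)" "\<And>n. norm (act (h n) (- X n) - v) < 1 / real (Suc n)"
    by metis
  have lim: "(\<lambda>n. 1 / real (Suc n)) \<longlonglongrightarrow> 0" using LIMSEQ_Suc[OF lim_1_over_n] by simp
  have "(\<lambda>n. act (g n) (X n) - v) \<longlonglongrightarrow> 0"
    by (rule Lim_null_comparison[OF _ lim]) (use X(4) in \<open>auto intro: always_eventually less_imp_le\<close>)
  then have gX: "(\<lambda>n. act (g n) (X n)) \<longlonglongrightarrow> v" by (simp add: LIM_zero_iff)
  have "(\<lambda>n. act (h n) (- X n) - v) \<longlonglongrightarrow> 0"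
    by (rule Lim_null_comparison[OF _ lim]) (use X(5) in \<open>auto intro: always_eventually less_imp_le\<close>)
  then have "(\<lambda>n. act (h n) (- X n)) \<longlonglongrightarrow> v" by (simp add: LIM_zero_iff)
  then have "(\<lambda>n. - act (h n) (- X n)) \<longlonglongrightarrow> - v" by (rule tendsto_minus)
  then have hX: "(\<lambda>n. act (h n) (X n)) \<longlonglongrightarrow> - v" by (simp add: act_uminus[OF X(3)])
  define k where "k n = h n \<otimes>\<^bsub>G\<^esub> inv\<^bsub>G\<^esub> g n" for n
  have k: "k n \<in> carrier G" for n using X by (simp add: k_def)
  have kg: "act (k n) (act (g n) (X n)) = act (h n) (X n)" for n
    using X by (simp add: k_def act_mult act_inv)
  \<comment> \<open>In the norm the maps \<open>act (k n)\<close> could magnify a small error; in d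
    they preserve it.\<close>
  have "(\<lambda>n. act (k n) v) \<longlonglongrightarrow> - v"
  proof (rule LIMSEQ_I)
    fix e :: real assume "e > 0"
    then obtain d where d: "d > 0" "\<forall>x L. conn (- v) x L \<longrightarrow> L \<le> d \<longrightarrow> norm (x - - v) < e"
      using conn_small_imp_close[OF vM(2)] by blast
    have d2: "d / 2 > 0" using d by simp
    have "\<forall>\<^sub>F n in sequentially. \<exists>L<d / 2. conn (act (g n) (X n)) v L"
      by (rule eventually_conn[OF gX _ vM(1) d2]) (use M_invariant X in simp)
    moreover have "\<forall>\<^sub>F n in sequentially. \<exists>L<d / 2. conn (act (h n) (X n)) (- v) L"
      by (rule eventually_conn[OF hX _ vM(2) d2]) (use M_invariant X in simp)
    ultimately have "\<forall>\<^sub>F n in sequentially. norm (act (k n) v - - v) < e"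
    proof eventually_elim
      case (elim n)
      obtain L1 where L1: "L1 < d / 2" "conn (act (g n) (X n)) v L1" using elim(1) by blast
      obtain L2 where L2: "L2 < d / 2" "conn (act (h n) (X n)) (- v) L2" using elim(2) by blast
      have "conn (act (h n) (X n)) (act (k n) v) L1" using conn_act[OF k[of n] L1(2)] by (simp add: kg)
      then have "conn (- v) (act (k n) v) (L2 + L1)" by (rule conn_trans[OF conn_sym[OF L2(2)]])
      moreover have "L2 + L1 \<le> d" using L1 L2 by simp
      ultimately show ?case using d(2) by blast
    qed
    then show "\<exists>n0. \<forall>n\<ge>n0. norm (act (k n) v - - v) < e" by (simp add: eventually_sequentially)
  qed
  then have "\<exists>h\<in>carrier G. act h v = - v" using Gstar k unfolding cond_Gstar_def by blast
  then show False using free v critical_set_eq by blast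
qed

text \<open>The radii \<open>s v\<close> vary with v, so compactness modulo the group is used twice:
  for a Lebesgue number of the cover of \<open>K\<close>, and for a finite net of orbits at half
  that scale.\<close>

lemma critical_orbit_cover:
  "\<exists>d>0. \<exists>F s. finite F \<and> F \<subseteq> K \<and> (\<forall>v\<in>F. orbit_ball v (s v) \<inter> uminus ` orbit_ball v (s v) = {}) \<and>
     S d \<subseteq> (\<Union>v\<in>F. orbit_ball v (s v))"
proof -
  define good where "good v s \<longleftrightarrow> s > 0 \<and> orbit_ball v s \<inter> uminus ` orbit_ball v s = {}" for v s
  have "\<forall>v\<in>K. \<exists>s. good v s" using orbit_ball_disjoint unfolding good_def by blast
  then obtain s where s: "\<forall>v\<in>K. good v (s v)" by metis
  define Q where "Q v = orbit_ball v (s v)" for v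
  \<comment> \<open>The Lebesgue number: around every u the points at distance below \<mu> lie in
    one common member of the cover. If there were none, centres u_n with radii tending to 0 would
    have translates tending to some u, and the member belonging to u would absorb the offending
    points.\<close>
  have "\<exists>\<mu>>0. \<forall>u\<in>K. \<exists>v\<in>K. \<forall>x L. conn x u L \<longrightarrow> L < \<mu> \<longrightarrow> x \<in> Q v"
  proof (rule ccontr)
    assume neg: "\<not> ?thesis"
    define far where "far n u \<longleftrightarrow> u \<in> K \<and> (\<forall>v\<in>K. \<exists>x L. conn x u L \<and> L < 1 / real (Suc n) \<and> x \<notin> Q v)" for n u
    have "\<exists>u. far n u" for n
    proof (rule ccontr)
      assume "\<not> ?thesis"
      then have "\<forall>u\<in>K. \<exists>v\<in>K. \<forall>x L. conn x u L \<longrightarrow> L < 1 / real (Suc n) \<longrightarrow> x \<in> Q v" unfolding far_def by blast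
      moreover have "1 / real (Suc n) > 0" by simp
      ultimately show False using neg by blast
    qed
    then obtain X where X: "\<And>n. far n (X n)" by metis
    have XK: "X n \<in> K" for n using X unfolding far_def by blast
    obtain r g u where u: "u \<in> K" "strict_mono (r::nat\<Rightarrow>nat)" "\<forall>n. g n \<in> carrier G" "(\<lambda>n. act (g n) (X (r n))) \<longlonglongrightarrow> u"
      using K_sequence[of X, OF XK] by blast
    have uM: "u \<in> M" using K_M u(1) by blast
    have su: "s u > 0" using s u(1) by (simp add: good_def)
    obtain d where d: "d > 0" "\<forall>x L. conn u x L \<longrightarrow> L \<le> d \<longrightarrow> norm (x - u) < s u"
      using conn_small_imp_close[OF uM su] by blast
    have d2: "d / 2 > 0" using d by simp
    have ev: "\<forall>\<^sub>F n in sequentially. act (g n) (X (r n)) \<in> M"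
      using M_invariant u(3) XK K_M by (intro always_eventually) blast
    have "\<forall>\<^sub>F n in sequentially. \<exists>L<d / 2. conn (act (g n) (X (r n))) u L"
      by (rule eventually_conn[OF u(4) ev uM d2])
    then obtain n1 where n1: "\<forall>n\<ge>n1. \<exists>L<d / 2. conn (act (g n) (X (r n))) u L"
      unfolding eventually_sequentially by blast
    obtain n2 where n2: "\<forall>n\<ge>n2. 1 / real (Suc n) < d / 2" using inverse_Suc_less[OF d2] by blast
    define n where "n = max n1 n2"
    obtain L' where L': "L' < d / 2" "conn (act (g n) (X (r n))) u L'" using n1 max.cobounded1[of n1 n2] unfolding n_def by blast
    have "n2 \<le> r n" using seq_suble[OF u(2), of n] by (simp add: n_def)
    then have rn: "1 / real (Suc (r n)) < d / 2" using n2 by blast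
    obtain x L where x: "conn x (X (r n)) L" "L < 1 / real (Suc (r n))" "x \<notin> Q u"
      using X[of "r n"] u(1) unfolding far_def by blast
    have gn: "g n \<in> carrier G" using u(3) by blast
    have "conn (act (g n) x) u (L + L')" by (rule conn_trans[OF conn_act[OF gn x(1)] L'(2)])
    then have "conn u (act (g n) x) (L + L')" by (rule conn_sym)
    moreover have "L + L' \<le> d" using x(2) L'(1) rn by linarith
    ultimately have "norm (act (g n) x - u) < s u" using d(2) by blast
    then have "x \<in> Q u" using gn conn_in_M(1)[OF x(1)] unfolding Q_def orbit_ball_def by blast
    then show False using x(3) by blast
  qed
  then obtain \<mu> where \<mu>: "\<mu> > 0" "\<forall>u\<in>K. \<exists>v\<in>K. \<forall>x L. conn x u L \<longrightarrow> L < \<mu> \<longrightarrow> x \<in> Q v" by blast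
  obtain w where w: "\<forall>u\<in>K. w u \<in> K \<and> (\<forall>x L. conn x u L \<longrightarrow> L < \<mu> \<longrightarrow> x \<in> Q (w u))"
    using \<mu>(2) by metis
  define near where "near u f \<longleftrightarrow> (\<exists>g\<in>carrier G. \<exists>L<\<mu> / 2. conn (act g u) f L)" for u f
  have "\<exists>F. finite F \<and> F \<subseteq> K \<and> (\<forall>u\<in>K. \<exists>f\<in>F. near u f)"
  proof (rule ccontr)
    assume neg: "\<not> ?thesis"
    define pick where "pick F = (SOME u. u \<in> K \<and> (\<forall>f\<in>F. \<not> near u f))" for F
    have pick: "pick F \<in> K \<and> (\<forall>f\<in>F. \<not> near (pick F) f)" if F: "finite F" "F \<subseteq> K" for F
    proof -
      have "\<exists>u. u \<in> K \<and> (\<forall>f\<in>F. \<not> near u f)"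
      proof (rule ccontr)
        assume "\<nexists>u. u \<in> K \<and> (\<forall>f\<in>F. \<not> near u f)"
        then have "\<forall>u\<in>K. \<exists>f\<in>F. near u f" by blast
        with F have "finite F \<and> F \<subseteq> K \<and> (\<forall>u\<in>K. \<exists>f\<in>F. near u f)" by (intro conjI)
        then have "\<exists>F. finite F \<and> F \<subseteq> K \<and> (\<forall>u\<in>K. \<exists>f\<in>F. near u f)" by (rule exI)
        with neg show False by (rule notE)
      qed
      then show ?thesis unfolding pick_def by (rule someI_ex)
    qed
    \<comment> \<open>A greedy sequence: every new point is far, modulo the group, from all earlier
      ones. Two terms of a subsequence convergent modulo the group contradict this.\<close>
    define A where "A = rec_nat {} (\<lambda>n F. insert (pick F) F)"
    have A: "A 0 = {}" "A (Suc n) = insert (pick (A n)) (A n)" for n by (simp_all add: A_def)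
    have fin: "finite (A n) \<and> A n \<subseteq> K" for n
    proof (induction n)
      case 0 then show ?case by (simp add: A)
    next
      case (Suc n) then show ?case using pick[of "A n"] by (simp add: A)
    qed
    define X where "X n = pick (A n)" for n
    have XK: "X n \<in> K" for n using pick fin by (simp add: X_def)
    have XA: "X m \<in> A n" if "m < n" for m n
      using that by (induction n) (auto simp: A X_def less_Suc_eq)
    have notnear: "\<not> near (X n) (X m)" if "m < n" for m n
      using pick[of "A n"] fin XA[OF that] by (simp add: X_def)
    obtain r g u where u: "u \<in> K" "strict_mono (r::nat\<Rightarrow>nat)" "\<forall>n. g n \<in> carrier G" "(\<lambda>n. act (g n) (X (r n))) \<longlonglongrightarrow> u"
      using K_sequence[of X, OF XK] by blast
    have uM: "u \<in> M" using K_M u(1) by blast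
    have l4: "\<mu> / 4 > 0" using \<mu> by simp
    have ev: "\<forall>\<^sub>F n in sequentially. act (g n) (X (r n)) \<in> M"
      using M_invariant u(3) XK K_M by (intro always_eventually) blast
    have "\<forall>\<^sub>F n in sequentially. \<exists>L<\<mu> / 4. conn (act (g n) (X (r n))) u L"
      by (rule eventually_conn[OF u(4) ev uM l4])
    then obtain n where n: "\<forall>k\<ge>n. \<exists>L<\<mu> / 4. conn (act (g k) (X (r k))) u L"
      unfolding eventually_sequentially by blast
    obtain L1 where L1: "L1 < \<mu> / 4" "conn (act (g n) (X (r n))) u L1" using n by blast
    obtain L2 where L2: "L2 < \<mu> / 4" "conn (act (g (Suc n)) (X (r (Suc n)))) u L2" using n by (meson le_SucI order_refl)
    have gn: "g n \<in> carrier G" "inv\<^bsub>G\<^esub> g n \<in> carrier G" "g (Suc n) \<in> carrier G" using u(3) by simp_all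
    have "conn (act (g (Suc n)) (X (r (Suc n)))) (act (g n) (X (r n))) (L2 + L1)"
      by (rule conn_trans[OF L2(2) conn_sym[OF L1(2)]])
    then have "conn (act (inv\<^bsub>G\<^esub> g n) (act (g (Suc n)) (X (r (Suc n))))) (X (r n)) (L2 + L1)"
      using conn_act[OF gn(2)] by (metis act_inv[OF gn(1)])
    then have "conn (act (inv\<^bsub>G\<^esub> g n \<otimes>\<^bsub>G\<^esub> g (Suc n)) (X (r (Suc n)))) (X (r n)) (L2 + L1)"
      by (simp add: act_mult gn)
    moreover have "L2 + L1 < \<mu> / 2" using L1 L2 by linarith
    ultimately have "near (X (r (Suc n))) (X (r n))" unfolding near_def using gn by blast
    moreover have "r n < r (Suc n)" using u(2) by (simp add: strict_mono_def)
    ultimately show False using notnear by blast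
  qed
  then obtain F where F: "finite F" "F \<subseteq> K" "\<forall>u\<in>K. \<exists>f\<in>F. near u f" by blast
  have "S (\<mu> / 2) \<subseteq> (\<Union>v\<in>w ` F. Q v)"
  proof
    fix x assume "x \<in> S (\<mu> / 2)"
    then obtain v L where v: "v \<in> K" "L < \<mu> / 2" "conn x v L" unfolding S_def by blast
    obtain f where f: "f \<in> F" "near v f" using F(3) v(1) by blast
    then obtain g L' where g: "g \<in> carrier G" "L' < \<mu> / 2" "conn (act g v) f L'" unfolding near_def by blast
    have "conn (act g x) f (L + L')" by (rule conn_trans[OF conn_act[OF g(1) v(3)] g(3)])
    moreover have "L + L' < \<mu>" using v(2) g(2) by linarith
    ultimately have "act g x \<in> Q (w f)" using w f(1) F(2) by blast
    then have "x \<in> Q (w f)" using orbit_ball_act[OF g(1) conn_in_M(1)[OF v(3)]] by (simp add: Q_def)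
    then show "x \<in> (\<Union>v\<in>w ` F. Q v)" using f(1) by blast
  qed
  moreover have "w ` F \<subseteq> K" using w F(2) by blast
  moreover have "\<forall>v\<in>w ` F. orbit_ball v (s v) \<inter> uminus ` orbit_ball v (s v) = {}"
    using s \<open>w ` F \<subseteq> K\<close> unfolding good_def by blast
  moreover have "finite (w ` F)" using F(1) by simp
  moreover have "\<mu> / 2 > 0" using \<mu> by simp
  ultimately show ?thesis unfolding Q_def by blast
qed

end

subsection \<open>Descent through a strip of levels\<close>

lemma (in riemannian_setting) continuous_on_vel: "continuous_on regular vel"
  unfolding continuous_on_eq_continuous_within
proof
  fix u assume u: "u \<in> regular"
  obtain e L where e: "e > 0" "L \<ge> 0" "M \<inter> ball u e \<subseteq> regular"
    and L: "\<forall>x\<in>M \<inter> ball u e. \<forall>y\<in>M \<inter> ball u e. norm (vel x - vel y) \<le> L * norm (x - y)"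
    using vel_locally_lipschitz[OF u] by blast
  have lp: "L-lipschitz_on (regular \<inter> ball u e) vel"
    using L e(2) regular_M by (intro lipschitz_onI) (auto simp: dist_norm)
  have "continuous (at u within regular \<inter> ball u e) vel"
    using lipschitz_on_continuous_on[OF lp] u e(1) by (simp add: continuous_on_eq_continuous_within)
  moreover have "at u within regular \<inter> ball u e = at u within regular"
    using e(1) by (intro at_within_nhd[of u "ball u e"]) auto
  ultimately show "continuous (at u within regular) vel" by simp
qed

text \<open>The constants are tied to the speed \<open>1 / gnorm\<close>. Near \<open>K\<close> it
  is at most \<open>(1 + C) / \<alpha>\<close>, and at most C times that after reflection; \<kappa>
  dominates both. The condition \<open>2 * \<epsilon> * \<kappa> \<le> \<delta>\<close> keeps the
  moving radius between 2\<delta> and 3\<delta> across the whole strip, and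
  \<open>2 * \<epsilon> / \<alpha> \<le> 1 / 2\<close> permits an absorption in
  \<open>sol_speed\<close>.\<close>

locale cerami_strip = cerami_level G act ip M \<Phi> c
  for G :: "('g, 'm) monoid_scheme" and act :: "'g \<Rightarrow> 'a::{real_inner,complete_space} \<Rightarrow> 'a"
    and ip M \<Phi> c +
  fixes lo hi \<epsilon> \<delta> \<alpha> C \<kappa> :: real
  assumes strip_complete: "complete_wrt (curve_dist ip M) {u \<in> M. lo \<le> \<Phi> u \<and> \<Phi> u \<le> hi}"
    and \<delta>_pos: "\<delta> > 0" and \<alpha>_pos: "\<alpha> > 0" and C_pos: "C > 0" and \<epsilon>_pos: "\<epsilon> > 0"
    and level_bounds: "lo \<le> c - \<epsilon>" "c + \<epsilon> \<le> hi"
    and S_comparison: "\<And>x w. x \<in> S (4 * \<delta>) \<Longrightarrow> nrm x w \<le> C * nrm (- x) w"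
    and S_Nr: "\<And>x. x \<in> S (4 * \<delta>) \<Longrightarrow> Nr x \<le> C" "\<And>x. x \<in> S (4 * \<delta>) \<Longrightarrow> Nr (- x) \<le> C"
    and grad_bound: "\<And>x. x \<in> M \<Longrightarrow> \<bar>\<Phi> x - c\<bar> \<le> \<epsilon> \<Longrightarrow> x \<notin> S \<delta> \<or> - x \<notin> S \<delta> \<Longrightarrow> \<alpha> \<le> gnorm x * (1 + Nr x)"
    and \<kappa>_eq: "\<kappa> = (1 + C) * (1 + C) / \<alpha>"
    and \<epsilon>_small: "2 * \<epsilon> * \<kappa> \<le> \<delta>" "2 * \<epsilon> / \<alpha> \<le> 1 / 2"
begin

abbreviation "bot_level \<equiv> c - \<epsilon>"

text \<open>The radius of the forbidden tube shrinks at rate \<open>\<kappa>\<close> as the level drops. Both \<open>vel\<close> and its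
  reflection have speed at most \<open>\<kappa>\<close> near \<open>K\<close>, so neither flow can enter the tube.\<close>

definition Inv :: "'a \<Rightarrow> bool" where
  "Inv x \<longleftrightarrow> x \<in> M \<and> bot_level \<le> \<Phi> x \<and> \<Phi> x \<le> c + \<epsilon> \<and> x \<notin> S (2 * \<delta> + \<kappa> * (\<Phi> x - bot_level))"

lemma \<kappa>_nonneg: "\<kappa> \<ge> 0"
  using \<alpha>_pos by (simp add: \<kappa>_eq)

lemma speed_bound:
  assumes x: "x \<in> M" "\<bar>\<Phi> x - c\<bar> \<le> \<epsilon>" "x \<notin> S \<delta> \<or> - x \<notin> S \<delta>"
  shows "x \<in> regular" and "nrm x (vel x) \<le> (1 + Nr x) / \<alpha>"
proof -
  have g: "\<alpha> \<le> gnorm x * (1 + Nr x)" by (rule grad_bound[OF x])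
  then have "gnorm x \<noteq> 0" using \<alpha>_pos by auto
  then have "grad x \<noteq> 0" using M_neq_0[OF x(1)] by (auto simp: gnorm_def)
  then show r: "x \<in> regular" using x(1) by (simp add: regular_def)
  show "nrm x (vel x) \<le> (1 + Nr x) / \<alpha>"
    using g gnorm_pos[OF r] \<alpha>_pos by (simp add: nrm_vel[OF r] field_simps)
qed

lemma Inv_not_S: "Inv x \<Longrightarrow> x \<notin> S \<delta>"
proof -
  assume i: "Inv x"
  then have "0 \<le> \<kappa> * (\<Phi> x - bot_level)" using \<kappa>_nonneg by (simp add: Inv_def)
  then have "S \<delta> \<subseteq> S (2 * \<delta> + \<kappa> * (\<Phi> x - bot_level))" using \<delta>_pos by (intro S_mono) linarith
  then show ?thesis using i by (auto simp: Inv_def)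
qed

lemma Inv_level: "Inv x \<Longrightarrow> \<bar>\<Phi> x - c\<bar> \<le> \<epsilon>"
  by (auto simp: Inv_def abs_if)

lemma speed_near_K:
  assumes x: "x \<in> M" "\<bar>\<Phi> x - c\<bar> \<le> \<epsilon>" "x \<in> S (4 * \<delta>)" "x \<notin> S \<delta>"
  shows "nrm x (vel x) \<le> \<kappa>" and "nrm x (- vel (- x)) \<le> \<kappa>"
proof -
  have k: "(1 + C) / \<alpha> \<le> \<kappa>" "C * ((1 + C) / \<alpha>) \<le> \<kappa>"
    using \<alpha>_pos C_pos by (simp_all add: \<kappa>_eq field_simps)
  have "nrm x (vel x) \<le> (1 + Nr x) / \<alpha>" by (rule speed_bound(2)) (use x in simp_all)
  also have "\<dots> \<le> (1 + C) / \<alpha>" using S_Nr(1)[OF x(3)] \<alpha>_pos by (intro divide_right_mono) simp_all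
  finally show "nrm x (vel x) \<le> \<kappa>" using k by linarith
  have mx: "- x \<in> M" "\<bar>\<Phi> (- x) - c\<bar> \<le> \<epsilon>" using x M_uminus Phi_even by simp_all
  have "nrm x (- vel (- x)) = nrm x (vel (- x))" by (rule nrm_uminus[OF M_neq_0[OF x(1)]])
  also have "\<dots> \<le> C * nrm (- x) (vel (- x))" by (rule S_comparison[OF x(3)])
  also have "\<dots> \<le> C * ((1 + Nr (- x)) / \<alpha>)"
    using speed_bound(2)[OF mx] x(4) C_pos by (intro mult_left_mono) simp_all
  also have "\<dots> \<le> C * ((1 + C) / \<alpha>)"
    using S_Nr(2)[OF x(3)] \<alpha>_pos C_pos by (intro mult_left_mono divide_right_mono) simp_all
  finally show "nrm x (- vel (- x)) \<le> \<kappa>" using k by linarith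
qed

text \<open>Bisection for the implication that being outside the moving tube at time p means being
  outside at time q. The curve \<open>\<zeta>\<close> need not solve the equation; this covers the
  reflection of a solution, whose level drops at unit rate but which follows another field.\<close>

lemma Inv_preserved:
  assumes T: "0 \<le> T" and M: "\<And>t. t \<in> {0..T} \<Longrightarrow> \<zeta> t \<in> M"
    and d: "\<And>t. t \<in> {0..T} \<Longrightarrow> (\<zeta> has_vector_derivative \<zeta>' t) (at t within {0..T})"
    and c': "continuous_on {0..T} \<zeta>'"
    and \<Phi>: "\<And>t. t \<in> {0..T} \<Longrightarrow> \<Phi> (\<zeta> t) = \<Phi> (\<zeta> 0) - t" and fin: "T \<le> \<Phi> (\<zeta> 0) - bot_level"
    and sp: "\<And>t. t \<in> {0..T} \<Longrightarrow> \<zeta> t \<in> S (4 * \<delta>) \<Longrightarrow> \<zeta> t \<notin> S \<delta> \<Longrightarrow> nrm (\<zeta> t) (\<zeta>' t) \<le> \<kappa>"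
    and i0: "Inv (\<zeta> 0)" and t: "t \<in> {0..T}"
  shows "Inv (\<zeta> t)"
proof -
  define s where "s = \<Phi> (\<zeta> 0) - bot_level"
  define l where "l p = 2 * \<delta> + \<kappa> * (s - p)" for p
  have s: "T \<le> s" "s \<le> 2 * \<epsilon>" using fin i0 by (simp_all add: s_def Inv_def)
  have l: "2 * \<delta> \<le> l p" "l p \<le> 3 * \<delta>" if p: "p \<in> {0..T}" for p
  proof -
    have "0 \<le> \<kappa> * (s - p)" using \<kappa>_nonneg s p by simp
    then show "2 * \<delta> \<le> l p" by (simp add: l_def)
    have "\<kappa> * (s - p) \<le> \<kappa> * (2 * \<epsilon>)" using s p \<kappa>_nonneg by (intro mult_left_mono) auto
    also have "\<dots> \<le> \<delta>" using \<epsilon>_small(1) by (simp add: mult_ac)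
    finally show "l p \<le> 3 * \<delta>" by (simp add: l_def)
  qed
  have cont: "continuous_on {0..T} \<zeta>" using d by (rule vector_derivative_imp_continuous_on)
  have near: "\<exists>e>0. \<forall>y\<in>{0..T}. \<bar>y - x\<bar> < e \<longrightarrow> (\<exists>L<\<eta>. conn (\<zeta> y) (\<zeta> x) L)" if x: "x \<in> {0..T}" and \<eta>: "\<eta> > 0" for x \<eta>
  proof -
    have lim: "(\<zeta> \<longlongrightarrow> \<zeta> x) (at x within {0..T})" using cont x unfolding continuous_on_def by blast
    have "\<forall>\<^sub>F y in at x within {0..T}. \<exists>L<\<eta>. conn (\<zeta> y) (\<zeta> x) L"
      by (rule eventually_conn[OF lim _ M[OF x] \<eta>]) (use M in \<open>simp add: eventually_at_filter\<close>)
    then obtain e where e: "e > 0" "\<forall>y\<in>{0..T}. y \<noteq> x \<and> dist y x < e \<longrightarrow> (\<exists>L<\<eta>. conn (\<zeta> y) (\<zeta> x) L)"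
      unfolding eventually_at by blast
    have "\<exists>L<\<eta>. conn (\<zeta> y) (\<zeta> x) L" if y: "y \<in> {0..T}" "\<bar>y - x\<bar> < e" for y
    proof (cases "y = x")
      case True
      then show ?thesis using conn_refl[OF M[OF x]] \<eta> by blast
    next
      case False
      have "y \<noteq> x \<and> dist y x < e" using False y(2) by (simp add: dist_real_def)
      then show ?thesis using e(2) y(1) by blast
    qed
    then show ?thesis using e(1) by blast
  qed
  define P where "P p q \<longleftrightarrow> (0 \<le> p \<longrightarrow> q \<le> T \<longrightarrow> \<zeta> p \<notin> S (l p) \<longrightarrow> \<zeta> q \<notin> S (l q))" for p q
  have "P 0 t"
  proof (rule Bolzano[of 0 t P])
    show "0 \<le> t" using t by simp
    show "P p r" if "P p q" "P q r" "p \<le> q" "q \<le> r" for p q r using that unfolding P_def by auto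
    fix x assume x: "0 \<le> x" "x \<le> t"
    then have xT: "x \<in> {0..T}" using t by auto
    \<comment> \<open>Far from \<open>K\<close>, in the zone where the speed bound is available, or
      inside the tube. The zone ends at 4\<delta> and the tube at 3\<delta>, which leaves a margin
      \<delta> for short times.\<close>
    consider "\<zeta> x \<notin> S (4 * \<delta>)" | "\<zeta> x \<in> S (4 * \<delta>)" "\<zeta> x \<notin> S (l x)" | "\<zeta> x \<in> S (l x)" by blast
    then show "\<exists>d>0. \<forall>a b. a \<le> x \<and> x \<le> b \<and> b - a < d \<longrightarrow> P a b"
    proof cases
      case 1
      obtain e where e: "e > 0" "\<forall>y\<in>{0..T}. \<bar>y - x\<bar> < e \<longrightarrow> (\<exists>L<\<delta>. conn (\<zeta> y) (\<zeta> x) L)"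
        using near[OF xT \<delta>_pos] by blast
      have "P a b" if ab: "a \<le> x" "x \<le> b" "b - a < e" for a b
        unfolding P_def
      proof (intro impI notI)
        assume r: "0 \<le> a" "b \<le> T" and bS: "\<zeta> b \<in> S (l b)"
        have bT: "b \<in> {0..T}" "\<bar>b - x\<bar> < e" using r ab by auto
        obtain L where L: "L < \<delta>" "conn (\<zeta> b) (\<zeta> x) L" using e(2) bT by blast
        have "\<zeta> x \<in> S (l b + L)" by (rule S_conn[OF bS conn_sym[OF L(2)]])
        moreover have "l b + L \<le> 4 * \<delta>" using l(2)[OF bT(1)] L(1) by linarith
        ultimately show False using 1 S_mono by blast
      qed
      then show ?thesis using e(1) by blast
    next
      case 2
      then obtain v L0 where v: "v \<in> K" "L0 < 4 * \<delta>" "conn (\<zeta> x) v L0" unfolding S_def by blast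
      define \<eta> where "\<eta> = min \<delta> (4 * \<delta> - L0)"
      have \<eta>: "\<eta> > 0" using v \<delta>_pos by (simp add: \<eta>_def)
      obtain e where e: "e > 0" "\<forall>y\<in>{0..T}. \<bar>y - x\<bar> < e \<longrightarrow> (\<exists>L<\<eta>. conn (\<zeta> y) (\<zeta> x) L)"
        using near[OF xT \<eta>] by blast
      have "P a b" if ab: "a \<le> x" "x \<le> b" "b - a < e" for a b
        unfolding P_def
      proof (intro impI notI)
        assume r: "0 \<le> a" "b \<le> T" and aS: "\<zeta> a \<notin> S (l a)" and bS: "\<zeta> b \<in> S (l b)"
        have sub: "{a..b} \<subseteq> {0..T}" using r by auto
        have spd: "nrm (\<zeta> y) (\<zeta>' y) \<le> \<kappa>" if y: "y \<in> {a..b}" for y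
        proof -
          have yT: "y \<in> {0..T}" "\<bar>y - x\<bar> < e" using y sub ab by auto
          obtain L where L: "L < \<eta>" "conn (\<zeta> y) (\<zeta> x) L" using e(2) yT by blast
          have "conn (\<zeta> y) v (L + L0)" by (rule conn_trans[OF L(2) v(3)])
          moreover have "L + L0 < 4 * \<delta>" using L(1) by (simp add: \<eta>_def)
          ultimately have in4: "\<zeta> y \<in> S (4 * \<delta>)" unfolding S_def using v(1) by blast
          have "\<zeta> y \<notin> S \<delta>"
          proof
            assume "\<zeta> y \<in> S \<delta>"
            then have "\<zeta> x \<in> S (\<delta> + L)" by (rule S_conn[OF _ conn_sym[OF L(2)]])
            moreover have "\<delta> + L \<le> l x" using L(1) l(1)[OF xT] by (simp add: \<eta>_def)
            ultimately show False using 2(2) S_mono by blast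
          qed
          then show ?thesis by (rule sp[OF yT(1) in4])
        qed
        have "conn (\<zeta> a) (\<zeta> b) (\<kappa> * (b - a))"
        proof (rule conn_speed_bound)
          show "a \<le> b" using ab by simp
          show "continuous_on {a..b} \<zeta>'" by (rule continuous_on_subset[OF c' sub])
          fix y assume y: "y \<in> {a..b}"
          then have yT: "y \<in> {0..T}" using sub by blast
          show "\<zeta> y \<in> M" by (rule M[OF yT])
          show "(\<zeta> has_vector_derivative \<zeta>' y) (at y within {a..b})"
            by (rule has_vector_derivative_within_subset[OF d[OF yT] sub])
          show "nrm (\<zeta> y) (\<zeta>' y) \<le> \<kappa>" by (rule spd[OF y])
        qed
        \<comment> \<open>Going backwards over the interval, the distance to \<open>K\<close> grows
          by at most \<open>\<kappa> * (b - a)\<close>, exactly the amount by which the radius was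
          larger at \<open>a\<close>.\<close>
        then have "\<zeta> a \<in> S (l b + \<kappa> * (b - a))" by (rule S_conn[OF bS])
        moreover have "l b + \<kappa> * (b - a) = l a" by (simp add: l_def algebra_simps)
        ultimately show False using aS by simp
      qed
      then show ?thesis using e(1) by blast
    next
      case 3
      then obtain v L0 where v: "v \<in> K" "L0 < l x" "conn (\<zeta> x) v L0" unfolding S_def by blast
      have \<eta>: "l x - L0 > 0" using v by simp
      obtain e where e: "e > 0" "\<forall>y\<in>{0..T}. \<bar>y - x\<bar> < e \<longrightarrow> (\<exists>L<l x - L0. conn (\<zeta> y) (\<zeta> x) L)"
        using near[OF xT \<eta>] by blast
      have "P a b" if ab: "a \<le> x" "x \<le> b" "b - a < e" for a b
        unfolding P_def
      proof (intro impI)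
        assume r: "0 \<le> a" "b \<le> T" and aS: "\<zeta> a \<notin> S (l a)"
        have aT: "a \<in> {0..T}" "\<bar>a - x\<bar> < e" using r ab by auto
        obtain L where L: "L < l x - L0" "conn (\<zeta> a) (\<zeta> x) L" using e(2) aT by blast
        have "conn (\<zeta> a) v (L + L0)" by (rule conn_trans[OF L(2) v(3)])
        \<comment> \<open>The tube was larger at the earlier time, so a curve inside it at x was
          inside shortly before, against the premise at \<open>a\<close>.\<close>
        moreover have "l x \<le> l a"
        proof -
          have "\<kappa> * (s - x) \<le> \<kappa> * (s - a)" using ab \<kappa>_nonneg by (intro mult_left_mono) auto
          then show ?thesis by (simp add: l_def)
        qed
        moreover have "L + L0 < l x" using L(1) by simp
        ultimately have "\<zeta> a \<in> S (l a)" unfolding S_def using v(1) less_le_trans by blast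
        then show "\<zeta> b \<notin> S (l b)" using aS by blast
      qed
      then show ?thesis using e(1) by blast
    qed
  qed
  moreover have "\<zeta> 0 \<notin> S (l 0)" using i0 by (simp add: Inv_def l_def s_def)
  ultimately have "\<zeta> t \<notin> S (l t)" using t by (simp add: P_def)
  moreover have "l t = 2 * \<delta> + \<kappa> * (\<Phi> (\<zeta> t) - bot_level)" using \<Phi>[OF t] by (simp add: l_def s_def)
  ultimately show ?thesis using M[OF t] \<Phi>[OF t] t fin i0 by (simp add: Inv_def)
qed

text \<open>For \<open>sg = 1\<close> the solution itself stays outside the tube; for
  \<open>sg = - 1\<close> its reflection does, while the solution is the one that starts at the
  reflected point.\<close>

lemma sol_Inv:
  assumes s: "sol \<sigma> T" and T: "0 \<le> T" "T \<le> \<Phi> (\<sigma> 0) - bot_level" and sg: "sg = 1 \<or> sg = (- 1 :: real)"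
    and i0: "Inv (sg *\<^sub>R \<sigma> 0)" and t: "t \<in> {0..T}"
  shows "Inv (sg *\<^sub>R \<sigma> t)"
proof -
  have M: "\<sigma> t \<in> M" if "t \<in> {0..T}" for t using solD(1)[OF s that] regular_M by blast
  have sM: "sg *\<^sub>R \<sigma> t \<in> M" "\<Phi> (sg *\<^sub>R \<sigma> t) = \<Phi> (\<sigma> t)" if "t \<in> {0..T}" for t
    using M[OF that] M_uminus Phi_even sg by auto
  have 0: "0 \<in> {0..T}" using T by simp
  show ?thesis
  proof (rule Inv_preserved[OF T(1), where \<zeta> = "\<lambda>t. sg *\<^sub>R \<sigma> t" and \<zeta>' = "\<lambda>t. sg *\<^sub>R vel (\<sigma> t)"])
    show "continuous_on {0..T} (\<lambda>t. sg *\<^sub>R vel (\<sigma> t))"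
    proof -
      have "continuous_on {0..T} (\<lambda>t. vel (\<sigma> t))"
        by (rule continuous_on_compose2[OF continuous_on_vel sol_continuous[OF s]]) (use solD(1)[OF s] in blast)
      then show ?thesis by (intro continuous_intros)
    qed
    show "T \<le> \<Phi> (sg *\<^sub>R \<sigma> 0) - bot_level" using T sM(2)[OF 0] by simp
    show "Inv (sg *\<^sub>R \<sigma> 0)" by (rule i0)
    show "t \<in> {0..T}" by (rule t)
    fix t assume t: "t \<in> {0..T}"
    show "sg *\<^sub>R \<sigma> t \<in> M" by (rule sM(1)[OF t])
    show "((\<lambda>t. sg *\<^sub>R \<sigma> t) has_vector_derivative sg *\<^sub>R vel (\<sigma> t)) (at t within {0..T})"
      by (rule bounded_linear.has_vector_derivative[OF bounded_linear_scaleR_right solD(2)[OF s t]])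
    show ph: "\<Phi> (sg *\<^sub>R \<sigma> t) = \<Phi> (sg *\<^sub>R \<sigma> 0) - t"
      using sM(2)[OF t] sM(2)[OF 0] sol_Phi[OF s t] by simp
    have lev: "\<bar>\<Phi> (sg *\<^sub>R \<sigma> t) - c\<bar> \<le> \<epsilon>"
    proof -
      have "\<Phi> (sg *\<^sub>R \<sigma> 0) \<le> c + \<epsilon>" using i0 by (simp add: Inv_def)
      then show ?thesis using ph t T sM(2)[OF 0] by (simp add: abs_le_iff)
    qed
    assume S: "sg *\<^sub>R \<sigma> t \<in> S (4 * \<delta>)" "sg *\<^sub>R \<sigma> t \<notin> S \<delta>"
    show "nrm (sg *\<^sub>R \<sigma> t) (sg *\<^sub>R vel (\<sigma> t)) \<le> \<kappa>"
      using sg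
    proof
      assume "sg = 1"
      then show ?thesis using speed_near_K(1)[OF sM(1)[OF t] lev S] by simp
    next
      assume "sg = - 1"
      then show ?thesis using speed_near_K(2)[OF sM(1)[OF t] lev S] by simp
    qed
  qed
qed

text \<open>Let k be the maximal speed, attained at \<open>t1\<close>. The length up to
  \<open>t1\<close> is at most \<open>k * t1\<close>, so N has grown by at most this, and
  \<open>k \<le> (1 + N(\<sigma> 0) + k * t1) / \<alpha>\<close>. Since
  \<open>t1 \<le> 2 * \<epsilon>\<close>, the last term is at most k / 2 and is absorbed. The bound
  involves the starting point only.\<close>

lemma sol_speed:
  assumes s: "sol \<sigma> T" and T: "0 \<le> T" "T \<le> \<Phi> (\<sigma> 0) - bot_level" and sg: "sg = 1 \<or> sg = (- 1 :: real)"
    and i0: "Inv (sg *\<^sub>R \<sigma> 0)" and t: "t \<in> {0..T}"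
  shows "nrm (\<sigma> t) (vel (\<sigma> t)) \<le> 2 * (1 + Nr (\<sigma> 0)) / \<alpha>"
proof -
  have M: "\<sigma> t \<in> M" if "t \<in> {0..T}" for t using solD(1)[OF s that] regular_M by blast
  have cv: "continuous_on {0..T} (\<lambda>t. vel (\<sigma> t))"
    by (rule continuous_on_compose2[OF continuous_on_vel sol_continuous[OF s]]) (use solD(1)[OF s] in blast)
  have "continuous_on {0..T} (\<lambda>t. nrm (\<sigma> t) (vel (\<sigma> t)))"
    by (rule continuous_on_nrm[OF sol_continuous[OF s] cv]) (use M M_neq_0 in blast)
  moreover have "{0..T} \<noteq> {}" using T by simp
  ultimately obtain t1 where t1: "t1 \<in> {0..T}" "\<forall>t\<in>{0..T}. nrm (\<sigma> t) (vel (\<sigma> t)) \<le> nrm (\<sigma> t1) (vel (\<sigma> t1))"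
    using continuous_attains_sup[OF compact_Icc] by blast
  define k where "k = nrm (\<sigma> t1) (vel (\<sigma> t1))"
  have k0: "k \<ge> 0" unfolding k_def by (rule nrm_nonneg[OF M_neq_0[OF M[OF t1(1)]]])
  have sub: "{0..t1} \<subseteq> {0..T}" using t1 by auto
  have "conn (\<sigma> 0) (\<sigma> t1) (k * (t1 - 0))"
  proof (rule conn_speed_bound[where \<sigma>' = "\<lambda>t. vel (\<sigma> t)"])
    show "0 \<le> t1" using t1 by simp
    show "continuous_on {0..t1} (\<lambda>t. vel (\<sigma> t))" by (rule continuous_on_subset[OF cv sub])
    fix y assume "y \<in> {0..t1}"
    then have yT: "y \<in> {0..T}" using sub by blast
    show "\<sigma> y \<in> M" by (rule M[OF yT])
    show "(\<sigma> has_vector_derivative vel (\<sigma> y)) (at y within {0..t1})"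
      by (rule has_vector_derivative_within_subset[OF solD(2)[OF s yT] sub])
    show "nrm (\<sigma> y) (vel (\<sigma> y)) \<le> k" using t1(2) yT by (simp add: k_def)
  qed
  then have N1: "Nr (\<sigma> t1) \<le> Nr (\<sigma> 0) + k * t1" using Nr_conn by fastforce
  have i1: "Inv (sg *\<^sub>R \<sigma> t1)" by (rule sol_Inv[OF s T sg i0 t1(1)])
  have "\<bar>\<Phi> (\<sigma> t1) - c\<bar> \<le> \<epsilon>" using Inv_level[OF i1] sg Phi_even[OF M[OF t1(1)]] by auto
  moreover have "\<sigma> t1 \<notin> S \<delta> \<or> - \<sigma> t1 \<notin> S \<delta>" using Inv_not_S[OF i1] sg by auto
  ultimately have "k \<le> (1 + Nr (\<sigma> t1)) / \<alpha>" unfolding k_def by (rule speed_bound(2)[OF M[OF t1(1)]])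
  also have "\<dots> \<le> (1 + Nr (\<sigma> 0) + k * t1) / \<alpha>" using N1 \<alpha>_pos by (intro divide_right_mono) simp_all
  also have "\<dots> = (1 + Nr (\<sigma> 0)) / \<alpha> + k * (t1 / \<alpha>)" by (simp add: add_divide_distrib)
  also have "k * (t1 / \<alpha>) \<le> k * (1 / 2)"
  proof (rule mult_left_mono[OF _ k0])
    have "Inv (sg *\<^sub>R \<sigma> 0)" by (rule i0)
    then have "\<Phi> (\<sigma> 0) \<le> c + \<epsilon>" using sg Phi_even[OF M[of 0]] T by (auto simp: Inv_def)
    then have "t1 \<le> 2 * \<epsilon>" using t1 T by simp
    then have "t1 / \<alpha> \<le> 2 * \<epsilon> / \<alpha>" using \<alpha>_pos by (intro divide_right_mono) simp_all
    then show "t1 / \<alpha> \<le> 1 / 2" using \<epsilon>_small(2) by linarith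
  qed
  finally have "k \<le> 2 * ((1 + Nr (\<sigma> 0)) / \<alpha>)" by linarith
  moreover have "nrm (\<sigma> t) (vel (\<sigma> t)) \<le> k" using t1(2) t by (simp add: k_def)
  ultimately show ?thesis by (simp only: times_divide_eq_right)
qed

end

section \<open>Existence of the flow down to the bottom level\<close>

context cerami_strip begin

lemma Inv_regular:
  assumes "y \<in> M" "sg = 1 \<or> sg = (- 1 :: real)" "Inv (sg *\<^sub>R y)"
  shows "y \<in> regular"
proof (rule speed_bound(1)[OF assms(1)])
  show "\<bar>\<Phi> y - c\<bar> \<le> \<epsilon>" using Inv_level[OF assms(3)] assms(2) Phi_even[OF assms(1)] by auto
  show "y \<notin> S \<delta> \<or> - y \<notin> S \<delta>" using Inv_not_S[OF assms(3)] assms(2) by auto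
qed

text \<open>Bounded speed makes the solution Cauchy in d at the supremum \<open>T0\<close> of its
  existence times. Completeness of the strip gives a limit, the same speed bound keeps the gradient
  there away from 0, and a flow box at the limit continues the solution beyond
  \<open>T0\<close>.\<close>

lemma flows_to_bottom:
  assumes y: "y \<in> M" and sg: "sg = 1 \<or> sg = (- 1 :: real)" and i: "Inv (sg *\<^sub>R y)"
  shows "flows (\<Phi> y - bot_level) y"
proof -
  define s where "s = \<Phi> y - bot_level"
  have s0: "s \<ge> 0" "\<Phi> y \<le> c + \<epsilon>" using i sg Phi_even[OF y] by (auto simp: s_def Inv_def)
  have yr: "y \<in> regular" by (rule Inv_regular[OF y sg i])
  obtain \<rho> \<tau> where \<rho>: "\<rho> > 0" "\<tau> > 0" and box: "\<forall>x\<in>M \<inter> ball y \<rho>. \<exists>\<sigma>. \<sigma> 0 = x \<and> sol \<sigma> \<tau> \<and> (\<forall>t\<in>{0..\<tau>}. \<sigma> t \<in> ball y 1)"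
    using flow_box[OF yr zero_less_one] by blast
  have "y \<in> M \<inter> ball y \<rho>" using y \<rho> by simp
  then obtain \<sigma>1 where \<sigma>1: "\<sigma>1 0 = y" "sol \<sigma>1 \<tau>" using box by blast
  have restrict: "flows t' y" if "flows t y" "t' \<le> t" for t t'
    using that sol_restrict unfolding flows_def by blast
  define A where "A = {t\<in>{0..s}. flows t y}"
  have "flows \<tau> y" using \<sigma>1 unfolding flows_def by blast
  then have f\<tau>: "flows (min \<tau> s) y" by (rule restrict) simp
  show ?thesis
  proof (cases "s \<le> \<tau>")
    case True
    then have "min \<tau> s = s" by simp
    then show ?thesis using f\<tau> by (simp add: s_def)
  next
    case False
    then have sp: "s > 0" "min \<tau> s = \<tau>" using \<rho> by auto
    have A\<tau>: "\<tau> \<in> A" using f\<tau> sp \<rho> False by (simp add: A_def)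
    have bA: "bdd_above A" by (rule bdd_aboveI[of _ s]) (simp add: A_def)
    define T0 where "T0 = Sup A"
    have T0: "\<tau> \<le> T0" "T0 \<le> s" unfolding T0_def
      using cSup_upper[OF A\<tau> bA] A\<tau> by (auto intro: cSup_least simp: A_def)
    have T0p: "T0 > 0" using T0 \<rho> by simp
    have below: "flows t y" if t: "t < T0" for t
    proof -
      obtain t' where "t' \<in> A" "t < t'" using t A\<tau> unfolding T0_def by (metis less_cSupD empty_iff)
      then show ?thesis using restrict[of t' t] by (simp add: A_def)
    qed
    define k where "k = 2 * (1 + Nr y) / \<alpha>"
    have k: "k > 0" using Nr_nonneg[OF y] \<alpha>_pos by (simp add: k_def)
    have seg: "flow t y \<in> M \<and> flow t y \<in> regular \<and> 1 / k \<le> gnorm (flow t y) \<and> \<Phi> (flow t y) = \<Phi> y - t"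
      "conn (flow t y) (flow t' y) (k * (t' - t))" if t: "0 \<le> t" "t \<le> t'" "t' < T0" for t t'
    proof -
      obtain \<sigma> where \<sigma>: "sol \<sigma> t'" "\<sigma> 0 = y" using below[OF t(3)] unfolding flows_def by blast
      have t't: "t' \<in> {0..t'}" "t \<in> {0..t'}" using t by auto
      have e: "flow t y = \<sigma> t" "flow t' y = \<sigma> t'" by (rule flow_eq[OF \<sigma> t't(2)], rule flow_eq[OF \<sigma> t't(1)])
      have hyps: "0 \<le> t'" "t' \<le> \<Phi> (\<sigma> 0) - bot_level" "Inv (sg *\<^sub>R \<sigma> 0)" using t T0 i \<sigma>(2) by (auto simp: s_def)
      have sp: "nrm (\<sigma> p) (vel (\<sigma> p)) \<le> k" if "p \<in> {0..t'}" for p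
        using sol_speed[OF \<sigma>(1) hyps(1,2) sg hyps(3) that] by (simp add: k_def \<sigma>(2))
      have r: "\<sigma> t \<in> regular" by (rule solD(1)[OF \<sigma>(1) t't(2)])
      have "1 / gnorm (\<sigma> t) \<le> k" using sp[OF t't(2)] by (simp add: nrm_vel[OF r])
      then have "1 / k \<le> gnorm (\<sigma> t)" using gnorm_pos[OF r] k by (simp add: field_simps)
      then show "flow t y \<in> M \<and> flow t y \<in> regular \<and> 1 / k \<le> gnorm (flow t y) \<and> \<Phi> (flow t y) = \<Phi> y - t"
        using r regular_M[OF r] sol_Phi[OF \<sigma>(1) t't(2)] by (simp add: e \<sigma>(2))
      have sub: "{t..t'} \<subseteq> {0..t'}" using t by auto
      have cv: "continuous_on {0..t'} (\<lambda>t. vel (\<sigma> t))"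
        by (rule continuous_on_compose2[OF continuous_on_vel sol_continuous[OF \<sigma>(1)]]) (use solD(1)[OF \<sigma>(1)] in blast)
      show "conn (flow t y) (flow t' y) (k * (t' - t))"
        unfolding e
      proof (rule conn_speed_bound[OF t(2), where \<sigma>' = "\<lambda>t. vel (\<sigma> t)"])
        show "continuous_on {t..t'} (\<lambda>t. vel (\<sigma> t))" by (rule continuous_on_subset[OF cv sub])
        fix p assume "p \<in> {t..t'}"
        then have p: "p \<in> {0..t'}" using sub by blast
        show "\<sigma> p \<in> M" by (rule regular_M[OF solD(1)[OF \<sigma>(1) p]])
        show "(\<sigma> has_vector_derivative vel (\<sigma> p)) (at p within {t..t'})"
          by (rule has_vector_derivative_within_subset[OF solD(2)[OF \<sigma>(1) p] sub])
        show "nrm (\<sigma> p) (vel (\<sigma> p)) \<le> k" by (rule sp[OF p])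
      qed
    qed
    \<comment> \<open>Times that start at 0 and increase to \<open>T0\<close> without attaining
      it.\<close>
    define tn where "tn n = T0 - T0 / real (Suc n)" for n
    have tn: "0 \<le> tn n" "tn n < T0" for n using T0p by (simp_all add: tn_def field_simps)
    have tlim: "tn \<longlonglongrightarrow> T0"
    proof -
      have "(\<lambda>n. T0 * (1 / real (Suc n))) \<longlonglongrightarrow> T0 * 0"
        by (intro tendsto_mult tendsto_const LIMSEQ_Suc[OF lim_1_over_n])
      then have "(\<lambda>n. T0 - T0 * (1 / real (Suc n))) \<longlonglongrightarrow> T0 - T0 * 0" by (intro tendsto_diff tendsto_const)
      then show ?thesis by (simp add: tn_def[abs_def])
    qed
    define x where "x n = flow (tn n) y" for n
    have xM: "x n \<in> M" "1 / k \<le> gnorm (x n)" "\<Phi> (x n) = \<Phi> y - tn n" for n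
      using seg(1)[OF tn(1) order_refl tn(2)] by (simp_all add: x_def)
    have "\<exists>z\<in>{u \<in> M. lo \<le> \<Phi> u \<and> \<Phi> u \<le> hi}. x \<longlonglongrightarrow> z"
    proof (rule complete_wrt_conn[OF strip_complete])
      show "{u \<in> M. lo \<le> \<Phi> u \<and> \<Phi> u \<le> hi} \<subseteq> M" by blast
      show "x n \<in> {u \<in> M. lo \<le> \<Phi> u \<and> \<Phi> u \<le> hi}" for n
        using xM(1,3)[of n] tn[of n] T0 s0 level_bounds by (simp add: s_def)
      fix e :: real assume e: "e > 0"
      have "e / k > 0" using e k by simp
      then obtain n0 where n0: "\<forall>n\<ge>n0. norm (tn n - T0) < e / k" using LIMSEQ_D[OF tlim] by blast
      have cc: "conn (x p) (x q) e" if pq: "p \<ge> n0" "tn p \<le> tn q" for p q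
      proof -
        have "conn (x p) (x q) (k * (tn q - tn p))" unfolding x_def by (rule seg(2)[OF tn(1) pq(2) tn(2)])
        moreover have "tn q - tn p \<le> e / k" using n0 pq tn(2)[of q] tn(2)[of p] by (auto simp: abs_if dest!: spec[of _ p])
        then have "k * (tn q - tn p) \<le> e" using k by (simp add: field_simps)
        ultimately show ?thesis by (rule conn_mono)
      qed
      have "conn (x p) (x q) e" if pq: "p \<ge> n0" "q \<ge> n0" for p q
      proof (cases "tn p \<le> tn q")
        case True then show ?thesis using cc pq by blast
      next
        case False
        then have "conn (x q) (x p) e" using cc pq by simp
        then show ?thesis by (rule conn_sym)
      qed
      then show "\<exists>n0. \<forall>m\<ge>n0. \<forall>n\<ge>n0. conn (x m) (x n) e" by blast
    qed
    then obtain z where zM: "z \<in> M" and zl: "x \<longlonglongrightarrow> z" by blast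
    have "(\<lambda>n. gnorm (x n)) \<longlonglongrightarrow> gnorm z" by (rule tendsto_gnorm[OF zl _ zM]) (use xM in simp)
    \<comment> \<open>The speed of the normalised flow is \<open>1 / gnorm\<close>, so an upper
      bound for the speed is a lower bound for the gradient and passes to the limit.\<close>
    then have "1 / k \<le> gnorm z" by (rule LIMSEQ_le_const) (use xM in blast)
    then have "gnorm z > 0" using k by (meson less_le_trans zero_less_divide_1_iff)
    then have zr: "z \<in> regular" using zM M_neq_0[OF zM] by (auto simp: regular_def gnorm_def)
    obtain \<rho>2 \<tau>2 where \<rho>2: "\<rho>2 > 0" "\<tau>2 > 0" and box2: "\<forall>x\<in>M \<inter> ball z \<rho>2. \<exists>\<sigma>. \<sigma> 0 = x \<and> sol \<sigma> \<tau>2 \<and> (\<forall>t\<in>{0..\<tau>2}. \<sigma> t \<in> ball z 1)"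
      using flow_box[OF zr zero_less_one] by blast
    have "\<forall>\<^sub>F n in sequentially. dist (x n) z < \<rho>2" by (rule tendstoD[OF zl \<rho>2(1)])
    moreover have "\<forall>\<^sub>F n in sequentially. T0 - \<tau>2 < tn n" by (rule order_tendstoD(1)[OF tlim]) (use \<rho>2 in simp)
    ultimately have ev: "\<forall>\<^sub>F n in sequentially. dist (x n) z < \<rho>2 \<and> T0 - \<tau>2 < tn n" by (rule eventually_conj)
    obtain n where n: "dist (x n) z < \<rho>2" "T0 - \<tau>2 < tn n"
      using eventually_happens'[OF sequentially_bot ev] by blast
    have "x n \<in> M \<inter> ball z \<rho>2" using n(1) xM(1) by (simp add: dist_commute)
    then obtain \<sigma>2 where \<sigma>2: "\<sigma>2 0 = x n" "sol \<sigma>2 \<tau>2" using box2 by blast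
    obtain \<sigma> where \<sigma>: "sol \<sigma> (tn n)" "\<sigma> 0 = y" using below[OF tn(2)[of n]] unfolding flows_def by blast
    have "x n = \<sigma> (tn n)" unfolding x_def by (rule flow_eq[OF \<sigma>]) (use tn in simp)
    then have e2: "\<sigma>2 0 = \<sigma> (tn n)" using \<sigma>2 by simp
    have "sol (\<lambda>t. if t \<in> {0..tn n} then \<sigma> t else \<sigma>2 (- tn n + t)) (tn n + \<tau>2)"
      by (rule sol_concat[OF \<sigma>(1) \<sigma>2(2) e2 tn(1)]) (use \<rho>2 in simp)
    then have big: "flows (tn n + \<tau>2) y" unfolding flows_def
      using tn(1)[of n] \<sigma>(2) by (intro exI[of _ "\<lambda>t. if t \<in> {0..tn n} then \<sigma> t else \<sigma>2 (- tn n + t)"]) simp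
    have gt: "T0 < tn n + \<tau>2" using n(2) by simp
    show ?thesis
    proof (cases "s \<le> tn n + \<tau>2")
      case True
      then have "flows s y" by (rule restrict[OF big])
      then show ?thesis by (simp add: s_def)
    next
      case False
      then have "tn n + \<tau>2 \<in> A" using big tn(1)[of n] \<rho>2 by (simp add: A_def)
      then have "tn n + \<tau>2 \<le> T0" unfolding T0_def by (rule cSup_upper[OF _ bA])
      then show ?thesis using gt by simp
    qed
  qed
qed

lemma flow_properties:
  assumes y: "y \<in> M" and sg: "sg = 1 \<or> sg = (- 1 :: real)" and i: "Inv (sg *\<^sub>R y)"
    and t: "0 \<le> t" "t \<le> \<Phi> y - bot_level"
  shows "flows t y" and "Inv (sg *\<^sub>R flow t y)" and "\<Phi> (flow t y) = \<Phi> y - t" and "flow t y \<in> M"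
proof -
  obtain \<sigma> where \<sigma>: "sol \<sigma> (\<Phi> y - bot_level)" "\<sigma> 0 = y"
    using flows_to_bottom[OF y sg i] unfolding flows_def by blast
  have tt: "t \<in> {0..\<Phi> y - bot_level}" using t by simp
  show "flows t y" unfolding flows_def using \<sigma> sol_restrict[OF \<sigma>(1) t(2)] by blast
  have e: "flow t y = \<sigma> t" by (rule flow_eq[OF \<sigma> tt])
  show "\<Phi> (flow t y) = \<Phi> y - t" using sol_Phi[OF \<sigma>(1) tt] by (simp add: e \<sigma>(2))
  show "flow t y \<in> M" unfolding e by (rule regular_M[OF solD(1)[OF \<sigma>(1) tt]])
  show "Inv (sg *\<^sub>R flow t y)" unfolding e
    by (rule sol_Inv[OF \<sigma>(1) _ _ sg _ tt]) (use t i \<sigma>(2) in auto)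
qed

text \<open>Below the bottom level nothing is required, since steps leave such points fixed. From
  there upwards only x, not -x, has to avoid the tube, so the set of admissible points need not be
  symmetric.\<close>

definition admissible :: "'a \<Rightarrow> bool" where
  "admissible x \<longleftrightarrow> x \<in> M \<and> \<Phi> x \<le> c + \<epsilon> \<and> (bot_level \<le> \<Phi> x \<longrightarrow> Inv x)"

text \<open>The scalar products at \<open>u\<close> and \<open>- u\<close> are unrelated, so \<open>vel\<close> is not odd, and solutions of
  the symmetrised field \<open>(vel u - vel (- u)) / 2\<close> may have infinite length in finite time because
  completeness is controlled at one of \<open>u\<close> and \<open>- u\<close> only. A step therefore follows either \<open>vel\<close>
  or its reflection; the sign of an odd control \<open>h\<close> selects the field and its modulus limits the
  duration, so that a step is odd in \<open>(h, x)\<close> and, being trivial for \<open>h = 0\<close>, continuous.\<close>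

definition duration :: "real \<Rightarrow> 'a \<Rightarrow> real" where
  "duration h x = min (max 0 (\<Phi> x - bot_level)) \<bar>h\<bar>"

definition descend :: "real \<Rightarrow> 'a \<Rightarrow> 'a" where
  "descend h x = (if h \<ge> 0 then flow (duration h x) x else - flow (duration h x) (- x))"

lemma duration_props:
  "0 \<le> duration h x" "\<Phi> x \<le> bot_level \<Longrightarrow> duration h x = 0" "bot_level \<le> \<Phi> x \<Longrightarrow> duration h x \<le> \<Phi> x - bot_level"
  by (auto simp: duration_def)

lemma descend_below: "\<Phi> x \<le> bot_level \<Longrightarrow> descend h x = x"
  by (simp add: descend_def duration_props)

lemma descend_admissible:
  assumes a: "admissible x"
  shows "admissible (descend h x)" and "\<Phi> (descend h x) = \<Phi> x - duration h x"
proof -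
  have "admissible (descend h x) \<and> \<Phi> (descend h x) = \<Phi> x - duration h x"
  proof (cases "bot_level \<le> \<Phi> x")
    case False
    then show ?thesis using a descend_below[of x h] duration_props(2)[of x h] by simp
  next
    case True
    define t where "t = duration h x"
    have t: "0 \<le> t" "t \<le> \<Phi> x - bot_level" using duration_props True by (auto simp: t_def)
    have x: "x \<in> M" "Inv x" "\<Phi> x \<le> c + \<epsilon>" using a True by (simp_all add: admissible_def)
    have mx: "- x \<in> M" "\<Phi> (- x) = \<Phi> x" using x M_uminus Phi_even by simp_all
    show ?thesis
    proof (cases "h \<ge> 0")
      case True
      note f = flow_properties[OF x(1), of 1 t]
      have "Inv (flow t x)" "\<Phi> (flow t x) = \<Phi> x - t" "flow t x \<in> M"
        using f(2,3,4) x t by simp_all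
      then show ?thesis using True x t by (simp add: descend_def t_def[symmetric] admissible_def)
    next
      case False
      note f = flow_properties[OF mx(1), of "- 1" t]
      have g: "Inv (- flow t (- x))" "\<Phi> (flow t (- x)) = \<Phi> x - t" "flow t (- x) \<in> M"
        using f(2,3,4) x mx t by simp_all
      then have "\<Phi> (- flow t (- x)) = \<Phi> x - t" "- flow t (- x) \<in> M" using M_uminus Phi_even by simp_all
      then show ?thesis using False g x t by (simp add: descend_def t_def[symmetric] admissible_def)
    qed
  qed
  then show "admissible (descend h x)" "\<Phi> (descend h x) = \<Phi> x - duration h x" by simp_all
qed

lemma descend_odd: "x \<in> M \<Longrightarrow> descend (- h) (- x) = - descend h x"
  by (auto simp: descend_def duration_def Phi_even)

text \<open>Away from \<open>h0 = 0\<close> a single field is in use nearby. At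
  \<open>h0 = 0\<close> the field may change along the filter, but the duration tends to 0 and both
  candidates tend to \<open>x0\<close>.\<close>

lemma tendsto_descend:
  assumes h: "(h \<longlongrightarrow> h0) F" and X: "(X \<longlongrightarrow> x0) F" "\<forall>\<^sub>F n in F. X n \<in> M" and a: "admissible x0"
  shows "((\<lambda>n. descend (h n) (X n)) \<longlongrightarrow> descend h0 x0) F"
proof -
  have x0: "x0 \<in> M" using a by (simp add: admissible_def)
  have ph: "((\<lambda>n. \<Phi> (X n)) \<longlongrightarrow> \<Phi> x0) F" by (rule tendsto_Phi[OF x0 X])
  show ?thesis
  proof (cases "\<Phi> x0 < bot_level")
    case True
    have "\<forall>\<^sub>F n in F. \<Phi> (X n) < bot_level" by (rule order_tendstoD(2)[OF ph True])
    then have "\<forall>\<^sub>F n in F. descend (h n) (X n) = X n" by eventually_elim (simp add: descend_below)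
    then show ?thesis using X(1) True by (simp add: tendsto_cong descend_below)
  next
    case False
    then have lev: "bot_level \<le> \<Phi> x0" by simp
    then have i0: "Inv x0" using a by (simp add: admissible_def)
    define t where "t n = duration (h n) (X n)" for n
    define t0 where "t0 = duration h0 x0"
    have tl: "(t \<longlongrightarrow> t0) F" unfolding t_def[abs_def] t0_def duration_def
      by (intro tendsto_min tendsto_max tendsto_diff tendsto_rabs tendsto_const ph h)
    have t0: "0 \<le> t0" "t0 \<le> \<Phi> x0 - bot_level" using duration_props lev by (auto simp: t0_def)
    have tp: "\<forall>\<^sub>F n in F. 0 \<le> t n" by (simp add: t_def duration_props)
    have mx: "- x0 \<in> M" "\<Phi> (- x0) = \<Phi> x0" using x0 M_uminus Phi_even by simp_all
    have f1: "flows t0 x0" using flow_properties(1)[OF x0, of 1 t0] i0 t0 by simp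
    have f2: "flows t0 (- x0)" using flow_properties(1)[OF mx(1), of "- 1" t0] i0 t0 mx by simp
    have mX: "((\<lambda>n. - X n) \<longlongrightarrow> - x0) F" "\<forall>\<^sub>F n in F. - X n \<in> M"
      by (rule tendsto_minus[OF X(1)]) (use X(2) M_uminus in \<open>auto elim: eventually_mono\<close>)
    have l1: "((\<lambda>n. flow (t n) (X n)) \<longlongrightarrow> flow t0 x0) F"
      by (rule tendsto_flow[OF f1 t0(1) tl tp X])
    have l2: "((\<lambda>n. - flow (t n) (- X n)) \<longlongrightarrow> - flow t0 (- x0)) F"
      by (rule tendsto_minus[OF tendsto_flow[OF f2 t0(1) tl tp mX]])
    consider "h0 > 0" | "h0 < 0" | "h0 = 0" by linarith
    then show ?thesis
    proof cases
      case 1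
      have "\<forall>\<^sub>F n in F. h n > 0" by (rule order_tendstoD(1)[OF h 1])
      then have "\<forall>\<^sub>F n in F. descend (h n) (X n) = flow (t n) (X n)"
        by eventually_elim (simp add: descend_def t_def)
      then show ?thesis using l1 1 by (simp add: tendsto_cong descend_def t0_def)
    next
      case 2
      have "\<forall>\<^sub>F n in F. h n < 0" by (rule order_tendstoD(2)[OF h 2])
      then have "\<forall>\<^sub>F n in F. descend (h n) (X n) = - flow (t n) (- X n)"
        by eventually_elim (simp add: descend_def t_def)
      then show ?thesis using l2 2 by (simp add: tendsto_cong descend_def t0_def)
    next
      case 3
      have t00: "t0 = 0" unfolding t0_def duration_def 3 by simp
      have d0: "descend h0 x0 = x0" 
      proof -
        have "h0 \<ge> 0" "duration h0 x0 = 0" using 3 t00 by (simp_all add: t0_def)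
        then show ?thesis by (simp add: descend_def)
      qed
      have "((\<lambda>n. norm (flow (t n) (X n) - x0) + norm (- flow (t n) (- X n) - x0)) \<longlongrightarrow> norm (x0 - x0) + norm (x0 - x0)) F"
        by (intro tendsto_intros) (use l1 l2 t00 in simp_all)
      then have z: "((\<lambda>n. norm (flow (t n) (X n) - x0) + norm (- flow (t n) (- X n) - x0)) \<longlongrightarrow> 0) F" by simp
      have "norm (descend (h n) (X n) - x0) \<le> norm (flow (t n) (X n) - x0) + norm (- flow (t n) (- X n) - x0)" for n
        by (simp add: descend_def t_def)
      then have "\<forall>\<^sub>F n in F. norm (descend (h n) (X n) - x0) \<le> norm (flow (t n) (X n) - x0) + norm (- flow (t n) (- X n) - x0)"
        by simp
      then have "((\<lambda>n. descend (h n) (X n) - x0) \<longlongrightarrow> 0) F" using z by (rule Lim_null_comparison)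
      then show ?thesis unfolding d0 by (simp add: LIM_zero_iff)
    qed
  qed
qed

section \<open>Composition of steps into an odd deformation\<close>

primrec descents :: "(nat \<Rightarrow> 'a \<Rightarrow> real) \<Rightarrow> nat \<Rightarrow> 'a \<Rightarrow> 'a" where
  "descents g 0 u = u"
| "descents g (Suc n) u = descend (g n u) (descents g n u)"

text \<open>Step j lowers the level by the full amount \<open>\<bar>g j u\<bar>\<close> unless the
  bottom level stops it. The controls are evaluated at the initial point u, not along the way, so
  their sum can be prescribed in advance.\<close>

lemma descents_admissible:
  assumes "admissible u"
  shows "admissible (descents g n u)"
    and "\<Phi> (descents g n u) \<le> max bot_level (\<Phi> u - (\<Sum>j<n. \<bar>g j u\<bar>))"
proof -
  have "admissible (descents g n u) \<and> \<Phi> (descents g n u) \<le> max bot_level (\<Phi> u - (\<Sum>j<n. \<bar>g j u\<bar>))"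
  proof (induction n)
    case 0 then show ?case using assms by simp
  next
    case (Suc n)
    note a = conjunct1[OF Suc]
    have "\<Phi> (descents g (Suc n) u) \<le> max bot_level (\<Phi> u - (\<Sum>j<Suc n. \<bar>g j u\<bar>))"
      using Suc descend_admissible(2)[OF a, of "g n u"] by (simp add: duration_def) linarith
    then show ?case using descend_admissible(1)[OF a, of "g n u"] by simp
  qed
  then show "admissible (descents g n u)"
    "\<Phi> (descents g n u) \<le> max bot_level (\<Phi> u - (\<Sum>j<n. \<bar>g j u\<bar>))" by simp_all
qed

lemma descents_odd:
  assumes g: "\<And>n u. g n (- u) = - g n u" and u: "admissible u"
  shows "descents g n (- u) = - descents g n u"
proof (induction n)
  case (Suc n)
  have "descents g n u \<in> M" using descents_admissible(1)[OF u] by (simp add: admissible_def)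
  then show ?case using Suc descend_odd g by simp
qed simp

lemma tendsto_descents:
  assumes g: "\<And>n. continuous_on UNIV (g n)" and u: "admissible u"
    and X: "(X \<longlongrightarrow> u) F" "\<forall>\<^sub>F n in F. admissible (X n)"
  shows "((\<lambda>k. descents g n (X k)) \<longlongrightarrow> descents g n u) F"
proof (induction n)
  case 0 then show ?case using X by simp
next
  case (Suc n)
  have gl: "((\<lambda>k. g n (X k)) \<longlongrightarrow> g n u) F"
    by (rule continuous_on_tendsto_compose[OF g X(1)]) simp_all
  have "\<forall>\<^sub>F k in F. descents g n (X k) \<in> M"
    using X(2) by eventually_elim (use descents_admissible(1) in \<open>simp add: admissible_def\<close>)
  then have "((\<lambda>k. descend (g n (X k)) (descents g n (X k))) \<longlongrightarrow> descend (g n u) (descents g n u)) F"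
    by (rule tendsto_descend[OF gl Suc _ descents_admissible(1)[OF u]])
  then show ?case by simp
qed

lemma descents_stable:
  assumes "\<Phi> (descents g N u) \<le> bot_level" "N \<le> n" shows "descents g n u = descents g N u"
  using assms(2)
proof (induction n rule: dec_induct)
  case (step n)
  then show ?case using assms(1) by (simp add: descend_below)
qed simp

lemma odd_deformation:
  "\<exists>h. continuous_on {u. admissible u} h \<and> (\<forall>u. admissible u \<longrightarrow> h u \<in> M \<and> \<Phi> (h u) \<le> bot_level) \<and>
     (\<forall>u. admissible u \<longrightarrow> admissible (- u) \<longrightarrow> h (- u) = - h u)"
proof -
  obtain g0 :: "nat \<Rightarrow> 'a \<Rightarrow> real" where g0: "\<forall>n. continuous_on UNIV (g0 n)" "\<forall>n u. g0 n (- u) = - g0 n u"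
    "\<forall>u. u \<noteq> 0 \<longrightarrow> (\<exists>n. g0 n u \<noteq> 0)" using odd_functions_exist by blast
  \<comment> \<open>Through the pairing function every member of the family occurs infinitely often,
    so at each nonzero u the sum of the moduli diverges.\<close>
  define g where "g n = g0 (fst (prod_decode n))" for n
  have gc: "continuous_on UNIV (g n)" and godd: "g n (- u) = - g n u" for n u
    using g0(1,2) by (simp_all add: g_def)
  have large: "\<exists>N. B < (\<Sum>j<N. \<bar>g j u\<bar>)" if u: "u \<noteq> 0" for u B
  proof -
    obtain m where m: "g0 m u \<noteq> 0" using g0(3) u by blast
    define a where "a = \<bar>g0 m u\<bar>"
    have a: "a > 0" using m by (simp add: a_def)
    obtain k :: nat where k: "B < k * a" using reals_Archimedean3[OF a] by blast
    define I where "I = (\<lambda>j. prod_encode (m, j)) ` {..<k}"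
    have inj: "inj_on (\<lambda>j. prod_encode (m, j)) {..<k}" by (auto simp: inj_on_def)
    have fin: "finite I" by (simp add: I_def)
    have "(\<Sum>j\<in>I. \<bar>g j u\<bar>) = (\<Sum>j<k. a)"
      unfolding I_def by (subst sum.reindex[OF inj]) (simp add: g_def a_def)
    then have eq: "(\<Sum>j\<in>I. \<bar>g j u\<bar>) = k * a" by simp
    obtain N where N: "\<forall>i\<in>I. i < N" using fin finite_nat_set_iff_bounded by blast
    have "(\<Sum>j\<in>I. \<bar>g j u\<bar>) \<le> (\<Sum>j<N. \<bar>g j u\<bar>)" using N by (intro sum_mono2) auto
    then show ?thesis using eq k by (intro exI[of _ N]) simp
  qed
  define N where "N u = (LEAST n. \<Phi> (descents g n u) \<le> bot_level)" for u
  define h where "h u = descents g (N u) u" for u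
  \<comment> \<open>The strip has height 2\<epsilon>, so a larger sum forces arrival at the bottom
    level. Unlike arrival itself, this criterion is an open condition on u.\<close>
  have reach: "\<Phi> (descents g n u) \<le> bot_level" if u: "admissible u" "2 * \<epsilon> < (\<Sum>j<n. \<bar>g j u\<bar>)" for u n
    using descents_admissible(2)[OF u(1), of g n] u by (simp add: admissible_def)
  have NE: "\<exists>n. 2 * \<epsilon> < (\<Sum>j<n. \<bar>g j u\<bar>)" if "admissible u" for u
    using that by (intro large M_neq_0) (simp add: admissible_def)
  have hlow: "\<Phi> (h u) \<le> bot_level" if u: "admissible u" for u
    unfolding h_def N_def by (rule LeastI_ex) (use NE[OF u] reach[OF u] in blast)
  have hN: "h u = descents g n u" if u: "admissible u" "\<Phi> (descents g n u) \<le> bot_level" for u n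
  proof -
    have "N u \<le> n" unfolding N_def by (rule Least_le) (rule u(2))
    then show ?thesis unfolding h_def using hlow[OF u(1)] by (intro descents_stable[symmetric]) (simp_all add: h_def)
  qed
  have "continuous_on {u. admissible u} h"
    unfolding continuous_on_def
  proof
    fix u assume "u \<in> {u. admissible u}"
    then have u: "admissible u" by simp
    obtain n where n: "2 * \<epsilon> < (\<Sum>j<n. \<bar>g j u\<bar>)" using NE[OF u] by blast
    let ?F = "at u within {u. admissible u}"
    have adm: "\<forall>\<^sub>F v in ?F. admissible v" by (simp add: eventually_at_filter)
    have gt: "(g j \<longlongrightarrow> g j u) ?F" for j
      by (rule continuous_on_tendsto_compose[OF gc tendsto_ident_at]) simp_all
    have "((\<lambda>v. \<Sum>j<n. \<bar>g j v\<bar>) \<longlongrightarrow> (\<Sum>j<n. \<bar>g j u\<bar>)) ?F"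
      by (intro tendsto_sum tendsto_rabs gt)
    then have "\<forall>\<^sub>F v in ?F. 2 * \<epsilon> < (\<Sum>j<n. \<bar>g j v\<bar>)" using n by (rule order_tendstoD(1))
    with adm have ev: "\<forall>\<^sub>F v in ?F. h v = descents g n v"
      by eventually_elim (use hN reach in blast)
    have "(descents g n \<longlongrightarrow> descents g n u) ?F"
      by (rule tendsto_descents[OF gc u tendsto_ident_at adm])
    then show "(h \<longlongrightarrow> h u) ?F"
      using tendsto_cong[OF ev] hN[OF u reach[OF u n]] by simp
  qed
  moreover have "h u \<in> M" if "admissible u" for u
    unfolding h_def using descents_admissible(1)[OF that] by (simp add: admissible_def)
  moreover have "h (- u) = - h u" if u: "admissible u" "admissible (- u)" for u
  proof -
    \<comment> \<open>The minimal number of steps for -u is not computed; \<open>N u\<close> steps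
      suffice there too, and \<open>hN\<close> identifies the result with
      \<open>h (- u)\<close>.\<close>
    have o: "descents g (N u) (- u) = - h u" unfolding h_def by (rule descents_odd[where g = g, OF godd u(1)])
    have "h u \<in> M" unfolding h_def using descents_admissible(1)[OF u(1)] by (simp add: admissible_def)
    then have "\<Phi> (descents g (N u) (- u)) \<le> bot_level" using hlow[OF u(1)] o Phi_even by simp
    then have "h (- u) = descents g (N u) (- u)" by (rule hN[OF u(2)])
    then show ?thesis using o by simp
  qed
  ultimately show ?thesis using hlow by blast
qed

text \<open>Subadditivity for a part \<open>B\<close> from which the odd deformation reaches the
  lower sublevel, and the part \<open>A\<close> near \<open>K\<close> or its reflection. Removing
  the closure of a smaller tube makes \<open>B\<close> relatively open while the two parts still
  overlap enough to cover everything.\<close>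

lemma genus_le_across_level:
  assumes k: "genus_le {u\<in>M. \<Phi> u \<le> bot_level} k"
    and m: "genus_le {u\<in>M. \<Phi> u \<le> c + \<epsilon> \<and> (u \<in> S (4 * \<delta>) \<or> - u \<in> S (4 * \<delta>))} m"
  shows "genus_le {u\<in>M. \<Phi> u \<le> c + \<epsilon>} (k + m)"
proof -
  define Z where "Z = {u\<in>M. \<Phi> u \<le> c + \<epsilon>}"
  define D where "D = closure (S (3 * \<delta>))"
  \<comment> \<open>Both u and -u are kept away from the tube, so both are admissible and the
    deformation is odd on \<open>B\<close>.\<close>
  define B where "B = {u\<in>Z. u \<notin> D \<and> - u \<notin> D}"
  define A where "A = {u\<in>M. \<Phi> u \<le> c + \<epsilon> \<and> (u \<in> S (4 * \<delta>) \<or> - u \<in> S (4 * \<delta>))}"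
  \<comment> \<open>The closure is taken in the norm; a point of M in it is within length \<delta>
    of the tube of radius 3\<delta>.\<close>
  have D4: "u \<in> S (4 * \<delta>)" if u: "u \<in> M" "u \<in> D" for u
  proof -
    have "\<forall>\<^sub>F y in at u within M. \<exists>L<\<delta>. conn y u L"
      by (rule eventually_conn[OF tendsto_ident_at _ u(1) \<delta>_pos]) (simp add: eventually_at_filter)
    then obtain e where e: "e > 0" "\<forall>y\<in>M. y \<noteq> u \<and> dist y u < e \<longrightarrow> (\<exists>L<\<delta>. conn y u L)"
      unfolding eventually_at by blast
    obtain y where y: "y \<in> S (3 * \<delta>)" "dist y u < e" using u(2) e(1) unfolding D_def closure_approachable by blast
    have "\<exists>L<\<delta>. conn y u L"
    proof (cases "y = u")
      case True then show ?thesis using conn_refl[OF u(1)] \<delta>_pos by blast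
    next
      case False then show ?thesis using e(2) y S_M by blast
    qed
    then obtain L where L: "L < \<delta>" "conn y u L" by blast
    have "u \<in> S (3 * \<delta> + L)" by (rule S_conn[OF y(1) conn_sym[OF L(2)]])
    moreover have "3 * \<delta> + L \<le> 4 * \<delta>" using L by simp
    ultimately show ?thesis using S_mono by blast
  qed
  have symZ: "- u \<in> Z" if "u \<in> Z" for u using that M_uminus Phi_even by (simp add: Z_def)
  have ZM: "u \<in> M" "- u \<in> M" if "u \<in> Z" for u using that M_uminus by (simp_all add: Z_def)
  have union: "B \<union> A = Z"
  proof
    show "B \<union> A \<subseteq> Z" by (auto simp: B_def A_def Z_def)
    show "Z \<subseteq> B \<union> A"
    proof
      fix u assume u: "u \<in> Z"
      then show "u \<in> B \<union> A"
        using D4[OF ZM(1)[OF u]] D4[OF ZM(2)[OF u]] by (cases "u \<in> D \<or> - u \<in> D") (auto simp: B_def A_def Z_def)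
    qed
  qed
  have sym: "uminus ` E = E" if E: "\<forall>u\<in>E. - u \<in> E" for E :: "'a set"
  proof
    show "uminus ` E \<subseteq> E" using E by blast
    show "E \<subseteq> uminus ` E" using E by (metis image_eqI minus_minus subsetI)
  qed
  have sB: "uminus ` B = B" by (rule sym) (use symZ in \<open>simp add: B_def\<close>)
  have sA: "uminus ` A = A" by (rule sym) (use M_uminus Phi_even in \<open>auto simp: A_def\<close>)
  have oB: "openin (top_of_set Z) B"
  proof -
    have "closed D" by (simp add: D_def)
    then have "open (- D)" "open (uminus -` (- D))" by (auto intro!: open_vimage continuous_intros)
    then have "open (- D \<inter> uminus -` (- D))" by (rule open_Int)
    moreover have "B = Z \<inter> (- D \<inter> uminus -` (- D))" by (auto simp: B_def)
    ultimately show ?thesis by (simp add: openin_open_Int)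
  qed
  have oA: "openin (top_of_set Z) A"
  proof -
    obtain T where T: "open T" "S (4 * \<delta>) = M \<inter> T" using S_open by (auto simp: openin_open)
    have "open (uminus -` T)" using T(1) by (intro open_vimage continuous_intros)
    then have "open (T \<union> uminus -` T)" using T(1) by (intro open_Un)
    moreover have "A = Z \<inter> (T \<union> uminus -` T)"
      using T(2) M_uminus by (auto simp: A_def Z_def)
    ultimately show ?thesis by (simp add: openin_open_Int)
  qed
  have adm: "admissible u" if u: "u \<in> Z" "u \<notin> D" for u
  proof -
    have "Inv u" if lev: "bot_level \<le> \<Phi> u"
    proof -
      have "\<kappa> * (\<Phi> u - bot_level) \<le> \<kappa> * (2 * \<epsilon>)" using u(1) \<kappa>_nonneg by (intro mult_left_mono) (auto simp: Z_def)
      also have "\<dots> \<le> \<delta>" using \<epsilon>_small(1) by (simp add: mult_ac)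
      finally have "S (2 * \<delta> + \<kappa> * (\<Phi> u - bot_level)) \<subseteq> S (3 * \<delta>)" by (intro S_mono) simp
      then have "u \<notin> S (2 * \<delta> + \<kappa> * (\<Phi> u - bot_level))" using u(2) closure_subset unfolding D_def by blast
      then show ?thesis using u(1) lev by (simp add: Inv_def Z_def)
    qed
    then show ?thesis using u(1) by (simp add: admissible_def Z_def)
  qed
  obtain h where h: "continuous_on {u. admissible u} h" "\<forall>u. admissible u \<longrightarrow> h u \<in> M \<and> \<Phi> (h u) \<le> bot_level"
    "\<forall>u. admissible u \<longrightarrow> admissible (- u) \<longrightarrow> h (- u) = - h u" using odd_deformation by blast
  have Badm: "admissible u" "admissible (- u)" if "u \<in> B" for u using that adm symZ by (auto simp: B_def)
  have "genus_le B k"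
  proof (rule genus_le_vimage[OF k])
    show "continuous_on B h" by (rule continuous_on_subset[OF h(1)]) (use Badm in blast)
    show "h ` B \<subseteq> {u \<in> M. \<Phi> u \<le> bot_level}" using h(2) Badm(1) by blast
    show "h (- x) = - h x" if "x \<in> B" for x using h(3) Badm[OF that] by blast
  qed
  moreover have "genus_le A m" using m by (simp add: A_def)
  ultimately have "genus_le (B \<union> A) (k + m)"
    using oB oA sB sA by (intro genus_le_Un) (simp_all add: union)
  then show ?thesis by (simp add: union Z_def)
qed

end

subsection \<open>The minimax values\<close>

context cerami_level begin

text \<open>The number m counts the critical orbits needed in the cover and is fixed before k.
  Without critical points at the level the cover is empty and m is 0.\<close>

lemma genus_le_crossing:
  assumes lo_hi: "lo < c" "c < hi" and comp: "complete_wrt (curve_dist ip M) {u \<in> M. lo \<le> \<Phi> u \<and> \<Phi> u \<le> hi}"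
  shows "\<exists>\<epsilon>>0. \<exists>m. (critical_set M \<Phi> c = {} \<longrightarrow> m = 0) \<and>
    (\<forall>k. genus_le {u \<in> M. \<Phi> u \<le> c - \<epsilon>} k \<longrightarrow> genus_le {u \<in> M. \<Phi> u \<le> c + \<epsilon>} (k + m))"
proof -
  obtain d1 C where C: "d1 > 0" "C > 0" and bounds: "\<forall>x\<in>S d1. (\<forall>w. nrm x w \<le> C * nrm (- x) w) \<and> Nr x \<le> C \<and> Nr (- x) \<le> C"
    using S_bounds by (elim exE conjE)
  obtain d2 F s where F: "d2 > 0" "finite F" "F \<subseteq> K"
    and disj: "\<forall>v\<in>F. orbit_ball v (s v) \<inter> uminus ` orbit_ball v (s v) = {}"
    and cover: "S d2 \<subseteq> (\<Union>v\<in>F. orbit_ball v (s v))"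
    using critical_orbit_cover by (elim exE conjE)
  define \<delta> where "\<delta> = min d1 d2 / 4"
  have \<delta>: "\<delta> > 0" "4 * \<delta> \<le> d1" "4 * \<delta> \<le> d2" using C F by (auto simp: \<delta>_def)
  obtain \<alpha> \<epsilon>1 where \<alpha>: "\<alpha> > 0" "\<epsilon>1 > 0"
    and grad_bound: "\<forall>x\<in>M. \<bar>\<Phi> x - c\<bar> < \<epsilon>1 \<longrightarrow> x \<notin> S \<delta> \<or> - x \<notin> S \<delta> \<longrightarrow> \<alpha> \<le> gnorm x * (1 + Nr x)"
    using gradient_lower_bound[OF \<delta>(1)] by (elim exE conjE)
  define \<kappa> where "\<kappa> = (1 + C) * (1 + C) / \<alpha>"
  have \<kappa>: "\<kappa> > 0" using C \<alpha> by (simp add: \<kappa>_def)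
  \<comment> \<open>In order: the gradient bound holds on the closed strip, the moving radius
    changes by at most \<delta>, the absorption for the speed works, and the strip lies within the
    complete one.\<close>
  define \<epsilon> where "\<epsilon> = Min {\<epsilon>1 / 2, \<delta> / (2 * \<kappa>), \<alpha> / 4, c - lo, hi - c}"
  have \<epsilon>: "\<epsilon> > 0" "\<epsilon> \<le> \<epsilon>1 / 2" "\<epsilon> \<le> \<delta> / (2 * \<kappa>)" "\<epsilon> \<le> \<alpha> / 4" "\<epsilon> \<le> c - lo" "\<epsilon> \<le> hi - c"
  proof -
    show "\<epsilon> > 0" using \<alpha> \<kappa> \<delta> lo_hi by (simp add: \<epsilon>_def)
  qed (unfold \<epsilon>_def, (rule Min_le, simp, simp)+)
  have S4: "x \<in> S d1" "x \<in> S d2" if "x \<in> S (4 * \<delta>)" for x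
    using that S_mono[OF \<delta>(2)] S_mono[OF \<delta>(3)] by blast+
  interpret cerami_strip G act ip M \<Phi> c lo hi \<epsilon> \<delta> \<alpha> C \<kappa>
  proof
    show "complete_wrt (curve_dist ip M) {u \<in> M. lo \<le> \<Phi> u \<and> \<Phi> u \<le> hi}" by (rule comp)
    show "\<kappa> = (1 + C) * (1 + C) / \<alpha>" by (rule \<kappa>_def)
    show "2 * \<epsilon> * \<kappa> \<le> \<delta>" using \<epsilon>(3) \<kappa> by (simp add: field_simps)
    show "2 * \<epsilon> / \<alpha> \<le> 1 / 2" using \<epsilon>(4) \<alpha> by (simp add: field_simps)
    show "lo \<le> c - \<epsilon>" "c + \<epsilon> \<le> hi" using \<epsilon> by linarith+
    fix x
    show "nrm x w \<le> C * nrm (- x) w" if "x \<in> S (4 * \<delta>)" for w using bounds S4(1)[OF that] by blast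
    show "Nr x \<le> C" if "x \<in> S (4 * \<delta>)" using bounds S4(1)[OF that] by blast
    show "Nr (- x) \<le> C" if "x \<in> S (4 * \<delta>)" using bounds S4(1)[OF that] by blast
    assume x: "x \<in> M" "\<bar>\<Phi> x - c\<bar> \<le> \<epsilon>" "x \<notin> S \<delta> \<or> - x \<notin> S \<delta>"
    have "\<bar>\<Phi> x - c\<bar> < \<epsilon>1" using x(2) \<epsilon>(2) \<alpha>(2) by linarith
    then show "\<alpha> \<le> gnorm x * (1 + Nr x)" using grad_bound x(1,3) by blast
  qed (use \<delta> \<alpha> C \<epsilon> in auto)
  have near: "genus_le {u \<in> M. \<Phi> u \<le> c + \<epsilon> \<and> (u \<in> S (4 * \<delta>) \<or> - u \<in> S (4 * \<delta>))} (card F)"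
  proof (rule genus_le_finite_cover[where P = "\<lambda>v. orbit_ball v (s v)" and Y = M])
    show "finite F" by (rule F)
    show "- x \<in> M" if "x \<in> M" for x using that by (rule M_uminus)
    show "openin (top_of_set M) (orbit_ball v (s v))" for v by (rule orbit_ball_open)
    show "orbit_ball v (s v) \<inter> uminus ` orbit_ball v (s v) = {}" if "v \<in> F" for v using disj that by blast
    have "u \<in> (\<Union>v\<in>F. orbit_ball v (s v) \<union> uminus ` orbit_ball v (s v))" if u: "u \<in> S (4 * \<delta>) \<or> - u \<in> S (4 * \<delta>)" for u
    proof -
      from u have "u \<in> S d2 \<or> - u \<in> S d2" using S4(2) by blast
      then obtain v where v: "v \<in> F" "u \<in> orbit_ball v (s v) \<or> - u \<in> orbit_ball v (s v)" using cover by blast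
      then have "u \<in> orbit_ball v (s v) \<union> uminus ` orbit_ball v (s v)" by (metis UnCI image_eqI minus_minus)
      then show ?thesis using v(1) by blast
    qed
    then show "{u \<in> M. \<Phi> u \<le> c + \<epsilon> \<and> (u \<in> S (4 * \<delta>) \<or> - u \<in> S (4 * \<delta>))}
      \<subseteq> (\<Union>v\<in>F. orbit_ball v (s v) \<union> uminus ` orbit_ball v (s v))" by blast
  qed
  have "critical_set M \<Phi> c = {} \<longrightarrow> card F = 0" using F(3) by (auto simp: critical_set_eq)
  moreover have "\<forall>k. genus_le {u \<in> M. \<Phi> u \<le> c - \<epsilon>} k \<longrightarrow> genus_le {u \<in> M. \<Phi> u \<le> c + \<epsilon>} (k + card F)"
    using genus_le_across_level near by blast
  ultimately show ?thesis using \<epsilon>(1) by blast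
qed

end

section \<open>Sublevels and the values c_k\<close>

lemma genus_mono: "Y \<subseteq> Z \<Longrightarrow> genus Y \<le> genus Z"
  using genus_le_mono[of Z _ Y] by (cases "genus Z") (auto simp: genus_le_iff[symmetric])

lemma genus_sublevel_mono: "a \<le> b \<Longrightarrow> genus (sublevel M \<Phi> a) \<le> genus (sublevel M \<Phi> b)"
  by (rule genus_mono) (auto simp: sublevel_def)

lemma genus_sublevel_below_LS:
  assumes "ereal c < LS_value M \<Phi> k" shows "genus (sublevel M \<Phi> c) < enat k"
proof (rule ccontr)
  assume "\<not> ?thesis"
  then have "LS_value M \<Phi> k \<le> ereal c" unfolding LS_value_def by (intro Inf_lower) (simp add: not_less)
  then show False using assms by simp
qed

lemma genus_sublevel_above_LS:
  assumes "LS_value M \<Phi> k < ereal c" shows "enat k \<le> genus (sublevel M \<Phi> c)"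
proof -
  obtain c' where "enat k \<le> genus (sublevel M \<Phi> (ereal c'))" "ereal c' < ereal c"
    using assms unfolding LS_value_def Inf_less_iff by blast
  then show ?thesis using genus_sublevel_mono[of "ereal c'" "ereal c" M \<Phi>] by (meson less_imp_le order_trans)
qed

lemma LS_value_mono: "k \<le> l \<Longrightarrow> LS_value M \<Phi> k \<le> LS_value M \<Phi> l"
  unfolding LS_value_def by (rule Inf_superset_mono) (use enat_ord_simps(1) order_trans in blast)

text \<open>The level c separates x from the infimum, which turns a statement about one sublevel
  into a strict inequality for c_k.\<close>

lemma LS_value_gt:
  assumes "x < ereal c" "genus (sublevel M \<Phi> c) < enat k" shows "x < LS_value M \<Phi> k"
proof -
  have "ereal c \<le> LS_value M \<Phi> k"
    using assms(2) genus_sublevel_above_LS[of M \<Phi> k c] by (meson not_less)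
  with assms(1) show ?thesis by (rule order.strict_trans2)
qed

lemma sublevel_ereal: "sublevel M \<Phi> (ereal c) = {u \<in> M. \<Phi> u \<le> c}"
  by (simp add: sublevel_def)

theorem theorem2p3:
  fixes G :: "('g, 'm) monoid_scheme"
    and T :: "'g topology"
    and act :: "'g \<Rightarrow> 'a::{real_inner,complete_space} \<Rightarrow> 'a"
    and ip :: "'a \<Rightarrow> 'a \<Rightarrow> 'a \<Rightarrow> real"
    and M :: "'a set"
    and \<Phi> :: "'a \<Rightarrow> real"
    and cstar cinf :: ereal
    and kstar :: nat
  assumes scalar_products: "\<And>u. u \<noteq> 0 \<Longrightarrow> is_scalar_product (ip u)"
    and top_group: "topological_group G T"
    and action: "linear_action G act"
    and M1: "cond_M1 ip"
    and M2: "cond_M2 ip"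
    and M3: "cond_M3 G act ip"
    and M_nonzero: "M \<subseteq> UNIV - {0}"
    and M_submanifold: "C11_submanifold M"
    and M_symmetric: "M = uminus ` M"
    and M_invariant: "\<And>g u. g \<in> carrier G \<Longrightarrow> u \<in> M \<Longrightarrow> act g u \<in> M"
    and Phi_C11: "C11_functional M \<Phi>"
    and Phi_even: "\<And>u. u \<in> M \<Longrightarrow> \<Phi> (- u) = \<Phi> u"
    and Phi_invariant: "\<And>g u. g \<in> carrier G \<Longrightarrow> u \<in> M \<Longrightarrow> \<Phi> (act g u) = \<Phi> u"
    and Gstar: "cond_Gstar G act"
    and c_range: "cstar \<noteq> -\<infinity>" "cinf \<noteq> -\<infinity>" "cstar < cinf"
    and i: "\<And>c :: real. ereal c < cinf \<Longrightarrow>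
              complete_wrt (curve_dist ip M) {u \<in> M. cstar \<le> ereal (\<Phi> u) \<and> \<Phi> u \<le> c}"
    and ii: "((\<lambda>c. genus (sublevel M \<Phi> c)) \<longlongrightarrow> enat kstar) (at_right cstar)"
    and iii: "((\<lambda>c. genus (sublevel M \<Phi> c)) \<longlongrightarrow> \<infinity>) (at_left cinf)"
    and iv: "\<And>c :: real. cstar \<le> ereal c \<Longrightarrow> ereal c < cinf \<Longrightarrow>
              cond_NCG G act ip M \<Phi> c \<and>
              (\<forall>u\<in>critical_set M \<Phi> c. \<forall>g\<in>carrier G. act g u \<noteq> - u)"
  shows "cstar < LS_value M \<Phi> (kstar + 1)
       \<and> (\<forall>k>kstar. LS_value M \<Phi> k \<le> LS_value M \<Phi> (k + 1) \<and> LS_value M \<Phi> k < cinf)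
       \<and> (\<lambda>k. LS_value M \<Phi> k) \<longlonglongrightarrow> cinf
       \<and> (\<forall>k>kstar. critical_value M \<Phi> (LS_value M \<Phi> k))
       \<and> (\<exists>u :: nat \<Rightarrow> 'a.
            (\<forall>k. critical_point M \<Phi> (u k) \<and> critical_point M \<Phi> (- u k)) \<and>
            (\<lambda>k. ereal (\<Phi> (u k))) \<longlonglongrightarrow> cinf)"
proof -
  interpret riemannian_setting G act ip M \<Phi>
  proof (rule riemannian_setting.intro)
    show "group G" using top_group by (simp add: topological_group_def)
  qed (fact assms)+
  obtain a where a: "cstar = ereal a" using c_range by (cases cstar) auto
  \<comment> \<open>Only levels strictly above the lower end are crossed, so that a strip below
    \<open>c\<close> remains in the complete part; the upper end \<open>hi\<close> of that part is
    any real between \<open>c\<close> and the upper value.\<close>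
  have crossing: "\<exists>\<epsilon>>0. \<exists>m. (critical_set M \<Phi> c = {} \<longrightarrow> m = 0) \<and>
      (\<forall>k. genus (sublevel M \<Phi> (ereal (c - \<epsilon>))) \<le> enat k \<longrightarrow> genus (sublevel M \<Phi> (ereal (c + \<epsilon>))) \<le> enat (k + m))"
    if c: "a < c" "ereal c < cinf" for c
  proof -
    obtain hi where hi: "ereal c < ereal hi" "ereal hi < cinf" using ereal_dense2[OF c(2)] by blast
    interpret cerami_level G act ip M \<Phi> c
    proof
      show "cond_NCG G act ip M \<Phi> c" "\<And>u g. u \<in> critical_set M \<Phi> c \<Longrightarrow> g \<in> carrier G \<Longrightarrow> act g u \<noteq> - u"
        using iv[of c] c by (simp_all add: a)
    qed (rule Gstar)
    have comp: "complete_wrt (curve_dist ip M) {u \<in> M. a \<le> \<Phi> u \<and> \<Phi> u \<le> hi}" using i[OF hi(2)] by (simp add: a)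
    have "c < hi" using hi(1) by simp
    then show ?thesis unfolding genus_le_iff sublevel_ereal by (rule genus_le_crossing[OF c(1) _ comp])
  qed
  \<comment> \<open>Genus values are discrete: convergence to \<open>kstar\<close> keeps them below
    \<open>kstar + 1\<close> on levels close to \<open>cstar\<close>. A real level \<open>c0\<close>
    in that range then separates \<open>cstar\<close> from the next minimax value.\<close>
  have "\<forall>\<^sub>F c in at_right cstar. genus (sublevel M \<Phi> c) < enat (kstar + 1)"
    by (rule order_tendstoD(2)[OF ii]) simp
  then have "\<exists>b>cstar. \<forall>y>cstar. y < b \<longrightarrow> genus (sublevel M \<Phi> y) < enat (kstar + 1)"
    by (simp only: eventually_at_right[OF c_range(3)])
  then obtain b where b: "cstar < b" "\<forall>y>cstar. y < b \<longrightarrow> genus (sublevel M \<Phi> y) < enat (kstar + 1)"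
    by (elim exE conjE)
  obtain c0 where c0: "cstar < ereal c0" "ereal c0 < b" using ereal_dense2[OF b(1)] by blast
  have gt: "cstar < LS_value M \<Phi> (kstar + 1)"
    by (rule LS_value_gt[OF c0(1)]) (use b(2) c0 in simp)
  have lt: "LS_value M \<Phi> k < cinf" for k
  proof -
    have "\<forall>\<^sub>F c in at_left cinf. enat k < genus (sublevel M \<Phi> c)"
      by (rule order_tendstoD(1)[OF iii]) simp
    then have "\<exists>b<cinf. \<forall>y>b. y < cinf \<longrightarrow> enat k < genus (sublevel M \<Phi> y)"
      by (simp only: eventually_at_left[OF c_range(3)])
    then obtain b where b: "b < cinf" "\<forall>y>b. y < cinf \<longrightarrow> enat k < genus (sublevel M \<Phi> y)"
      by (elim exE conjE)
    obtain c1 where c1: "b < ereal c1" "ereal c1 < cinf" using ereal_dense2[OF b(1)] by blast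
    then have "enat k \<le> genus (sublevel M \<Phi> (ereal c1))" using b(2) by (simp add: less_imp_le)
    then have "LS_value M \<Phi> k \<le> ereal c1"
      unfolding LS_value_def by (intro Inf_lower CollectI exI[of _ c1] conjI refl)
    then show ?thesis using c1(2) by (rule order.strict_trans1)
  qed
  have real: "\<exists>c. LS_value M \<Phi> k = ereal c \<and> a < c" if "k > kstar" for k
  proof -
    have "cstar < LS_value M \<Phi> k" using gt LS_value_mono[of "kstar + 1" k M \<Phi>] that by simp
    then show ?thesis using lt[of k] by (cases "LS_value M \<Phi> k") (auto simp: a)
  qed
  \<comment> \<open>With m = 0 the genus would still be at most \<open>k - 1\<close> slightly above
    c_k, where by definition it is at least k. Here \<open>k - 1\<close> is genuine subtraction, as
    k exceeds \<open>kstar\<close>.\<close>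
  have crit: "critical_value M \<Phi> (LS_value M \<Phi> k)" if k: "k > kstar" for k
  proof (rule ccontr)
    assume nc: "\<not> ?thesis"
    obtain c where c: "LS_value M \<Phi> k = ereal c" "a < c" using real[OF k] by blast
    have "critical_set M \<Phi> c = {}" using nc c(1) by (auto simp: critical_value_def critical_set_def)
    moreover have "ereal c < cinf" using lt[of k] c(1) by simp
    ultimately obtain \<epsilon> m where "m = 0" and \<epsilon>: "\<epsilon> > 0"
      "\<forall>k. genus (sublevel M \<Phi> (ereal (c - \<epsilon>))) \<le> enat k \<longrightarrow> genus (sublevel M \<Phi> (ereal (c + \<epsilon>))) \<le> enat (k + m)"
      using crossing[OF c(2)] by (elim meta_impE exE conjE) simp_all
    have "genus (sublevel M \<Phi> (ereal (c - \<epsilon>))) < enat k"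
      by (rule genus_sublevel_below_LS) (use \<epsilon>(1) c(1) in simp)
    then have "genus (sublevel M \<Phi> (ereal (c - \<epsilon>))) \<le> enat (k - 1)"
      by (cases "genus (sublevel M \<Phi> (ereal (c - \<epsilon>)))") auto
    then have "genus (sublevel M \<Phi> (ereal (c + \<epsilon>))) \<le> enat (k - 1)" using \<epsilon>(2) \<open>m = 0\<close> by fastforce
    moreover have "enat k \<le> genus (sublevel M \<Phi> (ereal (c + \<epsilon>)))"
      by (rule genus_sublevel_above_LS) (use \<epsilon>(1) c(1) in simp)
    ultimately have "enat k \<le> enat (k - 1)" by (rule order_trans[rotated])
    then show False using k by simp
  qed
  define s where "s = (SUP k. LS_value M \<Phi> k)"
  have lim_s: "(\<lambda>k. LS_value M \<Phi> k) \<longlonglongrightarrow> s"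
    unfolding s_def by (rule LIMSEQ_SUP) (use LS_value_mono in \<open>auto simp: incseq_def\<close>)
  have up: "LS_value M \<Phi> k \<le> s" for k unfolding s_def by (rule SUP_upper) simp
  \<comment> \<open>Some c_k lies above \<open>r - \<epsilon>\<close>, so the genus is finite just
    below the supremum \<open>r\<close>, and crossing \<open>r\<close> leaves it at most
    \<open>k + m\<close>. All c_k stay below \<open>r + \<epsilon>\<close>, so it is also at least
    \<open>k + m + 1\<close>.\<close>
  have "s = cinf"
  proof (rule ccontr)
    assume "s \<noteq> cinf"
    moreover have "s \<le> cinf" unfolding s_def using lt by (intro SUP_least less_imp_le)
    ultimately have s: "s < cinf" by simp
    moreover have "cstar < s" using gt up by (rule order.strict_trans2)
    ultimately obtain r where r: "s = ereal r" "a < r" by (cases s) (auto simp: a)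
    obtain \<epsilon> m where \<epsilon>: "\<epsilon> > 0"
      "\<forall>k. genus (sublevel M \<Phi> (ereal (r - \<epsilon>))) \<le> enat k \<longrightarrow> genus (sublevel M \<Phi> (ereal (r + \<epsilon>))) \<le> enat (k + m)"
      using crossing[OF r(2)] s unfolding r(1) by (elim meta_impE exE conjE)
    have "ereal (r - \<epsilon>) < s" using \<epsilon>(1) r(1) by simp
    then obtain k where "ereal (r - \<epsilon>) < LS_value M \<Phi> k" unfolding s_def less_SUP_iff by blast
    then have "genus (sublevel M \<Phi> (ereal (r - \<epsilon>))) < enat k" by (rule genus_sublevel_below_LS)
    then have "genus (sublevel M \<Phi> (ereal (r + \<epsilon>))) \<le> enat (k + m)" using \<epsilon>(2) less_imp_le by blast
    moreover have "LS_value M \<Phi> (k + m + 1) < ereal (r + \<epsilon>)"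
      by (rule order.strict_trans1[OF up]) (use \<epsilon>(1) r(1) in simp)
    then have "enat (k + m + 1) \<le> genus (sublevel M \<Phi> (ereal (r + \<epsilon>)))" by (rule genus_sublevel_above_LS)
    ultimately have "enat (k + m + 1) \<le> enat (k + m)" by (rule order_trans[rotated])
    then show False by simp
  qed
  with lim_s have lim: "(\<lambda>k. LS_value M \<Phi> k) \<longlonglongrightarrow> cinf" by simp
  \<comment> \<open>The shift by \<open>kstar + 1\<close> discards the indices for which c_k need
    not be critical.\<close>
  have "\<forall>k. \<exists>u. critical_point M \<Phi> u \<and> ereal (\<Phi> u) = LS_value M \<Phi> (k + (kstar + 1))"
    using crit unfolding critical_value_def by simp
  then obtain u where u: "\<forall>k. critical_point M \<Phi> (u k) \<and> ereal (\<Phi> (u k)) = LS_value M \<Phi> (k + (kstar + 1))"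
    by metis
  have "(\<lambda>k. ereal (\<Phi> (u k))) \<longlonglongrightarrow> cinf"
    using LIMSEQ_ignore_initial_segment[OF lim, of "kstar + 1"] u by simp
  moreover have "critical_point M \<Phi> (- u k)" for k
    using u grad_uminus_0 M_uminus by (simp add: critical_point_iff)
  ultimately have "\<exists>u :: nat \<Rightarrow> 'a. (\<forall>k. critical_point M \<Phi> (u k) \<and> critical_point M \<Phi> (- u k)) \<and>
      (\<lambda>k. ereal (\<Phi> (u k))) \<longlonglongrightarrow> cinf"
    using u by blast
  moreover have "LS_value M \<Phi> k \<le> LS_value M \<Phi> (k + 1)" for k by (rule LS_value_mono) simp
  ultimately show ?thesis using gt lt lim crit by blast
qed

end
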